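(* Let $\mathcal{G}$ be a finite group scheme over an algebraically closed field $k$ and let $\mathcal{N}$ be an infinitesimal normal subgroup scheme of $\mathcal{G}$ such that $\mathcal{G}^0/\mathcal{N}$ is multiplicative. Let $k(\mathcal{G}/\mathcal{N})=\bigoplus_{i=1}^nP_i$ be the decomposition into projective indecomposable $\mathcal{G}/\mathcal{N}$-modules. Let $M$ be a $\mathcal{G}$-module such that $\operatorname{res}^{\mathcal{G}}_{\mathcal{G}^0}M$ is indecomposable and $M$ is $\mathcal{G}^0/\mathcal{N}$-regular. Then $k\mathcal{G}\otimes_{k\mathcal{N}}M$ is isomorphic to the direct sum $\bigoplus_{i=1}^nM\otimes_kP_i$ of indecomposable $\mathcal{G}$-modules, and $M\otimes_kP_i\cong M\otimes_kP_j$ as $\mathcal{G}$-modules if and only if $P_i\cong P_j$ as $\mathcal{G}/\mathcal{N}$-modules.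
   Context: All modules are finite-dimensional. $k\mathcal{G}:=k[\mathcal{G}]^*$ is the group algebra and $\mathcal{G}^0$ the connected component of $\mathcal{G}$; $\mathcal{N}$ infinitesimal (i.e. $k[\mathcal{N}]$ local) implies $\mathcal{N}\subseteq\mathcal{G}^0$. A finite group scheme $\mathcal{M}$ is multiplicative if $k[\mathcal{M}]$ is isomorphic to the group algebra $kX(\mathcal{M})$ of its character group. A $\mathcal{G}/\mathcal{N}$-module is viewed as a $\mathcal{G}$-module via $\mathcal{G}\to\mathcal{G}/\mathcal{N}$, and tensor products carry the diagonal action. For $\lambda\in X(\mathcal{G}^0/\mathcal{N})$, $k_\lambda$ is the corresponding one-dimensional module. A $\mathcal{G}^0$-module $M$ is $\mathcal{G}^0/\mathcal{N}$-regular if $\{\lambda\in X(\mathcal{G}^0/\mathcal{N})\mid M\otimes_kk_\lambda\cong M \text{ as } \mathcal{G}^0\text{-modules}\}$ is trivial; a $\mathcal{G}$-module is called $\mathcal{G}^0/\mathcal{N}$-regular if its restriction to $\mathcal{G}^0$ is. *)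

theory Defs
  imports
    "HOL-Computational_Algebra.Polynomial"
    "HOL-Library.Function_Algebras"
begin

text \<open>
  A finite group scheme over \<open>k\<close> is given by its coordinate algebra, a finite-dimensional
  commutative Hopf algebra \<open>k[G]\<close>; morphisms of group schemes are given by their comorphisms.
  All spaces are subspaces \<open>carr V\<close> of an ambient vector space, which is a HOL type
  with scalar multiplication \<open>scal V\<close>.
\<close>


section \<open>Vector spaces, multilinear forms and tensor products\<close>

record ('k, 'v) space =
  carr :: "'v set"
  scal :: "'k \<Rightarrow> 'v \<Rightarrow> 'v"

definition fin_dim_space :: "('k::field, 'v::ab_group_add, 'z) space_scheme \<Rightarrow> bool" where
  "fin_dim_space V \<longleftrightarrow>
     vector_space (scal V) \<and> (\<exists>B. finite B \<and> module.span (scal V) B = carr V)"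

definition ground :: "('k::field, 'k) space" where
  "ground = \<lparr>carr = UNIV, scal = (*)\<rparr>"

definition fscale :: "'k::field \<Rightarrow> ('x \<Rightarrow> 'k) \<Rightarrow> 'x \<Rightarrow> 'k" where
  "fscale c f = (\<lambda>x. c * f x)"

definition lin_on ::
  "('k::field, 'v::ab_group_add, 'y) space_scheme \<Rightarrow> ('k, 'w::ab_group_add, 'z) space_scheme
    \<Rightarrow> ('v \<Rightarrow> 'w) \<Rightarrow> bool" where
  "lin_on V W f \<longleftrightarrow>
     (\<forall>v\<in>carr V. f v \<in> carr W) \<and>
     (\<forall>u\<in>carr V. \<forall>v\<in>carr V. f (u + v) = f u + f v) \<and>
     (\<forall>c. \<forall>v\<in>carr V. f (scal V c v) = scal W c (f v))"

definition bil ::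
  "('k::field, 'v::ab_group_add, 'y) space_scheme \<Rightarrow> ('k, 'w::ab_group_add, 'z) space_scheme
    \<Rightarrow> ('v \<Rightarrow> 'w \<Rightarrow> 'k) set" where
  "bil V W = {\<beta>. (\<forall>v\<in>carr V. lin_on W ground (\<beta> v)) \<and>
                 (\<forall>w\<in>carr W. lin_on V ground (\<lambda>v. \<beta> v w))}"

definition tril ::
  "('k::field, 'v::ab_group_add, 'z) space_scheme \<Rightarrow> ('v \<Rightarrow> 'v \<Rightarrow> 'v \<Rightarrow> 'k) set" where
  "tril V = {\<tau>. (\<forall>a\<in>carr V. \<tau> a \<in> bil V V) \<and>
                (\<forall>b\<in>carr V. \<forall>c\<in>carr V. lin_on V ground (\<lambda>a. \<tau> a b c))}"

text \<open>
  A tensor \<open>t = \<Sum>i. v\<^sub>i \<otimes> w\<^sub>i\<close> is represented by the functional \<open>\<beta> \<mapsto> \<Sum>i. \<beta> v\<^sub>i w\<^sub>i\<close> on a space \<open>B\<close>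
  of bilinear forms: all of \<open>bil V W\<close> for the tensor product over \<open>k\<close>, and the \<open>A\<close>-balanced
  ones for the tensor product over an algebra \<open>A\<close>.  This is the image of the tensor product
  under the injection into its double dual, because \<open>B\<close> is the dual of the tensor product;
  see \<open>tensor_universal\<close> below.  Thus for \<open>t = \<Delta> f\<close>, evaluation at \<open>\<beta>\<close> is the Sweedler sum
  \<open>\<Sum> \<beta> f\<^sub>1 f\<^sub>2\<close>.
\<close>

definition ten :: "('v \<Rightarrow> 'w \<Rightarrow> 'k::field) set \<Rightarrow> 'v \<Rightarrow> 'w \<Rightarrow> ('v \<Rightarrow> 'w \<Rightarrow> 'k) \<Rightarrow> 'k" where
  "ten B v w = (\<lambda>\<beta>. if \<beta> \<in> B then \<beta> v w else 0)"

definition ten_carr :: "('v \<Rightarrow> 'w \<Rightarrow> 'k::field) set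
    \<Rightarrow> ('k, 'v, 'y) space_scheme \<Rightarrow> ('k, 'w, 'z) space_scheme
    \<Rightarrow> (('v \<Rightarrow> 'w \<Rightarrow> 'k) \<Rightarrow> 'k) set" where
  "ten_carr B V W = module.span fscale {ten B v w | v w. v \<in> carr V \<and> w \<in> carr W}"

definition tensor ::
  "('k::field, 'v::ab_group_add, 'y) space_scheme \<Rightarrow> ('k, 'w::ab_group_add, 'z) space_scheme
    \<Rightarrow> ('k, ('v \<Rightarrow> 'w \<Rightarrow> 'k) \<Rightarrow> 'k) space" where
  "tensor V W = \<lparr>carr = ten_carr (bil V W) V W, scal = fscale\<rparr>"

lemma vector_space_fscale: "vector_space (fscale :: 'k::field \<Rightarrow> ('x \<Rightarrow> 'k) \<Rightarrow> 'x \<Rightarrow> 'k)"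
  by unfold_locales (auto simp: fscale_def fun_eq_iff algebra_simps)

lemma ten_bilinear:
  assumes "v \<in> carr V" "v' \<in> carr V" "w \<in> carr W" "w' \<in> carr W" "B \<subseteq> bil V W"
  shows "ten B (v + v') w = ten B v w + ten B v' w"
    and "ten B v (w + w') = ten B v w + ten B v w'"
    and "ten B (scal V c v) w = fscale c (ten B v w)"
    and "ten B v (scal W c w) = fscale c (ten B v w)"
  using assms by (auto simp: ten_def fscale_def fun_eq_iff bil_def lin_on_def ground_def)

lemma tensor_universal:
  fixes V :: "('k::field, 'v::ab_group_add, 'y) space_scheme"
    and W :: "('k, 'w::ab_group_add, 'z) space_scheme"
  shows "\<beta> \<in> bil V W \<Longrightarrow>
           lin_on (tensor V W) ground (\<lambda>t. t \<beta>) \<and> (\<forall>v w. ten (bil V W) v w \<beta> = \<beta> v w)"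
    and "lin_on (tensor V W) ground \<phi> \<Longrightarrow>
           \<exists>\<beta>\<in>bil V W. \<forall>t\<in>carr (tensor V W). \<phi> t = t \<beta>"
proof -
  show "lin_on (tensor V W) ground (\<lambda>t. t \<beta>) \<and> (\<forall>v w. ten (bil V W) v w \<beta> = \<beta> v w)"
    if "\<beta> \<in> bil V W"
    using that by (auto simp: lin_on_def tensor_def ground_def fscale_def ten_def)
next
  assume \<phi>: "lin_on (tensor V W) ground \<phi>"
  interpret vector_space "fscale :: 'k \<Rightarrow> (('v \<Rightarrow> 'w \<Rightarrow> 'k) \<Rightarrow> 'k) \<Rightarrow> _"
    by (rule vector_space_fscale)
  let ?T = "{ten (bil V W) v w | v w. v \<in> carr V \<and> w \<in> carr W}"
  have carr: "carr (tensor V W) = span ?T"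
    by (simp add: tensor_def ten_carr_def)
  have add: "\<phi> (s + t) = \<phi> s + \<phi> t" if "s \<in> span ?T" "t \<in> span ?T" for s t
    using \<phi> that by (simp add: lin_on_def carr)
  have scale: "\<phi> (fscale c t) = c * \<phi> t" if "t \<in> span ?T" for c t
    using \<phi> that by (simp add: lin_on_def carr ground_def) (simp add: tensor_def)
  have mem: "ten (bil V W) v w \<in> span ?T" if "v \<in> carr V" "w \<in> carr W" for v w
    using that by (auto intro: span_base)
  define \<beta> where "\<beta> = (\<lambda>v w. \<phi> (ten (bil V W) v w))"
  have "lin_on W ground (\<beta> v)" if "v \<in> carr V" for v
    using that unfolding lin_on_def
    by (simp add: \<beta>_def ground_def ten_bilinear[where V = V and W = W] add scale mem)
  moreover have "lin_on V ground (\<lambda>v. \<beta> v w)" if "w \<in> carr W" for w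
    using that unfolding lin_on_def
    by (simp add: \<beta>_def ground_def ten_bilinear[where V = V and W = W] add scale mem)
  ultimately have \<beta>: "\<beta> \<in> bil V W"
    by (simp add: bil_def)
  have "t \<in> span ?T \<and> \<phi> t = t \<beta>" if "t \<in> span ?T" for t
    using that
  proof (induction rule: span_induct_alt)
    case base
    have "\<phi> 0 = 0"
      using scale[OF span_zero, of 0] by (simp add: fscale_def zero_fun_def)
    then show ?case
      using span_zero[of ?T] by (simp add: zero_fun_def)
  next
    case (step c x y)
    obtain v w where x: "x = ten (bil V W) v w" "v \<in> carr V" "w \<in> carr W"
      using step by blast
    have "x \<in> span ?T"
      using x mem by blast
    then have "fscale c x + y \<in> span ?T" "\<phi> (fscale c x + y) = c * \<phi> x + \<phi> y"
      using step by (auto simp: add scale span_scale span_add)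
    moreover have "\<phi> x = x \<beta>"
      using \<beta> by (simp add: x(1) ten_def) (simp add: \<beta>_def ten_def)
    moreover have "fscale c x \<beta> = c * x \<beta>"
      by (simp add: fscale_def)
    ultimately show ?case
      using step by (simp add: plus_fun_def)
  qed
  then show "\<exists>\<beta>\<in>bil V W. \<forall>t\<in>carr (tensor V W). \<phi> t = t \<beta>"
    using \<beta> carr by blast
qed

text \<open>
  The value at \<open>t\<close> of the linear map on a tensor product that sends \<open>v \<otimes> w\<close> to \<open>F v w\<close>.  Here \<open>F\<close>
  takes values in a space of \<open>k\<close>-valued functions, such as another tensor product.
\<close>

definition lift :: "('v \<Rightarrow> 'w \<Rightarrow> 'x \<Rightarrow> 'k) \<Rightarrow> (('v \<Rightarrow> 'w \<Rightarrow> 'k) \<Rightarrow> 'k) \<Rightarrow> 'x \<Rightarrow> 'k" where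
  "lift F t = (\<lambda>x. t (\<lambda>v w. F v w x))"

text \<open>The map \<open>f \<otimes> g\<close> with values in \<open>tensor V W\<close>.\<close>

definition tmap ::
  "('k::field, 'v::ab_group_add, 'y) space_scheme \<Rightarrow> ('k, 'w::ab_group_add, 'z) space_scheme
    \<Rightarrow> ('a \<Rightarrow> 'v) \<Rightarrow> ('b \<Rightarrow> 'w) \<Rightarrow> (('a \<Rightarrow> 'b \<Rightarrow> 'k) \<Rightarrow> 'k) \<Rightarrow> ('v \<Rightarrow> 'w \<Rightarrow> 'k) \<Rightarrow> 'k" where
  "tmap V W f g t = lift (\<lambda>a b. ten (bil V W) (f a) (g b)) t"

definition dual_space ::
  "('k::field, 'v::ab_group_add, 'z) space_scheme \<Rightarrow> ('k, 'v \<Rightarrow> 'k) space" where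
  "dual_space V =
     \<lparr>carr = {\<phi>. lin_on V ground \<phi> \<and> (\<forall>v. v \<notin> carr V \<longrightarrow> \<phi> v = 0)}, scal = fscale\<rparr>"


section \<open>Finite group schemes\<close>

record ('k, 'h) hopf = "('k, 'h) space" +
  mul :: "'h \<Rightarrow> 'h \<Rightarrow> 'h"
  uni :: "'h"
  comul :: "'h \<Rightarrow> ('h \<Rightarrow> 'h \<Rightarrow> 'k) \<Rightarrow> 'k"
  counit :: "'h \<Rightarrow> 'k"
  antipode :: "'h \<Rightarrow> 'h"

text \<open>
  Identities between elements of \<open>k[G] \<otimes> k[G] \<otimes> k[G]\<close> and of \<open>k[G]\<close> are tested against all
  trilinear, respectively linear, forms.
\<close>

locale finite_group_scheme =
  fixes G :: "('k::field, 'h::ab_group_add) hopf"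
  assumes fin_dim: "fin_dim_space G"
    and uni_closed: "uni G \<in> carr G"
    and mul_linear: "\<And>a. a \<in> carr G \<Longrightarrow> lin_on G G (mul G a)"
    and mul_comm: "\<And>a b. a \<in> carr G \<Longrightarrow> b \<in> carr G \<Longrightarrow> mul G a b = mul G b a"
    and mul_assoc: "\<And>a b c. a \<in> carr G \<Longrightarrow> b \<in> carr G \<Longrightarrow> c \<in> carr G \<Longrightarrow>
          mul G (mul G a b) c = mul G a (mul G b c)"
    and mul_uni: "\<And>a. a \<in> carr G \<Longrightarrow> mul G (uni G) a = a"
    and comul_linear: "lin_on G (tensor G G) (comul G)"
    and comul_uni: "comul G (uni G) = ten (bil G G) (uni G) (uni G)"
    and comul_mul: "\<And>f g. f \<in> carr G \<Longrightarrow> g \<in> carr G \<Longrightarrow>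
          comul G (mul G f g) =
          lift (\<lambda>a b. lift (\<lambda>c d. ten (bil G G) (mul G a c) (mul G b d)) (comul G g)) (comul G f)"
    and coassoc: "\<And>f \<tau>. f \<in> carr G \<Longrightarrow> \<tau> \<in> tril G \<Longrightarrow>
          comul G f (\<lambda>a b. comul G a (\<lambda>a1 a2. \<tau> a1 a2 b)) =
          comul G f (\<lambda>a b. comul G b (\<lambda>b1 b2. \<tau> a b1 b2))"
    and counit_linear: "lin_on G ground (counit G)"
    and counit_uni: "counit G (uni G) = 1"
    and counit_mul: "\<And>a b. a \<in> carr G \<Longrightarrow> b \<in> carr G \<Longrightarrow>
          counit G (mul G a b) = counit G a * counit G b"
    and counit_left: "\<And>f \<phi>. f \<in> carr G \<Longrightarrow> lin_on G ground \<phi> \<Longrightarrow>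
          comul G f (\<lambda>a b. counit G a * \<phi> b) = \<phi> f"
    and counit_right: "\<And>f \<phi>. f \<in> carr G \<Longrightarrow> lin_on G ground \<phi> \<Longrightarrow>
          comul G f (\<lambda>a b. \<phi> a * counit G b) = \<phi> f"
    and antipode_linear: "lin_on G G (antipode G)"
    and antipode_left: "\<And>f \<phi>. f \<in> carr G \<Longrightarrow> lin_on G ground \<phi> \<Longrightarrow>
          comul G f (\<lambda>a b. \<phi> (mul G (antipode G a) b)) = counit G f * \<phi> (uni G)"
    and antipode_right: "\<And>f \<phi>. f \<in> carr G \<Longrightarrow> lin_on G ground \<phi> \<Longrightarrow>
          comul G f (\<lambda>a b. \<phi> (mul G a (antipode G b))) = counit G f * \<phi> (uni G)"

text \<open>A homomorphism of bialgebras; between Hopf algebras it commutes with the antipodes.\<close>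

definition hopf_hom ::
  "('k::field, 'h::ab_group_add) hopf \<Rightarrow> ('k, 'l::ab_group_add) hopf \<Rightarrow> ('h \<Rightarrow> 'l) \<Rightarrow> bool" where
  "hopf_hom H L f \<longleftrightarrow>
     lin_on H L f \<and> f (uni H) = uni L \<and>
     (\<forall>a\<in>carr H. \<forall>b\<in>carr H. f (mul H a b) = mul L (f a) (f b)) \<and>
     (\<forall>a\<in>carr H. comul L (f a) = tmap L L f f (comul H a)) \<and>
     (\<forall>a\<in>carr H. counit L (f a) = counit H a)"

definition hopf_iso ::
  "('k::field, 'h::ab_group_add) hopf \<Rightarrow> ('k, 'l::ab_group_add) hopf \<Rightarrow> bool" where
  "hopf_iso H L \<longleftrightarrow> (\<exists>f. hopf_hom H L f \<and> bij_betw f (carr H) (carr L))"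

text \<open>
  A closed subgroup scheme \<open>N\<close> of \<open>G\<close>, with \<open>\<pi> : k[G] \<rightarrow> k[N]\<close> the restriction of functions.
\<close>

definition closed_subgroup_scheme ::
  "('k::field, 'h::ab_group_add) hopf \<Rightarrow> ('k, 'n::ab_group_add) hopf \<Rightarrow> ('h \<Rightarrow> 'n) \<Rightarrow> bool" where
  "closed_subgroup_scheme G N \<pi> \<longleftrightarrow>
     finite_group_scheme N \<and> hopf_hom G N \<pi> \<and> \<pi> ` carr G = carr N"

text \<open>
  Normality: the conjugation morphism \<open>G \<times> N \<rightarrow> G\<close>, \<open>(g, x) \<mapsto> g x g\<^sup>-\<^sup>1\<close>, factors through \<open>N\<close>.  Its
  comorphism \<open>f \<mapsto> \<Sum> f\<^sub>1 S(f\<^sub>3) \<otimes> \<pi>(f\<^sub>2)\<close> has to vanish on the ideal \<open>ker \<pi>\<close> of \<open>N\<close>.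
\<close>

definition normal_subgroup_scheme ::
  "('k::field, 'h::ab_group_add) hopf \<Rightarrow> ('k, 'n::ab_group_add) hopf \<Rightarrow> ('h \<Rightarrow> 'n) \<Rightarrow> bool" where
  "normal_subgroup_scheme G N \<pi> \<longleftrightarrow>
     closed_subgroup_scheme G N \<pi> \<and>
     (\<forall>f\<in>carr G. \<pi> f = 0 \<longrightarrow>
        lift (\<lambda>a b. lift (\<lambda>b1 b2. ten (bil G N) (mul G a (antipode G b2)) (\<pi> b1)) (comul G b))
          (comul G f) = 0)"

definition alg_ideal :: "('k::field, 'h::ab_group_add) hopf \<Rightarrow> 'h set \<Rightarrow> bool" where
  "alg_ideal H I \<longleftrightarrow> I \<subseteq> carr H \<and> 0 \<in> I \<and> (\<forall>a\<in>I. \<forall>b\<in>I. a + b \<in> I) \<and>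
     (\<forall>r\<in>carr H. \<forall>a\<in>I. mul H r a \<in> I)"

definition maximal_alg_ideal :: "('k::field, 'h::ab_group_add) hopf \<Rightarrow> 'h set \<Rightarrow> bool" where
  "maximal_alg_ideal H I \<longleftrightarrow> alg_ideal H I \<and> I \<noteq> carr H \<and>
     (\<forall>J. alg_ideal H J \<longrightarrow> I \<subseteq> J \<longrightarrow> J = I \<or> J = carr H)"

definition infinitesimal :: "('k::field, 'h::ab_group_add) hopf \<Rightarrow> bool" where
  "infinitesimal G \<longleftrightarrow> (\<exists>!I. maximal_alg_ideal G I)"

text \<open>
  The connected components of \<open>G\<close> correspond to the primitive idempotents of \<open>k[G]\<close>; the one
  containing the identity belongs to the primitive idempotent \<open>e\<close> with \<open>\<epsilon>(e) = 1\<close>.  The coordinate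
  algebra of the component is \<open>k[G] e\<close>, and restriction of functions from \<open>G\<close> is multiplication
  by \<open>e\<close>.
\<close>

definition primitive_idempotent :: "('k::field, 'h::ab_group_add) hopf \<Rightarrow> 'h \<Rightarrow> bool" where
  "primitive_idempotent H e \<longleftrightarrow> e \<in> carr H \<and> e \<noteq> 0 \<and> mul H e e = e \<and>
     (\<forall>d\<in>carr H. mul H d d = d \<longrightarrow> mul H d e = d \<longrightarrow> d = 0 \<or> d = e)"

definition conn_idem :: "('k::field, 'h::ab_group_add) hopf \<Rightarrow> 'h" where
  "conn_idem G = (THE e. primitive_idempotent G e \<and> counit G e = 1)"

definition conn_restr :: "('k::field, 'h::ab_group_add) hopf \<Rightarrow> 'h \<Rightarrow> 'h" where
  "conn_restr G f = mul G f (conn_idem G)"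

definition conn_space :: "('k::field, 'h::ab_group_add) hopf \<Rightarrow> ('k, 'h) space" where
  "conn_space G = \<lparr>carr = conn_restr G ` carr G, scal = scal G\<rparr>"

definition conn_comp :: "('k::field, 'h::ab_group_add) hopf \<Rightarrow> ('k, 'h) hopf" where
  "conn_comp G =
     \<lparr>carr = carr (conn_space G), scal = scal G,
      mul = mul G, uni = conn_idem G,
      comul = (\<lambda>f. tmap (conn_space G) (conn_space G) (conn_restr G) (conn_restr G) (comul G f)),
      counit = counit G, antipode = (\<lambda>f. conn_restr G (antipode G f))\<rparr>"

text \<open>
  \<open>k[G/N]\<close> is the algebra of functions with \<open>f (g x) = f g\<close> for \<open>x\<close> in \<open>N\<close>, that is,
  \<open>(id \<otimes> \<pi>)(\<Delta> f) = f \<otimes> 1\<close>.  Its comultiplication is that of \<open>k[G]\<close>, read as an element of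
  \<open>k[G/N] \<otimes> k[G/N]\<close>.
\<close>

definition quot_space ::
  "('k::field, 'h::ab_group_add) hopf \<Rightarrow> ('k, 'n::ab_group_add) hopf \<Rightarrow> ('h \<Rightarrow> 'n)
    \<Rightarrow> ('k, 'h) space" where
  "quot_space G N \<pi> =
     \<lparr>carr = {f \<in> carr G. tmap G N id \<pi> (comul G f) = ten (bil G N) f (uni N)}, scal = scal G\<rparr>"

definition quot_scheme ::
  "('k::field, 'h::ab_group_add) hopf \<Rightarrow> ('k, 'n::ab_group_add) hopf \<Rightarrow> ('h \<Rightarrow> 'n)
    \<Rightarrow> ('k, 'h) hopf" where
  "quot_scheme G N \<pi> = (let Q = quot_space G N \<pi> in
     \<lparr>carr = carr Q, scal = scal G,
      mul = mul G, uni = uni G,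
      comul = (\<lambda>f. THE t. t \<in> carr (tensor Q Q) \<and> tmap G G id id t = comul G f),
      counit = counit G, antipode = antipode G\<rparr>)"

text \<open>
  A character \<open>G \<rightarrow> \<bbbG>\<^sub>m\<close> is given by a group-like element of \<open>k[G]\<close>.  The characters form a
  (finite) group under the multiplication of \<open>k[G]\<close>, with inversion given by the antipode.
\<close>

definition characters :: "('k::field, 'h::ab_group_add) hopf \<Rightarrow> 'h set" where
  "characters G = {x \<in> carr G. comul G x = ten (bil G G) x x \<and> counit G x = 1}"

definition char_alg_space :: "('k::field, 'h::ab_group_add) hopf \<Rightarrow> ('k, 'h \<Rightarrow> 'k) space" where
  "char_alg_space G = \<lparr>carr = {u. \<forall>x. x \<notin> characters G \<longrightarrow> u x = 0}, scal = fscale\<rparr>"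

definition delta :: "'x \<Rightarrow> 'x \<Rightarrow> 'k::field" where
  "delta x = (\<lambda>y. if y = x then 1 else 0)"

text \<open>The group algebra \<open>k X(G)\<close> of the character group, with its usual Hopf algebra structure.\<close>

definition char_alg :: "('k::field, 'h::ab_group_add) hopf \<Rightarrow> ('k, 'h \<Rightarrow> 'k) hopf" where
  "char_alg G = (let X = characters G; B = bil (char_alg_space G) (char_alg_space G) in
     \<lparr>carr = carr (char_alg_space G), scal = fscale,
      mul = (\<lambda>u v z. \<Sum>(x, y) \<in> {(x, y) \<in> X \<times> X. mul G x y = z}. u x * v y),
      uni = delta (uni G),
      comul = (\<lambda>u \<beta>. \<Sum>x\<in>X. u x * ten B (delta x) (delta x) \<beta>),
      counit = (\<lambda>u. \<Sum>x\<in>X. u x),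
      antipode = (\<lambda>u x. if x \<in> X then u (antipode G x) else 0)\<rparr>)"

definition multiplicative :: "('k::field, 'h::ab_group_add) hopf \<Rightarrow> bool" where
  "multiplicative G \<longleftrightarrow> hopf_iso G (char_alg G)"


section \<open>Group algebras and modules\<close>

text \<open>
  The group algebra \<open>kG = k[G]\<^sup>*\<close> with the dual Hopf algebra structure: the product is
  convolution, and \<open>\<Delta> x \<in> kG \<otimes> kG\<close> is determined by \<open>\<Sum> x\<^sub>1(f) x\<^sub>2(g) = x(f g)\<close>.
\<close>

definition group_alg :: "('k::field, 'h::ab_group_add) hopf \<Rightarrow> ('k, 'h \<Rightarrow> 'k) hopf" where
  "group_alg G = (let D = dual_space G in
     \<lparr>carr = carr D, scal = fscale,
      mul = (\<lambda>x y f. if f \<in> carr G then comul G f (\<lambda>a b. x a * y b) else 0),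
      uni = (\<lambda>f. if f \<in> carr G then counit G f else 0),
      comul = (\<lambda>x. THE t. t \<in> carr (tensor D D) \<and>
                 (\<forall>f\<in>carr G. \<forall>g\<in>carr G. t (\<lambda>a b. a f * b g) = x (mul G f g))),
      counit = (\<lambda>x. x (uni G)),
      antipode = (\<lambda>x f. if f \<in> carr G then x (antipode G f) else 0)\<rparr>)"

text \<open>
  The algebra homomorphism \<open>kG \<rightarrow> kL\<close> induced by a homomorphism \<open>G \<rightarrow> L\<close> with comorphism
  \<open>\<pi> : k[L] \<rightarrow> k[G]\<close>.
\<close>

definition push :: "('k::field, 'l::ab_group_add) hopf \<Rightarrow> ('l \<Rightarrow> 'h) \<Rightarrow> ('h \<Rightarrow> 'k) \<Rightarrow> 'l \<Rightarrow> 'k" where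
  "push L \<pi> x = (\<lambda>f. if f \<in> carr L then x (\<pi> f) else 0)"

record ('k, 'r, 'm) rep = "('k, 'm) space" +
  act :: "'r \<Rightarrow> 'm \<Rightarrow> 'm"

text \<open>Finite-dimensional left modules over an algebra.\<close>

definition fd_module ::
  "('k::field, 'r::ab_group_add) hopf \<Rightarrow> ('k, 'r, 'm::ab_group_add) rep \<Rightarrow> bool" where
  "fd_module A M \<longleftrightarrow>
     fin_dim_space M \<and>
     (\<forall>x\<in>carr A. lin_on M M (act M x)) \<and>
     (\<forall>m\<in>carr M. lin_on A M (\<lambda>x. act M x m)) \<and>
     (\<forall>x\<in>carr A. \<forall>y\<in>carr A. \<forall>m\<in>carr M. act M (mul A x y) m = act M x (act M y m)) \<and>
     (\<forall>m\<in>carr M. act M (uni A) m = m)"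

abbreviation scheme_module ::
  "('k::field, 'h::ab_group_add) hopf \<Rightarrow> ('k, 'h \<Rightarrow> 'k, 'm::ab_group_add) rep \<Rightarrow> bool" where
  "scheme_module G M \<equiv> fd_module (group_alg G) M"

definition module_iso ::
  "('k::field, 'r::ab_group_add) hopf \<Rightarrow> ('k, 'r, 'm::ab_group_add) rep
    \<Rightarrow> ('k, 'r, 'p::ab_group_add) rep \<Rightarrow> bool" where
  "module_iso A M P \<longleftrightarrow>
     (\<exists>f. lin_on M P f \<and> bij_betw f (carr M) (carr P) \<and>
          (\<forall>x\<in>carr A. \<forall>m\<in>carr M. f (act M x m) = act P x (f m)))"

definition submodule ::
  "('k::field, 'r::ab_group_add) hopf \<Rightarrow> ('k, 'r, 'm::ab_group_add) rep \<Rightarrow> 'm set \<Rightarrow> bool" where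
  "submodule A M U \<longleftrightarrow> U \<subseteq> carr M \<and> module.subspace (scal M) U \<and>
     (\<forall>x\<in>carr A. \<forall>u\<in>U. act M x u \<in> U)"

definition indecomposable ::
  "('k::field, 'r::ab_group_add) hopf \<Rightarrow> ('k, 'r, 'm::ab_group_add) rep \<Rightarrow> bool" where
  "indecomposable A M \<longleftrightarrow> fd_module A M \<and> carr M \<noteq> {0} \<and>
     (\<forall>U W. submodule A M U \<longrightarrow> submodule A M W \<longrightarrow> U \<inter> W = {0} \<longrightarrow>
        {u + w | u w. u \<in> U \<and> w \<in> W} = carr M \<longrightarrow> U = {0} \<or> W = {0})"

definition regular_rep :: "('k::field, 'r::ab_group_add) hopf \<Rightarrow> ('k, 'r, 'r) rep" where
  "regular_rep A = \<lparr>carr = carr A, scal = scal A, act = mul A\<rparr>"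

definition sub_regular_rep :: "('k::field, 'r::ab_group_add) hopf \<Rightarrow> 'r set \<Rightarrow> ('k, 'r, 'r) rep" where
  "sub_regular_rep A U = \<lparr>carr = U, scal = scal A, act = mul A\<rparr>"

text \<open>
  A decomposition of the regular module as an internal direct sum of indecomposable submodules
  \<open>P 1, \<dots>, P n\<close>.  As direct summands of a free module these are automatically projective.
\<close>

definition pim_decomposition ::
  "('k::field, 'r::ab_group_add) hopf \<Rightarrow> nat \<Rightarrow> (nat \<Rightarrow> 'r set) \<Rightarrow> bool" where
  "pim_decomposition A n P \<longleftrightarrow>
     (\<forall>i\<in>{1..n}. submodule A (regular_rep A) (P i) \<and>
        indecomposable A (sub_regular_rep A (P i))) \<and>
     (\<forall>r\<in>carr A. \<exists>!u. (\<forall>i\<in>{1..n}. u i \<in> P i) \<and> (\<forall>i. i \<notin> {1..n} \<longrightarrow> u i = 0) \<and>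
        (\<Sum>i=1..n. u i) = r)"

text \<open>
  The \<open>G\<close>-module obtained from an \<open>L\<close>-module along a homomorphism \<open>G \<rightarrow> L\<close> with comorphism \<open>\<pi>\<close>.
  The comorphism of \<open>G \<rightarrow> G/N\<close> is the inclusion of \<open>k[G/N]\<close> in \<open>k[G]\<close>.
\<close>

definition pull_rep ::
  "('k::field, 'l::ab_group_add) hopf \<Rightarrow> ('l \<Rightarrow> 'h) \<Rightarrow> ('k, 'l \<Rightarrow> 'k, 'm) rep
    \<Rightarrow> ('k, 'h \<Rightarrow> 'k, 'm) rep" where
  "pull_rep L \<pi> M = \<lparr>carr = carr M, scal = scal M, act = (\<lambda>x. act M (push L \<pi> x))\<rparr>"

definition res_conn ::
  "('k::field, 'h::ab_group_add) hopf \<Rightarrow> ('k, 'h \<Rightarrow> 'k, 'm) rep \<Rightarrow> ('k, 'h \<Rightarrow> 'k, 'm) rep" where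
  "res_conn G M = pull_rep G (conn_restr G) M"

definition inflate ::
  "('k::field, 'h::ab_group_add) hopf \<Rightarrow> ('k, 'n::ab_group_add) hopf \<Rightarrow> ('h \<Rightarrow> 'n)
    \<Rightarrow> ('k, 'h \<Rightarrow> 'k, 'm) rep \<Rightarrow> ('k, 'h \<Rightarrow> 'k, 'm) rep" where
  "inflate G N \<pi> M = pull_rep (quot_scheme G N \<pi>) id M"

text \<open>The diagonal action: \<open>x (m \<otimes> p) = \<Sum> x\<^sub>1 m \<otimes> x\<^sub>2 p\<close>.\<close>

definition tensor_rep ::
  "('k::field, 'h::ab_group_add) hopf \<Rightarrow> ('k, 'h \<Rightarrow> 'k, 'm::ab_group_add) rep
    \<Rightarrow> ('k, 'h \<Rightarrow> 'k, 'p::ab_group_add) rep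
    \<Rightarrow> ('k, 'h \<Rightarrow> 'k, ('m \<Rightarrow> 'p \<Rightarrow> 'k) \<Rightarrow> 'k) rep" where
  "tensor_rep G M P =
     \<lparr>carr = carr (tensor M P), scal = fscale,
      act = (\<lambda>x. lift (\<lambda>m p. lift (\<lambda>a b. ten (bil M P) (act M a m) (act P b p))
                               (comul (group_alg G) x)))\<rparr>"

text \<open>The one-dimensional module \<open>k\<^sub>\<mu>\<close> of a character \<open>\<mu>\<close>.\<close>

definition char_rep :: "'h \<Rightarrow> ('k::field, 'h \<Rightarrow> 'k, 'k) rep" where
  "char_rep \<mu> = \<lparr>carr = UNIV, scal = (*), act = (\<lambda>x c. x \<mu> * c)\<rparr>"

text \<open>
  The notion of a \<open>G\<^sup>0/N\<close>-regular \<open>G\<^sup>0\<close>-module, here with a group scheme \<open>G\<close> in place of \<open>G\<^sup>0\<close>.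
\<close>

definition quot_regular ::
  "('k::field, 'h::ab_group_add) hopf \<Rightarrow> ('k, 'n::ab_group_add) hopf \<Rightarrow> ('h \<Rightarrow> 'n)
    \<Rightarrow> ('k, 'h \<Rightarrow> 'k, 'm::ab_group_add) rep \<Rightarrow> bool" where
  "quot_regular G N \<pi> M \<longleftrightarrow> (let Q = quot_scheme G N \<pi> in
     {\<mu> \<in> characters Q.
        module_iso (group_alg G) (tensor_rep G M (inflate G N \<pi> (char_rep \<mu>))) M} = {uni Q})"

text \<open>
  The induced module \<open>kG \<otimes>\<^bsub>kN\<^esub> M\<close>; \<open>kN\<close> acts on \<open>kG\<close> from the right and on \<open>M\<close> via \<open>kN \<rightarrow> kG\<close>.
\<close>

definition balanced_forms ::
  "('k::field, 'h::ab_group_add) hopf \<Rightarrow> ('k, 'n::ab_group_add) hopf \<Rightarrow> ('h \<Rightarrow> 'n)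
    \<Rightarrow> ('k, 'h \<Rightarrow> 'k, 'm::ab_group_add) rep \<Rightarrow> (('h \<Rightarrow> 'k) \<Rightarrow> 'm \<Rightarrow> 'k) set" where
  "balanced_forms G N \<pi> M =
     {\<beta> \<in> bil (group_alg G) M. \<forall>x\<in>carr (group_alg G). \<forall>y\<in>carr (group_alg N). \<forall>m\<in>carr M.
        \<beta> (mul (group_alg G) x (push G \<pi> y)) m = \<beta> x (act M (push G \<pi> y) m)}"

definition induced_rep ::
  "('k::field, 'h::ab_group_add) hopf \<Rightarrow> ('k, 'n::ab_group_add) hopf \<Rightarrow> ('h \<Rightarrow> 'n)
    \<Rightarrow> ('k, 'h \<Rightarrow> 'k, 'm::ab_group_add) rep
    \<Rightarrow> ('k, 'h \<Rightarrow> 'k, (('h \<Rightarrow> 'k) \<Rightarrow> 'm \<Rightarrow> 'k) \<Rightarrow> 'k) rep" where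
  "induced_rep G N \<pi> M = (let B = balanced_forms G N \<pi> M in
     \<lparr>carr = ten_carr B (group_alg G) M, scal = fscale,
      act = (\<lambda>z. lift (\<lambda>x m. ten B (mul (group_alg G) z x) m))\<rparr>)"

definition direct_sum_rep ::
  "nat \<Rightarrow> (nat \<Rightarrow> ('k::field, 'r, 'm::ab_group_add) rep)
    \<Rightarrow> ('k, 'r, nat \<Rightarrow> 'm) rep" where
  "direct_sum_rep n M =
     \<lparr>carr = {u. (\<forall>i\<in>{1..n}. u i \<in> carr (M i)) \<and> (\<forall>i. i \<notin> {1..n} \<longrightarrow> u i = 0)},
      scal = (\<lambda>c u i. scal (M i) c (u i)),
      act = (\<lambda>x u i. if i \<in> {1..n} then act (M i) x (u i) else 0)\<rparr>"

end

theory Submission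
  imports Defs
begin

text \<open>
  The adjoint action of \<open>kG\<close> on \<open>E = End\<^sub>N(M)\<close> makes \<open>E\<close> a module over the diagonalizable group \<open>G\<^sup>0/N\<close>, so
  \<open>E\<close> is graded by the finite group \<open>X(G\<^sup>0/N)\<close>.  The part of degree \<open>1\<close> is the local ring \<open>End(M|G\<^sup>0)\<close>.  A
  bijective element of degree \<open>\<lambda> \<noteq> 1\<close> would be an isomorphism \<open>M \<otimes> k\<^sub>\<lambda> \<cong> M\<close> and is excluded by regularity.
  Hence the non-invertible homogeneous elements span a nilpotent ideal \<open>J\<close> with \<open>E = k \<oplus> J\<close>.  The
  projection \<open>chi : E \<rightarrow> k\<close> is invariant under \<open>G\<^sup>0\<close> and under the rational points, hence under \<open>G\<close>.

  A \<open>G\<close>-homomorphism \<open>M \<otimes> P \<rightarrow> M \<otimes> P'\<close> is a matrix over \<open>E\<close>.  Applying \<open>chi\<close> to its entries yields a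
  \<open>G/N\<close>-homomorphism \<open>P \<rightarrow> P'\<close>, functorially, and an idempotent that becomes \<open>0\<close> has entries in \<open>J\<close>, so it
  vanishes.  This transfers indecomposability and isomorphisms between \<open>P\<close> and \<open>M \<otimes> P\<close>.  The
  decomposition is the tensor identity \<open>kG \<otimes>\<^bsub>kN\<^esub> M \<cong> M \<otimes> k(G/N)\<close>.
\<close>

section \<open>Finite-dimensional linear algebra\<close>

text \<open>The work takes place in the dual algebra \<open>kG\<close>, where commutativity of
  \<open>k[G]\<close> becomes cocommutativity, so that Sweedler components can be reordered. Passing
  to \<open>k(G/N)\<close> forms no quotient algebra: a linear functional on \<open>kG\<close> on
  which right multiplication by \<open>kN\<close> acts through the counit is evaluation at an
  element of \<open>k[G/N]\<close>. Algebraic closedness enters twice: eigenvalues make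
  endomorphisms of the indecomposable module scalar plus nilpotent, and rational points together
  with the connected component separate functions on \<open>G\<close>. Conjugation by a rational
  point may permute the degrees, so invariance of \<open>chi\<close> under points is read off from
  nilpotency, not from homogeneous components. Nilpotency of single elements of \<open>J\<close>
  would not control matrices with entries in \<open>J\<close>; hence one filtration of
  \<open>M\<close> is built that all of \<open>J\<close> lowers. It comes from words in homogeneous
  elements: with finitely many degrees, long words contain many factors of degree one. That
  functionals on the component are closed under convolution follows by identifying them with the
  functionals killing a power of the augmentation ideal.\<close>

locale fdv =
  fixes V :: "('k::field, 'v::ab_group_add, 'z) space_scheme"
  assumes fin_dim_V: "fin_dim_space V"
begin

sublocale vector_space "scal V"
  using fin_dim_V by (simp add: fin_dim_space_def)

lemma subspace_carr [simp]: "subspace (carr V)"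
proof -
  obtain B where "span B = carr V"
    using fin_dim_V by (auto simp: fin_dim_space_def)
  then show ?thesis using subspace_span by metis
qed

lemma zero_carr [simp]: "0 \<in> carr V"
  by (rule subspace_0[OF subspace_carr])

lemma add_carr [simp]: "u \<in> carr V \<Longrightarrow> v \<in> carr V \<Longrightarrow> u + v \<in> carr V"
  by (rule subspace_add[OF subspace_carr])

lemma diff_carr [simp]: "u \<in> carr V \<Longrightarrow> v \<in> carr V \<Longrightarrow> u - v \<in> carr V"
  by (rule subspace_diff[OF subspace_carr])

lemma scale_carr [simp]: "v \<in> carr V \<Longrightarrow> scal V c v \<in> carr V"
  by (rule subspace_scale[OF subspace_carr])

lemma sum_carr [simp]: "(\<And>i. i \<in> I \<Longrightarrow> f i \<in> carr V) \<Longrightarrow> (\<Sum>i\<in>I. f i) \<in> carr V"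
  by (rule subspace_sum[OF subspace_carr])

lemma finite_basis_ex: "\<exists>B. finite B \<and> independent B \<and> B \<subseteq> carr V \<and> span B = carr V"
proof -
  obtain S where S: "finite S" "span S = carr V"
    using fin_dim_V by (auto simp: fin_dim_space_def)
  obtain B where "B \<subseteq> S" "independent B" "S \<subseteq> span B"
    using maximal_independent_subset by blast
  then have "span B = carr V"
    using S span_mono[of B S] span_minimal[of S "span B"] subspace_span by blast
  then show ?thesis
    using \<open>B \<subseteq> S\<close> S \<open>independent B\<close> finite_subset[of B S] span_superset[of B] by blast
qed

definition bas :: "'v set" where
  "bas = (SOME B. finite B \<and> independent B \<and> B \<subseteq> carr V \<and> span B = carr V)"

lemma bas: "finite bas" "independent bas" "bas \<subseteq> carr V" "span bas = carr V"
  using someI_ex[OF finite_basis_ex] unfolding bas_def by auto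

lemma finite_bas [simp]: "finite bas" by (rule bas)

lemma bas_carr [simp]: "b \<in> bas \<Longrightarrow> b \<in> carr V" using bas by auto

text \<open>Zero off the carrier, so that the coordinate functional is literally an element of
  \<open>dual_space V\<close>.\<close>

definition du :: "'v \<Rightarrow> 'v \<Rightarrow> 'k" where
  "du b v = (if v \<in> carr V then representation bas v b else 0)"

lemma du_expand: "v \<in> carr V \<Longrightarrow> (\<Sum>b\<in>bas. scal V (du b v) b) = v"
  using sum_representation_eq[of bas v bas] bas by (simp add: du_def)

lemma du_lin: "lin_on V ground (du b)"
  using bas by (simp add: lin_on_def ground_def du_def representation_add representation_scale)

lemma du_dual [simp]: "du b \<in> carr (dual_space V)"
  using du_lin by (simp add: dual_space_def du_def)

lemma lin_on_0: "lin_on V W f \<Longrightarrow> f 0 = 0"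
  unfolding lin_on_def by (metis add_cancel_right_right add_0 zero_carr)

lemma lin_on_sum:
  assumes "lin_on V W f" "\<And>i. i \<in> I \<Longrightarrow> g i \<in> carr V"
  shows "f (\<Sum>i\<in>I. g i) = (\<Sum>i\<in>I. f (g i))"
  using assms(2)
proof (induction I rule: infinite_finite_induct)
  case (insert x F)
  then show ?case
    using assms(1) by (simp add: lin_on_def)
qed (auto simp: lin_on_0[OF assms(1)])

lemma lin_on_add: "lin_on V W f \<Longrightarrow> u \<in> carr V \<Longrightarrow> v \<in> carr V \<Longrightarrow> f (u + v) = f u + f v"
  by (simp add: lin_on_def)

lemma lin_on_scale: "lin_on V W f \<Longrightarrow> v \<in> carr V \<Longrightarrow> f (scal V c v) = scal W c (f v)"
  by (simp add: lin_on_def)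

lemma lin_on_diff: "lin_on V W f \<Longrightarrow> u \<in> carr V \<Longrightarrow> v \<in> carr V \<Longrightarrow> f (u - v) = f u - f v"
  by (metis add_diff_cancel diff_add_cancel diff_carr lin_on_add)

lemma lin_on_carr: "lin_on V W f \<Longrightarrow> v \<in> carr V \<Longrightarrow> f v \<in> carr W"
  by (simp add: lin_on_def)

lemma finite_independent: "independent B \<Longrightarrow> B \<subseteq> carr V \<Longrightarrow> finite B \<and> card B \<le> card bas"
  using independent_span_bound[of bas B] bas by auto

lemma dim_strict_mono:
  assumes "subspace U" "subspace W" "U \<subset> W" "W \<subseteq> carr V"
  shows "dim U < dim W"
proof -
  obtain B where B: "B \<subseteq> U" "independent B" "U \<subseteq> span B" "card B = dim U"
    using basis_exists by blast
  obtain C where C: "C \<subseteq> W" "independent C" "W \<subseteq> span C" "card C = dim W"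
    using basis_exists by blast
  have fin: "finite B" "finite C"
    using finite_independent[of B] finite_independent[of C] B(1,2) C(1,2) assms(3,4)
    by (auto dest: subset_trans)
  obtain w where w: "w \<in> W" "w \<notin> U" using assms by auto
  have "span B \<subseteq> U"
    using B assms by (simp add: span_minimal)
  then have "independent (insert w B)"
    using w B(2) independent_insertI[of w B] by blast
  then have "card (insert w B) \<le> card C"
    using independent_span_bound[OF fin(2), of "insert w B"] B(1) C(3) w(1) assms(3) by blast
  moreover have "w \<notin> B" using w B by auto
  ultimately show ?thesis using fin B C by auto
qed

lemma dim_mono_carr:
  assumes "subspace U" "subspace W" "U \<subseteq> W" "W \<subseteq> carr V"
  shows "dim U \<le> dim W"
  using assms dim_strict_mono[of U W] by (cases "U = W") (auto simp: psubset_eq)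

text \<open>Each strict inclusion costs a dimension. One stationary step is enough for the
  applications, where \<open>A\<close> obeys a recursion that then repeats.\<close>

lemma decreasing_stable:
  assumes "\<And>n. subspace (A n)" "\<And>n. A (Suc n) \<subseteq> A n" "A 0 \<subseteq> carr V"
  shows "\<exists>n. A (Suc n) = A n"
proof (rule ccontr)
  assume "\<not> ?thesis"
  then have strict: "A (Suc n) \<subset> A n" for n using assms by auto
  have sub: "A n \<subseteq> carr V" for n using assms by (induction n) auto
  have "dim (A n) + n \<le> dim (A 0)" for n
  proof (induction n)
    case (Suc n)
    have "dim (A (Suc n)) < dim (A n)"
      by (rule dim_strict_mono[OF assms(1) assms(1) strict sub])
    then show ?case using Suc by linarith
  qed simp
  then show False by (metis add_leD2 not_less_eq_eq order_refl)
qed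

lemma increasing_stable:
  assumes "\<And>n. subspace (A n)" "\<And>n. A n \<subseteq> A (Suc n)" "\<And>n. A n \<subseteq> carr V"
  shows "\<exists>n. A (Suc n) = A n"
proof (rule ccontr)
  assume "\<not> ?thesis"
  then have strict: "A n \<subset> A (Suc n)" for n using assms by auto
  have "n \<le> dim (A n)" for n
  proof (induction n)
    case (Suc n)
    have "dim (A n) < dim (A (Suc n))"
      by (rule dim_strict_mono[OF assms(1) assms(1) strict assms(3)])
    then show ?case using Suc by linarith
  qed simp
  moreover have "dim (A n) \<le> dim (carr V)" for n
    using assms by (intro dim_mono_carr) auto
  ultimately show False by (meson not_less_eq_eq order_trans)
qed

text \<open>Minimality for inclusion is obtained from minimality of the dimension. The predicate is
  left open because it serves stable subspaces, ideals generated by idempotents and ideals of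
  functions alike.\<close>

lemma minimal_subspace_ex:
  assumes "subspace U" "Pr U" "U \<subseteq> carr V"
  shows "\<exists>U. subspace U \<and> Pr U \<and> U \<subseteq> carr V \<and>
    (\<forall>W. subspace W \<longrightarrow> Pr W \<longrightarrow> W \<subseteq> U \<longrightarrow> W = U)"
proof -
  let ?Q = "\<lambda>U. subspace U \<and> Pr U \<and> U \<subseteq> carr V"
  define U0 where "U0 = arg_min dim ?Q"
  have U0: "?Q U0"
    unfolding U0_def by (rule arg_min_natI[of ?Q U dim]) (use assms in blast)
  have min: "dim U0 \<le> dim W" if "?Q W" for W
    unfolding U0_def by (rule arg_min_nat_le[of ?Q W dim, OF that])
  have "W = U0" if W: "subspace W" "Pr W" "W \<subseteq> U0" for W
  proof (rule ccontr)
    assume "W \<noteq> U0"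
    then have "dim W < dim U0"
      using dim_strict_mono[of W U0] W U0 by blast
    then show False using min[of W] W U0 by auto
  qed
  then show ?thesis using U0 by blast
qed

lemma maximal_subspace_ex:
  assumes "subspace U" "Pr U" "U \<subseteq> carr V"
  shows "\<exists>W. subspace W \<and> Pr W \<and> W \<subseteq> carr V \<and> U \<subseteq> W \<and>
    (\<forall>X. subspace X \<longrightarrow> Pr X \<longrightarrow> X \<subseteq> carr V \<longrightarrow> W \<subseteq> X \<longrightarrow> W = X)"
proof -
  let ?Q = "\<lambda>W. subspace W \<and> Pr W \<and> W \<subseteq> carr V \<and> U \<subseteq> W"
  have bd: "\<forall>W. ?Q W \<longrightarrow> dim W < Suc (dim (carr V))"
    using dim_mono_carr by (simp add: less_Suc_eq_le)
  define U0 where "U0 = arg_max dim ?Q"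
  have U0: "?Q U0"
    unfolding U0_def by (rule arg_max_natI[of ?Q U dim, OF _ bd]) (use assms in blast)
  have max: "dim W \<le> dim U0" if "?Q W" for W
    unfolding U0_def by (rule arg_max_nat_le[of ?Q W dim, OF that bd])
  have "U0 = X" if X: "subspace X" "Pr X" "X \<subseteq> carr V" "U0 \<subseteq> X" for X
  proof (rule ccontr)
    assume "U0 \<noteq> X"
    then have "dim U0 < dim X"
      using dim_strict_mono[of U0 X] X U0 by blast
    then show False using max[of X] X U0 by auto
  qed
  then show ?thesis using U0 by blast
qed

subsection \<open>Endomorphisms\<close>

lemma lin_on_id: "lin_on V V (\<lambda>v. v)" by (simp add: lin_on_def)

lemma lin_on_comp: "lin_on V V F \<Longrightarrow> lin_on V V G \<Longrightarrow> lin_on V V (\<lambda>v. F (G v))"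
  by (simp add: lin_on_def)

lemma lin_on_plus: "lin_on V V F \<Longrightarrow> lin_on V V G \<Longrightarrow> lin_on V V (\<lambda>v. F v + G v)"
  by (simp add: lin_on_def scale_right_distrib)

lemma lin_on_scaled: "lin_on V V F \<Longrightarrow> lin_on V V (\<lambda>v. scal V c (F v))"
  by (simp add: lin_on_def scale_right_distrib mult.commute)

lemma lin_on_minus: "lin_on V V F \<Longrightarrow> lin_on V V G \<Longrightarrow> lin_on V V (\<lambda>v. F v - G v)"
  by (simp add: lin_on_def scale_right_diff_distrib)

lemma lin_on_funpow: "lin_on V V F \<Longrightarrow> lin_on V V (F ^^ n)"
  by (induction n) (auto simp: lin_on_def)

lemma subspace_image:
  assumes "lin_on V V F" "subspace U" "U \<subseteq> carr V"
  shows "subspace (F ` U)"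
proof (rule subspaceI)
  show "0 \<in> F ` U"
    using lin_on_0[OF assms(1)] subspace_0[OF assms(2)] by force
  fix x y assume "x \<in> F ` U" "y \<in> F ` U"
  then obtain u v where "u \<in> U" "v \<in> U" "x = F u" "y = F v" by auto
  then show "x + y \<in> F ` U"
    using subspace_add[OF assms(2), of u v] lin_on_add[OF assms(1), of u v] assms(3)
    by (auto intro!: image_eqI[of _ _ "u + v"] simp: subset_eq)
next
  fix c x assume "x \<in> F ` U"
  then obtain u where "u \<in> U" "x = F u" by auto
  then show "scal V c x \<in> F ` U"
    using subspace_scale[OF assms(2), of u c] lin_on_scale[OF assms(1), of u c] assms(3)
    by (auto intro!: image_eqI[of _ _ "scal V c u"] simp: subset_eq)
qed

lemma subspace_kernel:
  assumes "lin_on V V F" "subspace U" "U \<subseteq> carr V"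
  shows "subspace {u \<in> U. F u = 0}"
  using assms lin_on_0[OF assms(1)]
  by (intro subspaceI) (auto simp: subspace_0 subspace_add subspace_scale subset_eq
      lin_on_add[OF assms(1)] lin_on_scale[OF assms(1)])

text \<open>If a nonzero \<open>u\<close> is killed, a preimage of \<open>u\<close> under
  \<open>F ^^ n\<close> is killed by \<open>F ^^ Suc n\<close> but not by \<open>F ^^ n\<close>, so
  the kernels would grow forever.\<close>

lemma surj_imp_inj_on:
  assumes F: "lin_on V V F" and U: "subspace U" "U \<subseteq> carr V" and FU: "F ` U = U"
    and u: "u \<in> U" "F u = 0"
  shows "u = 0"
proof (rule ccontr)
  assume "u \<noteq> 0"
  have surj: "(F ^^ n) ` U = U" for n
    by (induction n) (simp_all only: funpow.simps image_id id_def image_ident image_comp[symmetric] FU)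
  define A where "A n = {v \<in> U. (F ^^ n) v = 0}" for n
  have "\<exists>n. A (Suc n) = A n"
  proof (rule increasing_stable)
    show "subspace (A n)" for n
      unfolding A_def using subspace_kernel[OF lin_on_funpow[OF F] U] .
    show "A n \<subseteq> A (Suc n)" for n
      unfolding A_def using lin_on_0[OF F] by auto
    show "A n \<subseteq> carr V" for n using U by (auto simp: A_def)
  qed
  then obtain n where n: "A (Suc n) = A n" ..
  obtain v where v: "v \<in> U" "(F ^^ n) v = u"
    using surj[of n] u(1) by (metis imageE)
  then have "v \<in> A (Suc n)" using u by (simp add: A_def)
  then have "v \<in> A n" using n by blast
  then show False using v \<open>u \<noteq> 0\<close> by (simp add: A_def)
qed

text \<open>Once the images of the powers repeat, \<open>(F ^^ n) v\<close> equals
  \<open>(F ^^ n) (F u)\<close> for some \<open>u\<close>, and injectivity of the power cancels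
  it.\<close>

lemma inj_imp_surj:
  assumes F: "lin_on V V F" and inj: "\<And>u. u \<in> carr V \<Longrightarrow> F u = 0 \<Longrightarrow> u = 0"
  shows "F ` carr V = carr V"
proof -
  define A where "A n = (F ^^ n) ` carr V" for n
  have sub: "F ` carr V \<subseteq> carr V" using F by (auto simp: lin_on_def)
  have mono: "A (Suc n) \<subseteq> A n" for n
    using sub unfolding A_def funpow_Suc_right image_comp[symmetric] by blast
  have subsp: "subspace (A n)" for n
    unfolding A_def by (intro subspace_image lin_on_funpow F) auto
  have "\<exists>n. A (Suc n) = A n"
    using decreasing_stable[of A, OF subsp mono] by (simp add: A_def)
  then obtain n where n: "A (Suc n) = A n" ..
  have inj_n: "u = v" if "(F ^^ n) u = (F ^^ n) v" "u \<in> carr V" "v \<in> carr V" for u v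
    using that
  proof (induction n)
    case (Suc n)
    have "(F ^^ n) u \<in> carr V" "(F ^^ n) v \<in> carr V"
      using lin_on_carr[OF lin_on_funpow[OF F]] Suc.prems by auto
    then have "(F ^^ n) u - (F ^^ n) v = 0"
      using Suc.prems by - (rule inj, auto simp: lin_on_diff[OF F])
    then show ?case using Suc by auto
  qed simp
  show ?thesis
  proof (intro equalityI sub subsetI)
    fix v assume v: "v \<in> carr V"
    then have "(F ^^ n) v \<in> A (Suc n)" using n by (auto simp: A_def)
    then obtain u where "u \<in> carr V" "(F ^^ n) (F u) = (F ^^ n) v"
      unfolding A_def funpow_Suc_right by auto
    then have "F u = v" using inj_n[of "F u" v] v sub by auto
    then show "v \<in> F ` carr V" using \<open>u \<in> carr V\<close> by auto
  qed
qed

text \<open>Fitting's decomposition: \<open>F\<close> is onto on the stable image, hence so is every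
  power, which leaves no kernel there; subtracting a suitable vector of the stable image moves any
  vector into the kernel.\<close>

lemma fitting:
  assumes F: "lin_on V V F"
  shows "\<exists>n>0. {u \<in> carr V. (F ^^ n) u = 0} \<inter> (F ^^ n) ` carr V = {0} \<and>
    {u + w | u w. u \<in> {u \<in> carr V. (F ^^ n) u = 0} \<and> w \<in> (F ^^ n) ` carr V} = carr V"
proof -
  define A where "A n = (F ^^ n) ` carr V" for n
  have sub: "F ` carr V \<subseteq> carr V" using F by (auto simp: lin_on_def)
  have mono: "A (Suc n) \<subseteq> A n" for n
    using sub unfolding A_def funpow_Suc_right image_comp[symmetric] by blast
  have subsp: "subspace (A n)" for n
    unfolding A_def by (intro subspace_image lin_on_funpow F) auto
  have Ac: "A n \<subseteq> carr V" for n
    unfolding A_def using lin_on_carr[OF lin_on_funpow[OF F]] by auto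
  \<comment> \<open>The chain is shifted by one so that the exponent comes out positive; later uses
    split off one factor \<open>F\<close> from the power.\<close>
  have "\<exists>n. A (Suc (Suc n)) = A (Suc n)"
    using decreasing_stable[of "\<lambda>n. A (Suc n)"] mono subsp Ac by blast
  then obtain n0 where n0: "A (Suc (Suc n0)) = A (Suc n0)" ..
  define n where "n = Suc n0"
  have FA: "F ` A n = A n"
    using n0 by (simp add: A_def n_def image_comp)
  have FnA: "(F ^^ k) ` A n = A n" for k
    by (induction k) (simp_all only: funpow.simps image_id id_def image_ident image_comp[symmetric] FA)
  show ?thesis
  proof (intro exI conjI)
    show "0 < n" by (simp add: n_def)
    have "u = 0" if "u \<in> carr V" "(F ^^ n) u = 0" "u \<in> A n" for u
      using surj_imp_inj_on[OF lin_on_funpow[OF F] subsp Ac FnA] that by blast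
    moreover have "0 \<in> A n" by (rule subspace_0[OF subsp])
    ultimately show "{u \<in> carr V. (F ^^ n) u = 0} \<inter> (F ^^ n) ` carr V = {0}"
      using lin_on_0[OF lin_on_funpow[OF F]] by (auto simp: A_def[symmetric])
    show "{u + w |u w. u \<in> {u \<in> carr V. (F ^^ n) u = 0} \<and> w \<in> (F ^^ n) ` carr V} = carr V"
    proof (intro equalityI subsetI)
      fix v assume v: "v \<in> carr V"
      have "(F ^^ n) v \<in> (F ^^ n) ` A n"
        using v FnA by (auto simp: A_def)
      then obtain w where w: "w \<in> A n" "(F ^^ n) w = (F ^^ n) v" by auto
      then have "w \<in> carr V" using Ac by auto
      then have "v - w \<in> carr V" "(F ^^ n) (v - w) = 0"
        using v w lin_on_diff[OF lin_on_funpow[OF F]] by auto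
      moreover have "v = (v - w) + w" by simp
      ultimately show "v \<in> {u + w |u w. u \<in> {u \<in> carr V. (F ^^ n) u = 0} \<and> w \<in> (F ^^ n) ` carr V}"
        using w unfolding A_def by blast
    qed (use lin_on_carr[OF lin_on_funpow[OF F]] in auto)
  qed
qed

definition nilp :: "('v \<Rightarrow> 'v) \<Rightarrow> bool" where
  "nilp F \<longleftrightarrow> (\<exists>n. \<forall>v\<in>carr V. (F ^^ n) v = 0)"

text \<open>The last nonvanishing iterate of a nonzero vector of \<open>U\<close> is the
  witness.\<close>

lemma nilp_kernel:
  assumes "nilp F" "lin_on V V F" "subspace U" "U \<subseteq> carr V" "U \<noteq> {0}" "F ` U \<subseteq> U"
  shows "\<exists>v\<in>U. v \<noteq> 0 \<and> F v = 0"
proof -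
  obtain u where u: "u \<in> U" "u \<noteq> 0"
    using assms(3,5) subspace_0 by blast
  obtain n where n: "(F ^^ n) u = 0"
    using assms(1,4) u by (auto simp: nilp_def)
  define k where "k = (LEAST k. (F ^^ k) u = 0)"
  have k: "(F ^^ k) u = 0" "\<And>j. j < k \<Longrightarrow> (F ^^ j) u \<noteq> 0"
    using n LeastI[of "\<lambda>k. (F ^^ k) u = 0"] not_less_Least[of _ "\<lambda>k. (F ^^ k) u = 0"]
    by (auto simp: k_def)
  have "k \<noteq> 0" using k(1) u by (cases k) auto
  then obtain j where j: "k = Suc j" using not0_implies_Suc by blast
  have "(F ^^ i) u \<in> U" for i
    using u assms(6) by (induction i) auto
  then show ?thesis using k j by (intro bexI[of _ "(F ^^ j) u"]) auto
qed

end

subsection \<open>Eigenvalues\<close>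

locale fdv_closed = fdv V for V :: "('k::alg_closed_field, 'v::ab_group_add, 'z) space_scheme"
begin

definition papp :: "('v \<Rightarrow> 'v) \<Rightarrow> 'k poly \<Rightarrow> 'v \<Rightarrow> 'v" where
  "papp F p v = (\<Sum>i\<le>degree p. scal V (coeff p i) ((F ^^ i) v))"

lemma papp_eq:
  assumes "degree p \<le> n"
  shows "papp F p v = (\<Sum>i\<le>n. scal V (coeff p i) ((F ^^ i) v))"
  unfolding papp_def using assms
  by (intro sum.mono_neutral_left) (auto simp: coeff_eq_0)

lemma papp_pCons:
  assumes F: "lin_on V V F" and v: "v \<in> carr V"
  shows "papp F (pCons 0 p) v = F (papp F p v)"
proof -
  have c: "(F ^^ i) v \<in> carr V" for i
    using lin_on_carr[OF lin_on_funpow[OF F] v] .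
  have "papp F (pCons 0 p) v = (\<Sum>i\<le>Suc (degree p). scal V (coeff (pCons 0 p) i) ((F ^^ i) v))"
    by (rule papp_eq) (simp add: degree_pCons_le)
  also have "\<dots> = (\<Sum>i\<le>degree p. scal V (coeff p i) (F ((F ^^ i) v)))"
    by (subst sum.atMost_Suc_shift) simp
  also have "\<dots> = F (papp F p v)"
    unfolding papp_def using c
    by (subst lin_on_sum[OF F]) (auto simp: lin_on_scale[OF F])
  finally show ?thesis .
qed

lemma papp_factor:
  assumes F: "lin_on V V F" and v: "v \<in> carr V"
  shows "papp F ([:- c, 1:] * q) v = F (papp F q v) - scal V c (papp F q v)"
proof -
  have eq: "[:- c, 1:] * q = pCons 0 q - smult c q"
    by (simp add: minus_pCons)
  let ?n = "Suc (degree q)"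
  have "papp F ([:- c, 1:] * q) v =
      (\<Sum>i\<le>?n. scal V (coeff (pCons 0 q) i - c * coeff q i) ((F ^^ i) v))"
    unfolding eq by (subst papp_eq[of _ ?n])
      (auto intro!: degree_diff_le simp: degree_pCons_le le_SucI degree_smult_le[THEN order_trans])
  also have "\<dots> = (\<Sum>i\<le>?n. scal V (coeff (pCons 0 q) i) ((F ^^ i) v)) -
      scal V c (\<Sum>i\<le>?n. scal V (coeff q i) ((F ^^ i) v))"
    by (simp add: scale_left_diff_distrib sum_subtractf scale_sum_right del: sum.atMost_Suc)
  also have "\<dots> = papp F (pCons 0 q) v - scal V c (papp F q v)"
    by (simp add: papp_eq[of _ ?n] degree_pCons_le del: sum.atMost_Suc)
  finally show ?thesis using papp_pCons[OF F v] by simp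
qed

text \<open>The first \<open>card bas + 1\<close> iterates of \<open>v\<close> are too many to be
  independent.\<close>

lemma annihilating_poly_ex:
  assumes F: "lin_on V V F" and v: "v \<in> carr V"
  shows "\<exists>p. p \<noteq> 0 \<and> papp F p v = 0"
proof -
  let ?n = "card bas"
  let ?f = "\<lambda>i. (F ^^ i) v"
  have c: "?f i \<in> carr V" for i
    using lin_on_carr[OF lin_on_funpow[OF F] v] .
  show ?thesis
  \<comment> \<open>\<open>dependent\<close> speaks of sets, so coinciding iterates, which carry a
    trivial relation, have to be treated apart.\<close>
  proof (cases "inj_on ?f {..?n}")
    case True
    then have "card (?f ` {..?n}) = Suc ?n" by (simp add: card_image)
    then have "dependent (?f ` {..?n})"
      using finite_independent[of "?f ` {..?n}"] c by auto
    then obtain u where u: "\<exists>w\<in>?f ` {..?n}. u w \<noteq> 0" "(\<Sum>w\<in>?f ` {..?n}. scal V (u w) w) = 0"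
      using dependent_finite[of "?f ` {..?n}"] by auto
    define p where "p = (\<Sum>i\<le>?n. monom (u (?f i)) i)"
    have co: "coeff p i = (if i \<le> ?n then u (?f i) else 0)" for i
      by (simp add: p_def coeff_sum if_distrib[of "\<lambda>x. x i"] sum.delta' cong: if_cong)
    have "degree p \<le> ?n" by (rule degree_le) (simp add: co)
    then have "papp F p v = (\<Sum>i\<le>?n. scal V (u (?f i)) (?f i))"
      by (simp add: papp_eq co)
    also have "\<dots> = 0"
      using u(2) sum.reindex[OF True, of "\<lambda>w. scal V (u w) w"] by simp
    finally have "papp F p v = 0" .
    moreover have "p \<noteq> 0" using u(1) co by (metis (no_types, lifting) atMost_iff coeff_0 imageE)
    ultimately show ?thesis by blast
  next
    case False
    then obtain i j where ij: "i \<noteq> j" "?f i = ?f j" by (auto simp: inj_on_def)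
    define p where "p = monom (1::'k) i - monom 1 j"
    have "p \<noteq> 0"
      using ij by (auto simp: p_def poly_eq_iff intro!: exI[of _ i])
    have "degree p \<le> i + j" by (simp add: p_def degree_diff_le degree_monom_eq)
    then have "papp F p v = (\<Sum>k\<le>i + j. scal V (coeff p k) (?f k))" by (rule papp_eq)
    also have "\<dots> = (\<Sum>k\<le>i + j. (if k = i then ?f i else 0) - (if k = j then ?f j else 0))"
      by (intro sum.cong) (auto simp: p_def)
    also have "\<dots> = 0" using ij by (simp add: sum_subtractf)
    finally show ?thesis using \<open>p \<noteq> 0\<close> by blast
  qed
qed

text \<open>Take an annihilating polynomial of least degree at a single vector \<open>u\<close> of
  \<open>U\<close> and split off a root: the cofactor applied to \<open>u\<close> is nonzero by
  minimality and is an eigenvector. Working with one vector keeps the eigenvector inside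
  \<open>U\<close>.\<close>

lemma eigenvector_ex:
  assumes F: "lin_on V V F" and U: "subspace U" "U \<subseteq> carr V" "U \<noteq> {0}" "F ` U \<subseteq> U"
  shows "\<exists>c. \<exists>v\<in>U. v \<noteq> 0 \<and> F v = scal V c v"
proof -
  obtain u where u: "u \<in> U" "u \<noteq> 0" using U subspace_0 by blast
  then have uc: "u \<in> carr V" using U by auto
  define n where "n = (LEAST n. \<exists>p. p \<noteq> 0 \<and> papp F p u = 0 \<and> degree p = n)"
  have ex: "\<exists>n p. p \<noteq> 0 \<and> papp F p u = 0 \<and> degree p = n"
    using annihilating_poly_ex[OF F uc] by auto
  obtain p where p: "p \<noteq> 0" "papp F p u = 0" "degree p = n"
    using LeastI_ex[OF ex] unfolding n_def by blast
  have min: "papp F q u \<noteq> 0" if "q \<noteq> 0" "degree q < n" for q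
    using not_less_Least[of "degree q" "\<lambda>n. \<exists>p. p \<noteq> 0 \<and> papp F p u = 0 \<and> degree p = n"] that
    unfolding n_def by blast
  have "degree p > 0"
  proof (rule ccontr)
    assume "\<not> degree p > 0"
    then have "papp F p u = scal V (coeff p 0) u" by (simp add: papp_def)
    then show False using p u \<open>\<not> degree p > 0\<close> by (metis leading_coeff_0_iff neq0_conv scale_eq_0_iff)
  qed
  then obtain c where "poly p c = 0" using alg_closed_imp_poly_has_root by blast
  then obtain q where q: "p = [:- c, 1:] * q" by (auto simp: poly_eq_0_iff_dvd)
  have "q \<noteq> 0" using p q by auto
  moreover have "degree q < n"
    using degree_mult_eq[of "[:- c, 1:]" q] p(3) q \<open>q \<noteq> 0\<close> by simp
  ultimately have "papp F q u \<noteq> 0" by (rule min)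
  moreover have "F (papp F q u) = scal V c (papp F q u)"
    using papp_factor[OF F uc, of c q] p q by simp
  moreover have "(F ^^ i) u \<in> U" for i using u U by (induction i) auto
  then have "papp F q u \<in> U"
    unfolding papp_def using U by (auto intro!: subspace_sum subspace_scale)
  ultimately show ?thesis by blast
qed

end

lemma (in fdv) complement_projection:
  assumes U: "subspace U" and W: "subspace W" and UW: "U \<inter> W = {0}" "{u + w | u w. u \<in> U \<and> w \<in> W} = carr V"
  shows "\<exists>e. lin_on V V e \<and> (\<forall>v\<in>carr V. e v \<in> U \<and> v - e v \<in> W) \<and> (\<forall>u\<in>U. \<forall>w\<in>W. e (u + w) = u)"
proof -
  have UV: "u + w \<in> carr V" if "u \<in> U" "w \<in> W" for u w using UW(2) that by blast
  have U0: "0 \<in> U" "0 \<in> W" using subspace_0 U W by blast+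
  have "\<forall>v\<in>carr V. \<exists>u. u \<in> U \<and> v - u \<in> W"
  proof
    fix v assume "v \<in> carr V"
    then obtain u w where "v = u + w" "u \<in> U" "w \<in> W" using UW(2) by blast
    then show "\<exists>u. u \<in> U \<and> v - u \<in> W" by (intro exI[of _ u]) simp
  qed
  then obtain e where e: "\<And>v. v \<in> carr V \<Longrightarrow> e v \<in> U" "\<And>v. v \<in> carr V \<Longrightarrow> v - e v \<in> W" using bchoice[of "carr V"] by metis
  have eq: "e (u + w) = u" if "u \<in> U" "w \<in> W" for u w
  proof -
    have "e (u + w) - u \<in> U" using e(1)[OF UV[OF that]] subspace_diff[OF U] that by blast
    moreover have "w - (u + w - e (u + w)) \<in> W" using e(2)[OF UV[OF that]] subspace_diff[OF W] that by blast
    moreover have "w - (u + w - e (u + w)) = e (u + w) - u" by simp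
    ultimately have "e (u + w) - u \<in> U \<inter> W" by simp
    then show ?thesis using UW(1) by simp
  qed
  have "e (u + v) = e u + e v" if "u \<in> carr V" "v \<in> carr V" for u v
    using eq[of "e u + e v" "(u - e u) + (v - e v)"] subspace_add[OF U] subspace_add[OF W] e that by (simp add: add_diff_add)
  moreover have "e (scal V c v) = scal V c (e v)" if "v \<in> carr V" for c v
    using eq[of "scal V c (e v)" "scal V c (v - e v)"] subspace_scale[OF U] subspace_scale[OF W] e that
    by (simp add: scale_right_distrib[symmetric])
  moreover have "e v \<in> carr V" if "v \<in> carr V" for v using UV[OF e(1)[OF that] U0(2)] by simp
  ultimately have "lin_on V V e" unfolding lin_on_def by blast
  then show ?thesis using e eq by blast
qed

section \<open>Graded algebras of endomorphisms\<close>

context fdv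
begin

section \<open>Nilpotent maps and flags\<close>

lemma nilp_cong: "nilp F \<Longrightarrow> lin_on V V F \<Longrightarrow> (\<And>v. v \<in> carr V \<Longrightarrow> F v = G v) \<Longrightarrow> nilp G"
proof -
  assume F: "nilp F" "lin_on V V F" and eq: "\<And>v. v \<in> carr V \<Longrightarrow> F v = G v"
  have "(G ^^ n) v = (F ^^ n) v" if "v \<in> carr V" for n v
    using that lin_on_carr[OF lin_on_funpow[OF F(2)]] eq by (induction n) auto
  then show "nilp G" using F(1) by (auto simp: nilp_def)
qed

lemma nilp_funpowD: "nilp (F ^^ k) \<Longrightarrow> nilp F"
  by (auto simp: nilp_def funpow_mult)

lemma carr_nonzero: "carr V \<noteq> {0} \<Longrightarrow> \<exists>v\<in>carr V. v \<noteq> 0"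
  using zero_carr by blast

lemma nilp_not_inj:
  assumes "nilp F" "lin_on V V F" "carr V \<noteq> {0}"
  shows "\<exists>v\<in>carr V. v \<noteq> 0 \<and> F v = 0"
proof -
  have "F ` carr V \<subseteq> carr V" using assms(2) by (auto simp: lin_on_def)
  then show ?thesis
    using nilp_kernel[OF assms(1,2) subspace_carr subset_refl assms(3)] by blast
qed

lemma eigenvector_funpow:
  assumes "lin_on V V F" "v \<in> carr V" "F v = scal V c v"
  shows "(F ^^ n) v = scal V (c ^ n) v"
  using assms by (induction n) (auto simp: lin_on_scale[OF assms(1)] mult.commute)

lemma nilp_eigenvalue:
  assumes "lin_on V V F" "v \<in> carr V" "v \<noteq> 0" "F v = scal V c v" "nilp F"
  shows "c = 0"
proof -
  obtain n where "(F ^^ n) v = 0" using assms by (auto simp: nilp_def)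
  then show ?thesis using eigenvector_funpow[OF assms(1,2,4), of n] assms(3) by simp
qed

text \<open>A minimal stable subspace \<open>U\<close> strictly above \<open>Z\<close> works. If
  \<open>s u\<close> were outside \<open>Z\<close>, then \<open>S u + Z\<close> would be stable and
  properly larger than \<open>Z\<close>, hence all of \<open>U\<close>; so
  \<open>u = t u + z\<close> with \<open>t\<close> in \<open>S\<close>, and iterating shows
  \<open>u\<close> congruent to \<open>(t ^^ k) u\<close> modulo \<open>Z\<close>, which puts
  \<open>u\<close> into \<open>Z\<close>.\<close>

lemma flag_step:
  assumes S: "\<And>s. s \<in> S \<Longrightarrow> lin_on V V s \<and> nilp s"
    "\<And>s t. s \<in> S \<Longrightarrow> t \<in> S \<Longrightarrow> (\<lambda>v. s v + t v) \<in> S"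
    "\<And>s c. s \<in> S \<Longrightarrow> (\<lambda>v. scal V c (s v)) \<in> S"
    "\<And>s t. s \<in> S \<Longrightarrow> t \<in> S \<Longrightarrow> (\<lambda>v. s (t v)) \<in> S"
    "(\<lambda>v. 0) \<in> S"
    and Z: "subspace Z" "Z \<subset> carr V" "\<And>s. s \<in> S \<Longrightarrow> s ` Z \<subseteq> Z"
  shows "\<exists>U. subspace U \<and> U \<subseteq> carr V \<and> Z \<subset> U \<and> (\<forall>s\<in>S. s ` U \<subseteq> Z)"
proof -
  let ?P = "\<lambda>U. Z \<subset> U \<and> (\<forall>s\<in>S. s ` U \<subseteq> U)"
  have "?P (carr V)" using S(1) Z(2) by (auto simp: lin_on_def)
  from minimal_subspace_ex[of "carr V" ?P, OF _ this] obtain U where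
    U: "subspace U" "Z \<subset> U" "\<forall>s\<in>S. s ` U \<subseteq> U" "U \<subseteq> carr V"
    and min: "\<And>W. subspace W \<Longrightarrow> ?P W \<Longrightarrow> W \<subseteq> U \<Longrightarrow> W = U"
    by auto
  have "s u \<in> Z" if s: "s \<in> S" "u \<in> U" for s u
  proof (rule ccontr)
    assume nz: "s u \<notin> Z"
    have uc: "u \<in> carr V" using that U by auto
    define W where "W = {t u + z | t z. t \<in> S \<and> z \<in> Z}"
    have Zc: "z \<in> carr V" if "z \<in> Z" for z using that Z by auto
    have "subspace W"
    proof (rule subspaceI)
      show "0 \<in> W"
        unfolding W_def using S(5) subspace_0[OF Z(1)] by force
      fix x y assume "x \<in> W" "y \<in> W"
      then obtain t z t' z' where *: "x = t u + z" "y = t' u + z'" "t \<in> S" "t' \<in> S" "z \<in> Z" "z' \<in> Z"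
        by (auto simp: W_def)
      then have "x + y = (\<lambda>v. t v + t' v) u + (z + z')" by (simp add: algebra_simps)
      then show "x + y \<in> W"
        unfolding W_def using S(2)[OF *(3,4)] subspace_add[OF Z(1) *(5,6)]
        by (intro CollectI exI[of _ "\<lambda>v. t v + t' v"] exI[of _ "z + z'"]) simp
    next
      fix c x assume "x \<in> W"
      then obtain t z where *: "x = t u + z" "t \<in> S" "z \<in> Z"
        by (auto simp: W_def)
      then have "scal V c x = (\<lambda>v. scal V c (t v)) u + scal V c z" by (simp add: scale_right_distrib)
      then show "scal V c x \<in> W"
        unfolding W_def using S(3)[OF *(2)] subspace_scale[OF Z(1) *(3)]
        by (intro CollectI exI[of _ "\<lambda>v. scal V c (t v)"] exI[of _ "scal V c z"]) simp
    qed
    moreover have "W \<subseteq> U"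
    proof
      fix x assume "x \<in> W"
      then obtain t z where *: "x = t u + z" "t \<in> S" "z \<in> Z" by (auto simp: W_def)
      have "t u \<in> U" "z \<in> U" using U * s(2) by auto
      then show "x \<in> U" using subspace_add[OF U(1)] * by simp
    qed
    moreover have "Z \<subset> W"
    proof
      show "Z \<subseteq> W"
        unfolding W_def using S(5) by force
      have "s u \<in> W"
        unfolding W_def using s(1) subspace_0[OF Z(1)] by force
      then show "Z \<noteq> W" using nz by auto
    qed
    moreover have "t ` W \<subseteq> W" if t: "t \<in> S" for t
    proof
      fix y assume "y \<in> t ` W"
      then obtain t' z where *: "y = t (t' u + z)" "t' \<in> S" "z \<in> Z" by (auto simp: W_def)
      have "t' u \<in> carr V" using S(1)[OF *(2)] uc by (auto simp: lin_on_def)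
      then have "y = (\<lambda>v. t (t' v)) u + t z"
        using * lin_on_add[of V t "t' u" z] S(1)[OF t] Zc by simp
      moreover have "t z \<in> Z" using Z(3)[OF t] * by auto
      ultimately show "y \<in> W"
        unfolding W_def using S(4)[OF t *(2)]
        by (intro CollectI exI[of _ "\<lambda>v. t (t' v)"] exI[of _ "t z"]) simp
    qed
    ultimately have "W = U" using min by blast
    then obtain t z where t: "u = t u + z" "t \<in> S" "z \<in> Z"
      using s(2) by (auto simp: W_def)
    have lt: "lin_on V V t" using S(1) t by auto
    have "u - (t ^^ k) u \<in> Z" for k
    proof (induction k)
      case (Suc k)
      have c: "(t ^^ k) u \<in> carr V" using lin_on_carr[OF lin_on_funpow[OF lt] uc] .
      have "t u = u - z" using t(1) by (metis add_diff_cancel_right')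
      then have "u - (t ^^ Suc k) u = z + t (u - (t ^^ k) u)"
        using lin_on_diff[OF lt uc c] by simp
      moreover have "t (u - (t ^^ k) u) \<in> Z" using Z(3)[OF t(2)] Suc by auto
      ultimately show ?case using subspace_add[OF Z(1) t(3)] by simp
    qed (simp add: subspace_0[OF Z(1)])
    moreover obtain k where "(t ^^ k) u = 0"
      using S(1)[OF t(2)] uc by (auto simp: nilp_def)
    ultimately have "u \<in> Z" by (metis diff_zero)
    then show False using nz Z(3)[OF s(1)] by auto
  qed
  then show ?thesis using U by blast
qed

text \<open>A linear space of nilpotent maps closed under composition is nilpotent as a whole.
  \<open>Z\<close> is the ascending series of iterated common kernels, and \<open>flag_step\<close>
  forbids it to stop below \<open>carr V\<close>.\<close>

lemma flag_ex:
  assumes S: "\<And>s. s \<in> S \<Longrightarrow> lin_on V V s \<and> nilp s"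
    "\<And>s t. s \<in> S \<Longrightarrow> t \<in> S \<Longrightarrow> (\<lambda>v. s v + t v) \<in> S"
    "\<And>s c. s \<in> S \<Longrightarrow> (\<lambda>v. scal V c (s v)) \<in> S"
    "\<And>s t. s \<in> S \<Longrightarrow> t \<in> S \<Longrightarrow> (\<lambda>v. s (t v)) \<in> S"
    "(\<lambda>v. 0) \<in> S"
  shows "\<exists>Z n. Z 0 = {0} \<and> Z n = carr V \<and> (\<forall>i. \<forall>s\<in>S. s ` Z (Suc i) \<subseteq> Z i)"
proof -
  define Z where "Z = rec_nat {0} (\<lambda>_ A. {v \<in> carr V. \<forall>s\<in>S. s v \<in> A})"
  have Z0: "Z 0 = {0}" and ZS: "Z (Suc i) = {v \<in> carr V. \<forall>s\<in>S. s v \<in> Z i}" for i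
    by (simp_all add: Z_def)
  have sub: "subspace (Z i)" for i
  proof (induction i)
    case (Suc i)
    have "s (x + y) = s x + s y" "s (scal V c x) = scal V c (s x)"
      if "s \<in> S" "x \<in> carr V" "y \<in> carr V" for s x y c
      using S(1)[OF that(1)] that by (auto simp: lin_on_def)
    note lin = this
    show ?case unfolding ZS
    proof (rule subspaceI)
      show "0 \<in> {v \<in> carr V. \<forall>s\<in>S. s v \<in> Z i}"
        using lin_on_0 S(1) subspace_0[OF Suc] by fastforce
    qed (auto simp: lin subspace_add[OF Suc] subspace_scale[OF Suc])
  qed (simp add: Z0)
  have carr: "Z i \<subseteq> carr V" for i by (cases i) (auto simp: Z0 ZS)
  have mono: "Z i \<subseteq> Z (Suc i)" for i
  proof (induction i)
    case 0
    then show ?case using lin_on_0 S(1) by (fastforce simp: Z0 ZS)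
  next
    case (Suc i)
    then show ?case unfolding ZS[of "Suc i"] ZS[of i] by auto
  qed
  obtain n where n: "Z (Suc n) = Z n" using increasing_stable[of Z, OF sub mono carr] ..
  have "Z n = carr V"
  proof (rule ccontr)
    assume "Z n \<noteq> carr V"
    then have a: "Z n \<subset> carr V" using carr by auto
    have b: "s ` Z n \<subseteq> Z n" if "s \<in> S" for s
      using that n ZS[of n] by auto
    have "\<exists>U. subspace U \<and> U \<subseteq> carr V \<and> Z n \<subset> U \<and> (\<forall>s\<in>S. s ` U \<subseteq> Z n)"
      by (rule flag_step[of S]) (fact S sub a b)+
    then obtain U where "U \<subseteq> carr V" "Z n \<subset> U" "\<forall>s\<in>S. s ` U \<subseteq> Z n" by blast
    then have "U \<subseteq> Z (Suc n)" unfolding ZS by auto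
    then show False using \<open>Z n \<subset> U\<close> n by auto
  qed
  then show ?thesis using Z0 ZS by (intro exI[of _ Z] exI[of _ n]) auto
qed

end

text \<open>The abstract situation left after the module theory. Inverses in the group of degrees
  enter through \<open>op_cancel\<close>; \<open>W_one\<close> records a local endomorphism ring
  with residue field \<open>k\<close>, and \<open>W_other\<close> records regularity.\<close>

locale graded_endos = fdv V
  for V :: "('k::field, 'v::ab_group_add, 'z) space_scheme" +
  fixes X :: "'x set" and op :: "'x \<Rightarrow> 'x \<Rightarrow> 'x" and one :: 'x and W :: "'x \<Rightarrow> ('v \<Rightarrow> 'v) set"
  assumes nonzero: "carr V \<noteq> {0}"
    and finite_X: "finite X" and one_X: "one \<in> X"
    and op_X: "\<And>a b. a \<in> X \<Longrightarrow> b \<in> X \<Longrightarrow> op a b \<in> X"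
    and op_assoc: "\<And>a b c. a \<in> X \<Longrightarrow> b \<in> X \<Longrightarrow> c \<in> X \<Longrightarrow> op (op a b) c = op a (op b c)"
    and op_one: "\<And>a. a \<in> X \<Longrightarrow> op one a = a" "\<And>a. a \<in> X \<Longrightarrow> op a one = a"
    and op_cancel: "\<And>a b. a \<in> X \<Longrightarrow> b \<in> X \<Longrightarrow> op a b = b \<Longrightarrow> a = one"
    and W_lin: "\<And>l F. l \<in> X \<Longrightarrow> F \<in> W l \<Longrightarrow> lin_on V V F"
    and W_zero: "\<And>l. l \<in> X \<Longrightarrow> (\<lambda>v. 0) \<in> W l"
    and W_add: "\<And>l F G. l \<in> X \<Longrightarrow> F \<in> W l \<Longrightarrow> G \<in> W l \<Longrightarrow> (\<lambda>v. F v + G v) \<in> W l"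
    and W_scale: "\<And>l F c. l \<in> X \<Longrightarrow> F \<in> W l \<Longrightarrow> (\<lambda>v. scal V c (F v)) \<in> W l"
    and W_comp: "\<And>a b F G. a \<in> X \<Longrightarrow> b \<in> X \<Longrightarrow> F \<in> W a \<Longrightarrow> G \<in> W b \<Longrightarrow> (\<lambda>v. F (G v)) \<in> W (op a b)"
    and W_id: "(\<lambda>v. v) \<in> W one"
    and W_inv: "\<And>F. F \<in> W one \<Longrightarrow> bij_betw F (carr V) (carr V) \<Longrightarrow> inv_into (carr V) F \<in> W one"
    and W_one: "\<And>F. F \<in> W one \<Longrightarrow> \<exists>c. nilp (\<lambda>v. F v - scal V c v)"
    and W_other: "\<And>l F. l \<in> X \<Longrightarrow> l \<noteq> one \<Longrightarrow> F \<in> W l \<Longrightarrow> \<exists>v\<in>carr V. v \<noteq> 0 \<and> F v = 0"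
begin

text \<open>Two powers of \<open>l\<close> coincide in the finite set \<open>X\<close>, and
  \<open>op_cancel\<close> turns the coincidence into a positive power equal to
  \<open>one\<close>.\<close>

lemma W_funpow:
  assumes "l \<in> X" "F \<in> W l"
  shows "\<exists>k>0. (F ^^ k) \<in> W one"
proof -
  define pw where "pw n = (op l ^^ n) one" for n
  have pX: "pw n \<in> X" for n by (induction n) (auto simp: pw_def one_X op_X assms)
  have add: "pw (m + n) = op (pw m) (pw n)" for m n
    using pX by (induction m) (auto simp: pw_def op_one op_assoc assms(1))
  have FW: "(F ^^ n) \<in> W (pw n)" for n
  proof (induction n)
    case 0
    then show ?case using W_id by (simp add: pw_def id_def)
  next
    case (Suc n)
    then show ?case using W_comp[OF assms(1) pX assms(2) Suc] by (simp add: pw_def comp_def)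
  qed
  have "\<not> inj pw"
    using finite_X pX by (metis finite_subset image_subset_iff infinite_UNIV_nat finite_imageD)
  then obtain i j where "i < j" "pw i = pw j"
    unfolding inj_on_def by (metis linorder_neqE_nat)
  then have "op (pw (j - i)) (pw i) = pw i" using add[of "j - i" i] by simp
  then have "pw (j - i) = one" using op_cancel pX by blast
  then show ?thesis using FW[of "j - i"] \<open>i < j\<close> by (intro exI[of _ "j - i"]) auto
qed

text \<open>A power of \<open>F\<close> has degree one, where maps are scalar plus nilpotent; a
  kernel vector forces the scalar to be zero.\<close>

lemma W_noninj_nilp:
  assumes l: "l \<in> X" "F \<in> W l" and v: "v \<in> carr V" "v \<noteq> 0" "F v = 0"
  shows "nilp F"
proof -
  have one: "nilp F" if F: "F \<in> W one" and Fv: "F v = 0" for F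
  proof -
    obtain c where c: "nilp (\<lambda>v. F v - scal V c v)" using W_one F by blast
    have lin: "lin_on V V F" using W_lin[OF one_X F] .
    have "lin_on V V (\<lambda>v. F v - scal V c v)"
      by (intro lin_on_minus lin lin_on_scaled lin_on_id)
    \<comment> \<open>On the kernel vector \<open>v\<close> the nilpotent map acts as the scalar
      \<open>- c\<close>.\<close>
    from nilp_eigenvalue[OF this v(1,2) _ c, of "- c"] have "c = 0" using Fv by simp
    then show ?thesis using c by simp
  qed
  obtain k where k: "k > 0" "(F ^^ k) \<in> W one" using W_funpow l by blast
  obtain j where "k = Suc j" using k by (cases k) auto
  moreover have "(F ^^ j) 0 = 0" using lin_on_0[OF lin_on_funpow[OF W_lin[OF l]]] .
  ultimately have "(F ^^ k) v = 0" using v by (simp only: funpow_Suc_right comp_def)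
  then have "nilp (F ^^ k)" using one k by blast
  then show ?thesis by (rule nilp_funpowD)
qed

definition nil_part :: "'x \<Rightarrow> ('v \<Rightarrow> 'v) set" where
  "nil_part l = {F \<in> W l. nilp F}"

lemma nil_part_kernel:
  "l \<in> X \<Longrightarrow> F \<in> nil_part l \<Longrightarrow> \<exists>v\<in>carr V. v \<noteq> 0 \<and> F v = 0"
  using nilp_not_inj W_lin nonzero by (auto simp: nil_part_def)

lemma nil_partI: "l \<in> X \<Longrightarrow> F \<in> W l \<Longrightarrow> v \<in> carr V \<Longrightarrow> v \<noteq> 0 \<Longrightarrow> F v = 0 \<Longrightarrow> F \<in> nil_part l"
  using W_noninj_nilp by (auto simp: nil_part_def)

lemma nil_part_comp_left:
  assumes "a \<in> X" "b \<in> X" "F \<in> W a" "G \<in> nil_part b"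
  shows "(\<lambda>v. F (G v)) \<in> nil_part (op a b)"
proof -
  obtain v where "v \<in> carr V" "v \<noteq> 0" "G v = 0" using nil_part_kernel assms by blast
  then show ?thesis
    using assms W_comp lin_on_0[OF W_lin[OF assms(1,3)]]
    by (intro nil_partI[of _ _ v] op_X) (auto simp: nil_part_def)
qed

text \<open>Nilpotency is checked through a kernel vector: either \<open>G\<close> has one, or
  \<open>G\<close> is onto and a kernel vector of \<open>F\<close> is pulled back along it.\<close>

lemma nil_part_comp_right:
  assumes "a \<in> X" "b \<in> X" "F \<in> nil_part a" "G \<in> W b"
  shows "(\<lambda>v. F (G v)) \<in> nil_part (op a b)"
proof -
  have FW: "F \<in> W a" using assms by (simp add: nil_part_def)
  note lG = W_lin[OF assms(2,4)] and lF = W_lin[OF assms(1) FW]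
  have "\<exists>v\<in>carr V. v \<noteq> 0 \<and> F (G v) = 0"
  proof (cases "\<exists>v\<in>carr V. v \<noteq> 0 \<and> G v = 0")
    case True
    then obtain v where "v \<in> carr V" "v \<noteq> 0" "G v = 0" by blast
    then show ?thesis using lin_on_0[OF lF] by (intro bexI[of _ v]) simp_all
  next
    case False
    then have surj: "G ` carr V = carr V" by (intro inj_imp_surj[OF lG]) auto
    obtain v where v: "v \<in> carr V" "v \<noteq> 0" "F v = 0" using nil_part_kernel assms by blast
    obtain u where u: "u \<in> carr V" "v = G u" using v(1) surj by (metis imageE)
    then have "u \<noteq> 0" using v(2) lin_on_0[OF lG] by auto
    then show ?thesis using v u by (intro bexI[of _ u]) simp_all
  qed
  then show ?thesis
    using assms W_comp[OF assms(1,2) FW assms(4)] nil_partI op_X by blast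
qed

lemma nil_part_scale: "l \<in> X \<Longrightarrow> F \<in> nil_part l \<Longrightarrow> (\<lambda>v. scal V c (F v)) \<in> nil_part l"
  using nil_part_kernel[of l F] W_scale[of l F c] nil_partI[of l "\<lambda>v. scal V c (F v)"]
  by (auto simp: nil_part_def)

lemma nil_part_zero: "l \<in> X \<Longrightarrow> (\<lambda>v. 0) \<in> nil_part l"
  using W_zero carr_nonzero[OF nonzero] nil_partI[of l "\<lambda>v. 0"] by auto

lemma nil_part_other: "l \<in> X \<Longrightarrow> l \<noteq> one \<Longrightarrow> F \<in> W l \<Longrightarrow> F \<in> nil_part l"
  using W_other nil_partI by blast

text \<open>Here the degree-one part is shown to be local: if \<open>s + t\<close> were invertible with inverse \<open>u\<close>,
  then \<open>1 = u s + u t\<close> would be a sum of two nilpotent elements.\<close>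

lemma nil_part_add:
  assumes l: "l \<in> X" and s: "s \<in> nil_part l" and t: "t \<in> nil_part l"
  shows "(\<lambda>v. s v + t v) \<in> nil_part l"
proof (cases "l = one")
  case False
  then show ?thesis using W_add nil_part_other assms by (auto simp: nil_part_def)
next
  case True
  define f where "f = (\<lambda>v. s v + t v)"
  have fW: "f \<in> W one" using W_add assms True by (auto simp: nil_part_def f_def)
  note lf = W_lin[OF one_X fW]
  have sl: "lin_on V V s" "lin_on V V t" using W_lin s t l by (auto simp: nil_part_def)
  have "\<exists>v\<in>carr V. v \<noteq> 0 \<and> f v = 0"
  proof (rule ccontr)
    assume no: "\<not> ?thesis"
    then have surj: "f ` carr V = carr V" by (intro inj_imp_surj[OF lf]) auto
    have inj: "inj_on f (carr V)"
      using no lin_on_diff[OF lf] by (auto simp: inj_on_def) (metis diff_carr eq_iff_diff_eq_0)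
    define g where "g = inv_into (carr V) f"
    have gW: "g \<in> W one" unfolding g_def using W_inv[OF fW] inj surj by (simp add: bij_betw_def)
    note lg = W_lin[OF one_X gW]
    have gs: "(\<lambda>v. g (s v)) \<in> nil_part one" "(\<lambda>v. g (t v)) \<in> nil_part one"
      using nil_part_comp_left[OF one_X one_X gW] s t True op_one one_X by auto
    have gf: "g (s v) + g (t v) = v" if v: "v \<in> carr V" for v
    proof -
      have "g (s v) + g (t v) = g (f v)"
        unfolding f_def using v lin_on_carr[OF sl(1)] lin_on_carr[OF sl(2)] by (simp add: lin_on_add[OF lg])
      then show ?thesis using inj v by (simp add: g_def)
    qed
    obtain v where v: "v \<in> carr V" "v \<noteq> 0" "g (t v) = 0" using nil_part_kernel[OF one_X gs(2)] by auto
    have "g (s v) = scal V 1 v" using gf v by force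
    moreover have "nilp (\<lambda>v. g (s v))" using gs by (simp add: nil_part_def)
    ultimately show False
      using nilp_eigenvalue[OF _ v(1,2)] lin_on_comp[OF lg sl(1)] by fastforce
  qed
  then show ?thesis using nil_partI[OF one_X fW] True by (auto simp: f_def)
qed

section \<open>Words in noninvertible homogeneous elements\<close>

fun wprod :: "('x \<times> ('v \<Rightarrow> 'v)) list \<Rightarrow> 'v \<Rightarrow> 'v" where
  "wprod [] v = v"
| "wprod (x # w) v = snd x (wprod w v)"

fun wdeg :: "('x \<times> ('v \<Rightarrow> 'v)) list \<Rightarrow> 'x" where
  "wdeg [] = one"
| "wdeg (x # w) = op (fst x) (wdeg w)"

text \<open>Counts the suffixes of degree \<open>a\<close>, the empty suffix of degree
  \<open>one\<close> included; this is why the counts over \<open>X\<close> add up to one more than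
  the length.\<close>

fun visits :: "'x \<Rightarrow> ('x \<times> ('v \<Rightarrow> 'v)) list \<Rightarrow> nat" where
  "visits a [] = (if a = one then 1 else 0)"
| "visits a (x # w) = visits a w + (if a = wdeg (x # w) then 1 else 0)"

definition word :: "('x \<times> ('v \<Rightarrow> 'v)) list \<Rightarrow> bool" where
  "word w \<longleftrightarrow> (\<forall>x\<in>set w. fst x \<in> X \<and> snd x \<in> nil_part (fst x))"

lemma wdeg_X: "word w \<Longrightarrow> wdeg w \<in> X"
  by (induction w) (auto simp: word_def one_X op_X)

lemma wprod_W: "word w \<Longrightarrow> wprod w \<in> W (wdeg w)"
proof (induction w)
  case Nil
  then show ?case using W_id by (simp add: wprod.simps(1)[abs_def])
next
  case (Cons x w)
  then have "fst x \<in> X" "snd x \<in> W (fst x)" "word w" by (auto simp: word_def nil_part_def)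
  then show ?case
    using W_comp[of "fst x" "wdeg w"] Cons wdeg_X by (simp add: wprod.simps(2)[abs_def])
qed

lemma wprod_nil_part: "word (x # w) \<Longrightarrow> wprod (x # w) \<in> nil_part (wdeg (x # w))"
  using nil_part_comp_right[of "fst x" "wdeg w" "snd x" "wprod w"] wdeg_X[of w] wprod_W[of w]
  by (auto simp: word_def wprod.simps(2)[abs_def])

lemma wprod_append: "wprod (u @ w) v = wprod u (wprod w v)"
  by (induction u) auto

lemma wdeg_append: "word u \<Longrightarrow> word w \<Longrightarrow> wdeg (u @ w) = op (wdeg u) (wdeg w)"
proof (induction u)
  case (Cons x u)
  then have "fst x \<in> X" "word u" by (auto simp: word_def)
  then show ?case using Cons wdeg_X by (simp add: op_assoc)
qed (simp add: op_one wdeg_X)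

lemma sum_visits: "word w \<Longrightarrow> (\<Sum>a\<in>X. visits a w) = Suc (length w)"
proof (induction w)
  case Nil
  then show ?case using finite_X one_X by simp
next
  case (Cons x w)
  then have "wdeg (x # w) \<in> X" "word w" by (auto intro: wdeg_X simp: word_def simp del: wdeg.simps)
  then show ?case using Cons finite_X by (simp add: sum.distrib del: wdeg.simps)
qed

text \<open>Between two suffixes of the same degree a word has a factor in degree one, and that factor
  moves the flag of the degree-one part one step down.\<close>

lemma word_flag:
  assumes Z: "Z 0 = {0}" "Z n = carr V" "\<And>i s. s \<in> nil_part one \<Longrightarrow> s ` Z (Suc i) \<subseteq> Z i"
    and "word w" "a \<in> X" "visits a w > 0"
  shows "\<exists>w1 w2. w = w1 @ w2 \<and> wdeg w2 = a \<and> (\<forall>v\<in>carr V. wprod w2 v \<in> Z (n - (visits a w - 1)))"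
  using assms(4,6)
proof (induction w)
  case Nil
  then show ?case using Z(2) by (auto split: if_splits)
next
  case (Cons x w)
  have w: "word w" and x: "word [x]" using Cons by (auto simp: word_def)
  have Zs: "s z \<in> Z (k - 1)" if "s \<in> nil_part one" "z \<in> Z k" for s z k
  proof (cases k)
    case 0
    then show ?thesis
      using that Z(1) lin_on_0[OF W_lin[OF one_X]] by (auto simp: nil_part_def)
  next
    case (Suc i)
    then show ?thesis using that Z(3) by auto
  qed
  have full: "wprod (x # w) v \<in> carr V" if "v \<in> carr V" for v
    using lin_on_carr[OF W_lin[OF wdeg_X[OF Cons.prems(1)] wprod_W[OF Cons.prems(1)]] that] .
  show ?case
  proof (cases "visits a w > 0")
    case False
    \<comment> \<open>The first suffix of degree \<open>a\<close> gains nothing and only lands in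
      \<open>Z n\<close>; hence the \<open>- 1\<close> in the depth.\<close>
    then have "wdeg (x # w) = a" "visits a (x # w) = 1"
      using Cons.prems by (auto split: if_splits simp del: wdeg.simps)
    then show ?thesis using full Z(2)
      by - (rule exI[of _ "[]"], rule exI[of _ "x # w"], auto simp del: wdeg.simps wprod.simps visits.simps)
  next
    case True
    then obtain w1 w2 where ww: "w = w1 @ w2" "wdeg w2 = a"
      "\<And>v. v \<in> carr V \<Longrightarrow> wprod w2 v \<in> Z (n - (visits a w - 1))"
      using Cons.IH[OF w] by blast
    show ?thesis
    proof (cases "a = wdeg (x # w)")
      case False
      then show ?thesis using ww
        by - (rule exI[of _ "x # w1"], rule exI[of _ w2], auto simp del: wdeg.simps)
    next
      case True
      have wd: "word (x # w1)" "word w2" using Cons.prems ww by (auto simp: word_def)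
      have "op (wdeg (x # w1)) a = a"
        using wdeg_append[OF wd] True ww by simp
      then have "wdeg (x # w1) = one" using op_cancel wdeg_X[OF wd(1)] assms(5) by blast
      then have "wprod (x # w1) \<in> nil_part one" using wprod_nil_part[OF wd(1)] by simp
      then have "wprod (x # w) v \<in> Z (n - (visits a w - 1) - 1)" if "v \<in> carr V" for v
        using Zs ww(3)[OF that] wprod_append[of "x # w1" w2 v] ww(1) by force
      moreover have "visits a (x # w) - 1 = Suc (visits a w - 1)"
        using True \<open>visits a w > 0\<close> by (simp del: wdeg.simps)
      ultimately show ?thesis using True
        by - (rule exI[of _ "[]"], rule exI[of _ "x # w"], auto simp del: wdeg.simps wprod.simps visits.simps)
    qed
  qed
qed

lemma long_words_vanish:
  "\<exists>L. \<forall>w. word w \<longrightarrow> length w = L \<longrightarrow> (\<forall>v\<in>carr V. wprod w v = 0)"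
proof -
  have "\<exists>Z n. Z 0 = {0} \<and> Z n = carr V \<and> (\<forall>i. \<forall>s\<in>nil_part one. s ` Z (Suc i) \<subseteq> Z i)"
  proof (rule flag_ex)
    show "lin_on V V s \<and> nilp s" if "s \<in> nil_part one" for s
      using that W_lin one_X by (auto simp: nil_part_def)
    show "(\<lambda>v. s (t v)) \<in> nil_part one" if "s \<in> nil_part one" "t \<in> nil_part one" for s t
      using nil_part_comp_left[OF one_X one_X] that op_one one_X by (auto simp: nil_part_def)
  qed (auto intro: nil_part_add nil_part_scale nil_part_zero one_X)
  then obtain Z n where Z: "Z 0 = {0}" "Z n = carr V" "\<And>i s. s \<in> nil_part one \<Longrightarrow> s ` Z (Suc i) \<subseteq> Z i"
    by metis
  \<comment> \<open>A word of this length has \<open>card X * n + 1\<close> suffixes, so some degree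
    occurs more than \<open>n\<close> times and the depth reaches \<open>Z 0\<close>.\<close>
  have "wprod w v = 0" if w: "word w" "length w = card X * n" and v: "v \<in> carr V" for w v
  proof -
    have "\<exists>a\<in>X. visits a w > n"
    proof (rule ccontr)
      assume "\<not> ?thesis"
      then have "(\<Sum>a\<in>X. visits a w) \<le> (\<Sum>a\<in>X. n)" by (intro sum_mono) auto
      then show False using sum_visits[OF w(1)] w(2) by simp
    qed
    then obtain a where a: "a \<in> X" "visits a w > n" by blast
    then obtain w1 w2 where ww: "w = w1 @ w2" "\<forall>v\<in>carr V. wprod w2 v \<in> Z (n - (visits a w - 1))"
      using word_flag[of Z n w a, OF Z w(1) a(1)] by auto
    have "word w1" using w ww by (auto simp: word_def)
    then have "wprod w1 0 = 0"
      using lin_on_0[OF W_lin[OF wdeg_X wprod_W]] by blast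
    moreover have "wprod w2 v = 0" using ww(2) v a Z(1) by auto
    ultimately show ?thesis by (simp add: ww(1) wprod_append)
  qed
  then show ?thesis by blast
qed

section \<open>The algebra spanned by the homogeneous maps and its nilpotent ideal\<close>

definition total :: "('v \<Rightarrow> 'v) set" where
  "total = {F. lin_on V V F \<and> (\<exists>s. (\<forall>l\<in>X. s l \<in> W l) \<and> (\<forall>v\<in>carr V. F v = (\<Sum>l\<in>X. s l v)))}"

text \<open>As for \<open>total\<close>, the decomposition is demanded on the carrier only, since
  values off the carrier are arbitrary.\<close>

definition nil_ideal :: "('v \<Rightarrow> 'v) set" where
  "nil_ideal = {F. lin_on V V F \<and> (\<exists>s. (\<forall>l\<in>X. s l \<in> nil_part l) \<and> (\<forall>v\<in>carr V. F v = (\<Sum>l\<in>X. s l v)))}"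

text \<open>\<open>Y k\<close> is spanned by the images of words of length \<open>k\<close>, and
  long words vanish. One filtration lowered by all elements at once is what matrices with entries in
  \<open>nil_ideal\<close> require.\<close>

lemma nil_ideal_flag:
  "\<exists>Y L. Y 0 = carr V \<and> Y L = {0} \<and> (\<forall>k. Y k \<subseteq> carr V) \<and> (\<forall>F\<in>nil_ideal. \<forall>k. F ` Y k \<subseteq> Y (Suc k))
     \<and> (\<forall>k. subspace (Y k))"
proof -
  obtain L where L: "\<And>w v. word w \<Longrightarrow> length w = L \<Longrightarrow> v \<in> carr V \<Longrightarrow> wprod w v = 0"
    using long_words_vanish by blast
  define T where "T k = {wprod w v | w v. word w \<and> length w = k \<and> v \<in> carr V}" for k
  have wc: "wprod w v \<in> carr V" if "word w" "v \<in> carr V" for w v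
    using lin_on_carr[OF W_lin[OF wdeg_X wprod_W]] that by blast
  have Tc: "T k \<subseteq> carr V" for k using wc by (auto simp: T_def)
  have Yc: "span (T k) \<subseteq> carr V" for k
    using Tc by (intro span_minimal) auto
  have T0: "T 0 = carr V" by (auto simp: T_def word_def)
  have "T L \<subseteq> {0}" using L by (auto simp: T_def)
  then have TL: "span (T L) = {0}"
    using span_mono[of "T L" "{0}"] span_0 span_zero[of "T L"] by (auto simp: span_insert_0)
  have step: "F y \<in> span (T (Suc k))" if F: "F \<in> nil_ideal" and y: "y \<in> span (T k)" for F y k
  proof -
    from F obtain s where s: "\<And>l. l \<in> X \<Longrightarrow> s l \<in> nil_part l" "\<And>v. v \<in> carr V \<Longrightarrow> F v = (\<Sum>l\<in>X. s l v)"
      and lF: "lin_on V V F" by (auto simp: nil_ideal_def)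
    have gen: "s l x \<in> T (Suc k)" if l: "l \<in> X" and x: "x \<in> T k" for l x
    proof -
      obtain w v where w: "x = wprod w v" "word w" "length w = k" "v \<in> carr V" using x by (auto simp: T_def)
      then show ?thesis
        unfolding T_def using s(1)[OF l] l
        by (intro CollectI exI[of _ "(l, s l) # w"] exI[of _ v]) (auto simp: word_def)
    qed
    have "y \<in> carr V \<and> F y \<in> span (T (Suc k))"
      using y
    proof (induction rule: span_induct_alt)
      case base
      then show ?case using lin_on_0[OF lF] by (simp add: span_zero)
    next
      case (step c x y)
      have x: "x \<in> carr V" using step Tc by auto
      have "F x \<in> span (T (Suc k))"
        unfolding s(2)[OF x] by (rule span_sum, rule span_base, rule gen) (use step in auto)
      then show ?case using step x
        by (auto simp: lin_on_add[OF lF] lin_on_scale[OF lF] intro: span_add span_scale)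
    qed
    then show ?thesis ..
  qed
  show ?thesis
    using T0 TL Yc step span_subspace[OF _ _ subspace_carr] 
    by (intro exI[of _ "\<lambda>k. span (T k)"] exI[of _ L]) (auto simp: span_eq_iff)
qed

lemma nil_ideal_nilp: "F \<in> nil_ideal \<Longrightarrow> nilp F"
proof -
  assume F: "F \<in> nil_ideal"
  obtain Y L where Y: "Y 0 = carr V" "Y L = {0}" "\<forall>F\<in>nil_ideal. \<forall>k. F ` Y k \<subseteq> Y (Suc k)"
    using nil_ideal_flag by blast
  have "(F ^^ k) v \<in> Y k" if "v \<in> carr V" for k v
    using that F Y by (induction k) (auto simp: image_subset_iff)
  then show "nilp F" using Y(2) unfolding nilp_def by blast
qed

lemma total_lin: "F \<in> total \<Longrightarrow> lin_on V V F" by (simp add: total_def)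

lemma nil_ideal_lin: "F \<in> nil_ideal \<Longrightarrow> lin_on V V F" by (simp add: nil_ideal_def)

lemma nil_ideal_total: "F \<in> nil_ideal \<Longrightarrow> F \<in> total"
  by (auto simp: total_def nil_ideal_def nil_part_def)

lemma W_total: "l \<in> X \<Longrightarrow> F \<in> W l \<Longrightarrow> F \<in> total"
  unfolding total_def using finite_X W_lin[of l F] W_zero
  by (auto intro!: exI[of _ "\<lambda>a. if a = l then F else (\<lambda>v. 0)"] simp: if_distrib[of "\<lambda>f. f _"] cong: if_cong)

lemma nil_part_nil_ideal: "l \<in> X \<Longrightarrow> F \<in> nil_part l \<Longrightarrow> F \<in> nil_ideal"
  unfolding nil_ideal_def using finite_X W_lin[of l F] nil_part_zero
  by (auto intro!: exI[of _ "\<lambda>a. if a = l then F else (\<lambda>v. 0)"] simp: if_distrib[of "\<lambda>f. f _"] nil_part_def[of l] cong: if_cong)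

lemma nil_ideal_add:
  assumes F: "F \<in> nil_ideal" and G: "G \<in> nil_ideal"
  shows "(\<lambda>v. F v + G v) \<in> nil_ideal"
proof -
  from F obtain s where s: "\<forall>l\<in>X. s l \<in> nil_part l" "\<forall>v\<in>carr V. F v = (\<Sum>l\<in>X. s l v)"
    by (auto simp: nil_ideal_def)
  from G obtain t where t: "\<forall>l\<in>X. t l \<in> nil_part l" "\<forall>v\<in>carr V. G v = (\<Sum>l\<in>X. t l v)"
    by (auto simp: nil_ideal_def)
  show ?thesis
    unfolding nil_ideal_def using s t nil_part_add lin_on_plus nil_ideal_lin F G
    by (auto intro!: exI[of _ "\<lambda>l v. s l v + t l v"] simp: sum.distrib)
qed

lemma total_add:
  assumes F: "F \<in> total" and G: "G \<in> total"
  shows "(\<lambda>v. F v + G v) \<in> total"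
proof -
  from F obtain s where s: "\<forall>l\<in>X. s l \<in> W l" "\<forall>v\<in>carr V. F v = (\<Sum>l\<in>X. s l v)"
    by (auto simp: total_def)
  from G obtain t where t: "\<forall>l\<in>X. t l \<in> W l" "\<forall>v\<in>carr V. G v = (\<Sum>l\<in>X. t l v)"
    by (auto simp: total_def)
  show ?thesis
    unfolding total_def using s t W_add lin_on_plus total_lin F G
    by (auto intro!: exI[of _ "\<lambda>l v. s l v + t l v"] simp: sum.distrib)
qed

lemma nil_ideal_zero: "(\<lambda>v. 0) \<in> nil_ideal"
  using nil_part_nil_ideal nil_part_zero one_X by blast

lemma nil_ideal_sum: "(\<And>i. i \<in> I \<Longrightarrow> f i \<in> nil_ideal) \<Longrightarrow> (\<lambda>v. \<Sum>i\<in>I. f i v) \<in> nil_ideal"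
  by (induction I rule: infinite_finite_induct) (auto simp: nil_ideal_zero nil_ideal_add)

lemma nil_ideal_scale: "F \<in> nil_ideal \<Longrightarrow> (\<lambda>v. scal V c (F v)) \<in> nil_ideal"
proof -
  assume F: "F \<in> nil_ideal"
  then obtain s where s: "\<forall>l\<in>X. s l \<in> nil_part l" "\<forall>v\<in>carr V. F v = (\<Sum>l\<in>X. s l v)"
    by (auto simp: nil_ideal_def)
  show ?thesis
    unfolding nil_ideal_def using s nil_part_scale lin_on_scaled nil_ideal_lin F
    by (auto intro!: exI[of _ "\<lambda>l v. scal V c (s l v)"] simp: scale_sum_right)
qed

lemma total_scale: "F \<in> total \<Longrightarrow> (\<lambda>v. scal V c (F v)) \<in> total"
proof -
  assume F: "F \<in> total"
  then obtain s where s: "\<forall>l\<in>X. s l \<in> W l" "\<forall>v\<in>carr V. F v = (\<Sum>l\<in>X. s l v)"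
    by (auto simp: total_def)
  show ?thesis
    unfolding total_def using s W_scale lin_on_scaled total_lin F
    by (auto intro!: exI[of _ "\<lambda>l v. scal V c (s l v)"] simp: scale_sum_right)
qed

lemma nil_ideal_cong:
  "F \<in> nil_ideal \<Longrightarrow> (\<And>v. v \<in> carr V \<Longrightarrow> F v = G v) \<Longrightarrow> G \<in> nil_ideal"
  by (auto simp: nil_ideal_def lin_on_def)

lemma nil_ideal_comp:
  assumes "F \<in> total" "G \<in> total" "F \<in> nil_ideal \<or> G \<in> nil_ideal"
  shows "(\<lambda>v. F (G v)) \<in> nil_ideal"
proof -
  have "\<exists>s t. (\<forall>l\<in>X. s l \<in> W l) \<and> (\<forall>v\<in>carr V. F v = (\<Sum>l\<in>X. s l v)) \<and>
      (\<forall>l\<in>X. t l \<in> W l) \<and> (\<forall>v\<in>carr V. G v = (\<Sum>l\<in>X. t l v)) \<and>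
      ((\<forall>l\<in>X. s l \<in> nil_part l) \<or> (\<forall>l\<in>X. t l \<in> nil_part l))"
    using assms(3)
  proof
    assume "F \<in> nil_ideal"
    then obtain s where "\<forall>l\<in>X. s l \<in> nil_part l" "\<forall>v\<in>carr V. F v = (\<Sum>l\<in>X. s l v)"
      by (auto simp: nil_ideal_def)
    moreover obtain t where "\<forall>l\<in>X. t l \<in> W l" "\<forall>v\<in>carr V. G v = (\<Sum>l\<in>X. t l v)"
      using assms(2) by (auto simp: total_def)
    ultimately show ?thesis
      by - (rule exI[of _ s], rule exI[of _ t], auto simp: nil_part_def)
  next
    assume "G \<in> nil_ideal"
    then obtain t where "\<forall>l\<in>X. t l \<in> nil_part l" "\<forall>v\<in>carr V. G v = (\<Sum>l\<in>X. t l v)"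
      by (auto simp: nil_ideal_def)
    moreover obtain s where "\<forall>l\<in>X. s l \<in> W l" "\<forall>v\<in>carr V. F v = (\<Sum>l\<in>X. s l v)"
      using assms(1) by (auto simp: total_def)
    ultimately show ?thesis
      by - (rule exI[of _ s], rule exI[of _ t], auto simp: nil_part_def)
  qed
  then obtain s t where s: "\<And>l. l \<in> X \<Longrightarrow> s l \<in> W l" "\<And>v. v \<in> carr V \<Longrightarrow> F v = (\<Sum>l\<in>X. s l v)"
    and t: "\<And>l. l \<in> X \<Longrightarrow> t l \<in> W l" "\<And>v. v \<in> carr V \<Longrightarrow> G v = (\<Sum>l\<in>X. t l v)"
    and st: "(\<forall>l\<in>X. s l \<in> nil_part l) \<or> (\<forall>l\<in>X. t l \<in> nil_part l)"
    by blast
  have one: "(\<lambda>v. s a (t b v)) \<in> nil_ideal" if "a \<in> X" "b \<in> X" for a b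
    using st that s(1) t(1) nil_part_comp_left[of a b "s a" "t b"] nil_part_comp_right[of a b "s a" "t b"]
    by (intro nil_part_nil_ideal[of "op a b"] op_X) auto
  have "(\<lambda>v. \<Sum>a\<in>X. \<Sum>b\<in>X. s a (t b v)) \<in> nil_ideal"
    by (intro nil_ideal_sum one)
  moreover have "F (G v) = (\<Sum>a\<in>X. \<Sum>b\<in>X. s a (t b v))" if v: "v \<in> carr V" for v
  proof -
    have tc: "t b v \<in> carr V" if "b \<in> X" for b using W_lin[OF that t(1)[OF that]] v by (auto simp: lin_on_def)
    have "F (G v) = (\<Sum>a\<in>X. s a (\<Sum>b\<in>X. t b v))"
      using s(2)[of "G v"] t(2)[OF v] tc by simp
    also have "\<dots> = (\<Sum>a\<in>X. \<Sum>b\<in>X. s a (t b v))"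
      using tc by (intro sum.cong refl lin_on_sum[OF W_lin[OF _ s(1)]]) auto
    finally show ?thesis .
  qed
  ultimately show ?thesis using nil_ideal_cong by (metis (no_types, lifting))
qed

text \<open>Well defined because a nonzero scalar is not nilpotent on the nonzero space
  \<open>V\<close>; it is the residue map of the local algebra \<open>total\<close>.\<close>

definition chi :: "('v \<Rightarrow> 'v) \<Rightarrow> 'k" where
  "chi F = (THE c. (\<lambda>v. F v - scal V c v) \<in> nil_ideal)"

lemma scalar_not_nil_ideal: "(\<lambda>v. scal V c v) \<in> nil_ideal \<Longrightarrow> c = 0"
  using nil_ideal_nilp[of "\<lambda>v. scal V c v"] nilp_eigenvalue[of "\<lambda>v. scal V c v" _ c]
    carr_nonzero[OF nonzero] lin_on_scaled[OF lin_on_id] by blast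

lemma chi_eqI: "(\<lambda>v. F v - scal V c v) \<in> nil_ideal \<Longrightarrow> chi F = c"
  unfolding chi_def
proof (rule the_equality)
  fix d assume a: "(\<lambda>v. F v - scal V c v) \<in> nil_ideal" "(\<lambda>v. F v - scal V d v) \<in> nil_ideal"
  have "(\<lambda>v. (F v - scal V d v) + scal V (- 1) (F v - scal V c v)) \<in> nil_ideal"
    by (intro nil_ideal_add nil_ideal_scale a)
  then have "(\<lambda>v. scal V (c - d) v) \<in> nil_ideal"
    by (rule nil_ideal_cong) (simp add: scale_left_diff_distrib)
  then show "d = c" using scalar_not_nil_ideal by fastforce
qed

lemma chi_nil_ideal: "F \<in> total \<Longrightarrow> (\<lambda>v. F v - scal V (chi F) v) \<in> nil_ideal"
proof -
  assume F: "F \<in> total"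
  then obtain s where s: "\<And>l. l \<in> X \<Longrightarrow> s l \<in> W l" "\<And>v. v \<in> carr V \<Longrightarrow> F v = (\<Sum>l\<in>X. s l v)"
    by (auto simp: total_def)
  obtain c where c: "nilp (\<lambda>v. s one v - scal V c v)" using W_one s(1) one_X by blast
  \<comment> \<open>Only the component of degree one contributes a scalar; every other component is
    already noninvertible.\<close>
  define t where "t l = (if l = one then (\<lambda>v. s one v - scal V c v) else s l)" for l
  have "(\<lambda>v. s one v + scal V (- c) v) \<in> W one"
    by (intro W_add one_X s W_scale W_id)
  then have "t one \<in> nil_part one" using c by (simp add: t_def nil_part_def)
  then have t: "t l \<in> nil_part l" if "l \<in> X" for l
    using that s nil_part_other by (cases "l = one") (auto simp: t_def)
  have "(\<lambda>v. \<Sum>l\<in>X. t l v) \<in> nil_ideal"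
    by (rule nil_ideal_sum, rule nil_part_nil_ideal[OF _ t])
  moreover have "(\<Sum>l\<in>X. t l v) = F v - scal V c v" if "v \<in> carr V" for v
  proof -
    have "(\<Sum>l\<in>X. t l v) = t one v + (\<Sum>l\<in>X - {one}. t l v)"
      using finite_X one_X by (simp add: sum.remove)
    moreover have "(\<Sum>l\<in>X - {one}. t l v) = (\<Sum>l\<in>X - {one}. s l v)"
      by (intro sum.cong) (auto simp: t_def)
    moreover have "F v = s one v + (\<Sum>l\<in>X - {one}. s l v)"
      using s(2)[OF that] finite_X one_X by (simp add: sum.remove)
    ultimately show ?thesis by (simp add: t_def)
  qed
  ultimately have "(\<lambda>v. F v - scal V c v) \<in> nil_ideal" by (rule nil_ideal_cong)
  then show ?thesis using chi_eqI by metis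
qed

lemma chi_0_nil_ideal: "F \<in> total \<Longrightarrow> chi F = 0 \<Longrightarrow> F \<in> nil_ideal"
  using chi_nil_ideal[of F] by simp

lemma chi_nil: "F \<in> nil_ideal \<Longrightarrow> chi F = 0"
  by (rule chi_eqI) simp

lemma chi_add: "F \<in> total \<Longrightarrow> G \<in> total \<Longrightarrow> chi (\<lambda>v. F v + G v) = chi F + chi G"
  by (rule chi_eqI, rule nil_ideal_cong[OF nil_ideal_add[OF chi_nil_ideal[of F] chi_nil_ideal[of G]]])
    (auto simp: scale_left_distrib)

lemma chi_scale: "F \<in> total \<Longrightarrow> chi (\<lambda>v. scal V c (F v)) = c * chi F"
  by (rule chi_eqI, rule nil_ideal_cong[OF nil_ideal_scale[OF chi_nil_ideal, of _ c]])
    (auto simp: scale_right_diff_distrib)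

lemma chi_id: "chi (\<lambda>v. v) = 1"
  by (rule chi_eqI, rule nil_ideal_cong[OF nil_ideal_zero]) auto

lemma chi_other: "l \<in> X \<Longrightarrow> l \<noteq> one \<Longrightarrow> F \<in> W l \<Longrightarrow> chi F = 0"
  using chi_nil nil_part_nil_ideal nil_part_other by blast

lemma chi_cong: "F \<in> total \<Longrightarrow> (\<And>v. v \<in> carr V \<Longrightarrow> F v = G v) \<Longrightarrow> chi G = chi F"
  by (rule chi_eqI, rule nil_ideal_cong[OF chi_nil_ideal]) auto

text \<open>Uses \<open>F G - c d = F (G - d) + d (F - c)\<close>, where \<open>c\<close> and
  \<open>d\<close> are the values of \<open>chi\<close> at \<open>F\<close> and \<open>G\<close>,
  together with the ideal property.\<close>

lemma chi_comp:
  assumes F: "F \<in> total" and G: "G \<in> total"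
  shows "chi (\<lambda>v. F (G v)) = chi F * chi G"
proof (rule chi_eqI)
  have "(\<lambda>v. F (G v - scal V (chi G) v)) \<in> nil_ideal"
    using nil_ideal_comp[OF F nil_ideal_total[OF chi_nil_ideal[OF G]]] chi_nil_ideal[OF G] by blast
  then have "(\<lambda>v. F (G v - scal V (chi G) v) + scal V (chi G) (F v - scal V (chi F) v)) \<in> nil_ideal"
    by (intro nil_ideal_add nil_ideal_scale chi_nil_ideal F)
  then show "(\<lambda>v. F (G v) - scal V (chi F * chi G) v) \<in> nil_ideal"
    by (rule nil_ideal_cong)
      (use lin_on_carr[OF total_lin[OF G]] in \<open>auto simp: lin_on_diff[OF total_lin[OF F]]
        lin_on_scale[OF total_lin[OF F]] scale_right_diff_distrib mult.commute\<close>)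
qed

lemma total_comp:
  assumes F: "F \<in> total" and G: "G \<in> total"
  shows "(\<lambda>v. F (G v)) \<in> total"
proof -
  have "(\<lambda>v. F (G v - scal V (chi G) v)) \<in> nil_ideal"
    using nil_ideal_comp[OF F nil_ideal_total[OF chi_nil_ideal[OF G]]] chi_nil_ideal[OF G] by blast
  then have "(\<lambda>v. F (G v - scal V (chi G) v) + scal V (chi G) (F v)) \<in> total"
    by (intro total_add total_scale F nil_ideal_total)
  moreover have "F (G v - scal V (chi G) v) + scal V (chi G) (F v) = F (G v)" if "v \<in> carr V" for v
    using that lin_on_carr[OF total_lin[OF G]] by (auto simp: lin_on_diff[OF total_lin[OF F]]
        lin_on_scale[OF total_lin[OF F]])
  ultimately show ?thesis
    using lin_on_comp[OF total_lin[OF F] total_lin[OF G]] by (auto simp: total_def)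
qed

text \<open>Determines \<open>chi F\<close> without homogeneous components, as is needed after
  conjugation by a rational point. \<open>F\<close> minus its value under \<open>chi\<close> is
  nilpotent and so has a kernel vector, on which the other difference acts by the scalar
  \<open>chi F - c\<close>.\<close>

lemma chi_nilp:
  assumes F: "F \<in> total" and n: "nilp (\<lambda>v. F v - scal V c v)"
  shows "chi F = c"
proof -
  define j where "j = (\<lambda>v. F v - scal V (chi F) v)"
  have j: "j \<in> nil_ideal" unfolding j_def by (rule chi_nil_ideal[OF F])
  obtain v where v: "v \<in> carr V" "v \<noteq> 0" "j v = 0"
    using nilp_not_inj[OF nil_ideal_nilp[OF j] nil_ideal_lin[OF j] nonzero] by blast
  then have "F v - scal V c v = scal V (chi F - c) v"
    by (simp add: j_def scale_left_diff_distrib)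
  moreover have "lin_on V V (\<lambda>v. F v - scal V c v)"
    by (intro lin_on_minus total_lin[OF F] lin_on_scaled lin_on_id)
  ultimately have "chi F - c = 0" using nilp_eigenvalue v n by blast
  then show ?thesis by simp
qed

lemma chi_sum:
  "(\<And>i. i \<in> I \<Longrightarrow> f i \<in> total) \<Longrightarrow> (\<lambda>v. \<Sum>i\<in>I. f i v) \<in> total \<and> chi (\<lambda>v. \<Sum>i\<in>I. f i v) = (\<Sum>i\<in>I. chi (f i))"
  by (induction I rule: infinite_finite_induct)
    (auto simp: nil_ideal_total[OF nil_ideal_zero] chi_nil[OF nil_ideal_zero] chi_add total_add)

end

section \<open>Tensors and dual spaces\<close>

text \<open>Unlike \<open>lin_on\<close> it fixes no target carrier, only a scalar multiplication
  \<open>s\<close>; Sweedler sums with values in scalars, functionals, tensors and modules can then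
  share their lemmas.\<close>

definition lin :: "('k::field, 'v::ab_group_add, 'z) space_scheme \<Rightarrow> ('k \<Rightarrow> 'w \<Rightarrow> 'w) \<Rightarrow> ('v \<Rightarrow> 'w::ab_group_add) \<Rightarrow> bool" where
  "lin V s f \<longleftrightarrow> (\<forall>u\<in>carr V. \<forall>v\<in>carr V. f (u + v) = f u + f v) \<and> (\<forall>c. \<forall>v\<in>carr V. f (scal V c v) = s c (f v))"

lemma linI:
  "(\<And>u v. u \<in> carr V \<Longrightarrow> v \<in> carr V \<Longrightarrow> f (u + v) = f u + f v) \<Longrightarrow>
   (\<And>c v. v \<in> carr V \<Longrightarrow> f (scal V c v) = s c (f v)) \<Longrightarrow> lin V s f"
  by (auto simp: lin_def)

lemma lin_add: "lin V s f \<Longrightarrow> u \<in> carr V \<Longrightarrow> v \<in> carr V \<Longrightarrow> f (u + v) = f u + f v"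
  by (auto simp: lin_def)

lemma lin_scal: "lin V s f \<Longrightarrow> v \<in> carr V \<Longrightarrow> f (scal V c v) = s c (f v)"
  by (auto simp: lin_def)

lemma lin_on_ground [simp]: "lin_on V ground f \<longleftrightarrow> lin V (*) f"
  by (auto simp: lin_on_def lin_def ground_def)

lemma lin_on_lin: "lin_on V W f \<longleftrightarrow> (\<forall>v\<in>carr V. f v \<in> carr W) \<and> lin V (scal W) f"
  by (auto simp: lin_on_def lin_def)

lemma bil_iff: "\<beta> \<in> bil V W \<longleftrightarrow> (\<forall>v\<in>carr V. lin W (*) (\<beta> v)) \<and> (\<forall>w\<in>carr W. lin V (*) (\<lambda>v. \<beta> v w))"
  by (auto simp: bil_def)

lemma bilI:
  "(\<And>v. v \<in> carr V \<Longrightarrow> lin W (*) (\<beta> v)) \<Longrightarrow> (\<And>w. w \<in> carr W \<Longrightarrow> lin V (*) (\<lambda>v. \<beta> v w)) \<Longrightarrow> \<beta> \<in> bil V W"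
  by (auto simp: bil_def)

lemma vector_space_mult: "vector_space ((*) :: 'k::field \<Rightarrow> 'k \<Rightarrow> 'k)"
  by unfold_locales (auto simp: algebra_simps)

interpretation fs: vector_space "fscale :: 'k::field \<Rightarrow> ('x \<Rightarrow> 'k) \<Rightarrow> 'x \<Rightarrow> 'k"
  by (rule vector_space_fscale)

lemma sum_rotate3:
  "(\<Sum>b\<in>B. \<Sum>c\<in>C. \<Sum>d\<in>E. f b c d) = (\<Sum>c\<in>C. \<Sum>d\<in>E. \<Sum>b\<in>B. f b c d)"
  by (rule trans[OF sum.swap]) (intro sum.cong refl, rule sum.swap)

lemma sum_swap4:
  "(\<Sum>a\<in>A. \<Sum>b\<in>B. \<Sum>c\<in>C. \<Sum>d\<in>E. f a b c d) = (\<Sum>c\<in>C. \<Sum>d\<in>E. \<Sum>a\<in>A. \<Sum>b\<in>B. f a b c d)"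
  by (rule trans[OF _ sum_rotate3]) (intro sum.cong refl, rule sum_rotate3)

lemma dual_carr: "\<phi> \<in> carr (dual_space V) \<longleftrightarrow> lin V (*) \<phi> \<and> (\<forall>v. v \<notin> carr V \<longrightarrow> \<phi> v = 0)"
  by (simp add: dual_space_def)

lemma dual_scal [simp]: "scal (dual_space V) = fscale"
  by (simp add: dual_space_def)

lemma fscale_apply [simp]: "fscale c f x = c * f x"
  by (simp add: fscale_def)

lemma sum_fun_apply: "(\<Sum>i\<in>I. f i) x = (\<Sum>i\<in>I. f i x)"
  by (induction I rule: infinite_finite_induct) auto

lemma lin_sum_fun: "vector_space s \<Longrightarrow> (\<And>i. i \<in> I \<Longrightarrow> lin V s (f i)) \<Longrightarrow> lin V s (\<lambda>v. \<Sum>i\<in>I. f i v)"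
proof -
  assume s: "vector_space s" and f: "\<And>i. i \<in> I \<Longrightarrow> lin V s (f i)"
  interpret s: vector_space s by fact
  show ?thesis using f by (auto simp: lin_def sum.distrib s.scale_sum_right)
qed

lemma lin_scale_const:
  assumes "vector_space s" "lin V s f" shows "lin V s (\<lambda>v. s c (f v))"
proof -
  interpret s: vector_space s by fact
  show ?thesis using assms(2) by (auto simp: lin_def s.scale_right_distrib s.scale_left_commute)
qed

lemma lin_scale_left:
  assumes "vector_space s" "lin V (*) f" shows "lin V s (\<lambda>v. s (f v) w)"
proof -
  interpret s: vector_space s by fact
  show ?thesis using assms(2) by (auto simp: lin_def s.scale_left_distrib)
qed

context fdv begin

lemma lin_0: "lin V s f \<Longrightarrow> f 0 = 0"
  unfolding lin_def by (metis add_cancel_right_right add_0 zero_carr)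

lemma lin_sum:
  assumes "lin V s f" "\<And>i. i \<in> I \<Longrightarrow> g i \<in> carr V"
  shows "f (\<Sum>i\<in>I. g i) = (\<Sum>i\<in>I. f (g i))"
  using assms(2)
  by (induction I rule: infinite_finite_induct) (auto simp: lin_0[OF assms(1)] lin_add[OF assms(1)])

lemma lin_expand:
  assumes "lin V s f" "v \<in> carr V"
  shows "f v = (\<Sum>b\<in>bas. s (du b v) (f b))"
proof -
  have "f v = f (\<Sum>b\<in>bas. scal V (du b v) b)"
    using assms by (simp add: du_expand)
  also have "\<dots> = (\<Sum>b\<in>bas. s (du b v) (f b))"
    using assms by (subst lin_sum[OF assms(1)]) (auto simp: lin_scal[OF assms(1)])
  finally show ?thesis .
qed

lemma bil_expand:
  assumes "fdv W" "\<beta> \<in> bil V W" "v \<in> carr V" "w \<in> carr W"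
  shows "\<beta> v w = (\<Sum>i\<in>bas \<times> fdv.bas W. \<beta> (fst i) (snd i) * (du (fst i) v * fdv.du W (snd i) w))"
proof -
  interpret W: fdv W by fact
  have "\<beta> v w = (\<Sum>p\<in>bas. du p v * \<beta> p w)"
    using lin_expand[of "(*)" "\<lambda>v. \<beta> v w" v] assms by (auto simp: bil_iff)
  also have "\<dots> = (\<Sum>p\<in>bas. du p v * (\<Sum>c\<in>W.bas. W.du c w * \<beta> p c))"
    using W.lin_expand[of "(*)" "\<beta> _" w] assms by (auto simp: bil_iff)
  finally show ?thesis
    by (simp add: sum_distrib_left mult_ac sum.cartesian_product case_prod_unfold)
qed

lemma lin_du: "lin V (*) (du b)"
  using du_lin[of b] by (auto simp: lin_def)

lemma dual_lin: "x \<in> carr (dual_space V) \<Longrightarrow> lin V (*) x"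
  by (simp add: dual_carr)

lemma dual_expand: "x \<in> carr (dual_space V) \<Longrightarrow> v \<in> carr V \<Longrightarrow> x v = (\<Sum>b\<in>bas. du b v * x b)"
  using lin_expand[of "(*)" x v] by (simp add: dual_carr)

lemma dual_expand_fun:
  assumes "x \<in> carr (dual_space V)"
  shows "x = (\<Sum>b\<in>bas. fscale (x b) (du b))"
proof
  fix v show "x v = (\<Sum>b\<in>bas. fscale (x b) (du b)) v"
    using assms dual_expand[OF assms, of v]
    by (cases "v \<in> carr V") (auto simp: sum_fun_apply mult.commute dual_carr du_def)
qed

lemma dual_closed:
  "x \<in> carr (dual_space V) \<Longrightarrow> y \<in> carr (dual_space V) \<Longrightarrow> x + y \<in> carr (dual_space V)"
  "x \<in> carr (dual_space V) \<Longrightarrow> fscale c x \<in> carr (dual_space V)"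
  "0 \<in> carr (dual_space V)"
  by (auto simp: dual_carr lin_def algebra_simps)

lemma fin_dim_dual: "fin_dim_space (dual_space V)"
proof -
  have sub: "fs.subspace (carr (dual_space V))"
    by (intro fs.subspaceI dual_closed)
  have "fs.span (du ` bas) = carr (dual_space V)"
  proof (intro equalityI fs.span_minimal sub subsetI)
    fix x assume "x \<in> carr (dual_space V)"
    then show "x \<in> fs.span (du ` bas)"
      by (subst dual_expand_fun) (auto intro!: fs.span_sum fs.span_scale intro: fs.span_base)
  qed auto
  then show ?thesis
    unfolding fin_dim_space_def using vector_space_fscale finite_bas
    by (auto simp: vector_space_fscale intro!: exI[of _ "du ` bas"])
qed

lemma lin_dual_expand:
  assumes "lin (dual_space V) s F" "x \<in> carr (dual_space V)"
  shows "F x = (\<Sum>b\<in>bas. s (x b) (F (du b)))"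
proof -
  interpret d: fdv "dual_space V" by unfold_locales (rule fin_dim_dual)
  have "F x = F (\<Sum>b\<in>bas. fscale (x b) (du b))" using assms(2) dual_expand_fun by metis
  also have "\<dots> = (\<Sum>b\<in>bas. F (fscale (x b) (du b)))"
    by (rule d.lin_sum[OF assms(1)]) (simp add: dual_closed)
  also have "\<dots> = (\<Sum>b\<in>bas. s (x b) (F (du b)))"
    using lin_scal[OF assms(1) du_dual] by simp
  finally show ?thesis .
qed

lemma dual_separates: "v \<in> carr V \<Longrightarrow> (\<And>x. x \<in> carr (dual_space V) \<Longrightarrow> x v = 0) \<Longrightarrow> v = 0"
proof -
  assume v: "v \<in> carr V" and x: "\<And>x. x \<in> carr (dual_space V) \<Longrightarrow> x v = 0"
  have "(\<Sum>b\<in>bas. scal V (du b v) b) = 0" by (simp add: x)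
  then show "v = 0" using du_expand[OF v] by simp
qed

end

lemma ten_in: "v \<in> carr V \<Longrightarrow> w \<in> carr W \<Longrightarrow> ten B v w \<in> ten_carr B V W"
  unfolding ten_carr_def by (rule fs.span_base) blast

text \<open>Replaces Sweedler notation on the side of \<open>k[G]\<close>: a coproduct can be named
  as a concrete finite sum, the coefficients being absorbed into the first factors.\<close>

lemma ten_carr_ex:
  assumes t: "t \<in> ten_carr B V W" and B: "B \<subseteq> bil V W" and V: "fin_dim_space V"
  shows "\<exists>n v w. (\<forall>i<(n::nat). v i \<in> carr V \<and> w i \<in> carr W) \<and>
    t = (\<lambda>\<beta>. if \<beta> \<in> B then \<Sum>i<n. \<beta> (v i) (w i) else 0)"
proof -
  interpret V: fdv V by unfold_locales fact
  show ?thesis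
    using t unfolding ten_carr_def
  proof (induction rule: fs.span_induct_alt)
    case base
    show ?case by (rule exI[of _ 0]) (auto simp: zero_fun_def fun_eq_iff)
  next
    case (step c x y)
    obtain v0 w0 where x: "x = ten B v0 w0" "v0 \<in> carr V" "w0 \<in> carr W" using step by blast
    obtain n v w where y: "\<And>i. i < (n::nat) \<Longrightarrow> v i \<in> carr V \<and> w i \<in> carr W"
      "y = (\<lambda>\<beta>. if \<beta> \<in> B then \<Sum>i<n. \<beta> (v i) (w i) else 0)" using step by blast
    define v' where "v' i = (if i = n then scal V c v0 else v i)" for i
    define w' where "w' i = (if i = n then w0 else w i)" for i
    have "(fscale c x + y) \<beta> = (if \<beta> \<in> B then \<Sum>i<Suc n. \<beta> (v' i) (w' i) else 0)" for \<beta>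
    proof -
      have "\<beta> (scal V c v0) w0 = c * \<beta> v0 w0" if "\<beta> \<in> B"
        using that B x lin_scal[of V "(*)" "\<lambda>v. \<beta> v w0" v0 c] by (auto simp: bil_iff)
      moreover have "(\<Sum>i<n. \<beta> (v' i) (w' i)) = (\<Sum>i<n. \<beta> (v i) (w i))"
        by (intro sum.cong) (auto simp: v'_def w'_def)
      ultimately show ?thesis by (auto simp: x y ten_def v'_def w'_def)
    qed
    moreover have "\<forall>i<Suc n. v' i \<in> carr V \<and> w' i \<in> carr W"
      using x y by (auto simp: v'_def w'_def less_Suc_eq)
    ultimately show ?case by (intro exI[of _ "Suc n"] exI[of _ v'] exI[of _ w']) auto
  qed
qed

lemma ten_carr_I:
  assumes "\<And>i. i \<in> I \<Longrightarrow> v i \<in> carr V" "\<And>i. i \<in> I \<Longrightarrow> w i \<in> carr W"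
  shows "(\<lambda>\<beta>. if \<beta> \<in> B then \<Sum>i\<in>I. c i * \<beta> (v i) (w i) else 0) \<in> ten_carr B V W"
proof -
  have "(\<lambda>\<beta>. if \<beta> \<in> B then \<Sum>i\<in>I. c i * \<beta> (v i) (w i) else 0) = (\<Sum>i\<in>I. fscale (c i) (ten B (v i) (w i)))"
    by (auto simp: fun_eq_iff sum_fun_apply ten_def)
  then show ?thesis
    unfolding ten_carr_def using assms
    by (auto intro!: fs.span_sum fs.span_scale simp: ten_in[unfolded ten_carr_def])
qed

lemma ten_carr_induct [consumes 1, case_names zero add scale ten]:
  assumes "t \<in> ten_carr B V W" "P 0" "\<And>s t. P s \<Longrightarrow> P t \<Longrightarrow> P (s + t)" "\<And>c t. P t \<Longrightarrow> P (fscale c t)"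
    "\<And>v w. v \<in> carr V \<Longrightarrow> w \<in> carr W \<Longrightarrow> P (ten B v w)"
  shows "P t"
  using assms(1)[unfolded ten_carr_def]
proof (rule fs.span_induct)
  show "fs.subspace {t. P t}" using assms(2-4) by (auto simp: fs.subspace_def)
  show "\<And>x. x \<in> {ten B v w |v w. v \<in> carr V \<and> w \<in> carr W} \<Longrightarrow> P x" using assms(5) by blast
qed

text \<open>Forms are HOL functions on whole types, so two forms agreeing on the carriers can be
  different arguments of \<open>t\<close>; elements of the tensor product do not tell them
  apart.\<close>

lemma ten_cong:
  assumes "t \<in> ten_carr B V W" "\<beta> \<in> B" "\<beta>' \<in> B"
    "\<And>v w. v \<in> carr V \<Longrightarrow> w \<in> carr W \<Longrightarrow> \<beta> v w = \<beta>' v w"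
  shows "t \<beta> = t \<beta>'"
  using assms(1) by (induction rule: ten_carr_induct) (simp_all add: ten_def assms(2-))

lemma ten_off: "t \<in> ten_carr B V W \<Longrightarrow> \<beta> \<notin> B \<Longrightarrow> t \<beta> = 0"
  by (induction rule: ten_carr_induct) (simp_all add: ten_def)

lemma ten_sum:
  assumes "t \<in> ten_carr B V W" "\<beta> \<in> B" "\<And>i. i \<in> I \<Longrightarrow> \<gamma> i \<in> B"
    "\<And>v w. v \<in> carr V \<Longrightarrow> w \<in> carr W \<Longrightarrow> \<beta> v w = (\<Sum>i\<in>I. c i * \<gamma> i v w)"
  shows "t \<beta> = (\<Sum>i\<in>I. c i * t (\<gamma> i))"
  using assms(1)
  by (induction rule: ten_carr_induct)
    (simp_all add: ten_def assms(2-) sum.distrib distrib_left sum_distrib_left mult.left_commute)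

lemma lin_ten:
  assumes "B \<subseteq> bil V W"
  shows "w \<in> carr W \<Longrightarrow> lin V fscale (\<lambda>v. ten B v w)" "v \<in> carr V \<Longrightarrow> lin W fscale (ten B v)"
  using ten_bilinear[of _ V _ _ W _ B] assms by (auto intro!: linI)

lemma tensor_carr: "carr (tensor V W) = ten_carr (bil V W) V W" by (simp add: tensor_def)

lemma tensor_scal [simp]: "scal (tensor V W) = fscale" by (simp add: tensor_def)

lemma ten_carr_closed:
  "0 \<in> ten_carr B V W"
  "s \<in> ten_carr B V W \<Longrightarrow> t \<in> ten_carr B V W \<Longrightarrow> s + t \<in> ten_carr B V W"
  "t \<in> ten_carr B V W \<Longrightarrow> fscale c t \<in> ten_carr B V W"
proof -
  show "0 \<in> ten_carr B V W"
    "s \<in> ten_carr B V W \<Longrightarrow> t \<in> ten_carr B V W \<Longrightarrow> s + t \<in> ten_carr B V W"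
    "t \<in> ten_carr B V W \<Longrightarrow> fscale c t \<in> ten_carr B V W"
    unfolding ten_carr_def by (auto intro: fs.span_zero fs.span_add fs.span_scale)
qed

lemma fin_dim_ten:
  assumes B: "B \<subseteq> bil V W" and V: "fin_dim_space V" and W: "fin_dim_space W"
    and S: "carr S = ten_carr B V W" "scal S = fscale"
  shows "fin_dim_space S"
proof -
  interpret V: fdv V by unfold_locales fact
  interpret W: fdv W by unfold_locales fact
  let ?T = "(\<lambda>(a, b). ten B a b) ` (V.bas \<times> W.bas)"
  have "ten B v w \<in> fs.span ?T" if vw: "v \<in> carr V" "w \<in> carr W" for v w
  proof -
    have "ten B v w = (\<Sum>a\<in>V.bas. fscale (V.du a v) (\<Sum>b\<in>W.bas. fscale (W.du b w) (ten B a b)))"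
      using V.lin_expand[OF lin_ten(1)[OF B vw(2)] vw(1)] W.lin_expand[OF lin_ten(2)[OF B V.bas_carr] vw(2)] by simp
    then show ?thesis by (auto intro!: fs.span_sum fs.span_scale intro: fs.span_base)
  qed
  then have "fs.span {ten B v w | v w. v \<in> carr V \<and> w \<in> carr W} \<subseteq> fs.span ?T"
    by (intro fs.span_minimal) auto
  moreover have "fs.span ?T \<subseteq> fs.span {ten B v w | v w. v \<in> carr V \<and> w \<in> carr W}"
    using V.bas_carr W.bas_carr by (intro fs.span_mono) fastforce
  ultimately have "fs.span ?T = carr S" unfolding S ten_carr_def by blast
  then show ?thesis
    unfolding fin_dim_space_def S by (auto simp: vector_space_fscale intro!: exI[of _ ?T])
qed

text \<open>The map \<open>v \<otimes> w \<mapsto> q(w) v\<close>.\<close>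

definition (in fdv) contr :: "('w \<Rightarrow> 'k) \<Rightarrow> (('v \<Rightarrow> 'w \<Rightarrow> 'k) \<Rightarrow> 'k) \<Rightarrow> 'v" where
  "contr q t = (\<Sum>b\<in>bas. scal V (t (\<lambda>v w. du b v * q w)) b)"

context fdv begin

lemma contr_carr [simp]: "contr q t \<in> carr V" by (simp add: contr_def)

lemma contr_form: "lin W (*) q \<Longrightarrow> (\<lambda>v w. du b v * q w) \<in> bil V W"
  using du_lin[of b] by (auto simp: bil_iff lin_def algebra_simps)

lemma contr_add: "contr q (s + t) = contr q s + contr q t"
  by (simp add: contr_def scale_left_distrib sum.distrib)

lemma contr_0: "contr q 0 = 0"
  by (simp add: contr_def)

lemma contr_fscale: "contr q (fscale c t) = scal V c (contr q t)"
  by (simp add: contr_def scale_sum_right)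

lemma contr_sum: "contr q (\<Sum>i\<in>I. f i) = (\<Sum>i\<in>I. contr q (f i))"
  by (simp add: contr_def sum_fun_apply scale_sum_left) (rule sum.swap)

lemma contr_ten:
  assumes "lin W (*) q" "v \<in> carr V"
  shows "contr q (ten (bil V W) v w) = scal V (q w) v"
proof -
  have "contr q (ten (bil V W) v w) = scal V (q w) (\<Sum>b\<in>bas. scal V (du b v) b)"
    using contr_form[OF assms(1)] by (simp add: contr_def ten_def mult.commute scale_sum_right)
  then show ?thesis using du_expand[OF assms(2)] by simp
qed

text \<open>Identifies a tensor with its column of coordinates in \<open>V\<close>, one for each
  basis vector of \<open>W\<close>; homomorphisms between tensor products become matrices through
  it.\<close>

lemma ten_contr_expand:
  assumes W: "fin_dim_space W" and t: "t \<in> carr (tensor V W)"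
  shows "t = (\<Sum>c\<in>fdv.bas W. ten (bil V W) (contr (fdv.du W c) t) c)"
proof -
  interpret W: fdv W by unfold_locales fact
  have l: "lin V fscale (\<lambda>v. ten (bil V W) v c)" if "c \<in> W.bas" for c
    by (rule lin_ten(1)[OF order_refl W.bas_carr[OF that]])
  show ?thesis
    using t unfolding tensor_carr
  proof (induction rule: ten_carr_induct)
    case zero
    show ?case using lin_0[OF l] by (simp only: contr_0 sum.neutral_const cong: sum.cong)
  next
    case (add s t)
    have "(\<Sum>c\<in>W.bas. ten (bil V W) (contr (W.du c) (s + t)) c) =
        (\<Sum>c\<in>W.bas. ten (bil V W) (contr (W.du c) s) c) + (\<Sum>c\<in>W.bas. ten (bil V W) (contr (W.du c) t) c)"
      unfolding sum.distrib[symmetric] contr_add by (intro sum.cong refl lin_add[OF l]) simp_all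
    then show ?case using add by (simp only: add[symmetric])
  next
    case (scale c t)
    have "(\<Sum>k\<in>W.bas. ten (bil V W) (contr (W.du k) (fscale c t)) k) =
        fscale c (\<Sum>k\<in>W.bas. ten (bil V W) (contr (W.du k) t) k)"
      unfolding fs.scale_sum_right contr_fscale by (intro sum.cong refl lin_scal[OF l]) simp_all
    then show ?case by (simp only: scale[symmetric])
  next
    case (ten v w)
    have "ten (bil V W) v w = (\<Sum>c\<in>W.bas. fscale (W.du c w) (ten (bil V W) v c))"
      by (rule W.lin_expand[OF lin_ten(2)]) (use ten in simp_all)
    also have "\<dots> = (\<Sum>c\<in>W.bas. ten (bil V W) (contr (W.du c) (ten (bil V W) v w)) c)"
    proof (rule sum.cong[OF refl])
      fix c assume c: "c \<in> W.bas"
      have "lin W (*) (W.du c)" using W.du_lin by simp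
      from contr_ten[OF this ten(1), of w]
      show "fscale (W.du c w) (ten (bil V W) v c) = ten (bil V W) (contr (W.du c) (ten (bil V W) v w)) c"
        using lin_scal[OF l[OF c] ten(1)] by simp
    qed
    finally show ?case .
  qed
qed

end

section \<open>Commutative algebras and the coproduct of the dual\<close>

text \<open>The product of \<open>k[G]\<close> by itself determines the comultiplication of the
  dual, so that theory is developed at this level.\<close>

locale comm_alg =
  fixes G :: "('k::field, 'h::ab_group_add) hopf"
  assumes fin_dim_alg: "fin_dim_space G"
    and uni_in: "uni G \<in> carr G"
    and mul_lin: "\<And>a. a \<in> carr G \<Longrightarrow> lin_on G G (mul G a)"
    and mul_com: "\<And>a b. a \<in> carr G \<Longrightarrow> b \<in> carr G \<Longrightarrow> mul G a b = mul G b a"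
    and mul_ass: "\<And>a b c. a \<in> carr G \<Longrightarrow> b \<in> carr G \<Longrightarrow> c \<in> carr G \<Longrightarrow>
          mul G (mul G a b) c = mul G a (mul G b c)"
    and uni_mul: "\<And>a. a \<in> carr G \<Longrightarrow> mul G (uni G) a = a"
begin

sublocale fdv G by unfold_locales (rule fin_dim_alg)

abbreviation D :: "('h \<Rightarrow> 'k) set" where "D \<equiv> carr (dual_space G)"

abbreviation linD :: "('k \<Rightarrow> 'w \<Rightarrow> 'w) \<Rightarrow> (('h \<Rightarrow> 'k) \<Rightarrow> 'w::ab_group_add) \<Rightarrow> bool" where
  "linD \<equiv> lin (dual_space G)"

abbreviation mult (infixl "\<cdot>" 70) where "a \<cdot> b \<equiv> mul G a b"

sublocale dual: fdv "dual_space G" by unfold_locales (rule fin_dim_dual)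

lemma mul_carr [simp]: "a \<in> carr G \<Longrightarrow> b \<in> carr G \<Longrightarrow> a \<cdot> b \<in> carr G"
  using mul_lin by (auto simp: lin_on_def)

lemma mul_add [simp]:
  "a \<in> carr G \<Longrightarrow> b \<in> carr G \<Longrightarrow> c \<in> carr G \<Longrightarrow> a \<cdot> (b + c) = a \<cdot> b + a \<cdot> c"
  "a \<in> carr G \<Longrightarrow> b \<in> carr G \<Longrightarrow> c \<in> carr G \<Longrightarrow> (b + c) \<cdot> a = b \<cdot> a + c \<cdot> a"
proof -
  show *: "a \<cdot> (b + c) = a \<cdot> b + a \<cdot> c" if "a \<in> carr G" "b \<in> carr G" "c \<in> carr G" for a b c
    using mul_lin that by (auto simp: lin_on_def)
  show "a \<in> carr G \<Longrightarrow> b \<in> carr G \<Longrightarrow> c \<in> carr G \<Longrightarrow> (b + c) \<cdot> a = b \<cdot> a + c \<cdot> a"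
    using *[of a b c] mul_com[of a] by simp
qed

lemma mul_scal [simp]:
  "a \<in> carr G \<Longrightarrow> b \<in> carr G \<Longrightarrow> a \<cdot> scal G c b = scal G c (a \<cdot> b)"
  "a \<in> carr G \<Longrightarrow> b \<in> carr G \<Longrightarrow> scal G c b \<cdot> a = scal G c (b \<cdot> a)"
proof -
  show *: "a \<cdot> scal G c b = scal G c (a \<cdot> b)" if "a \<in> carr G" "b \<in> carr G" for a b
    using mul_lin that by (auto simp: lin_on_def)
  show "a \<in> carr G \<Longrightarrow> b \<in> carr G \<Longrightarrow> scal G c b \<cdot> a = scal G c (b \<cdot> a)"
    using *[of a b] mul_com[of a] by simp
qed

lemma mul_uni_right: "a \<in> carr G \<Longrightarrow> a \<cdot> uni G = a"
  using uni_mul mul_com uni_in by metis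

lemma mul_0 [simp]: "a \<in> carr G \<Longrightarrow> a \<cdot> 0 = 0" "a \<in> carr G \<Longrightarrow> 0 \<cdot> a = 0"
  using lin_on_0[OF mul_lin] mul_com[of 0 a] by auto

lemma mul_diff:
  "a \<in> carr G \<Longrightarrow> b \<in> carr G \<Longrightarrow> c \<in> carr G \<Longrightarrow> a \<cdot> (b - c) = a \<cdot> b - a \<cdot> c"
  "a \<in> carr G \<Longrightarrow> b \<in> carr G \<Longrightarrow> c \<in> carr G \<Longrightarrow> (b - c) \<cdot> a = b \<cdot> a - c \<cdot> a"
  using lin_on_diff[OF mul_lin, of a b c] mul_com[of a] by auto

lemma D_add [simp]: "x \<in> D \<Longrightarrow> a \<in> carr G \<Longrightarrow> b \<in> carr G \<Longrightarrow> x (a + b) = x a + x b"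
  by (auto simp: dual_carr lin_def)

lemma D_scal [simp]: "x \<in> D \<Longrightarrow> a \<in> carr G \<Longrightarrow> x (scal G c a) = c * x a"
  by (auto simp: dual_carr lin_def)

lemma D_diff: "x \<in> D \<Longrightarrow> a \<in> carr G \<Longrightarrow> b \<in> carr G \<Longrightarrow> x (a - b) = x a - x b"
  using lin_on_diff[of ground x] by (simp add: dual_carr)

lemma D_0: "x \<in> D \<Longrightarrow> x 0 = 0"
  using lin_0 by (auto simp: dual_carr)

lemma D_sum: "x \<in> D \<Longrightarrow> (\<And>i. i \<in> I \<Longrightarrow> f i \<in> carr G) \<Longrightarrow> x (\<Sum>i\<in>I. f i) = (\<Sum>i\<in>I. x (f i))"
  using lin_sum[OF dual_lin] by blast

lemma D_off: "x \<in> D \<Longrightarrow> a \<notin> carr G \<Longrightarrow> x a = 0"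
  by (auto simp: dual_carr)

lemma D_ext: "x \<in> D \<Longrightarrow> y \<in> D \<Longrightarrow> (\<And>a. a \<in> carr G \<Longrightarrow> x a = y a) \<Longrightarrow> x = y"
  by (auto simp: fun_eq_iff) (metis D_off)

lemma carr_ext: "a \<in> carr G \<Longrightarrow> b \<in> carr G \<Longrightarrow> (\<And>x. x \<in> D \<Longrightarrow> x a = x b) \<Longrightarrow> a = b"
  using dual_separates[of "a - b"] D_diff by fastforce

text \<open>
  The Sweedler sum \<open>\<Sum> F x\<^sub>1 x\<^sub>2\<close> for \<open>\<Delta> x = \<Sum> x\<^sub>1 \<otimes> x\<^sub>2\<close> in the group algebra, where \<open>F\<close> is bilinear with values
  in a space with scalar multiplication \<open>s\<close>.  With respect to dual bases of \<open>k[G]\<close> and \<open>kG\<close> the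
  coefficients of \<open>\<Delta> x\<close> are \<open>x(a b)\<close>.
\<close>

definition swe :: "('k \<Rightarrow> 'w \<Rightarrow> 'w) \<Rightarrow> ('h \<Rightarrow> 'k) \<Rightarrow> (('h \<Rightarrow> 'k) \<Rightarrow> ('h \<Rightarrow> 'k) \<Rightarrow> 'w::ab_group_add) \<Rightarrow> 'w" where
  "swe s x F = (\<Sum>a\<in>bas. \<Sum>b\<in>bas. s (x (a \<cdot> b)) (F (du a) (du b)))"

lemma swe_cong: "(\<And>u v. u \<in> D \<Longrightarrow> v \<in> D \<Longrightarrow> F u v = F' u v) \<Longrightarrow> swe s x F = swe s x F'"
  unfolding swe_def by (intro sum.cong) auto

lemma swe_comm: "swe s x F = swe s x (\<lambda>u v. F v u)"
  unfolding swe_def by (subst sum.swap) (auto intro!: sum.cong simp: mul_com)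

lemma swe_swap:
  assumes "vector_space s"
  shows "swe s x (\<lambda>u v. swe s y (\<lambda>p q. F u v p q)) = swe s y (\<lambda>p q. swe s x (\<lambda>u v. F u v p q))"
proof -
  interpret s: vector_space s by fact
  have "swe s x (\<lambda>u v. swe s y (\<lambda>p q. F u v p q)) =
    (\<Sum>a\<in>bas. \<Sum>b\<in>bas. \<Sum>c\<in>bas. \<Sum>d\<in>bas. s (x (a \<cdot> b) * y (c \<cdot> d)) (F (du a) (du b) (du c) (du d)))"
    unfolding swe_def by (simp add: s.scale_sum_right)
  also have "\<dots> = (\<Sum>c\<in>bas. \<Sum>d\<in>bas. \<Sum>a\<in>bas. \<Sum>b\<in>bas. s (x (a \<cdot> b) * y (c \<cdot> d)) (F (du a) (du b) (du c) (du d)))"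
    by (rule sum_swap4)
  also have "\<dots> = swe s y (\<lambda>p q. swe s x (\<lambda>u v. F u v p q))"
    unfolding swe_def by (simp add: s.scale_sum_right mult.commute)
  finally show ?thesis .
qed

lemma swe_lin_param:
  assumes "vector_space s" "\<And>u v. u \<in> D \<Longrightarrow> v \<in> D \<Longrightarrow> lin V s (\<lambda>z. F z u v)"
  shows "lin V s (\<lambda>z. swe s x (F z))"
  unfolding swe_def using assms by (intro lin_sum_fun lin_scale_const) auto

lemma swe_lin: "vector_space s \<Longrightarrow> linD s (\<lambda>x. swe s x F)"
  unfolding swe_def by (intro lin_sum_fun lin_scale_left) (auto simp: lin_def)

lemma swe_map:
  assumes "fdv V" "lin V s' T" "\<And>u v. u \<in> D \<Longrightarrow> v \<in> D \<Longrightarrow> F u v \<in> carr V"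
  shows "T (swe (scal V) x F) = swe s' x (\<lambda>u v. T (F u v))"
proof -
  interpret V: fdv V by fact
  show ?thesis
    unfolding swe_def using assms(3)
    by (simp add: V.lin_sum[OF assms(2)] lin_scal[OF assms(2)])
qed

lemma swe_carr:
  assumes "fdv V" "\<And>u v. u \<in> D \<Longrightarrow> v \<in> D \<Longrightarrow> F u v \<in> carr V"
  shows "swe (scal V) x F \<in> carr V"
proof -
  interpret V: fdv V by fact
  show ?thesis unfolding swe_def using assms(2) by (intro V.sum_carr V.scale_carr) auto
qed

lemma swe_fscale_apply: "swe fscale x F z = swe (*) x (\<lambda>u v. F u v z)"
  by (simp add: swe_def sum_fun_apply)

lemma swe_D: "(\<And>u v. u \<in> D \<Longrightarrow> v \<in> D \<Longrightarrow> F u v \<in> D) \<Longrightarrow> swe fscale x F \<in> D"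
  using swe_carr[of "dual_space G" F x] dual.fdv_axioms by simp

text \<open>The defining property of the comultiplication of the dual, and the way back from
  Sweedler sums to values of \<open>x\<close>.\<close>

lemma swe_eval: "x \<in> D \<Longrightarrow> f \<in> carr G \<Longrightarrow> g \<in> carr G \<Longrightarrow> swe (*) x (\<lambda>u v. u f * v g) = x (f \<cdot> g)"
proof -
  assume x: "x \<in> D" "f \<in> carr G" "g \<in> carr G"
  have l1: "lin G (*) (\<lambda>f. x (f \<cdot> g))" and l2: "\<And>a. a \<in> bas \<Longrightarrow> lin G (*) (\<lambda>g. x (a \<cdot> g))"
    using x by (auto simp: lin_def)
  have "x (f \<cdot> g) = (\<Sum>a\<in>bas. du a f * x (a \<cdot> g))" using lin_expand[OF l1 x(2)] by simp
  also have "\<dots> = (\<Sum>a\<in>bas. du a f * (\<Sum>b\<in>bas. du b g * x (a \<cdot> b)))"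
    using lin_expand[OF l2 x(3)] by simp
  also have "\<dots> = swe (*) x (\<lambda>u v. u f * v g)"
    by (simp add: swe_def sum_distrib_left mult_ac)
  finally show ?thesis by simp
qed

text \<open>If \<open>x\<close> sees products only through \<open>r\<close>, its coproduct lies in
  the tensor square of the functionals factoring through \<open>r\<close>. It is applied to the
  group algebra of \<open>N\<close> and to that of the connected component.\<close>

lemma swe_restrict:
  assumes s: "vector_space s" and x: "x \<in> D" and r: "lin_on G G r"
    and xr: "\<And>a b. a \<in> carr G \<Longrightarrow> b \<in> carr G \<Longrightarrow> x (r a \<cdot> r b) = x (a \<cdot> b)"
    and F: "\<And>v. v \<in> D \<Longrightarrow> linD s (\<lambda>u. F u v)" "\<And>u. u \<in> D \<Longrightarrow> linD s (F u)"
  shows "swe s x F = swe s x (\<lambda>u v. F (\<lambda>f. if f \<in> carr G then u (r f) else 0) (\<lambda>f. if f \<in> carr G then v (r f) else 0))"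
proof -
  interpret s: vector_space s by fact
  define rs where "rs u = (\<lambda>f. if f \<in> carr G then u (r f) else 0)" for u :: "'h \<Rightarrow> 'k"
  have rD: "rs u \<in> D" if "u \<in> D" for u
    unfolding dual_carr[of "rs u"] lin_def
    using that lin_on_add[OF r] lin_on_scale[OF r] lin_on_carr[OF r] by (simp add: rs_def)
  have rc: "r a \<in> carr G" if "a \<in> carr G" for a using r that by (auto simp: lin_on_def)
  have "swe s x (\<lambda>u v. F (rs u) (rs v)) = (\<Sum>a\<in>bas. \<Sum>b\<in>bas. s (x (a \<cdot> b)) (\<Sum>c\<in>bas. \<Sum>d\<in>bas. s (du a (r c) * du b (r d)) (F (du c) (du d))))"
    unfolding swe_def
  proof (intro sum.cong refl arg_cong[where f = "s _"])
    fix a b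
    have "F (rs (du a)) (rs (du b)) = (\<Sum>c\<in>bas. s (rs (du a) c) (F (du c) (rs (du b))))"
      using lin_dual_expand[OF F(1)[OF rD[OF du_dual]] rD[OF du_dual]] by simp
    also have "\<dots> = (\<Sum>c\<in>bas. s (rs (du a) c) (\<Sum>d\<in>bas. s (rs (du b) d) (F (du c) (du d))))"
      using lin_dual_expand[OF F(2)[OF du_dual] rD[OF du_dual]] by simp
    also have "\<dots> = (\<Sum>c\<in>bas. \<Sum>d\<in>bas. s (du a (r c) * du b (r d)) (F (du c) (du d)))"
      by (simp add: s.scale_sum_right rs_def)
    finally show "F (rs (du a)) (rs (du b)) = (\<Sum>c\<in>bas. \<Sum>d\<in>bas. s (du a (r c) * du b (r d)) (F (du c) (du d)))" .
  qed
  also have "\<dots> = (\<Sum>c\<in>bas. \<Sum>d\<in>bas. s (\<Sum>a\<in>bas. \<Sum>b\<in>bas. x (a \<cdot> b) * (du a (r c) * du b (r d))) (F (du c) (du d)))"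
    by (simp add: s.scale_sum_right s.scale_sum_left) (rule sum_swap4)
  also have "\<dots> = (\<Sum>c\<in>bas. \<Sum>d\<in>bas. s (x (c \<cdot> d)) (F (du c) (du d)))"
  proof (intro sum.cong refl)
    fix c d assume "c \<in> bas" "d \<in> bas"
    then show "s (\<Sum>a\<in>bas. \<Sum>b\<in>bas. x (a \<cdot> b) * (du a (r c) * du b (r d))) (F (du c) (du d)) = s (x (c \<cdot> d)) (F (du c) (du d))"
      using swe_eval[OF x rc[of c] rc[of d]] xr[of c d] by (simp add: swe_def)
  qed
  finally show ?thesis by (simp add: swe_def rs_def)
qed

text \<open>Resolves the description operator: \<open>t0\<close> has the coefficients
  \<open>x (a \<cdot> b)\<close> on dual bases, and uniqueness holds because every bilinear form on
  the dual is a combination of products of evaluations.\<close>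

lemma comul_group_alg_carr: "x \<in> D \<Longrightarrow> comul (group_alg G) x \<in> carr (tensor (dual_space G) (dual_space G))"
  and comul_group_alg: "x \<in> D \<Longrightarrow> \<beta> \<in> bil (dual_space G) (dual_space G) \<Longrightarrow> comul (group_alg G) x \<beta> = swe (*) x \<beta>"
proof -
  assume x: "x \<in> D"
  let ?D = "dual_space G"
  define t0 where "t0 = (\<lambda>\<beta>. if \<beta> \<in> bil ?D ?D then \<Sum>i\<in>bas \<times> bas. x (fst i \<cdot> snd i) * \<beta> (du (fst i)) (du (snd i)) else 0)"
  let ?P = "\<lambda>t. t \<in> carr (tensor ?D ?D) \<and> (\<forall>f\<in>carr G. \<forall>g\<in>carr G. t (\<lambda>a b. a f * b g) = x (f \<cdot> g))"
  have t0: "t0 \<beta> = swe (*) x \<beta>" if "\<beta> \<in> bil ?D ?D" for \<beta>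
    using that by (simp add: t0_def swe_def sum.cartesian_product case_prod_unfold)
  have ev: "(\<lambda>a b. a f * b g) \<in> bil ?D ?D" for f g :: 'h
    by (auto simp: bil_iff lin_def algebra_simps)
  have t0c: "t0 \<in> carr (tensor ?D ?D)"
    unfolding t0_def tensor_carr by (rule ten_carr_I) auto
  have t0P: "?P t0"
    using t0c t0[OF ev] swe_eval[OF x] by simp
  have uniq: "t = t0" if "?P t" for t
  proof
    fix \<beta>
    have tc: "t \<in> ten_carr (bil ?D ?D) ?D ?D" using that by (simp add: tensor_carr)
    show "t \<beta> = t0 \<beta>"
    proof (cases "\<beta> \<in> bil ?D ?D")
      case False
      then show ?thesis using ten_off[OF tc] by (simp add: t0_def)
    next
      case True
      have "\<beta> u v = (\<Sum>i\<in>bas \<times> bas. \<beta> (du (fst i)) (du (snd i)) * (u (fst i) * v (snd i)))"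
        if uv: "u \<in> D" "v \<in> D" for u v
      proof -
        have "\<beta> u v = (\<Sum>a\<in>bas. u a * \<beta> (du a) v)"
          using lin_dual_expand[of "(*)" "\<lambda>u. \<beta> u v" u] True uv by (auto simp: bil_iff)
        also have "\<dots> = (\<Sum>a\<in>bas. u a * (\<Sum>b\<in>bas. v b * \<beta> (du a) (du b)))"
          using lin_dual_expand[of "(*)" "\<beta> (du _)" v] True uv by (auto simp: bil_iff)
        finally show ?thesis
          by (simp add: sum_distrib_left mult_ac sum.cartesian_product case_prod_unfold)
      qed
      then have "t \<beta> = (\<Sum>i\<in>bas \<times> bas. \<beta> (du (fst i)) (du (snd i)) * t (\<lambda>u v. u (fst i) * v (snd i)))"
        by (intro ten_sum[OF tc True]) (auto simp: ev)
      also have "\<dots> = t0 \<beta>"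
        using that True by (auto simp: t0_def mult.commute intro!: sum.cong)
      finally show ?thesis .
    qed
  qed
  have "comul (group_alg G) x = (THE t. ?P t)"
    by (simp add: group_alg_def Let_def)
  also have "\<dots> = t0" using t0P uniq by (rule the_equality)
  finally have eq: "comul (group_alg G) x = t0" .
  show "comul (group_alg G) x \<in> carr (tensor ?D ?D)" using eq t0c by simp
  show "\<beta> \<in> bil ?D ?D \<Longrightarrow> comul (group_alg G) x \<beta> = swe (*) x \<beta>" using eq t0 by simp
qed

text \<open>The coefficients of the iterated coproduct are the values
  \<open>x (a \<cdot> b \<cdot> c)\<close>, so coassociativity will come from associativity and
  commutativity of \<open>k[G]\<close>.\<close>

lemma swe3:
  assumes "vector_space s" "x \<in> D"
  shows "swe s x (\<lambda>y z. swe s y (\<lambda>u v. F u v z)) = (\<Sum>a\<in>bas. \<Sum>b\<in>bas. \<Sum>c\<in>bas. s (x (a \<cdot> b \<cdot> c)) (F (du a) (du b) (du c)))"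
proof -
  interpret s: vector_space s by fact
  have e1: "(\<Sum>d\<in>bas. x (d \<cdot> c) * du d w) = x (w \<cdot> c)" if "w \<in> carr G" "c \<in> carr G" for w c
    using lin_expand[of "(*)" "\<lambda>w. x (w \<cdot> c)" w] that assms by (auto simp: lin_def mult.commute)
  have "swe s x (\<lambda>y z. swe s y (\<lambda>u v. F u v z)) =
      (\<Sum>d\<in>bas. \<Sum>c\<in>bas. \<Sum>a\<in>bas. \<Sum>b\<in>bas. s (x (d \<cdot> c) * du d (a \<cdot> b)) (F (du a) (du b) (du c)))"
    unfolding swe_def by (simp add: s.scale_sum_right)
  also have "\<dots> = (\<Sum>c\<in>bas. \<Sum>d\<in>bas. \<Sum>(a, b)\<in>bas \<times> bas. s (x (d \<cdot> c) * du d (a \<cdot> b)) (F (du a) (du b) (du c)))"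
    by (rule trans[OF sum.swap]) (simp add: sum.cartesian_product)
  also have "\<dots> = (\<Sum>c\<in>bas. \<Sum>(a, b)\<in>bas \<times> bas. s (\<Sum>d\<in>bas. x (d \<cdot> c) * du d (a \<cdot> b)) (F (du a) (du b) (du c)))"
    by (intro sum.cong refl, subst sum.swap) (simp add: s.scale_sum_left case_prod_unfold)
  also have "\<dots> = (\<Sum>c\<in>bas. \<Sum>(a, b)\<in>bas \<times> bas. s (x (a \<cdot> b \<cdot> c)) (F (du a) (du b) (du c)))"
    by (intro sum.cong refl) (auto simp: e1)
  also have "\<dots> = (\<Sum>a\<in>bas. \<Sum>b\<in>bas. \<Sum>c\<in>bas. s (x (a \<cdot> b \<cdot> c)) (F (du a) (du b) (du c)))"
    by (simp only: sum.cartesian_product[symmetric]) (rule sum_rotate3)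
  finally show ?thesis .
qed

lemma swe_coassoc:
  assumes "vector_space s" "x \<in> D"
  shows "swe s x (\<lambda>y z. swe s y (\<lambda>u v. F u v z)) = swe s x (\<lambda>y z. swe s z (\<lambda>u v. F y u v))"
proof -
  \<comment> \<open>Cocommutativity brings the right-hand side into the shape of
    \<open>swe3\<close>, at the price of a cyclic shift of the three basis elements.\<close>
  have "swe s x (\<lambda>y z. swe s z (\<lambda>u v. F y u v)) = swe s x (\<lambda>z y. swe s z (\<lambda>u v. F y u v))"
    by (rule swe_comm)
  also have "\<dots> = (\<Sum>a\<in>bas. \<Sum>b\<in>bas. \<Sum>c\<in>bas. s (x (a \<cdot> b \<cdot> c)) (F (du c) (du a) (du b)))"
    by (rule swe3[OF assms])
  also have "\<dots> = (\<Sum>c\<in>bas. \<Sum>a\<in>bas. \<Sum>b\<in>bas. s (x (a \<cdot> b \<cdot> c)) (F (du c) (du a) (du b)))"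
    by (rule sum_rotate3[symmetric])
  also have "\<dots> = (\<Sum>a\<in>bas. \<Sum>b\<in>bas. \<Sum>c\<in>bas. s (x (a \<cdot> b \<cdot> c)) (F (du a) (du b) (du c)))"
  proof (intro sum.cong refl)
    fix a b c assume abc: "a \<in> bas" "b \<in> bas" "c \<in> bas"
    then have "b \<cdot> c \<cdot> a = a \<cdot> b \<cdot> c" using mul_com[of "b \<cdot> c" a] by (simp add: mul_ass)
    then show "s (x (b \<cdot> c \<cdot> a)) (F (du a) (du b) (du c)) = s (x (a \<cdot> b \<cdot> c)) (F (du a) (du b) (du c))" by simp
  qed
  finally show ?thesis using swe3[OF assms] by simp
qed

text \<open>Evaluation at the unit of \<open>k[G]\<close> is the counit of the group
  algebra.\<close>

lemma swe_counit_right: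
  assumes "x \<in> D" "vector_space s" "linD s F"
  shows "swe s x (\<lambda>u v. s (v (uni G)) (F u)) = F x"
proof -
  interpret s: vector_space s by fact
  have "swe s x (\<lambda>u v. s (v (uni G)) (F u)) = (\<Sum>a\<in>bas. s (\<Sum>b\<in>bas. du b (uni G) * x (a \<cdot> b)) (F (du a)))"
    by (simp add: swe_def s.scale_sum_left mult.commute)
  also have "\<dots> = (\<Sum>a\<in>bas. s (x a) (F (du a)))"
  proof (intro sum.cong refl)
    fix a assume a: "a \<in> bas"
    have "lin G (*) (\<lambda>b. x (a \<cdot> b))" using a assms by (auto simp: lin_def)
    from lin_expand[OF this uni_in] show "s (\<Sum>b\<in>bas. du b (uni G) * x (a \<cdot> b)) (F (du a)) = s (x a) (F (du a))"
      using a by (simp add: mul_uni_right)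
  qed
  finally show ?thesis using lin_dual_expand[OF assms(3,1)] by simp
qed

lemma swe_counit_left:
  assumes "x \<in> D" "vector_space s" "linD s F"
  shows "swe s x (\<lambda>u v. s (u (uni G)) (F v)) = F x"
  using swe_counit_right[OF assms] by (subst swe_comm)

end

section \<open>The group algebra as a cocommutative Hopf algebra\<close>

lemma lin_comp:
  "lin W s F \<Longrightarrow> (\<And>v. v \<in> carr V \<Longrightarrow> g v \<in> carr W) \<Longrightarrow> lin V (scal W) g \<Longrightarrow> lin V s (\<lambda>v. F (g v))"
  by (simp add: lin_def)

text \<open>The antipode is kept apart, so that the connected component can be made an instance from
  its bialgebra identities alone.\<close>

locale bialg = comm_alg G
  for G :: "('k::field, 'h::ab_group_add) hopf" +
  assumes comul_lin: "lin_on G (tensor G G) (comul G)"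
    and comul_1: "comul G (uni G) = ten (bil G G) (uni G) (uni G)"
    and comul_m: "\<And>f g. f \<in> carr G \<Longrightarrow> g \<in> carr G \<Longrightarrow>
          comul G (mul G f g) =
          lift (\<lambda>a b. lift (\<lambda>c d. ten (bil G G) (mul G a c) (mul G b d)) (comul G g)) (comul G f)"
    and coass: "\<And>f \<tau>. f \<in> carr G \<Longrightarrow> \<tau> \<in> tril G \<Longrightarrow>
          comul G f (\<lambda>a b. comul G a (\<lambda>a1 a2. \<tau> a1 a2 b)) =
          comul G f (\<lambda>a b. comul G b (\<lambda>b1 b2. \<tau> a b1 b2))"
    and counit_lin: "lin_on G ground (counit G)"
    and counit_1: "counit G (uni G) = 1"
    and counit_m: "\<And>a b. a \<in> carr G \<Longrightarrow> b \<in> carr G \<Longrightarrow>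
          counit G (mul G a b) = counit G a * counit G b"
    and counit_l: "\<And>f \<phi>. f \<in> carr G \<Longrightarrow> lin_on G ground \<phi> \<Longrightarrow>
          comul G f (\<lambda>a b. counit G a * \<phi> b) = \<phi> f"
    and counit_r: "\<And>f \<phi>. f \<in> carr G \<Longrightarrow> lin_on G ground \<phi> \<Longrightarrow>
          comul G f (\<lambda>a b. \<phi> a * counit G b) = \<phi> f"
begin

definition star :: "('h \<Rightarrow> 'k) \<Rightarrow> ('h \<Rightarrow> 'k) \<Rightarrow> 'h \<Rightarrow> 'k" (infixl "\<star>" 70) where
  "x \<star> y = mul (group_alg G) x y"

definition eps :: "'h \<Rightarrow> 'k" where "eps = uni (group_alg G)"

lemma carr_group_alg: "carr (group_alg G) = D" by (simp add: group_alg_def Let_def)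

lemma star_def': "x \<star> y = (\<lambda>f. if f \<in> carr G then comul G f (\<lambda>a b. x a * y b) else 0)"
  by (simp add: star_def group_alg_def Let_def)

lemma eps_def': "eps = (\<lambda>f. if f \<in> carr G then counit G f else 0)"
  by (simp add: eps_def group_alg_def Let_def)

lemma comul_in: "f \<in> carr G \<Longrightarrow> comul G f \<in> ten_carr (bil G G) G G"
  using lin_on_carr[OF comul_lin] by (simp add: tensor_carr)

lemma comul_ex:
  assumes "f \<in> carr G"
  shows "\<exists>n a b. (\<forall>i<(n::nat). a i \<in> carr G \<and> b i \<in> carr G) \<and> (\<forall>\<beta>\<in>bil G G. comul G f \<beta> = (\<Sum>i<n. \<beta> (a i) (b i)))"
proof -
  obtain n a b where "\<forall>i<(n::nat). a i \<in> carr G \<and> b i \<in> carr G"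
    "comul G f = (\<lambda>\<beta>. if \<beta> \<in> bil G G then \<Sum>i<n. \<beta> (a i) (b i) else 0)"
    using ten_carr_ex[OF comul_in[OF assms] order_refl fin_dim_alg] by blast
  then show ?thesis by - (rule exI[of _ n], rule exI[of _ a], rule exI[of _ b], simp)
qed

lemma comul_cong:
  assumes "f \<in> carr G" "\<beta> \<in> bil G G" "\<beta>' \<in> bil G G"
    "\<And>a b. a \<in> carr G \<Longrightarrow> b \<in> carr G \<Longrightarrow> \<beta> a b = \<beta>' a b"
  shows "comul G f \<beta> = comul G f \<beta>'"
  by (rule ten_cong[OF comul_in[OF assms(1)] assms(2-4)])

lemma comul_add: "f \<in> carr G \<Longrightarrow> g \<in> carr G \<Longrightarrow> comul G (f + g) \<beta> = comul G f \<beta> + comul G g \<beta>"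
  using lin_on_add[OF comul_lin] by simp

lemma comul_scal: "f \<in> carr G \<Longrightarrow> comul G (scal G c f) \<beta> = c * comul G f \<beta>"
  using lin_on_scale[OF comul_lin] by simp

lemma comul_sum: "f \<in> carr G \<Longrightarrow> (\<And>i. i \<in> I \<Longrightarrow> \<gamma> i \<in> bil G G) \<Longrightarrow> \<beta> \<in> bil G G \<Longrightarrow>
    (\<And>a b. a \<in> carr G \<Longrightarrow> b \<in> carr G \<Longrightarrow> \<beta> a b = (\<Sum>i\<in>I. c i * \<gamma> i a b)) \<Longrightarrow>
    comul G f \<beta> = (\<Sum>i\<in>I. c i * comul G f (\<gamma> i))"
  by (rule ten_sum[OF comul_in])

lemma lin_comul_param:
  assumes "f \<in> carr G" "\<And>z. z \<in> carr V \<Longrightarrow> \<tau> z \<in> bil G G"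
    "\<And>a b. a \<in> carr G \<Longrightarrow> b \<in> carr G \<Longrightarrow> lin V (*) (\<lambda>z. \<tau> z a b)"
    "fdv V"
  shows "lin V (*) (\<lambda>z. comul G f (\<tau> z))"
proof -
  interpret V: fdv V by fact
  obtain n a b where *: "\<forall>i<(n::nat). a i \<in> carr G \<and> b i \<in> carr G" "\<forall>\<beta>\<in>bil G G. comul G f \<beta> = (\<Sum>i<n. \<beta> (a i) (b i))"
    using comul_ex[OF assms(1)] by blast
  have "lin V (*) (\<lambda>z. \<Sum>i<n. \<tau> z (a i) (b i))"
    using * assms(3) by (intro lin_sum_fun vector_space_mult) auto
  then show ?thesis using * assms(2) by (simp add: lin_def)
qed

lemma prod_bil: "x \<in> D \<Longrightarrow> y \<in> D \<Longrightarrow> (\<lambda>a b. x a * y b) \<in> bil G G"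
  by (auto simp: bil_iff lin_def algebra_simps)

lemma star_apply: "f \<in> carr G \<Longrightarrow> (x \<star> y) f = comul G f (\<lambda>a b. x a * y b)"
  by (simp add: star_def')

lemma star_D [simp]: "x \<in> D \<Longrightarrow> y \<in> D \<Longrightarrow> x \<star> y \<in> D"
  unfolding dual_carr[of "x \<star> y"] lin_def by (simp add: star_def' comul_add comul_scal)

lemma star_apply_ex:
  assumes "f \<in> carr G"
  shows "\<exists>n a b. (\<forall>i<(n::nat). a i \<in> carr G \<and> b i \<in> carr G) \<and> (\<forall>x\<in>D. \<forall>y\<in>D. (x \<star> y) f = (\<Sum>i<n. x (a i) * y (b i)))"
proof -
  obtain n a b where *: "\<forall>i<(n::nat). a i \<in> carr G \<and> b i \<in> carr G" "\<forall>\<beta>\<in>bil G G. comul G f \<beta> = (\<Sum>i<n. \<beta> (a i) (b i))"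
    using comul_ex[OF assms] by blast
  then show ?thesis
    by - (rule exI[of _ n], rule exI[of _ a], rule exI[of _ b], auto simp: star_apply[OF assms] prod_bil)
qed

lemma star_add [simp]:
  assumes "x \<in> D" "y \<in> D" "z \<in> D"
  shows "(x + y) \<star> z = x \<star> z + y \<star> z" "z \<star> (x + y) = z \<star> x + z \<star> y"
proof -
  have *: "((x + y) \<star> z) f = (x \<star> z + y \<star> z) f \<and> (z \<star> (x + y)) f = (z \<star> x + z \<star> y) f" if f: "f \<in> carr G" for f
  proof -
    obtain n a b where "\<forall>x\<in>D. \<forall>y\<in>D. (x \<star> y) f = (\<Sum>i<(n::nat). x (a i) * y (b i))"
      using star_apply_ex[OF f] by blast
    then show ?thesis using assms by (simp add: dual_closed algebra_simps sum.distrib)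
  qed
  show "(x + y) \<star> z = x \<star> z + y \<star> z" "z \<star> (x + y) = z \<star> x + z \<star> y"
    using * assms by (auto intro!: D_ext simp: dual_closed)
qed

lemma star_scal [simp]:
  assumes "x \<in> D" "z \<in> D"
  shows "fscale c x \<star> z = fscale c (x \<star> z)" "z \<star> fscale c x = fscale c (z \<star> x)"
proof -
  have *: "(fscale c x \<star> z) f = (fscale c (x \<star> z)) f \<and> (z \<star> fscale c x) f = (fscale c (z \<star> x)) f" if f: "f \<in> carr G" for f
  proof -
    obtain n a b where "\<forall>x\<in>D. \<forall>y\<in>D. (x \<star> y) f = (\<Sum>i<(n::nat). x (a i) * y (b i))"
      using star_apply_ex[OF f] by blast
    then show ?thesis using assms by (simp add: dual_closed sum_distrib_left mult_ac)
  qed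
  show "fscale c x \<star> z = fscale c (x \<star> z)" "z \<star> fscale c x = fscale c (z \<star> x)"
    using * assms by (auto intro!: D_ext simp: dual_closed)
qed

lemmas D_closed [simp] = dual_closed

lemma star_diff [simp]:
  assumes "x \<in> D" "y \<in> D" "z \<in> D"
  shows "(x - y) \<star> z = x \<star> z - y \<star> z" "z \<star> (x - y) = z \<star> x - z \<star> y"
proof -
  have "lin_on (dual_space G) (dual_space G) (\<lambda>x. x \<star> z)" "lin_on (dual_space G) (dual_space G) (\<lambda>x. z \<star> x)"
    using assms by (simp_all add: lin_on_def)
  then show "(x - y) \<star> z = x \<star> z - y \<star> z" "z \<star> (x - y) = z \<star> x - z \<star> y"
    using dual.lin_on_diff assms by blast+
qed

text \<open>Coassociativity tested on the trilinear form \<open>\<tau>\<close>; the rest checks that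
  the inner coproducts are bilinear, so that the outer ones can be compared.\<close>

lemma star_assoc: 
  assumes "x \<in> D" "y \<in> D" "z \<in> D"
  shows "(x \<star> y) \<star> z = x \<star> (y \<star> z)"
proof (rule D_ext)
  fix f assume f: "f \<in> carr G"
  define \<tau> where "\<tau> a b c = x a * y b * z c" for a b c
  have tril: "\<tau> \<in> tril G"
    using assms by (auto simp: tril_def bil_iff lin_def \<tau>_def algebra_simps)
  have b1: "(\<lambda>a1 a2. \<tau> a1 a2 b) \<in> bil G G" and b2: "(\<lambda>b1 b2. \<tau> b b1 b2) \<in> bil G G" if "b \<in> carr G" for b
    using assms that by (auto simp: bil_iff lin_def \<tau>_def algebra_simps)
  have e1: "comul G a (\<lambda>a1 a2. \<tau> a1 a2 b) = (x \<star> y) a * z b" if "a \<in> carr G" "b \<in> carr G" for a b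
    using comul_sum[of a "{()}" "\<lambda>_ a1 a2. x a1 * y a2" "\<lambda>a1 a2. \<tau> a1 a2 b" "\<lambda>_. z b"] that assms b1
    by (simp add: star_apply prod_bil \<tau>_def mult_ac)
  have e2: "comul G b (\<lambda>b1 b2. \<tau> a b1 b2) = x a * (y \<star> z) b" if "a \<in> carr G" "b \<in> carr G" for a b
    using comul_sum[of b "{()}" "\<lambda>_ a1 a2. y a1 * z a2" "\<lambda>b1 b2. \<tau> a b1 b2" "\<lambda>_. x a"] that assms b2
    by (simp add: star_apply prod_bil \<tau>_def mult_ac)
  have m1: "(\<lambda>a b. comul G a (\<lambda>a1 a2. \<tau> a1 a2 b)) \<in> bil G G"
    using assms e1 by (auto simp: bil_iff lin_def algebra_simps)
  have m2: "(\<lambda>a b. comul G b (\<lambda>b1 b2. \<tau> a b1 b2)) \<in> bil G G"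
    using assms e2 by (auto simp: bil_iff lin_def algebra_simps)
  have "((x \<star> y) \<star> z) f = comul G f (\<lambda>a b. comul G a (\<lambda>a1 a2. \<tau> a1 a2 b))"
    unfolding star_apply[OF f] using assms e1 f m1 by (intro comul_cong) (auto simp: prod_bil)
  also have "\<dots> = comul G f (\<lambda>a b. comul G b (\<lambda>b1 b2. \<tau> a b1 b2))"
    by (rule coass[OF f tril])
  also have "\<dots> = (x \<star> (y \<star> z)) f"
    unfolding star_apply[OF f] using assms e2 f m2 by (intro comul_cong) (auto simp: prod_bil)
  finally show "((x \<star> y) \<star> z) f = (x \<star> (y \<star> z)) f" .
qed (use assms in auto)

lemma eps_D [simp]: "eps \<in> D"
  unfolding dual_carr[of eps] lin_def using counit_lin by (simp add: eps_def' lin_def)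

lemma eps_left [simp]: "x \<in> D \<Longrightarrow> eps \<star> x = x"
proof (rule D_ext)
  fix f assume x: "x \<in> D" and f: "f \<in> carr G"
  have "(eps \<star> x) f = comul G f (\<lambda>a b. counit G a * x b)"
    unfolding star_apply[OF f] using f x counit_lin
    by (intro comul_cong) (auto simp: prod_bil eps_def' bil_iff lin_def algebra_simps)
  then show "(eps \<star> x) f = x f" using counit_l[OF f, of x] x by (simp add: dual_lin)
qed auto

lemma eps_right [simp]: "x \<in> D \<Longrightarrow> x \<star> eps = x"
proof (rule D_ext)
  fix f assume x: "x \<in> D" and f: "f \<in> carr G"
  have "(x \<star> eps) f = comul G f (\<lambda>a b. x a * counit G b)"
    unfolding star_apply[OF f] using f x counit_lin
    by (intro comul_cong) (auto simp: prod_bil eps_def' bil_iff lin_def algebra_simps)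
  then show "(x \<star> eps) f = x f" using counit_r[OF f, of x] x by (simp add: dual_lin)
qed auto

lemma swe_sum:
  assumes "vector_space s"
  shows "swe s x (\<lambda>u v. \<Sum>i\<in>I. F i u v) = (\<Sum>i\<in>I. swe s x (F i))"
proof -
  interpret s: vector_space s by fact
  show ?thesis
    by (simp add: swe_def s.scale_sum_right) (rule sum_rotate3[symmetric])
qed

lemma swe_mult_left: "swe (*) x (\<lambda>u v. c * F u v) = c * swe (*) x F"
  by (simp add: swe_def sum_distrib_left mult_ac)

lemma swe_mult_right: "swe (*) x (\<lambda>u v. F u v * c) = swe (*) x F * c"
  by (simp add: swe_def sum_distrib_left sum_distrib_right mult_ac)

text \<open>Multiplicativity of the comultiplication of \<open>k[G]\<close>, transposed. Products of
  evaluations come first; \<open>swe_star\<close> reduces to them by expanding \<open>F\<close> in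
  dual bases.\<close>

lemma swe_star_eval:
  assumes xy: "x \<in> D" "y \<in> D" and pq: "p \<in> carr G" "q \<in> carr G"
  shows "(x \<star> y) (p \<cdot> q) = swe (*) x (\<lambda>x1 x2. swe (*) y (\<lambda>y1 y2. (x1 \<star> y1) p * (x2 \<star> y2) q))"
proof -
  obtain n a b where p: "\<forall>i<(n::nat). a i \<in> carr G \<and> b i \<in> carr G" "\<forall>\<beta>\<in>bil G G. comul G p \<beta> = (\<Sum>i<n. \<beta> (a i) (b i))"
    using comul_ex[OF pq(1)] by blast
  obtain m c d where q: "\<forall>i<(m::nat). c i \<in> carr G \<and> d i \<in> carr G" "\<forall>\<beta>\<in>bil G G. comul G q \<beta> = (\<Sum>i<m. \<beta> (c i) (d i))"
    using comul_ex[OF pq(2)] by blast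
  have sp: "(u \<star> v) p = (\<Sum>i<n. u (a i) * v (b i))" if "u \<in> D" "v \<in> D" for u v
    using p(2) that by (simp add: star_apply[OF pq(1)] prod_bil)
  have sq: "(u \<star> v) q = (\<Sum>i<m. u (c i) * v (d i))" if "u \<in> D" "v \<in> D" for u v
    using q(2) that by (simp add: star_apply[OF pq(2)] prod_bil)
  have inner: "(\<lambda>c d. x (a1 \<cdot> c) * y (b1 \<cdot> d)) \<in> bil G G" if "a1 \<in> carr G" "b1 \<in> carr G" for a1 b1
    using xy that by (auto simp: bil_iff lin_def algebra_simps)
  have outer: "(\<lambda>a b. comul G q (\<lambda>c d. x (a \<cdot> c) * y (b \<cdot> d))) \<in> bil G G"
    using xy inner by (auto intro!: bilI lin_comul_param pq simp: lin_def algebra_simps fdv_axioms)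
  have "(x \<star> y) (p \<cdot> q) = comul G p (\<lambda>a b. comul G q (\<lambda>c d. x (a \<cdot> c) * y (b \<cdot> d)))"
    using pq xy by (simp add: star_apply comul_m lift_def ten_def prod_bil)
  also have "\<dots> = (\<Sum>i<n. \<Sum>j<m. x (a i \<cdot> c j) * y (b i \<cdot> d j))"
    using p outer inner q(2) by simp
  finally have L: "(x \<star> y) (p \<cdot> q) = (\<Sum>i<n. \<Sum>j<m. x (a i \<cdot> c j) * y (b i \<cdot> d j))" .
  have "swe (*) x (\<lambda>x1 x2. swe (*) y (\<lambda>y1 y2. (x1 \<star> y1) p * (x2 \<star> y2) q)) =
     swe (*) x (\<lambda>x1 x2. swe (*) y (\<lambda>y1 y2. (\<Sum>i<n. \<Sum>j<m. (x1 (a i) * x2 (c j)) * (y1 (b i) * y2 (d j)))))"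
    by (intro swe_cong) (simp add: sp sq sum_product mult_ac)
  also have "\<dots> = (\<Sum>i<n. \<Sum>j<m. swe (*) x (\<lambda>x1 x2. x1 (a i) * x2 (c j)) * swe (*) y (\<lambda>y1 y2. y1 (b i) * y2 (d j)))"
    by (simp add: swe_sum[OF vector_space_mult] swe_mult_left swe_mult_right)
  also have "\<dots> = (\<Sum>i<n. \<Sum>j<m. x (a i \<cdot> c j) * y (b i \<cdot> d j))"
    using p q xy by (simp add: swe_eval)
  finally show ?thesis using L by simp
qed

lemma bilinear_expand:
  assumes "vector_space s" "\<And>v. v \<in> D \<Longrightarrow> linD s (\<lambda>u. F u v)" "\<And>u. u \<in> D \<Longrightarrow> linD s (F u)"
    and "u \<in> D" "v \<in> D"
  shows "F u v = (\<Sum>p\<in>bas. \<Sum>q\<in>bas. s (u p * v q) (F (du p) (du q)))"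
proof -
  interpret s: vector_space s by fact
  have "F u v = (\<Sum>p\<in>bas. s (u p) (F (du p) v))"
    using lin_dual_expand[OF assms(2)] assms by simp
  also have "\<dots> = (\<Sum>p\<in>bas. s (u p) (\<Sum>q\<in>bas. s (v q) (F (du p) (du q))))"
    using lin_dual_expand[OF assms(3)[OF du_dual] assms(5)] by simp
  finally show ?thesis by (simp add: s.scale_sum_right)
qed

lemma swe_star:
  assumes s: "vector_space s" and xy: "x \<in> D" "y \<in> D"
    and F: "\<And>v. v \<in> D \<Longrightarrow> linD s (\<lambda>u. F u v)" "\<And>u. u \<in> D \<Longrightarrow> linD s (F u)"
  shows "swe s (x \<star> y) F = swe s x (\<lambda>x1 x2. swe s y (\<lambda>y1 y2. F (x1 \<star> y1) (x2 \<star> y2)))"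
proof -
  interpret s: vector_space s by fact
  have "swe s x (\<lambda>x1 x2. swe s y (\<lambda>y1 y2. F (x1 \<star> y1) (x2 \<star> y2))) =
     swe s x (\<lambda>x1 x2. swe s y (\<lambda>y1 y2. \<Sum>p\<in>bas. \<Sum>q\<in>bas. s ((x1 \<star> y1) p * (x2 \<star> y2) q) (F (du p) (du q))))"
    using bilinear_expand[OF s F] by (intro swe_cong) simp
  also have "\<dots> = (\<Sum>a\<in>bas. \<Sum>b\<in>bas. \<Sum>c\<in>bas. \<Sum>d\<in>bas. \<Sum>p\<in>bas. \<Sum>q\<in>bas.
      s (x (a \<cdot> b) * y (c \<cdot> d) * ((du a \<star> du c) p * (du b \<star> du d) q)) (F (du p) (du q)))"
    unfolding swe_def by (simp add: s.scale_sum_right mult.assoc)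
  also have "\<dots> = (\<Sum>p\<in>bas. \<Sum>q\<in>bas. \<Sum>a\<in>bas. \<Sum>b\<in>bas. \<Sum>c\<in>bas. \<Sum>d\<in>bas.
      s (x (a \<cdot> b) * y (c \<cdot> d) * ((du a \<star> du c) p * (du b \<star> du d) q)) (F (du p) (du q)))"
    by (rule trans[OF _ sum_swap4]) (rule sum.cong[OF refl], rule sum.cong[OF refl], rule sum_swap4)
  also have "\<dots> = (\<Sum>p\<in>bas. \<Sum>q\<in>bas. s (swe (*) x (\<lambda>x1 x2. swe (*) y (\<lambda>y1 y2. (x1 \<star> y1) p * (x2 \<star> y2) q))) (F (du p) (du q)))"
    unfolding swe_def by (simp add: s.scale_sum_left sum_distrib_left mult.assoc)
  also have "\<dots> = swe s (x \<star> y) F"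
    unfolding swe_def[of s "x \<star> y"] using swe_star_eval[OF xy] by simp
  finally show ?thesis by simp
qed

lemma swe_eps:
  assumes s: "vector_space s"
    and F: "\<And>v. v \<in> D \<Longrightarrow> linD s (\<lambda>u. F u v)" "\<And>u. u \<in> D \<Longrightarrow> linD s (F u)"
  shows "swe s eps F = F eps eps"
  using bilinear_expand[OF s F eps_D eps_D] counit_m by (simp add: swe_def eps_def')

lemma star_uni [simp]: "x \<in> D \<Longrightarrow> y \<in> D \<Longrightarrow> (x \<star> y) (uni G) = x (uni G) * y (uni G)"
  using comul_1 uni_in by (simp add: star_apply ten_def prod_bil)

lemma eps_uni [simp]: "eps (uni G) = 1"
  using counit_1 uni_in by (simp add: eps_def')

lemma lin_apply: "linD (*) (\<lambda>x. x f)"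
  by (simp add: lin_def)

lemma lin_id_D: "linD fscale (\<lambda>x. x)" by (simp add: lin_def)

lemma swe_star_right: "z \<in> D \<Longrightarrow> (\<And>u v. u \<in> D \<Longrightarrow> v \<in> D \<Longrightarrow> F u v \<in> D) \<Longrightarrow> swe fscale x F \<star> z = swe fscale x (\<lambda>u v. F u v \<star> z)"
  using swe_map[OF dual.fdv_axioms, of fscale "\<lambda>w. w \<star> z" F x] by (simp add: lin_def)

lemma swe_star_left: "z \<in> D \<Longrightarrow> (\<And>u v. u \<in> D \<Longrightarrow> v \<in> D \<Longrightarrow> F u v \<in> D) \<Longrightarrow> z \<star> swe fscale x F = swe fscale x (\<lambda>u v. z \<star> F u v)"
  using swe_map[OF dual.fdv_axioms, of fscale "\<lambda>w. z \<star> w" F x] by (simp add: lin_def)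

end

context finite_group_scheme
begin

sublocale bialg G
  by unfold_locales (fact fin_dim uni_closed mul_linear mul_comm mul_assoc mul_uni comul_linear comul_uni
    comul_mul coassoc counit_linear counit_uni counit_mul counit_left counit_right)+

definition anti :: "('h \<Rightarrow> 'k) \<Rightarrow> 'h \<Rightarrow> 'k" where "anti x = antipode (group_alg G) x"

lemma anti_def': "anti x = (\<lambda>f. if f \<in> carr G then x (antipode G f) else 0)"
  by (simp add: anti_def group_alg_def Let_def)

lemma antipode_carr [simp]: "f \<in> carr G \<Longrightarrow> antipode G f \<in> carr G"
  using antipode_linear by (simp add: lin_on_def)

lemma antipode_add [simp]: "f \<in> carr G \<Longrightarrow> g \<in> carr G \<Longrightarrow> antipode G (f + g) = antipode G f + antipode G g"
  using antipode_linear by (simp add: lin_on_def)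

lemma antipode_scal [simp]: "f \<in> carr G \<Longrightarrow> antipode G (scal G c f) = scal G c (antipode G f)"
  using antipode_linear by (simp add: lin_on_def)

lemma anti_D [simp]: "x \<in> D \<Longrightarrow> anti x \<in> D"
  unfolding dual_carr[of "anti x"] lin_def by (simp add: anti_def')

lemma anti_add [simp]: "anti (x + y) = anti x + anti y"
  by (auto simp: anti_def')

lemma anti_scal [simp]: "anti (fscale c x) = fscale c (anti x)"
  by (auto simp: anti_def')

lemma antipode_form:
  "x \<in> D \<Longrightarrow> (\<lambda>a b. x (a \<cdot> antipode G b)) \<in> bil G G" "x \<in> D \<Longrightarrow> (\<lambda>a b. x (antipode G a \<cdot> b)) \<in> bil G G"
  by (auto simp: bil_iff lin_def)

lemma swe_anti_right:
  assumes s: "vector_space s" and x: "x \<in> D" and F: "linD s F"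
  shows "swe s x (\<lambda>u v. F (u \<star> anti v)) = s (x (uni G)) (F eps)"
proof -
  interpret s: vector_space s by fact
  have ev: "swe (*) x (\<lambda>u v. (u \<star> anti v) p) = eps p * x (uni G)" if p: "p \<in> carr G" for p
  proof -
    obtain n a b where ab: "\<forall>i<(n::nat). a i \<in> carr G \<and> b i \<in> carr G" "\<forall>\<beta>\<in>bil G G. comul G p \<beta> = (\<Sum>i<n. \<beta> (a i) (b i))"
      using comul_ex[OF p] by blast
    have "swe (*) x (\<lambda>u v. (u \<star> anti v) p) = swe (*) x (\<lambda>u v. \<Sum>i<n. u (a i) * v (antipode G (b i)))"
      using ab by (intro swe_cong) (simp add: star_apply[OF p] prod_bil anti_def'[of "_"] prod_bil[OF _ anti_D, unfolded anti_def'])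
    also have "\<dots> = (\<Sum>i<n. swe (*) x (\<lambda>u v. u (a i) * v (antipode G (b i))))"
      by (simp add: swe_def sum_distrib_left) (rule sum_rotate3[symmetric])
    also have "\<dots> = (\<Sum>i<n. x (a i \<cdot> antipode G (b i)))"
      using ab x by (intro sum.cong) (auto simp: swe_eval)
    also have "\<dots> = comul G p (\<lambda>a b. x (a \<cdot> antipode G b))"
      using ab antipode_form[OF x] by simp
    also have "\<dots> = eps p * x (uni G)"
      using antipode_right[OF p, of x] x p by (simp add: dual_lin eps_def')
    finally show ?thesis .
  qed
  have "swe s x (\<lambda>u v. F (u \<star> anti v)) = swe s x (\<lambda>u v. \<Sum>p\<in>bas. s ((u \<star> anti v) p) (F (du p)))"
    using lin_dual_expand[OF F] by (intro swe_cong) simp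
  also have "\<dots> = (\<Sum>p\<in>bas. s (swe (*) x (\<lambda>u v. (u \<star> anti v) p)) (F (du p)))"
    unfolding swe_def
    by (simp add: s.scale_sum_right s.scale_sum_left) (rule sum_rotate3[symmetric])
  also have "\<dots> = s (x (uni G)) (\<Sum>p\<in>bas. s (eps p) (F (du p)))"
    by (simp add: ev s.scale_sum_right mult.commute)
  finally show ?thesis using lin_dual_expand[OF F eps_D] by simp
qed

lemma swe_anti_left:
  assumes s: "vector_space s" and x: "x \<in> D" and F: "linD s F"
  shows "swe s x (\<lambda>u v. F (anti u \<star> v)) = s (x (uni G)) (F eps)"
proof -
  interpret s: vector_space s by fact
  have ev: "swe (*) x (\<lambda>u v. (anti u \<star> v) p) = eps p * x (uni G)" if p: "p \<in> carr G" for p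
  proof -
    obtain n a b where ab: "\<forall>i<(n::nat). a i \<in> carr G \<and> b i \<in> carr G" "\<forall>\<beta>\<in>bil G G. comul G p \<beta> = (\<Sum>i<n. \<beta> (a i) (b i))"
      using comul_ex[OF p] by blast
    have "swe (*) x (\<lambda>u v. (anti u \<star> v) p) = swe (*) x (\<lambda>u v. \<Sum>i<n. u (antipode G (a i)) * v (b i))"
      using ab by (intro swe_cong) (simp add: star_apply[OF p] prod_bil anti_def'[of "_"] prod_bil[OF anti_D, unfolded anti_def'])
    also have "\<dots> = (\<Sum>i<n. swe (*) x (\<lambda>u v. u (antipode G (a i)) * v (b i)))"
      by (simp add: swe_def sum_distrib_left) (rule sum_rotate3[symmetric])
    also have "\<dots> = (\<Sum>i<n. x (antipode G (a i) \<cdot> b i))"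
      using ab x by (intro sum.cong) (auto simp: swe_eval)
    also have "\<dots> = comul G p (\<lambda>a b. x (antipode G a \<cdot> b))"
      using ab antipode_form[OF x] by simp
    also have "\<dots> = eps p * x (uni G)"
      using antipode_left[OF p, of x] x p by (simp add: dual_lin eps_def')
    finally show ?thesis .
  qed
  have "swe s x (\<lambda>u v. F (anti u \<star> v)) = swe s x (\<lambda>u v. \<Sum>p\<in>bas. s ((anti u \<star> v) p) (F (du p)))"
    using lin_dual_expand[OF F] by (intro swe_cong) simp
  also have "\<dots> = (\<Sum>p\<in>bas. s (swe (*) x (\<lambda>u v. (anti u \<star> v) p)) (F (du p)))"
    unfolding swe_def
    by (simp add: s.scale_sum_right s.scale_sum_left) (rule sum_rotate3[symmetric])
  also have "\<dots> = s (x (uni G)) (\<Sum>p\<in>bas. s (eps p) (F (du p)))"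
    by (simp add: ev s.scale_sum_right mult.commute)
  finally show ?thesis using lin_dual_expand[OF F eps_D] by simp
qed

lemma anti_uni [simp]: "x \<in> D \<Longrightarrow> anti x (uni G) = x (uni G)"
proof -
  assume x: "x \<in> D"
  have "swe (*) x (\<lambda>u v. (u \<star> anti v) (uni G)) = x (uni G)"
    using swe_anti_right[OF vector_space_mult x lin_apply[of "uni G"]] by simp
  moreover have "swe (*) x (\<lambda>u v. (u \<star> anti v) (uni G)) = swe (*) x (\<lambda>u v. u (uni G) * anti v (uni G))"
    by (rule swe_cong) simp
  moreover have "\<dots> = anti x (uni G)"
    by (rule swe_counit_left[OF x vector_space_mult]) (simp add: lin_def)
  ultimately show ?thesis by simp
qed

lemma anti_eps [simp]: "anti eps = eps"
proof -
  have "swe fscale eps (\<lambda>u v. u \<star> anti v) = fscale (eps (uni G)) eps"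
    by (rule swe_anti_right[OF vector_space_fscale eps_D lin_id_D])
  moreover have "swe fscale eps (\<lambda>u v. u \<star> anti v) = eps \<star> anti eps"
    by (rule swe_eps[OF vector_space_fscale]) (auto simp: lin_def)
  ultimately show ?thesis by (simp add: fscale_def)
qed

text \<open>The identity is convolution invertible with inverse \<open>anti\<close>:
  \<open>V x\<close> is the sum of the terms \<open>V x1 \<star> x2 \<star> anti x3\<close>, and the
  first two factors already cancel.\<close>

lemma convolution_cancel:
  assumes V: "\<And>u. u \<in> D \<Longrightarrow> V u \<in> D" "linD fscale V"
    and 0: "\<And>x. x \<in> D \<Longrightarrow> swe fscale x (\<lambda>u v. V u \<star> v) = 0" and x: "x \<in> D"
  shows "V x = 0"
proof -
  note vs = vector_space_fscale
  have "V x = swe fscale x (\<lambda>u v. fscale (v (uni G)) (V u))"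
    using swe_counit_right[OF x vs V(2)] by simp
  also have "\<dots> = swe fscale x (\<lambda>u v. swe fscale v (\<lambda>p q. V u \<star> (p \<star> anti q)))"
    using V by (intro swe_cong) (simp add: swe_anti_right[OF vs, where F = "\<lambda>w. V _ \<star> w"] lin_def)
  also have "\<dots> = swe fscale x (\<lambda>w q. swe fscale w (\<lambda>u p. V u \<star> (p \<star> anti q)))"
    by (rule swe_coassoc[OF vs x, symmetric])
  also have "\<dots> = swe fscale x (\<lambda>w q. swe fscale w (\<lambda>u p. V u \<star> p) \<star> anti q)"
  proof (rule swe_cong)
    fix w q assume wq: "w \<in> D" "q \<in> D"
    have "swe fscale w (\<lambda>u p. V u \<star> p) \<star> anti q = swe fscale w (\<lambda>u p. V u \<star> p \<star> anti q)"
      using V wq by (intro swe_star_right) auto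
    also have "\<dots> = swe fscale w (\<lambda>u p. V u \<star> (p \<star> anti q))"
      using V wq by (intro swe_cong) (simp add: star_assoc)
    finally show "swe fscale w (\<lambda>u p. V u \<star> (p \<star> anti q)) = swe fscale w (\<lambda>u p. V u \<star> p) \<star> anti q" by simp
  qed
  also have "\<dots> = swe fscale x (\<lambda>w q. 0)"
    by (intro swe_cong) (simp add: 0 star_scal(1)[of 0 _ 0, simplified] fs.scale_zero_left)
  also have "\<dots> = 0" by (simp add: swe_def)
  finally show ?thesis .
qed

text \<open>The axioms contain only the two antipode identities. Convolving the defect with the
  identity in both arguments gives zero, because both terms become the product of the counits;
  \<open>convolution_cancel\<close> then removes the two convolutions one after the other.\<close>

lemma anti_star:
  assumes "x \<in> D" "y \<in> D"
  shows "anti (x \<star> y) = anti y \<star> anti x"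
proof -
  note vs = vector_space_fscale
  define U where "U x y = anti (x \<star> y) - anti y \<star> anti x" for x y
  have UD: "U x y \<in> D" if "x \<in> D" "y \<in> D" for x y
    using that unfolding U_def by (intro dual.diff_carr) auto
  have sub: "a - b = a + fscale (- 1) b" for a b :: "'h \<Rightarrow> 'k" by (simp add: fun_eq_iff)
  have Ul: "linD fscale (\<lambda>x. U x y)" if "y \<in> D" for y
    using that unfolding U_def sub by (auto simp: lin_def fun_eq_iff algebra_simps)
  have Ur: "linD fscale (\<lambda>y. U x y)" if "x \<in> D" for x
    using that unfolding U_def sub by (auto simp: lin_def fun_eq_iff algebra_simps)
  \<comment> \<open>Half of the double convolution: for fixed \<open>x\<close> it is cancelled in
    \<open>y\<close>, after which \<open>U\<close> itself is cancelled in \<open>x\<close>.\<close>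
  define V where "V x y = swe fscale x (\<lambda>u v. U u y \<star> v)" for x y
  have VD: "V x y \<in> D" if "y \<in> D" for x y
    using that UD unfolding V_def by (intro swe_D) auto
  have "V x y = 0" if xy: "x \<in> D" "y \<in> D" for x y
  proof (rule convolution_cancel[where V = "V x", OF _ _ _ xy(2)])
    show "linD fscale (V x)"
      unfolding V_def using Ur UD by (intro swe_lin_param vs) (auto simp: lin_def)
    fix y assume y: "y \<in> D"
    have "swe fscale y (\<lambda>p q. V x p \<star> q) = swe fscale y (\<lambda>p q. swe fscale x (\<lambda>u v. U u p \<star> v \<star> q))"
      unfolding V_def using UD by (intro swe_cong swe_star_right) auto
    also have "\<dots> = swe fscale x (\<lambda>u v. swe fscale y (\<lambda>p q. U u p \<star> v \<star> q))"
      by (rule swe_swap[OF vs])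
    also have "\<dots> = swe fscale x (\<lambda>u v. swe fscale y (\<lambda>p q. anti (u \<star> p) \<star> (v \<star> q))) -
       swe fscale x (\<lambda>u v. swe fscale y (\<lambda>p q. anti p \<star> anti u \<star> (v \<star> q)))"
    proof -
      have "U u p \<star> v \<star> q = anti (u \<star> p) \<star> (v \<star> q) - anti p \<star> anti u \<star> (v \<star> q)"
        if "u \<in> D" "p \<in> D" "v \<in> D" "q \<in> D" for u p v q
        using that unfolding U_def by (simp add: star_assoc)
      then have "swe fscale x (\<lambda>u v. swe fscale y (\<lambda>p q. U u p \<star> v \<star> q)) =
        swe fscale x (\<lambda>u v. swe fscale y (\<lambda>p q. anti (u \<star> p) \<star> (v \<star> q) - anti p \<star> anti u \<star> (v \<star> q)))"
        by (intro swe_cong) auto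
      then show ?thesis by (simp add: swe_def sum_subtractf fs.scale_right_diff_distrib)
    qed
    also have "swe fscale x (\<lambda>u v. swe fscale y (\<lambda>p q. anti (u \<star> p) \<star> (v \<star> q))) = swe fscale (x \<star> y) (\<lambda>u v. anti u \<star> v)"
      by (rule swe_star[OF vs xy(1) y, symmetric]) (auto simp: lin_def)
    also have "\<dots> = fscale (x (uni G) * y (uni G)) eps"
      using swe_anti_left[OF vs _ lin_id_D, of "x \<star> y"] xy y by simp
    also have "swe fscale x (\<lambda>u v. swe fscale y (\<lambda>p q. anti p \<star> anti u \<star> (v \<star> q))) =
        swe fscale y (\<lambda>p q. swe fscale x (\<lambda>u v. anti p \<star> anti u \<star> (v \<star> q)))"
      by (rule swe_swap[OF vs])
    also have "\<dots> = swe fscale y (\<lambda>p q. swe fscale x (\<lambda>u v. anti p \<star> ((anti u \<star> v) \<star> q)))"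
      by (intro swe_cong) (simp add: star_assoc)
    also have "\<dots> = swe fscale y (\<lambda>p q. fscale (x (uni G)) (anti p \<star> q))"
    proof (rule swe_cong)
      fix p q assume "p \<in> D" "q \<in> D"
      then show "swe fscale x (\<lambda>u v. anti p \<star> ((anti u \<star> v) \<star> q)) = fscale (x (uni G)) (anti p \<star> q)"
        using swe_anti_left[OF vs xy(1), of "\<lambda>w. anti p \<star> (w \<star> q)"] by (simp add: lin_def)
    qed
    also have "\<dots> = fscale (x (uni G)) (swe fscale y (\<lambda>p q. anti p \<star> q))"
      by (simp add: swe_def fs.scale_sum_right mult_ac)
    also have "\<dots> = fscale (x (uni G) * y (uni G)) eps"
      using swe_anti_left[OF vs y lin_id_D] by simp
    finally show "swe fscale y (\<lambda>p q. V x p \<star> q) = 0" by (simp only: diff_self)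
  qed (use VD in auto)
  then have "U x y = 0"
    using Ul[OF assms(2)] UD assms
    by (intro convolution_cancel[where V = "\<lambda>x. U x y", OF _ _ _ assms(1)]) (auto simp: V_def)
  then show ?thesis by (simp add: U_def)
qed

section \<open>The adjoint action of the group algebra on itself\<close>

definition ad :: "('h \<Rightarrow> 'k) \<Rightarrow> ('h \<Rightarrow> 'k) \<Rightarrow> 'h \<Rightarrow> 'k" where
  "ad x y = swe fscale x (\<lambda>u v. u \<star> y \<star> anti v)"

lemma ad_D [simp]: "y \<in> D \<Longrightarrow> ad x y \<in> D"
  unfolding ad_def by (intro swe_D) auto

lemma ad_lin: "linD fscale (\<lambda>x. ad x y)"
  unfolding ad_def by (rule swe_lin[OF vector_space_fscale])

lemma ad_star:
  assumes "x \<in> D" "z \<in> D" "y \<in> D"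
  shows "ad (x \<star> z) y = ad x (ad z y)"
proof -
  note vs = vector_space_fscale
  have "ad (x \<star> z) y = swe fscale x (\<lambda>x1 x2. swe fscale z (\<lambda>z1 z2. (x1 \<star> z1) \<star> y \<star> anti (x2 \<star> z2)))"
    unfolding ad_def using assms by (intro swe_star[OF vs]) (auto simp: lin_def)
  also have "\<dots> = swe fscale x (\<lambda>x1 x2. x1 \<star> ad z y \<star> anti x2)"
  proof (rule swe_cong)
    fix x1 x2 assume x12: "x1 \<in> D" "x2 \<in> D"
    have "x1 \<star> ad z y \<star> anti x2 = swe fscale z (\<lambda>z1 z2. x1 \<star> (z1 \<star> y \<star> anti z2)) \<star> anti x2"
      unfolding ad_def using x12 assms by (subst swe_star_left) auto
    also have "\<dots> = swe fscale z (\<lambda>z1 z2. x1 \<star> (z1 \<star> y \<star> anti z2) \<star> anti x2)"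
      using x12 assms by (subst swe_star_right) auto
    also have "\<dots> = swe fscale z (\<lambda>z1 z2. (x1 \<star> z1) \<star> y \<star> anti (x2 \<star> z2))"
      using x12 assms by (intro swe_cong) (simp add: anti_star star_assoc)
    finally show "swe fscale z (\<lambda>z1 z2. (x1 \<star> z1) \<star> y \<star> anti (x2 \<star> z2)) = x1 \<star> ad z y \<star> anti x2" by simp
  qed
  finally show ?thesis by (simp add: ad_def)
qed

lemma ad_eps: "y \<in> D \<Longrightarrow> ad eps y = y"
  unfolding ad_def by (subst swe_eps[OF vector_space_fscale]) (auto simp: lin_def)

lemma ad_uni: "x \<in> D \<Longrightarrow> y \<in> D \<Longrightarrow> ad x y (uni G) = x (uni G) * y (uni G)"
proof -
  assume xy: "x \<in> D" "y \<in> D"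
  have "ad x y (uni G) = swe (*) x (\<lambda>u v. v (uni G) * (u (uni G) * y (uni G)))"
    unfolding ad_def swe_fscale_apply using xy by (intro swe_cong) simp
  also have "\<dots> = x (uni G) * y (uni G)"
    using xy by (intro swe_counit_right[OF _ vector_space_mult]) (auto simp: lin_def algebra_simps)
  finally show ?thesis .
qed

text \<open>The sum of the terms \<open>x1 \<star> y \<star> anti x2 \<star> x3\<close> collapses to
  the product, since the last two factors contract to the counit.\<close>

lemma star_ad:
  assumes "x \<in> D" "y \<in> D"
  shows "x \<star> y = swe fscale x (\<lambda>u v. ad u y \<star> v)"
proof -
  note vs = vector_space_fscale
  have "swe fscale x (\<lambda>u v. ad u y \<star> v) = swe fscale x (\<lambda>w v. swe fscale w (\<lambda>p q. p \<star> y \<star> anti q \<star> v))"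
    unfolding ad_def using assms by (intro swe_cong swe_star_right) auto
  also have "\<dots> = swe fscale x (\<lambda>p w. swe fscale w (\<lambda>q v. p \<star> y \<star> anti q \<star> v))"
    by (rule swe_coassoc[OF vs assms(1)])
  also have "\<dots> = swe fscale x (\<lambda>p w. fscale (w (uni G)) (p \<star> y))"
  proof (rule swe_cong)
    fix p w assume pw: "p \<in> D" "w \<in> D"
    have "swe fscale w (\<lambda>q v. p \<star> y \<star> anti q \<star> v) = swe fscale w (\<lambda>q v. p \<star> y \<star> (anti q \<star> v))"
      using pw assms by (intro swe_cong) (simp add: star_assoc)
    also have "\<dots> = fscale (w (uni G)) (p \<star> y \<star> eps)"
      using pw assms by (intro swe_anti_left[OF vs]) (auto simp: lin_def)
    finally show "swe fscale w (\<lambda>q v. p \<star> y \<star> anti q \<star> v) = fscale (w (uni G)) (p \<star> y)"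
      using pw assms by simp
  qed
  also have "\<dots> = x \<star> y"
    using assms by (intro swe_counit_right[OF _ vs]) (auto simp: lin_def)
  finally show ?thesis by simp
qed

text \<open>Moves \<open>y\<close> across \<open>x\<close> from left to right. For \<open>y\<close>
  in \<open>kN\<close> the adjoint factors stay in \<open>kN\<close>, and so invariance under right
  multiplication by \<open>kN\<close> will imply invariance under left multiplication.\<close>

lemma star_ad_anti:
  assumes "x \<in> D" "y \<in> D"
  shows "y \<star> x = swe fscale x (\<lambda>u v. u \<star> ad (anti v) y)"
proof -
  note vs = vector_space_fscale
  have "swe fscale x (\<lambda>u v. u \<star> ad (anti v) y) = swe fscale x (\<lambda>w v. swe fscale w (\<lambda>p q. ad (q \<star> anti v) y \<star> p))"
  proof (rule swe_cong)
    fix u v assume uv: "u \<in> D" "v \<in> D"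
    have "u \<star> ad (anti v) y = swe fscale u (\<lambda>p q. ad p (ad (anti v) y) \<star> q)"
      using uv assms by (intro star_ad) auto
    also have "\<dots> = swe fscale u (\<lambda>p q. ad (p \<star> anti v) y \<star> q)"
      using uv assms by (intro swe_cong) (simp add: ad_star)
    \<comment> \<open>Cocommutativity exchanges \<open>p\<close> and \<open>q\<close> so that
      \<open>q\<close> stands next to \<open>anti v\<close> and coassociativity can contract
      them.\<close>
    finally show "u \<star> ad (anti v) y = swe fscale u (\<lambda>p q. ad (q \<star> anti v) y \<star> p)"
      using swe_comm[of fscale u] by metis
  qed
  also have "\<dots> = swe fscale x (\<lambda>p w. swe fscale w (\<lambda>q v. ad (q \<star> anti v) y \<star> p))"
    by (rule swe_coassoc[OF vs assms(1)])
  also have "\<dots> = swe fscale x (\<lambda>p w. fscale (w (uni G)) (y \<star> p))"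
  proof (rule swe_cong)
    fix p w assume pw: "p \<in> D" "w \<in> D"
    have "swe fscale w (\<lambda>q v. ad (q \<star> anti v) y \<star> p) = fscale (w (uni G)) (ad eps y \<star> p)"
      using pw assms lin_add[OF ad_lin[of y]] lin_scal[OF ad_lin[of y]]
      by (intro swe_anti_right[OF vs, where F = "\<lambda>z. ad z y \<star> p"]) (auto simp: lin_def)
    then show "swe fscale w (\<lambda>q v. ad (q \<star> anti v) y \<star> p) = fscale (w (uni G)) (y \<star> p)"
      using assms by (simp add: ad_eps)
  qed
  also have "\<dots> = y \<star> x"
    using assms by (intro swe_counit_right[OF _ vs]) (auto simp: lin_def)
  finally show ?thesis by simp
qed

end

section \<open>Quotients\<close>

context fdv begin

lemma fin_dim_subspace:
  assumes U: "subspace U" "U \<subseteq> carr V" and S: "carr S = U" "scal S = scal V"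
  shows "fin_dim_space S"
proof -
  obtain B where B: "B \<subseteq> U" "independent B" "U \<subseteq> span B" "card B = dim U"
    using basis_exists by blast
  have "finite B" using finite_independent[of B] B U by blast
  moreover have "span B = U" using B U span_minimal by blast
  ultimately show ?thesis
    unfolding fin_dim_space_def using S vector_space_axioms by auto
qed

lemma projection_ex:
  assumes U: "subspace U" "U \<subseteq> carr V"
  shows "\<exists>r. lin_on V V r \<and> (\<forall>v\<in>carr V. r v \<in> U) \<and> (\<forall>u\<in>U. r u = u)"
proof -
  obtain B where B: "B \<subseteq> U" "independent B" "U \<subseteq> span B" "card B = dim U"
    using basis_exists by blast
  have finB: "finite B" using finite_independent[of B] B U by blast
  have spB: "span B = U" using B U span_minimal by blast
  obtain C where C: "B \<subseteq> C" "C \<subseteq> carr V" "independent C" "carr V \<subseteq> span C"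
    using maximal_independent_subset_extend[of B "carr V"] B U by blast
  define r where "r v = (\<Sum>b\<in>B. scal V (representation C v b) b)" for v
  have "lin_on V V r"
    using C B U unfolding r_def lin_on_def
    by (auto simp: subset_eq representation_add representation_scale scale_left_distrib sum.distrib scale_sum_right)
  moreover have "r v \<in> U" for v
    unfolding r_def using B U by (intro subspace_sum subspace_scale) auto
  moreover have "r u = u" if u: "u \<in> U" for u
  proof -
    have "representation C u = representation B u"
      using representation_extend[OF C(3), of u B] u spB C by simp
    then show ?thesis
      unfolding r_def using sum_representation_eq[OF B(2), of u B] u spB finB by simp
  qed
  ultimately show ?thesis by blast
qed

end

lemma lift_apply [simp]: "lift F t x = t (\<lambda>v w. F v w x)" by (simp add: lift_def)

lemma tmap_apply: "tmap V W f g t \<beta> = t (\<lambda>a b. if \<beta> \<in> bil V W then \<beta> (f a) (g b) else 0)"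
  by (simp add: tmap_def ten_def)

text \<open>Stated for a bialgebra \<open>K\<close> because it is used twice, for \<open>G\<close>
  and for its connected component.\<close>

locale closed_sub = bialg K + N: bialg N
  for K :: "('k::field, 'h::ab_group_add) hopf" and N :: "('k, 'n::ab_group_add) hopf" +
  fixes \<pi> :: "'h \<Rightarrow> 'n"
  assumes hom_pi: "hopf_hom K N \<pi>" and surj_pi: "\<pi> ` carr K = carr N"
begin

notation star (infixl "\<star>" 70)

lemma pi_lin: "lin_on K N \<pi>" and pi_uni [simp]: "\<pi> (uni K) = uni N"
  and pi_mul: "a \<in> carr K \<Longrightarrow> b \<in> carr K \<Longrightarrow> \<pi> (mul K a b) = mul N (\<pi> a) (\<pi> b)"
  and pi_comul: "a \<in> carr K \<Longrightarrow> comul N (\<pi> a) = tmap N N \<pi> \<pi> (comul K a)"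
  and pi_counit: "a \<in> carr K \<Longrightarrow> counit N (\<pi> a) = counit K a"
  using hom_pi by (auto simp: hopf_hom_def)

lemma pi_carr [simp]: "a \<in> carr K \<Longrightarrow> \<pi> a \<in> carr N"
  and pi_add [simp]: "a \<in> carr K \<Longrightarrow> b \<in> carr K \<Longrightarrow> \<pi> (a + b) = \<pi> a + \<pi> b"
  and pi_scal [simp]: "a \<in> carr K \<Longrightarrow> \<pi> (scal K c a) = scal N c (\<pi> a)"
  using pi_lin by (auto simp: lin_on_def)

text \<open>The group algebra of \<open>N\<close>, as a subalgebra of that of \<open>K\<close>.\<close>

definition kN :: "('h \<Rightarrow> 'k) set" where
  "kN = {x \<in> D. \<forall>f\<in>carr K. \<pi> f = 0 \<longrightarrow> x f = 0}"

lemma kN_D [simp]: "x \<in> kN \<Longrightarrow> x \<in> D" by (simp add: kN_def)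

lemma push_D: "y \<in> N.D \<Longrightarrow> push K \<pi> y \<in> D"
  unfolding dual_carr[of "push K \<pi> y"] lin_def by (simp add: push_def)

lemma push_kN: "y \<in> N.D \<Longrightarrow> push K \<pi> y \<in> kN"
  unfolding kN_def mem_Collect_eq using push_D[of y] N.D_0[of y] by (simp add: push_def)

lemma kN_0: "x \<in> kN \<Longrightarrow> f \<in> carr K \<Longrightarrow> \<pi> f = 0 \<Longrightarrow> x f = 0"
  unfolding kN_def by blast

text \<open>Some linear section of \<open>\<pi>\<close>, not multiplicative in general; followed
  after \<open>\<pi>\<close> it gives the projection fed into \<open>swe_restrict\<close>.\<close>

definition sec :: "'n \<Rightarrow> 'h" where
  "sec m = (\<Sum>c\<in>N.bas. scal K (N.du c m) (inv_into (carr K) \<pi> c))"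

lemma inv_pi: "c \<in> carr N \<Longrightarrow> inv_into (carr K) \<pi> c \<in> carr K \<and> \<pi> (inv_into (carr K) \<pi> c) = c"
  using surj_pi by (metis f_inv_into_f inv_into_into)

lemma sec_lin: "lin_on N K sec"
  unfolding lin_on_def sec_def using N.du_lin inv_pi
  by (auto simp: lin_def scale_left_distrib sum.distrib scale_sum_right)

lemma pi_sec: "m \<in> carr N \<Longrightarrow> \<pi> (sec m) = m"
proof -
  assume m: "m \<in> carr N"
  have "\<pi> (sec m) = (\<Sum>c\<in>N.bas. \<pi> (scal K (N.du c m) (inv_into (carr K) \<pi> c)))"
    unfolding sec_def using inv_pi by (intro lin_on_sum[OF pi_lin]) auto
  also have "\<dots> = (\<Sum>c\<in>N.bas. scal N (N.du c m) c)"
    using inv_pi by (intro sum.cong) auto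
  finally show ?thesis using N.du_expand[OF m] by simp
qed

lemma sec_carr [simp]: "m \<in> carr N \<Longrightarrow> sec m \<in> carr K"
  using sec_lin by (simp add: lin_on_def)

lemma kN_sec: "x \<in> kN \<Longrightarrow> f \<in> carr K \<Longrightarrow> x (sec (\<pi> f)) = x f"
proof -
  assume x: "x \<in> kN" and f: "f \<in> carr K"
  have "\<pi> (sec (\<pi> f) - f) = 0"
    using lin_on_diff[OF pi_lin, of "sec (\<pi> f)" f] f pi_sec by simp
  then have "x (sec (\<pi> f) - f) = 0" using kN_0[OF x] f by simp
  then show ?thesis using D_diff[of x "sec (\<pi> f)" f] x f by simp
qed

lemma kN_push: "x \<in> kN \<Longrightarrow> \<exists>y\<in>N.D. x = push K \<pi> y"
proof -
  assume x: "x \<in> kN"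
  define y where "y m = (if m \<in> carr N then x (sec m) else 0)" for m
  have "y \<in> N.D"
    unfolding dual_carr[of y] lin_def using x N.lin_on_add[OF sec_lin] N.lin_on_scale[OF sec_lin]
    by (simp add: y_def)
  moreover have "x = push K \<pi> y"
    using kN_sec[OF x] D_off[OF kN_D[OF x]] by (auto simp: push_def y_def fun_eq_iff)
  ultimately show ?thesis by blast
qed

text \<open>An element of \<open>kN\<close> has its coproduct in the tensor square of
  \<open>kN\<close>, so the integrands need agree only there.\<close>

lemma swe_kN_cong:
  assumes s: "vector_space s" and y: "y \<in> kN"
    and F: "\<And>v. v \<in> D \<Longrightarrow> linD s (\<lambda>u. F u v)" "\<And>u. u \<in> D \<Longrightarrow> linD s (F u)"
    and F': "\<And>v. v \<in> D \<Longrightarrow> linD s (\<lambda>u. F' u v)" "\<And>u. u \<in> D \<Longrightarrow> linD s (F' u)"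
    and eq: "\<And>u v. u \<in> kN \<Longrightarrow> v \<in> kN \<Longrightarrow> F u v = F' u v"
  shows "swe s y F = swe s y F'"
proof -
  define r where "r f = sec (\<pi> f)" for f
  have r: "lin_on K K r"
    using pi_lin sec_lin by (auto simp: lin_on_def r_def)
  have pr: "\<pi> (r f) = \<pi> f" if "f \<in> carr K" for f using that by (simp add: r_def pi_sec)
  have rc: "r f \<in> carr K" if "f \<in> carr K" for f using that by (simp add: r_def)
  have yr: "y (mul K (r a) (r b)) = y (mul K a b)" if "a \<in> carr K" "b \<in> carr K" for a b
  proof -
    obtain y' where "y' \<in> N.D" "y = push K \<pi> y'" using kN_push[OF y] by blast
    then show ?thesis using that rc by (simp add: push_def pi_mul pr)
  qed
  have rk: "(\<lambda>f. if f \<in> carr K then u (r f) else 0) \<in> kN" if u: "u \<in> D" for u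
  proof -
    have "(\<lambda>f. if f \<in> carr K then u (r f) else 0) \<in> D"
      unfolding dual_carr[of "\<lambda>f. if f \<in> carr K then u (r f) else 0"] lin_def
      using u lin_on_add[OF r] lin_on_scale[OF r] rc by simp
    moreover have "sec 0 = 0" using N.lin_on_0[OF sec_lin] .
    ultimately show ?thesis
      unfolding kN_def mem_Collect_eq using D_0[OF u] by (simp add: r_def)
  qed
  have "swe s y F = swe s y (\<lambda>u v. F' (\<lambda>f. if f \<in> carr K then u (r f) else 0) (\<lambda>f. if f \<in> carr K then v (r f) else 0))"
    by (subst swe_restrict[OF s kN_D[OF y] r yr F]) (auto intro!: swe_cong eq rk)
  also have "\<dots> = swe s y F'"
    by (rule swe_restrict[OF s kN_D[OF y] r yr F', symmetric])
  finally show ?thesis .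
qed

section \<open>Functions on the quotient and functionals on them\<close>

abbreviation Q where "Q \<equiv> quot_scheme K N \<pi>"

lemma Q_simps: "scal Q = scal K" "mul Q = mul K" "uni Q = uni K" "counit Q = counit K"
  "carr Q = {f \<in> carr K. tmap K N id \<pi> (comul K f) = ten (bil K N) f (uni N)}"
  by (simp_all add: quot_scheme_def Let_def quot_space_def)

lemma pi_form: "x \<in> D \<Longrightarrow> y \<in> N.D \<Longrightarrow> (\<lambda>a b. x a * y b) \<in> bil K N"
  by (auto simp: bil_iff lin_def algebra_simps)

lemma form_pi: "\<beta> \<in> bil K N \<Longrightarrow> (\<lambda>a b. \<beta> a (\<pi> b)) \<in> bil K K"
  by (auto simp: bil_iff lin_def)

lemma star_push: "f \<in> carr K \<Longrightarrow> x \<in> D \<Longrightarrow> y \<in> N.D \<Longrightarrow> (x \<star> push K \<pi> y) f = comul K f (\<lambda>a b. x a * y (\<pi> b))"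
  using form_pi[OF pi_form, of x y]
  by (auto simp: star_apply push_def[abs_def] intro!: comul_cong prod_bil push_D[unfolded push_def[abs_def]])

text \<open>Products of functionals separate tensors, so the equation of tensors defining
  \<open>k[G/N]\<close> becomes right invariance under \<open>kN\<close>, with
  \<open>y (uni K)\<close> as the counit of \<open>y\<close>.\<close>

lemma Q_iff: "f \<in> carr Q \<longleftrightarrow> f \<in> carr K \<and> (\<forall>x\<in>D. \<forall>y\<in>kN. (x \<star> y) f = x f * y (uni K))"
proof (intro iffI conjI ballI)
  assume f: "f \<in> carr Q"
  then show fK: "f \<in> carr K" by (simp add: Q_simps)
  fix x y assume x: "x \<in> D" and y: "y \<in> kN"
  obtain y' where y': "y' \<in> N.D" "y = push K \<pi> y'" using kN_push[OF y] by blast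
  have "tmap K N id \<pi> (comul K f) (\<lambda>a b. x a * y' b) = ten (bil K N) f (uni N) (\<lambda>a b. x a * y' b)"
    using f by (simp add: Q_simps)
  then show "(x \<star> y) f = x f * y (uni K)"
    using x y' fK pi_form[OF x y'(1)] by (simp add: tmap_apply ten_def star_push) (simp add: push_def uni_in)
next
  assume f: "f \<in> carr K \<and> (\<forall>x\<in>D. \<forall>y\<in>kN. (x \<star> y) f = x f * y (uni K))"
  have "tmap K N id \<pi> (comul K f) \<beta> = ten (bil K N) f (uni N) \<beta>" for \<beta>
  proof (cases "\<beta> \<in> bil K N")
    case False
    have "comul K f (\<lambda>a b. 0) = 0"
      using comul_sum[of f "{}" _ "\<lambda>a b. 0"] f by (simp add: bil_iff lin_def)
    then show ?thesis using False by (simp add: tmap_apply ten_def)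
  next
    case True
    have ex: "\<beta> a n = (\<Sum>i\<in>bas \<times> N.bas. \<beta> (fst i) (snd i) * (du (fst i) a * N.du (snd i) n))"
      if "a \<in> carr K" "n \<in> carr N" for a n
      by (rule bil_expand[OF N.fdv_axioms True that])
    have "comul K f (\<lambda>a b. \<beta> a (\<pi> b)) =
       (\<Sum>i\<in>bas \<times> N.bas. \<beta> (fst i) (snd i) * comul K f (\<lambda>a b. du (fst i) a * N.du (snd i) (\<pi> b)))"
      using f form_pi[OF True] form_pi[OF pi_form[OF du_dual N.du_dual]]
      by (intro comul_sum) (auto simp: ex)
    also have "\<dots> = (\<Sum>i\<in>bas \<times> N.bas. \<beta> (fst i) (snd i) * (du (fst i) f * N.du (snd i) (uni N)))"
      using f push_kN[OF N.du_dual] by (intro sum.cong refl)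
        (simp add: star_push[symmetric], simp add: push_def uni_in)
    also have "\<dots> = \<beta> f (uni N)" using ex[of f "uni N"] f N.uni_in by simp
    finally show ?thesis using True by (simp add: tmap_apply ten_def)
  qed
  then show "f \<in> carr Q" using f by (auto simp: Q_simps)
qed

lemma Q_carr [simp]: "f \<in> carr Q \<Longrightarrow> f \<in> carr K" by (simp add: Q_iff)

lemma Q_subspace: "subspace (carr Q)"
  by (rule subspaceI) (auto simp: Q_iff algebra_simps D_0)

lemma fin_dim_Q: "fin_dim_space Q"
  using Q_subspace by (intro fin_dim_subspace[of "carr Q"]) (auto simp: Q_simps(1))

sublocale Q: fdv Q by unfold_locales (rule fin_dim_Q)

abbreviation DQ :: "('h \<Rightarrow> 'k) set" where "DQ \<equiv> carr (dual_space Q)"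

definition res :: "('h \<Rightarrow> 'k) \<Rightarrow> 'h \<Rightarrow> 'k" where "res = push Q id"

lemma res_apply: "res x f = (if f \<in> carr Q then x f else 0)" by (simp add: res_def push_def)

lemma res_D [simp]: "x \<in> D \<Longrightarrow> res x \<in> DQ"
  unfolding dual_carr[of "res x"] lin_def using Q.add_carr Q.scale_carr by (simp add: res_apply Q_simps(1))

definition prQ :: "'h \<Rightarrow> 'h" where
  "prQ = (SOME r. lin_on K K r \<and> (\<forall>v\<in>carr K. r v \<in> carr Q) \<and> (\<forall>u\<in>carr Q. r u = u))"

lemma prQ: "lin_on K K prQ" "v \<in> carr K \<Longrightarrow> prQ v \<in> carr Q" "u \<in> carr Q \<Longrightarrow> prQ u = u"
proof -
  have "carr Q \<subseteq> carr K" by auto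
  from someI_ex[OF projection_ex[OF Q_subspace this], folded prQ_def]
  show "lin_on K K prQ" "v \<in> carr K \<Longrightarrow> prQ v \<in> carr Q" "u \<in> carr Q \<Longrightarrow> prQ u = u" by auto
qed

lemma prQ_add [simp]: "a \<in> carr K \<Longrightarrow> b \<in> carr K \<Longrightarrow> prQ (a + b) = prQ a + prQ b"
  and prQ_scal [simp]: "a \<in> carr K \<Longrightarrow> prQ (scal K c a) = scal K c (prQ a)"
  using prQ(1) by (auto simp: lin_on_def)

text \<open>A linear section of \<open>res\<close> through the arbitrary projection
  \<open>prQ\<close>; \<open>star_res\<close> and later \<open>zet_res\<close> show that the choice
  does not matter.\<close>

definition ext :: "('h \<Rightarrow> 'k) \<Rightarrow> 'h \<Rightarrow> 'k" where
  "ext u = (\<lambda>f. if f \<in> carr K then u (prQ f) else 0)"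

lemma DQ_add [simp]: "u \<in> DQ \<Longrightarrow> a \<in> carr Q \<Longrightarrow> b \<in> carr Q \<Longrightarrow> u (a + b) = u a + u b"
  and DQ_scal [simp]: "u \<in> DQ \<Longrightarrow> a \<in> carr Q \<Longrightarrow> u (scal K c a) = c * u a"
  and DQ_off: "u \<in> DQ \<Longrightarrow> a \<notin> carr Q \<Longrightarrow> u a = 0"
  unfolding dual_carr lin_def Q_simps(1) by blast+

lemma ext_D [simp]: "u \<in> DQ \<Longrightarrow> ext u \<in> D"
  unfolding dual_carr[of "ext u"] lin_def by (simp add: ext_def prQ(2))

lemma res_ext [simp]: "u \<in> DQ \<Longrightarrow> res (ext u) = u"
  by (auto simp: fun_eq_iff res_apply ext_def prQ(3) DQ_off)

lemma ext_apply: "f \<in> carr Q \<Longrightarrow> ext u f = u f" by (simp add: ext_def prQ(3))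

lemma res_add [simp]: "res (x + y) = res x + res y" and res_scal [simp]: "res (fscale c x) = fscale c (res x)"
  by (auto simp: fun_eq_iff res_apply)

lemma ext_add [simp]: "ext (x + y) = ext x + ext y" and ext_scal [simp]: "ext (fscale c x) = fscale c (ext x)"
  by (auto simp: fun_eq_iff ext_def)

lemma res_star_kN: "x \<in> D \<Longrightarrow> y \<in> kN \<Longrightarrow> res (x \<star> y) = fscale (y (uni K)) (res x)"
  by (auto simp: fun_eq_iff res_apply Q_iff)

text \<open>Reflexivity of finite-dimensional spaces.\<close>

lemma functional_eval:
  assumes "linD (*) \<zeta>"
  shows "\<exists>h\<in>carr K. \<forall>x\<in>D. \<zeta> x = x h"
proof -
  let ?h = "\<Sum>b\<in>bas. scal K (\<zeta> (du b)) b"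
  have "\<zeta> x = x ?h" if x: "x \<in> D" for x
  proof -
    have "x ?h = (\<Sum>b\<in>bas. x (scal K (\<zeta> (du b)) b))" using x by (intro D_sum) auto
    also have "\<dots> = (\<Sum>b\<in>bas. x b * \<zeta> (du b))" using x by (intro sum.cong) auto
    finally show ?thesis using lin_dual_expand[OF assms x] by simp
  qed
  then show ?thesis by (intro bexI[of _ ?h]) auto
qed

text \<open>Serves in place of an isomorphism between \<open>k(G/N)\<close> and the quotient of
  \<open>kG\<close> by the left ideal generated by the augmentation ideal of \<open>kN\<close>: such
  functionals factor through \<open>res\<close>.\<close>

lemma invariant_functional:
  assumes l: "linD (*) \<zeta>" and inv: "\<And>x y. x \<in> D \<Longrightarrow> y \<in> kN \<Longrightarrow> \<zeta> (x \<star> y) = \<zeta> x * y (uni K)"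
  shows "\<exists>h\<in>carr Q. \<forall>x\<in>D. \<zeta> x = x h"
proof -
  obtain h where h: "h \<in> carr K" "\<forall>x\<in>D. \<zeta> x = x h" using functional_eval[OF l] by blast
  then have "h \<in> carr Q" using inv by (auto simp: Q_iff)
  then show ?thesis using h by blast
qed

lemma invariant_functional_res:
  assumes "linD (*) \<zeta>" "\<And>x y. x \<in> D \<Longrightarrow> y \<in> kN \<Longrightarrow> \<zeta> (x \<star> y) = \<zeta> x * y (uni K)"
    "x \<in> D" "x' \<in> D" "res x = res x'"
  shows "\<zeta> x = \<zeta> x'"
proof -
  obtain h where h: "h \<in> carr Q" "\<forall>x\<in>D. \<zeta> x = x h" using invariant_functional[OF assms(1,2)] by blast
  then have "x h = x' h" using assms(5) res_apply by metis
  then show ?thesis using h assms by simp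
qed

end

text \<open>Left invariance of right invariant functions is the consequence of normality that makes
  the comultiplication of \<open>K\<close> restrict to \<open>Q\<close>.\<close>

locale quot = closed_sub +
  assumes left_inv: "\<And>f x y. f \<in> carr Q \<Longrightarrow> x \<in> D \<Longrightarrow> y \<in> kN \<Longrightarrow> (y \<star> x) f = y (uni K) * x f"
begin

lemma star_res:
  assumes "x \<in> D" "x' \<in> D" "y \<in> D" "y' \<in> D" "res x = res x'" "res y = res y'" "f \<in> carr Q"
  shows "(x \<star> y) f = (x' \<star> y') f"
proof -
  have "(x \<star> y) f = (x \<star> y') f"
    by (rule invariant_functional_res[of "\<lambda>y. (x \<star> y) f"])
      (use assms in \<open>auto simp: lin_def Q_iff star_assoc[symmetric]\<close>)
  also have "\<dots> = (x' \<star> y') f"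
  proof (rule invariant_functional_res[of "\<lambda>x. (x \<star> y') f"])
    fix x z assume xz: "x \<in> D" "z \<in> kN"
    have l: "linD (*) (\<lambda>y. (x \<star> y) f)" using xz by (auto simp: lin_def)
    have i: "(x \<star> (u \<star> v)) f = (x \<star> u) f * v (uni K)" if "u \<in> D" "v \<in> kN" for u v
      using that xz assms by (simp add: star_assoc[symmetric] Q_iff)
    \<comment> \<open>\<open>h\<close> is the translate of \<open>f\<close> by \<open>x\<close>,
      again an element of \<open>k[G/N]\<close>, so left invariance applies to it.\<close>
    obtain h where h: "h \<in> carr Q" "\<forall>y\<in>D. (x \<star> y) f = y h"
      using invariant_functional[OF l i] by blast
    have "(x \<star> z \<star> y') f = (z \<star> y') h" using xz assms h by (simp add: star_assoc)
    also have "\<dots> = (x \<star> y') f * z (uni K)" using left_inv[OF h(1)] h(2) xz assms by simp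
    finally show "(x \<star> z \<star> y') f = (x \<star> y') f * z (uni K)" .
  qed (use assms in \<open>auto simp: lin_def\<close>)
  finally show ?thesis .
qed

lemma comul_ext_form: "\<beta> \<in> bil Q Q \<Longrightarrow> (\<lambda>a b. \<beta> (prQ a) (prQ b)) \<in> bil K K"
  by (auto simp: bil_iff lin_def prQ(2) Q_simps(1))

lemma bil_K_Q: "\<beta> \<in> bil K K \<Longrightarrow> \<beta> \<in> bil Q Q"
  by (auto simp: bil_iff lin_def Q_simps(1))

text \<open>Resolves the description operator in \<open>quot_scheme\<close>. Bilinear forms on
  \<open>Q\<close> extend to \<open>K\<close> along \<open>prQ\<close>, which determines the tensor;
  by \<open>star_res\<close>, composing a form on \<open>K\<close> with \<open>prQ\<close> does not
  change its value on the coproduct.\<close>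

lemma comul_Q:
  assumes f: "f \<in> carr Q"
  shows "comul Q f \<in> ten_carr (bil Q Q) Q Q"
    and "\<beta> \<in> bil Q Q \<Longrightarrow> comul Q f \<beta> = comul K f (\<lambda>a b. \<beta> (prQ a) (prQ b))"
proof -
  define t0 where "t0 = (\<lambda>\<beta>. if \<beta> \<in> bil Q Q then comul K f (\<lambda>a b. \<beta> (prQ a) (prQ b)) else 0)"
  let ?P = "\<lambda>t. t \<in> carr (tensor (quot_space K N \<pi>) (quot_space K N \<pi>)) \<and> tmap K K id id t = comul K f"
  have cc: "carr (quot_space K N \<pi>) = carr Q" "scal (quot_space K N \<pi>) = scal Q"
    unfolding Q_simps(1,5) by (simp_all only: quot_space_def space.simps)
  have bilQ: "bil (quot_space K N \<pi>) (quot_space K N \<pi>) = bil Q Q"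
    by (simp only: bil_def lin_on_def cc)
  have cQ: "carr (tensor (quot_space K N \<pi>) (quot_space K N \<pi>)) = ten_carr (bil Q Q) Q Q"
    unfolding tensor_carr bilQ by (simp only: ten_carr_def cc)
  have fK: "f \<in> carr K" using f by simp
  obtain n a b where ab: "\<forall>i<(n::nat). a i \<in> carr K \<and> b i \<in> carr K" "\<forall>\<beta>\<in>bil K K. comul K f \<beta> = (\<Sum>i<n. \<beta> (a i) (b i))"
    using comul_ex[OF fK] by blast
  have "t0 = (\<lambda>\<beta>. if \<beta> \<in> bil Q Q then \<Sum>i<n. 1 * \<beta> (prQ (a i)) (prQ (b i)) else 0)"
    unfolding t0_def using ab comul_ext_form by (auto simp: fun_eq_iff)
  moreover have "\<dots> \<in> ten_carr (bil Q Q) Q Q"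
    using ab prQ(2) by (intro ten_carr_I) auto
  ultimately have t0c: "t0 \<in> ten_carr (bil Q Q) Q Q" by simp
  have key: "comul K f (\<lambda>a b. \<gamma> (prQ a) (prQ b)) = comul K f \<gamma>" if g: "\<gamma> \<in> bil K K" for \<gamma>
  proof -
    have ex: "\<gamma> a b = (\<Sum>i\<in>bas \<times> bas. \<gamma> (fst i) (snd i) * (du (fst i) a * du (snd i) b))"
      if "a \<in> carr K" "b \<in> carr K" for a b
      by (rule bil_expand[OF fdv_axioms g that])
    define e where "e p = ext (res (du p))" for p
    have eD: "e p \<in> D" for p by (simp add: e_def)
    have ev: "e p a = du p (prQ a)" if "a \<in> carr K" for p a
      using that by (simp add: e_def ext_def res_apply prQ(2))
    have "comul K f (\<lambda>a b. \<gamma> (prQ a) (prQ b)) = (\<Sum>i\<in>bas \<times> bas. \<gamma> (fst i) (snd i) * comul K f (\<lambda>a b. e (fst i) a * e (snd i) b))"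
      using fK prod_bil[OF eD eD] comul_ext_form[OF bil_K_Q[OF g]] prQ(2)
      by (intro comul_sum) (auto simp: ex ev)
    also have "\<dots> = (\<Sum>i\<in>bas \<times> bas. \<gamma> (fst i) (snd i) * comul K f (\<lambda>a b. du (fst i) a * du (snd i) b))"
      using star_res[OF eD du_dual eD du_dual _ _ f]
      by (intro sum.cong refl) (simp add: star_apply[OF fK, symmetric] e_def)
    also have "\<dots> = comul K f \<gamma>"
      using fK prod_bil[OF du_dual du_dual] g by (intro comul_sum[symmetric]) (auto simp: ex)
    finally show ?thesis .
  qed
  have zero: "comul K f (\<lambda>a b. 0) = 0"
    using comul_sum[of f "{}" _ "\<lambda>a b. 0"] fK by (simp add: bil_iff lin_def)
  have zeroQ: "t (\<lambda>a b. 0) = 0" if "t \<in> ten_carr (bil Q Q) Q Q" for t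
    using ten_sum[OF that, of "\<lambda>a b. 0" "{}"] by (simp add: bil_iff lin_def)
  have tm: "tmap K K id id t \<gamma> = (if \<gamma> \<in> bil K K then t \<gamma> else 0)" if "t \<in> ten_carr (bil Q Q) Q Q" for t \<gamma>
    using zeroQ[OF that] by (simp add: tmap_apply)
  have P0: "?P t0"
  proof (intro conjI ext)
    show "t0 \<in> carr (tensor (quot_space K N \<pi>) (quot_space K N \<pi>))" using t0c cQ by simp
    fix \<gamma> show "tmap K K id id t0 \<gamma> = comul K f \<gamma>"
    proof (cases "\<gamma> \<in> bil K K")
      case True
      then show ?thesis using key bil_K_Q by (simp add: tm[OF t0c]) (simp add: t0_def)
    next
      case False
      then show ?thesis using ten_off[OF comul_in[OF fK]] by (simp add: tm[OF t0c])
    qed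
  qed
  have uniq: "t = t0" if "?P t" for t
  proof
    fix \<beta>
    have tc: "t \<in> ten_carr (bil Q Q) Q Q" using that cQ by simp
    show "t \<beta> = t0 \<beta>"
    proof (cases "\<beta> \<in> bil Q Q")
      case False
      then show ?thesis using ten_off[OF tc] by (simp add: t0_def)
    next
      case True
      let ?g = "\<lambda>a b. \<beta> (prQ a) (prQ b)"
      have "t \<beta> = t ?g"
        by (rule ten_cong[OF tc True bil_K_Q[OF comul_ext_form[OF True]]]) (simp add: prQ(3))
      also have "\<dots> = comul K f ?g" using that tm[OF tc, of ?g] comul_ext_form[OF True] by simp
      finally show ?thesis using True by (simp add: t0_def)
    qed
  qed
  have "comul Q f = (THE t. ?P t)" by (simp add: quot_scheme_def Let_def)
  also have "\<dots> = t0" using P0 uniq by (rule the_equality)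
  finally have eq: "comul Q f = t0" .
  show "comul Q f \<in> ten_carr (bil Q Q) Q Q" using eq t0c by simp
  show "\<beta> \<in> bil Q Q \<Longrightarrow> comul Q f \<beta> = comul K f (\<lambda>a b. \<beta> (prQ a) (prQ b))" using eq t0_def by simp
qed

lemma prod_bil_Q: "u \<in> DQ \<Longrightarrow> v \<in> DQ \<Longrightarrow> (\<lambda>a b. u a * v b) \<in> bil Q Q"
  by (auto simp: bil_iff lin_def algebra_simps Q_simps(1))

lemma comul_Q_star: "f \<in> carr Q \<Longrightarrow> u \<in> DQ \<Longrightarrow> v \<in> DQ \<Longrightarrow> comul Q f (\<lambda>a b. u a * v b) = (ext u \<star> ext v) f"
  using comul_ext_form[OF prod_bil_Q, of u v]
  by (auto simp: comul_Q(2)[OF _ prod_bil_Q] star_apply ext_def[abs_def] intro!: comul_cong prod_bil ext_D[unfolded ext_def[abs_def]])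

lemma kQ_simps: "carr (group_alg Q) = DQ" "scal (group_alg Q) = fscale"
  by (simp_all add: group_alg_def Let_def)

lemma mul_kQ: "u \<in> DQ \<Longrightarrow> v \<in> DQ \<Longrightarrow> mul (group_alg Q) u v = res (ext u \<star> ext v)"
  using comul_Q_star by (auto simp: group_alg_def Let_def res_apply fun_eq_iff)

lemma mul_kQ_res: "x \<in> D \<Longrightarrow> y \<in> D \<Longrightarrow> mul (group_alg Q) (res x) (res y) = res (x \<star> y)"
  using star_res[of "ext (res x)" x "ext (res y)" y] by (auto simp: mul_kQ res_apply[of "_ \<star> _"] fun_eq_iff)

lemma uni_kQ: "uni (group_alg Q) = res eps"
  by (auto simp: group_alg_def Let_def fun_eq_iff res_apply eps_def' Q_simps(4))

section \<open>Characters of the quotient\<close>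

lemma characters_iff:
  "g \<in> characters Q \<longleftrightarrow> g \<in> carr Q \<and> counit K g = 1 \<and> (\<forall>x\<in>D. \<forall>y\<in>D. (x \<star> y) g = x g * y g)"
proof (intro iffI conjI ballI)
  assume g: "g \<in> characters Q"
  then show gQ: "g \<in> carr Q" and "counit K g = 1" by (auto simp: characters_def Q_simps(4))
  fix x y assume xy: "x \<in> D" "y \<in> D"
  have "comul Q g (\<lambda>a b. res x a * res y b) = res x g * res y g"
    using g prod_bil_Q[of "res x" "res y"] xy by (simp add: characters_def ten_def)
  then show "(x \<star> y) g = x g * y g"
    using comul_Q_star[OF gQ, of "res x" "res y"] star_res[of "ext (res x)" x "ext (res y)" y g] xy gQ
    by (simp add: res_apply)
next
  assume g: "g \<in> carr Q \<and> counit K g = 1 \<and> (\<forall>x\<in>D. \<forall>y\<in>D. (x \<star> y) g = x g * y g)"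
  have "comul Q g \<beta> = ten (bil Q Q) g g \<beta>" for \<beta>
  proof (cases "\<beta> \<in> bil Q Q")
    case False
    then show ?thesis using g ten_off[OF comul_Q(1)] by (simp add: ten_def)
  next
    case True
    have ex: "\<beta> a b = (\<Sum>i\<in>Q.bas \<times> Q.bas. \<beta> (fst i) (snd i) * (Q.du (fst i) a * Q.du (snd i) b))"
      if "a \<in> carr Q" "b \<in> carr Q" for a b
      by (rule Q.bil_expand[OF Q.fdv_axioms True that])
    have "comul Q g \<beta> = (\<Sum>i\<in>Q.bas \<times> Q.bas. \<beta> (fst i) (snd i) * comul Q g (\<lambda>a b. Q.du (fst i) a * Q.du (snd i) b))"
      using g True prod_bil_Q[OF Q.du_dual Q.du_dual] by (intro ten_sum[OF comul_Q(1)]) (auto simp: ex)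
    also have "\<dots> = \<beta> g g" using g ex[of g g] comul_Q_star ext_apply by simp
    finally show ?thesis using True by (simp add: ten_def)
  qed
  then show "g \<in> characters Q" using g by (auto simp: characters_def Q_simps(4))
qed

text \<open>The isomorphism makes the characters a basis of \<open>k[G/N]\<close>, and
  \<open>y\<close> is the dual basis, lifted to functionals on \<open>K\<close>.\<close>

lemma multiplicative_basis:
  assumes "multiplicative Q"
  shows "finite (characters Q) \<and> (\<exists>y. \<forall>\<mu>\<in>characters Q. y \<mu> \<in> D \<and>
      (\<forall>\<mu>'\<in>characters Q. y \<mu> \<mu>' = (if \<mu> = \<mu>' then 1 else 0)) \<and>
      (\<forall>x\<in>D. (\<forall>\<mu>\<in>characters Q. x \<mu> = 0) \<longrightarrow> res x = 0))"
proof -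
  let ?X = "characters Q" and ?L = "char_alg Q" 
  obtain f where hom: "hopf_hom Q ?L f" and bij: "bij_betw f (carr Q) (carr ?L)"
    using assms by (auto simp: multiplicative_def hopf_iso_def)
  have cL: "carr ?L = {u. \<forall>x. x \<notin> ?X \<longrightarrow> u x = 0}" "scal ?L = fscale"
    by (simp_all add: char_alg_def Let_def char_alg_space_def)
  have dL: "delta x \<in> carr ?L" if "x \<in> ?X" for x
    using that by (auto simp: cL delta_def)
  have lf: "lin_on Q ?L f" using hom by (simp add: hopf_hom_def)
  have fadd: "f (a + b) = f a + f b" if "a \<in> carr Q" "b \<in> carr Q" for a b
    using that lf by (auto simp: lin_on_def cL Q_simps(1))
  have fsc: "f (scal K c a) = fscale c (f a)" if "a \<in> carr Q" for a c
    using that lf by (auto simp: lin_on_def cL Q_simps(1))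
  have fsum: "f (\<Sum>i\<in>I. h i) = (\<Sum>i\<in>I. f (h i))" if "\<And>i. i \<in> I \<Longrightarrow> h i \<in> carr Q" for I :: "'b set" and h
    using Q.lin_on_sum[OF lf, of I h] that by blast
  \<comment> \<open>\<open>f\<close> is an arbitrary isomorphism and need not send a character to
    its own \<open>delta\<close>; it is enough that \<open>g\<close> turns out to be a permutation
    of the characters.\<close>
  define g where "g x = inv_into (carr Q) f (delta x)" for x
  have gQ: "g x \<in> carr Q" and fg: "f (g x) = delta x" if "x \<in> ?X" for x
    using bij dL[OF that] by (auto simp: g_def bij_betw_def f_inv_into_f inv_into_into)
  have inj_g: "inj_on g ?X"
  proof (rule inj_onI)
    fix x y assume "x \<in> ?X" "y \<in> ?X" "g x = g y"
    then have "delta x = (delta y :: 'b \<Rightarrow> 'a)" using fg by metis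
    then have "delta x x = (delta y x :: 'a)" by simp
    then show "x = y" by (auto simp: delta_def split: if_splits)
  qed
  \<comment> \<open>Has to come first: the counit and the comultiplication of
    \<open>char_alg\<close> are sums over the characters and would be zero for an infinite
    set.\<close>
  have finX: "finite ?X"
  proof (rule ccontr)
    assume "infinite ?X"
    then obtain S where S: "S \<subseteq> ?X" "finite S" "card S = Suc (card Q.bas)"
      using infinite_arbitrarily_large by blast
    have "Q.independent (g ` S)"
    proof (rule Q.independent_if_scalars_zero)
      show "finite (g ` S)" using S by simp
      fix c v assume z: "(\<Sum>v\<in>g ` S. scal Q (c v) v) = 0" and v: "v \<in> g ` S"
      obtain x where x: "x \<in> S" "v = g x" using v by blast
      have "f (\<Sum>v\<in>g ` S. scal K (c v) v) = 0" using z Q.lin_on_0[OF lf] by (simp add: Q_simps(1))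
      moreover have "f (\<Sum>v\<in>g ` S. scal K (c v) v) = (\<Sum>v\<in>g ` S. fscale (c v) (f v))"
        using S gQ Q.scale_carr fsc by (subst fsum) (auto simp: Q_simps(1) intro!: sum.cong fsc)
      moreover have "\<dots> = (\<Sum>y\<in>S. fscale (c (g y)) (delta y))"
        using S fg inj_on_subset[OF inj_g] by (subst sum.reindex) (auto intro!: sum.cong)
      moreover have "(\<Sum>y\<in>S. fscale (c (g y)) (delta y)) x = c (g x)"
        using S x by (simp add: sum_fun_apply delta_def if_distrib cong: if_cong)
      ultimately show "c v = 0" using x by simp
    qed
    moreover have "g ` S \<subseteq> carr Q" using S gQ by auto
    ultimately have "card (g ` S) \<le> card Q.bas" using Q.finite_independent by blast
    then show False using S card_image[OF inj_on_subset[OF inj_g S(1)]] by simp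
  qed
  have ginX: "g x \<in> ?X" if x: "x \<in> ?X" for x
    unfolding characters_iff
  proof (intro conjI ballI)
    show "g x \<in> carr Q" using gQ x .
    have "counit ?L (f (g x)) = counit Q (g x)" using hom gQ[OF x] by (simp add: hopf_hom_def)
    moreover have "counit ?L (delta x) = 1"
      using finX x by (simp add: char_alg_def Let_def delta_def)
    ultimately show "counit K (g x) = 1" using fg[OF x] by (simp add: Q_simps(4))
    fix u v assume uv: "u \<in> D" "v \<in> D"
    let ?f' = "inv_into (carr Q) f"
    have f'f: "?f' (f a) = a" if "a \<in> carr Q" for a using bij that by (simp add: bij_betw_def)
    have ff': "f (?f' p) = p" "?f' p \<in> carr Q" if "p \<in> carr ?L" for p
      using bij that by (auto simp: bij_betw_def f_inv_into_f inv_into_into)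
    have f'add: "?f' (p + q) = ?f' p + ?f' q" if "p \<in> carr ?L" "q \<in> carr ?L" for p q
      using f'f[of "?f' p + ?f' q"] fadd ff' that Q.add_carr by metis
    have f'sc: "?f' (fscale c p) = scal K c (?f' p)" if "p \<in> carr ?L" for c p
      using f'f[of "scal K c (?f' p)"] fsc ff' that Q.scale_carr Q_simps(1) by metis
    define \<beta> where "\<beta> = (\<lambda>p q. u (?f' p) * v (?f' q))"
    have \<beta>: "\<beta> \<in> bil ?L ?L"
      using uv f'add f'sc ff' by (auto simp: bil_iff lin_def \<beta>_def cL(2) algebra_simps)
    have bL: "bil (char_alg_space Q) (char_alg_space Q) = bil ?L ?L"
      by (simp add: bil_def lin_on_def char_alg_def Let_def char_alg_space_def)
    have "comul ?L (f (g x)) \<beta> = tmap ?L ?L f f (comul Q (g x)) \<beta>"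
      using hom gQ[OF x] by (simp add: hopf_hom_def)
    also have "\<dots> = comul Q (g x) (\<lambda>a b. \<beta> (f a) (f b))"
      using \<beta> by (simp add: tmap_apply)
    also have "\<dots> = comul Q (g x) (\<lambda>a b. res u a * res v b)"
    proof (rule ten_cong[OF comul_Q(1)[OF gQ[OF x]]])
      show "(\<lambda>a b. \<beta> (f a) (f b)) \<in> bil Q Q"
        using \<beta> lf by (auto simp: bil_iff lin_def lin_on_def)
      show "(\<lambda>a b. res u a * res v b) \<in> bil Q Q" using uv by (intro prod_bil_Q) auto
    qed (use f'f in \<open>auto simp: \<beta>_def res_apply\<close>)
    also have "\<dots> = (u \<star> v) (g x)"
      using comul_Q_star[OF gQ[OF x], of "res u" "res v"] star_res[of "ext (res u)" u "ext (res v)" v "g x"] uv gQ[OF x]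
      by simp
    also have "comul ?L (f (g x)) \<beta> = \<beta> (delta x) (delta x)"
    proof -
      have "comul ?L (delta x) \<beta> = (\<Sum>z\<in>?X. delta x z * ten (bil ?L ?L) (delta z) (delta z) \<beta>)"
        unfolding bL[symmetric] by (simp add: char_alg_def Let_def)
      also have "\<dots> = (\<Sum>z\<in>?X. if z = x then \<beta> (delta x) (delta x) else 0)"
        using \<beta> by (intro sum.cong refl) (simp add: delta_def[of x] ten_def)
      finally show ?thesis using finX x fg[OF x] by simp
    qed
    also have "\<dots> = u (g x) * v (g x)" by (simp add: \<beta>_def g_def)
    finally show "(u \<star> v) (g x) = u (g x) * v (g x)" by simp
  qed
  have surj_g: "g ` ?X = ?X"
    using finX inj_g ginX by (intro endo_inj_surj) auto
  define y where "y \<mu> = ext (\<lambda>h. if h \<in> carr Q then f h (inv_into ?X g \<mu>) else 0)" for \<mu>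
  have yD: "y \<mu> \<in> D" for \<mu>
  proof -
    have "(\<lambda>h. if h \<in> carr Q then f h (inv_into ?X g \<mu>) else 0) \<in> DQ"
      unfolding dual_carr[of "\<lambda>h. if h \<in> carr Q then f h (inv_into ?X g \<mu>) else 0"] lin_def
      using fadd fsc Q.add_carr Q.scale_carr by (simp add: Q_simps(1))
    then show ?thesis unfolding y_def by simp
  qed
  have yv: "y (g x) (g x') = (if g x = g x' then 1 else 0)" if "x \<in> ?X" "x' \<in> ?X" for x x'
    using that gQ fg inj_g by (auto simp: y_def ext_apply delta_def inj_on_def)
  have sp: "h = (\<Sum>x\<in>?X. scal K (f h x) (g x))" if h: "h \<in> carr Q" for h
  proof -
    have inj: "inj_on f (carr Q)" using bij by (simp add: bij_betw_def)
    have c: "(\<Sum>x\<in>?X. scal K (f h x) (g x)) \<in> carr Q"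
      using Q.sum_carr[of ?X "\<lambda>x. scal K (f h x) (g x)"] gQ Q.scale_carr by (simp add: Q_simps(1))
    have "f (\<Sum>x\<in>?X. scal K (f h x) (g x)) = (\<Sum>x\<in>?X. fscale (f h x) (delta x))"
      using gQ fg fsc Q.scale_carr by (subst fsum) (auto simp: Q_simps(1) intro!: sum.cong)
    also have "\<dots> = f h"
    proof
      fix z
      have "f h \<in> carr ?L" using lf h by (simp add: lin_on_def)
      then show "(\<Sum>x\<in>?X. fscale (f h x) (delta x)) z = f h z"
        using finX by (cases "z \<in> ?X") (auto simp: sum_fun_apply delta_def if_distrib cL cong: if_cong)
    qed
    finally show ?thesis using inj_onD[OF inj _ h c] by simp
  qed
  have "res x = 0" if x: "x \<in> D" "\<forall>\<mu>\<in>?X. x \<mu> = 0" for x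
  proof
    fix h show "res x h = 0 h"
    proof (cases "h \<in> carr Q")
      case True
      have "x h = (\<Sum>z\<in>?X. x (scal K (f h z) (g z)))"
        using D_sum[OF x(1), of ?X "\<lambda>z. scal K (f h z) (g z)"] gQ sp[OF True] by simp
      also have "\<dots> = 0" using x ginX gQ by (intro sum.neutral) auto
      finally show ?thesis by (simp add: res_apply)
    qed (simp add: res_apply)
  qed
  moreover have "y \<mu> \<mu>' = (if \<mu> = \<mu>' then 1 else 0)" if "\<mu> \<in> ?X" "\<mu>' \<in> ?X" for \<mu> \<mu>'
  proof -
    have "\<mu> \<in> g ` ?X" "\<mu>' \<in> g ` ?X" using that surj_g by simp_all
    then obtain x x' where "x \<in> ?X" "\<mu> = g x" "x' \<in> ?X" "\<mu>' = g x'" by blast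
    then show ?thesis using yv by simp
  qed
  ultimately show ?thesis using finX yD by (intro conjI exI[of _ y]) auto
qed

end

section \<open>Normal subgroup schemes\<close>

locale normal_sub = finite_group_scheme G
  for G :: "('k::field, 'h::ab_group_add) hopf" +
  fixes N :: "('k, 'n::ab_group_add) hopf" and \<pi> :: "'h \<Rightarrow> 'n"
  assumes normal: "normal_subgroup_scheme G N \<pi>"
begin

lemma closed: "finite_group_scheme N" "hopf_hom G N \<pi>" "\<pi> ` carr G = carr N"
  using normal by (auto simp: normal_subgroup_scheme_def closed_subgroup_scheme_def)

sublocale closed_sub G N \<pi>
proof -
  interpret N: finite_group_scheme N by (rule closed)
  show "closed_sub G N \<pi>"
    by unfold_locales (fact closed)+
qed

text \<open>Dual form of normality: the value of \<open>ad x y\<close> at \<open>f\<close> is the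
  conjugation comorphism of \<open>f\<close> evaluated at \<open>x\<close> and \<open>y\<close>, and
  it vanishes when \<open>\<pi> f = 0\<close>.\<close>

lemma ad_kN:
  assumes x: "x \<in> D" and y: "y \<in> kN"
  shows "ad x y \<in> kN"
  unfolding kN_def mem_Collect_eq
proof (intro conjI ballI impI)
  show "ad x y \<in> D" using y by simp
  fix f assume f: "f \<in> carr G" and f0: "\<pi> f = 0"
  obtain y' where y': "y' \<in> N.D" "y = push G \<pi> y'" using kN_push[OF y] by blast
  have yD: "y \<in> D" using y by simp
  obtain n a b where ab: "\<forall>i<(n::nat). a i \<in> carr G \<and> b i \<in> carr G" "\<forall>\<beta>\<in>bil G G. comul G f \<beta> = (\<Sum>i<n. \<beta> (a i) (b i))"
    using comul_ex[OF f] by blast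
  have xS: "(\<lambda>b1 b2. x (mul G a1 (antipode G b2)) * y' (\<pi> b1)) \<in> bil G G" if "a1 \<in> carr G" for a1
    using x y'(1) that by (auto simp: bil_iff lin_def algebra_simps)
  have out: "(\<lambda>a b. comul G b (\<lambda>b1 b2. x (mul G a (antipode G b2)) * y' (\<pi> b1))) \<in> bil G G"
    using x xS y'(1) by (auto intro!: bilI lin_comul_param simp: fdv_axioms) (auto simp: lin_def comul_add comul_scal algebra_simps)
  \<comment> \<open>The normality condition, evaluated at the single form
    \<open>x \<otimes> y'\<close>.\<close>
  have N0: "comul G f (\<lambda>a b. comul G b (\<lambda>b1 b2. x (mul G a (antipode G b2)) * y' (\<pi> b1))) = 0"
  proof -
    have "lift (\<lambda>a b. lift (\<lambda>b1 b2. ten (bil G N) (mul G a (antipode G b2)) (\<pi> b1)) (comul G b))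
          (comul G f) = 0"
      using normal f f0 by (simp add: normal_subgroup_scheme_def)
    from fun_cong[OF this, of "\<lambda>a b. x a * y' b"] show ?thesis
      using pi_form[OF x y'(1)] by (simp add: ten_def)
  qed
  have "ad x y f = swe (*) x (\<lambda>u v. (u \<star> (y \<star> anti v)) f)"
    unfolding ad_def swe_fscale_apply using yD by (intro swe_cong) (simp add: star_assoc)
  also have "\<dots> = swe (*) x (\<lambda>u v. \<Sum>i<n. u (a i) * (y \<star> anti v) (b i))"
    using ab yD by (intro swe_cong) (simp add: star_apply[OF f] prod_bil)
  also have "\<dots> = (\<Sum>i<n. swe (*) x (\<lambda>u v. u (a i) * (y \<star> anti v) (b i)))"
    by (rule swe_sum[OF vector_space_mult])
  also have "\<dots> = (\<Sum>i<n. comul G (b i) (\<lambda>b1 b2. x (mul G (a i) (antipode G b2)) * y' (\<pi> b1)))"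
  proof (rule sum.cong[OF refl])
    fix i assume "i \<in> {..<n}"
    then have i: "a i \<in> carr G" "b i \<in> carr G" using ab by auto
    obtain m c d where cd: "\<forall>j<(m::nat). c j \<in> carr G \<and> d j \<in> carr G" "\<forall>\<beta>\<in>bil G G. comul G (b i) \<beta> = (\<Sum>j<m. \<beta> (c j) (d j))"
      using comul_ex[OF i(2)] by blast
    have "swe (*) x (\<lambda>u v. u (a i) * (y \<star> anti v) (b i)) = swe (*) x (\<lambda>u v. \<Sum>j<m. (u (a i) * v (antipode G (d j))) * y (c j))"
    proof (rule swe_cong)
      fix u v assume uv: "u \<in> D" "v \<in> D"
      have "(y \<star> anti v) (b i) = (\<Sum>j<m. y (c j) * anti v (d j))"
        using cd(2) prod_bil[OF yD anti_D[OF uv(2)]] by (simp add: star_apply[OF i(2)])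
      then show "u (a i) * (y \<star> anti v) (b i) = (\<Sum>j<m. (u (a i) * v (antipode G (d j))) * y (c j))"
        using cd by (simp add: anti_def' sum_distrib_left mult_ac)
    qed
    also have "\<dots> = (\<Sum>j<m. x (mul G (a i) (antipode G (d j))) * y (c j))"
      using cd i x by (simp add: swe_sum[OF vector_space_mult] swe_mult_right swe_eval)
    also have "\<dots> = comul G (b i) (\<lambda>b1 b2. x (mul G (a i) (antipode G b2)) * y' (\<pi> b1))"
      using cd xS[OF i(1)] y'(2) by (simp add: push_def)
    finally show "swe (*) x (\<lambda>u v. u (a i) * (y \<star> anti v) (b i)) =
      comul G (b i) (\<lambda>b1 b2. x (mul G (a i) (antipode G b2)) * y' (\<pi> b1))" .
  qed
  also have "\<dots> = 0" using N0 ab out by simp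
  finally show "ad x y f = 0" .
qed

text \<open>\<open>star_ad_anti\<close> moves \<open>y\<close> to the right of the components of
  \<open>x\<close> as an element of \<open>kN\<close>, where the right invariance of
  \<open>f\<close> removes it.\<close>

sublocale quot G N \<pi>
proof unfold_locales
  fix f x y assume f: "f \<in> carr Q" and x: "x \<in> D" and y: "y \<in> kN"
  have yD: "y \<in> D" using y by simp
  have "(y \<star> x) f = swe (*) x (\<lambda>u v. (u \<star> ad (anti v) y) f)"
    by (subst star_ad_anti[OF x yD]) (rule swe_fscale_apply)
  also have "\<dots> = swe (*) x (\<lambda>u v. v (uni G) * (y (uni G) * u f))"
    using f y yD by (intro swe_cong) (simp add: Q_iff ad_kN ad_uni)
  also have "\<dots> = y (uni G) * x f"
    using x by (intro swe_counit_right[OF _ vector_space_mult]) (auto simp: lin_def algebra_simps)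
  finally show "(y \<star> x) f = y (uni G) * x f" .
qed

end

section \<open>The connected component\<close>

context bialg begin

notation mult (infixl "\<cdot>" 70)
notation star (infixl "\<star>" 70)

lemma counit_add [simp]: "a \<in> carr G \<Longrightarrow> b \<in> carr G \<Longrightarrow> counit G (a + b) = counit G a + counit G b"
  and counit_scal [simp]: "a \<in> carr G \<Longrightarrow> counit G (scal G c a) = c * counit G a"
  using counit_lin by (auto simp: lin_def)

lemma counit_diff: "a \<in> carr G \<Longrightarrow> b \<in> carr G \<Longrightarrow> counit G (a - b) = counit G a - counit G b"
  using lin_on_diff[OF counit_lin] .

lemma mult_image_subspace: "d \<in> carr G \<Longrightarrow> subspace ((\<lambda>f. d \<cdot> f) ` carr G)"
  by (rule subspace_image[OF mul_lin]) auto

lemma counit_idempotent: "d \<in> carr G \<Longrightarrow> d \<cdot> d = d \<Longrightarrow> counit G d = 0 \<or> counit G d = 1"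
  using counit_m[of d d] by simp

text \<open>Existence from a minimal principal ideal generated by an idempotent of counit one: of
  \<open>d\<close> and \<open>e - d\<close> one has counit one and must then be all of
  \<open>e\<close>. Uniqueness since the product of two such idempotents is nonzero, its counit
  being one.\<close>

lemma conn_idem_ex: "\<exists>!e. primitive_idempotent G e \<and> counit G e = 1"
proof (rule ex_ex1I)
  let ?Pr = "\<lambda>U. \<exists>d\<in>carr G. d \<cdot> d = d \<and> counit G d = 1 \<and> U = (\<lambda>f. d \<cdot> f) ` carr G"
  have "?Pr ((\<lambda>f. uni G \<cdot> f) ` carr G)" using uni_in counit_1 uni_mul by blast
  moreover have "(\<lambda>f. uni G \<cdot> f) ` carr G \<subseteq> carr G" using uni_in by auto
  ultimately have "\<exists>U. subspace U \<and> ?Pr U \<and> U \<subseteq> carr G \<and> (\<forall>W. subspace W \<longrightarrow> ?Pr W \<longrightarrow> W \<subseteq> U \<longrightarrow> W = U)"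
    using minimal_subspace_ex[of _ ?Pr, OF mult_image_subspace[OF uni_in]] by blast
  then obtain U where "?Pr U" and min: "\<And>W. subspace W \<Longrightarrow> ?Pr W \<Longrightarrow> W \<subseteq> U \<Longrightarrow> W = U"
    by blast
  then obtain e where e: "e \<in> carr G" "e \<cdot> e = e" "counit G e = 1" "U = (\<lambda>f. e \<cdot> f) ` carr G" by blast
  have below: "d = e" if d: "d \<in> carr G" "d \<cdot> d = d" "d \<cdot> e = d" "counit G d = 1" for d
  proof -
    have "(\<lambda>f. d \<cdot> f) ` carr G \<subseteq> U"
    proof
      fix z assume "z \<in> (\<lambda>f. d \<cdot> f) ` carr G"
      then obtain f where f: "f \<in> carr G" "z = d \<cdot> f" by blast
      then have "z = e \<cdot> (d \<cdot> f)"
        using d e mul_ass[of e d f] mul_com[of e d] by simp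
      then show "z \<in> U" unfolding e(4) using d f by (intro image_eqI[of _ _ "d \<cdot> f"]) auto
    qed
    then have "(\<lambda>f. d \<cdot> f) ` carr G = U" using min mult_image_subspace d by blast
    moreover have "e \<in> U" unfolding e(4) using e by (intro image_eqI[of _ _ e]) auto
    ultimately obtain f where f: "f \<in> carr G" "e = d \<cdot> f" by blast
    have "d \<cdot> e = e" unfolding f(2) using mul_ass[of d d f] d f by simp
    then show ?thesis using d by simp
  qed
  have "primitive_idempotent G e"
    unfolding primitive_idempotent_def
  proof (intro conjI ballI impI)
    show "e \<noteq> 0" using e(3) lin_on_0[OF counit_lin] by auto
    fix d assume d: "d \<in> carr G" "d \<cdot> d = d" "d \<cdot> e = d"
    show "d = 0 \<or> d = e"
    proof (cases "counit G d = 1")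
      case True
      then show ?thesis using below d by blast
    next
      case False
      then have c0: "counit G d = 0" using counit_idempotent d by blast
      have ed: "e \<cdot> d = d" using d e mul_com by metis
      have "e - d = e"
        using d e ed c0 by (intro below) (auto simp: mul_diff counit_diff)
      then show ?thesis by simp
    qed
  qed (use e in auto)
  then show "\<exists>e. primitive_idempotent G e \<and> counit G e = 1" using e by blast
next
  fix e e' assume *: "primitive_idempotent G e \<and> counit G e = 1" "primitive_idempotent G e' \<and> counit G e' = 1"
  then have c: "e \<in> carr G" "e' \<in> carr G" and i: "e \<cdot> e = e" "e' \<cdot> e' = e'" by (auto simp: primitive_idempotent_def)
  define d where "d = e \<cdot> e'"
  have d: "d \<in> carr G" "counit G d = 1" using c * by (auto simp: d_def counit_m)
  have de': "d \<cdot> e' = d" using c i by (simp add: d_def mul_ass)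
  have de: "d \<cdot> e = d" using c i mul_com[of e e'] by (simp add: d_def mul_ass)
  have dd: "d \<cdot> d = d" using c d de de' mul_ass[of d e e'] by (simp add: d_def)
  have "d \<noteq> 0" using d lin_on_0[OF counit_lin] by auto
  then have "d = e" "d = e'" using * d(1) de de' dd by (auto simp: primitive_idempotent_def)
  then show "e = e'" by simp
qed

abbreviation e0 :: 'h where "e0 \<equiv> conn_idem G"

lemma e0: "primitive_idempotent G e0" "counit G e0 = 1"
  using theI'[OF conn_idem_ex] by (auto simp: conn_idem_def)

lemma e0_carr [simp]: "e0 \<in> carr G" and e0_idem [simp]: "e0 \<cdot> e0 = e0"
  and e0_prim: "d \<in> carr G \<Longrightarrow> d \<cdot> d = d \<Longrightarrow> d \<cdot> e0 = d \<Longrightarrow> d = 0 \<or> d = e0"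
  using e0 by (auto simp: primitive_idempotent_def)

definition He :: "'h set" where "He = {f \<in> carr G. f \<cdot> e0 = f}"

lemma He_carr: "f \<in> He \<Longrightarrow> f \<in> carr G" by (simp add: He_def)

lemma He_e0: "f \<in> He \<Longrightarrow> f \<cdot> e0 = f" by (simp add: He_def)

lemma mul_He: "f \<in> carr G \<Longrightarrow> g \<in> He \<Longrightarrow> f \<cdot> g \<in> He"
  by (simp add: He_def mul_ass)

lemma mul_He': "f \<in> carr G \<Longrightarrow> g \<in> He \<Longrightarrow> g \<cdot> f \<in> He"
  using mul_He[of f g] mul_com[of f g] He_carr[of g] by simp

lemma e0_He: "e0 \<in> He" by (simp add: He_def)

lemma He_subspace: "subspace He"
  by (rule subspaceI) (auto simp: He_def)

declare He_carr [simp] He_e0 [simp] mul_He [simp] mul_He' [simp] e0_He [simp]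

definition HeS :: "('k, 'h) space" where "HeS = \<lparr>carr = He, scal = scal G\<rparr>"

lemma HeS_simps [simp]: "carr HeS = He" "scal HeS = scal G" by (simp_all add: HeS_def)

lemma fdv_HeS: "fdv HeS"
  by unfold_locales (rule fin_dim_subspace[OF He_subspace], auto)

text \<open>Locality of \<open>k[G] e0\<close>. The Fitting components of multiplication by
  \<open>f\<close> are ideals, so they split \<open>e0\<close> into orthogonal idempotents; the part
  \<open>e2\<close> in the image has counit zero and vanishes by primitivity of
  \<open>e0\<close>.\<close>

lemma He_local:
  assumes f: "f \<in> He" "counit G f = 0"
  shows "fdv.nilp HeS (\<lambda>g. f \<cdot> g)"
proof -
  interpret E: fdv HeS by (rule fdv_HeS)
  let ?F = "\<lambda>g. f \<cdot> g"
  have F: "lin_on HeS HeS ?F" using f by (auto simp: lin_on_def)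
  obtain n where n: "n > 0" "{u \<in> He. (?F ^^ n) u = 0} \<inter> (?F ^^ n) ` He = {0}"
    "{u + w | u w. u \<in> {u \<in> He. (?F ^^ n) u = 0} \<and> w \<in> (?F ^^ n) ` He} = He"
    using E.fitting[OF F] by auto
  have Fg: "(?F ^^ k) (g \<cdot> u) = g \<cdot> (?F ^^ k) u \<and> (?F ^^ k) u \<in> He" if "g \<in> carr G" "u \<in> He" for g u k
    using that f mul_ass[of f g] mul_ass[of g f] mul_com[of f g]
    by (induction k) auto
  have ideal: "u1 \<cdot> u2 = 0" if u: "u1 \<in> He" "(?F ^^ n) u1 = 0" "u2 \<in> (?F ^^ n) ` He" for u1 u2
  proof -
    obtain w where w: "w \<in> He" "u2 = (?F ^^ n) w" using u by blast
    have u2: "u2 \<in> He" using w Fg[of e0 w] by simp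
    have "u1 \<cdot> u2 = (?F ^^ n) (u1 \<cdot> w)" using Fg[of u1 w] w u by simp
    then have "u1 \<cdot> u2 \<in> (?F ^^ n) ` He" using w u by (intro image_eqI[of _ _ "u1 \<cdot> w"]) auto
    moreover have "(?F ^^ n) (u1 \<cdot> u2) = 0"
      using Fg[of u2 u1] u u2 mul_com[of u1 u2] by simp
    moreover have "u1 \<cdot> u2 \<in> He" using u2 u by simp
    ultimately have "u1 \<cdot> u2 \<in> {0}" unfolding n(2)[symmetric] by blast
    then show ?thesis by simp
  qed
  have "e0 \<in> {u + w | u w. u \<in> {u \<in> He. (?F ^^ n) u = 0} \<and> w \<in> (?F ^^ n) ` He}"
    unfolding n(3) by simp
  then obtain e1 e2 where e: "e0 = e1 + e2" "e1 \<in> He" "(?F ^^ n) e1 = 0" "e2 \<in> (?F ^^ n) ` He" by blast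
  obtain w where w: "w \<in> He" "e2 = (?F ^^ n) w" using e by blast
  have e2H: "e2 \<in> He" using w Fg[of e0 w] by simp
  have e12: "e1 \<cdot> e2 = 0" using ideal e by blast
  have "e2 \<cdot> e2 = e2"
  proof -
    have "e2 = e2 \<cdot> (e1 + e2)" using He_e0[OF e2H] e(1) by simp
    also have "\<dots> = e2 \<cdot> e1 + e2 \<cdot> e2" using e e2H by simp
    also have "e2 \<cdot> e1 = 0" using e12 mul_com[of e1 e2] e e2H by simp
    finally show ?thesis by simp
  qed
  then have "e2 = 0 \<or> e2 = e0" using e0_prim e2H by simp
  moreover have "counit G e2 = 0"
  proof -
    obtain k where "n = Suc k" using n(1) by (cases n) auto
    then show ?thesis using w f counit_m[of f "(?F ^^ k) w"] Fg[of e0 w k] by simp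
  qed
  ultimately have "e2 = 0" using e0(2) by auto
  then have "(?F ^^ n) e0 = 0" using e by simp
  then have "(?F ^^ n) g = 0" if "g \<in> He" for g
    using Fg[of g e0 n] that by simp
  then show ?thesis unfolding E.nilp_def by auto
qed

text \<open>The transpose of multiplication, making \<open>kG\<close> a module over
  \<open>k[G]\<close>; \<open>hit_star\<close> expresses its compatibility with convolution.\<close>

definition hit :: "'h \<Rightarrow> ('h \<Rightarrow> 'k) \<Rightarrow> 'h \<Rightarrow> 'k" where
  "hit f x = (\<lambda>g. if g \<in> carr G then x (f \<cdot> g) else 0)"

lemma hit_D [simp]: "f \<in> carr G \<Longrightarrow> x \<in> D \<Longrightarrow> hit f x \<in> D"
  unfolding dual_carr[of "hit f x"] lin_def by (simp add: hit_def)

lemma hit_hit: "f \<in> carr G \<Longrightarrow> g \<in> carr G \<Longrightarrow> hit f (hit g x) = hit (f \<cdot> g) x"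
  using mul_ass[of g f] mul_com[of f g] by (auto simp: hit_def fun_eq_iff)

lemma hit_add: "f \<in> carr G \<Longrightarrow> g \<in> carr G \<Longrightarrow> x \<in> D \<Longrightarrow> hit (f + g) x = hit f x + hit g x"
  and hit_scal: "f \<in> carr G \<Longrightarrow> x \<in> D \<Longrightarrow> hit (scal G c f) x = fscale c (hit f x)"
  and hit_add': "f \<in> carr G \<Longrightarrow> x \<in> D \<Longrightarrow> y \<in> D \<Longrightarrow> hit f (x + y) = hit f x + hit f y"
  and hit_scal': "f \<in> carr G \<Longrightarrow> x \<in> D \<Longrightarrow> hit f (fscale c x) = fscale c (hit f x)"
  by (auto simp: hit_def fun_eq_iff)

lemma hit_uni: "x \<in> D \<Longrightarrow> hit (uni G) x = x"
  using D_off by (auto simp: hit_def fun_eq_iff uni_mul)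

lemma hit_0: "f \<in> carr G \<Longrightarrow> hit f 0 = 0"
  by (auto simp: hit_def fun_eq_iff)

lemma star_zero: "y \<in> D \<Longrightarrow> 0 \<star> y = 0" "y \<in> D \<Longrightarrow> y \<star> 0 = 0"
  using dual.lin_0[of fscale "\<lambda>x. x \<star> y"] dual.lin_0[of fscale "\<lambda>x. y \<star> x"] by (simp_all add: lin_def)

lemma hit_star:
  assumes f: "f \<in> carr G" and xy: "x \<in> D" "y \<in> D"
    and ab: "\<forall>i<(n::nat). a i \<in> carr G \<and> b i \<in> carr G" "\<forall>\<beta>\<in>bil G G. comul G f \<beta> = (\<Sum>i<n. \<beta> (a i) (b i))"
  shows "hit f (x \<star> y) = (\<Sum>i<n. hit (a i) x \<star> hit (b i) y)"
proof (rule D_ext)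
  show "(\<Sum>i<n. hit (a i) x \<star> hit (b i) y) \<in> D" using ab xy by (intro dual.sum_carr) auto
  show "hit f (x \<star> y) \<in> D" using f xy by simp
  fix g assume g: "g \<in> carr G"
  have inner: "(\<lambda>c d. x (a1 \<cdot> c) * y (b1 \<cdot> d)) \<in> bil G G" if "a1 \<in> carr G" "b1 \<in> carr G" for a1 b1
    using xy that by (auto simp: bil_iff lin_def algebra_simps)
  have outer: "(\<lambda>a b. comul G g (\<lambda>c d. x (a \<cdot> c) * y (b \<cdot> d))) \<in> bil G G"
    using xy inner by (auto intro!: bilI lin_comul_param g simp: lin_def algebra_simps fdv_axioms)
  have "hit f (x \<star> y) g = comul G f (\<lambda>a b. comul G g (\<lambda>c d. x (a \<cdot> c) * y (b \<cdot> d)))"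
    using f g xy by (simp add: hit_def star_apply comul_m ten_def prod_bil)
  also have "\<dots> = (\<Sum>i<n. comul G g (\<lambda>c d. x (a i \<cdot> c) * y (b i \<cdot> d)))"
    using ab outer by simp
  also have "\<dots> = (\<Sum>i<n. (hit (a i) x \<star> hit (b i) y) g)"
    unfolding star_apply[OF g] using ab xy inner
    by (intro sum.cong refl comul_cong[OF g]) (auto simp: prod_bil, auto simp: hit_def)
  finally show "hit f (x \<star> y) g = (\<Sum>i<n. hit (a i) x \<star> hit (b i) y) g"
    by (simp add: sum_fun_apply)
qed

text \<open>\<open>filt p\<close> consists of the functionals that vanish on the \<open>p\<close>-th power of the augmentation
  ideal.\<close>

primrec filt :: "nat \<Rightarrow> ('h \<Rightarrow> 'k) set" where
  "filt 0 = {0}"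
| "filt (Suc p) = {x \<in> D. \<forall>f\<in>carr G. counit G f = 0 \<longrightarrow> hit f x \<in> filt p}"

lemma filt_D: "x \<in> filt p \<Longrightarrow> x \<in> D"
  by (cases p) auto

lemma filt_closed:
  "0 \<in> filt p" "x \<in> filt p \<Longrightarrow> y \<in> filt p \<Longrightarrow> x + y \<in> filt p"
proof -
  show "0 \<in> filt p"
  proof (induction p)
    case (Suc p)
    then show ?case
      unfolding filt.simps by (intro CollectI conjI ballI impI dual_closed(3)) (simp only: hit_0)
  qed (simp add: zero_fun_def)
  show "x \<in> filt p \<Longrightarrow> y \<in> filt p \<Longrightarrow> x + y \<in> filt p"
    by (induction p arbitrary: x y) (auto simp: hit_add')
qed

lemma filt_sum: "(\<And>i. i \<in> I \<Longrightarrow> f i \<in> filt p) \<Longrightarrow> (\<Sum>i\<in>I. f i) \<in> filt p"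
  by (induction I rule: infinite_finite_induct) (auto simp: filt_closed)

lemma filt_hit: "x \<in> filt p \<Longrightarrow> h \<in> carr G \<Longrightarrow> hit h x \<in> filt p"
proof (induction p arbitrary: x)
  case (Suc p)
  have "hit f (hit h x) \<in> filt p" if "f \<in> carr G" "counit G f = 0" for f
  proof -
    have "hit h (hit f x) \<in> filt p" using Suc that by simp
    moreover have "hit f (hit h x) = hit h (hit f x)"
      using Suc.prems that hit_hit[of f h x] hit_hit[of h f x] mul_com[of f h] by simp
    ultimately show ?thesis by simp
  qed
  then show ?case using Suc by simp
qed (auto simp: hit_0)

text \<open>For \<open>f\<close> in the augmentation ideal, the coproduct of \<open>f\<close> is
  \<open>1 \<otimes> f\<close> plus terms whose first factor \<open>a'\<close> has counit zero;
  hence \<open>hit f\<close> lowers the index of one of the two factors in every term.\<close>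

lemma filt_star: "x \<in> filt p \<Longrightarrow> y \<in> filt q \<Longrightarrow> x \<star> y \<in> filt (p + q)"
proof (induction "p + q" arbitrary: p q x y)
  case 0
  then have "x = 0" "y = 0" by auto
  then have "x \<star> y = 0" using star_zero(1) dual_closed(3) by metis
  then show ?case using filt_closed(1) by metis
next
  case (Suc m)
  have xy: "x \<in> D" "y \<in> D" using Suc filt_D by auto
  consider "p = 0" | "q = 0" | p' q' where "p = Suc p'" "q = Suc q'" by (metis not0_implies_Suc)
  then show ?case
  proof cases
    case 1
    then have "x \<star> y = 0" using Suc.prems xy star_zero by simp
    then show ?thesis by (simp add: filt_closed)
  next
    case 2
    then have "x \<star> y = 0" using Suc.prems xy star_zero by simp
    then show ?thesis by (simp add: filt_closed)
  next
    case 3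
    have "hit f (x \<star> y) \<in> filt m" if f: "f \<in> carr G" "counit G f = 0" for f
    proof -
      obtain n a b where ab: "\<forall>i<(n::nat). a i \<in> carr G \<and> b i \<in> carr G" "\<forall>\<beta>\<in>bil G G. comul G f \<beta> = (\<Sum>i<n. \<beta> (a i) (b i))"
        using comul_ex[OF f(1)] by blast
      define a' where "a' i = a i - scal G (counit G (a i)) (uni G)" for i
      have a': "a' i \<in> carr G" "counit G (a' i) = 0" "a i = a' i + scal G (counit G (a i)) (uni G)" if "i < n" for i
        using ab that uni_in by (auto simp: a'_def counit_diff counit_1)
      have fe: "(\<Sum>i<n. scal G (counit G (a i)) (b i)) = f"
      proof (rule carr_ext)
        show "(\<Sum>i<n. scal G (counit G (a i)) (b i)) \<in> carr G" using ab by (intro sum_carr) auto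
        fix z assume z: "z \<in> D"
        have "z (\<Sum>i<n. scal G (counit G (a i)) (b i)) = (\<Sum>i<n. z (scal G (counit G (a i)) (b i)))"
          using z ab by (intro D_sum) auto
        also have "\<dots> = (\<Sum>i<n. counit G (a i) * z (b i))"
          using z ab by (intro sum.cong) auto
        also have "\<dots> = comul G f (\<lambda>a b. counit G a * z b)"
        proof -
          have "(\<lambda>a b. counit G a * z b) \<in> bil G G"
            using z by (auto simp: bil_iff lin_def algebra_simps)
          then show ?thesis using ab by simp
        qed
        also have "\<dots> = z f" using counit_l[OF f(1), of z] z by (simp add: dual_lin)
        finally show "z (\<Sum>i<n. scal G (counit G (a i)) (b i)) = z f" .
      qed (use f in auto)
      have hs: "hit (\<Sum>i\<in>I. scal G (c i) (b i)) y = (\<Sum>i\<in>I. fscale (c i) (hit (b i) y))"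
        if "I \<subseteq> {..<n}" for I c
      proof -
        have "finite I" using finite_subset[OF that] by simp
        then show ?thesis using that
      proof (induction I rule: finite_induct)
        case empty
        then show ?case using xy by (auto simp: hit_def fun_eq_iff D_0)
      next
        case (insert i I)
        have "(\<Sum>i\<in>I. scal G (c i) (b i)) \<in> carr G" using insert ab by (intro sum_carr) auto
        then show ?case using insert ab xy by (simp add: hit_add hit_scal)
      qed
      qed
      have "hit f (x \<star> y) = (\<Sum>i<n. hit (a i) x \<star> hit (b i) y)"
        by (rule hit_star[OF f(1) xy ab])
      also have "\<dots> = (\<Sum>i<n. hit (a' i) x \<star> hit (b i) y + x \<star> fscale (counit G (a i)) (hit (b i) y))"
      proof (rule sum.cong[OF refl])
        fix i assume "i \<in> {..<n}"
        then have i: "i < n" by simp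
        have "hit (a i) x = hit (a' i + scal G (counit G (a i)) (uni G)) x"
          by (rule arg_cong[OF a'(3)[OF i], of "\<lambda>z. hit z x"])
        also have "\<dots> = hit (a' i) x + fscale (counit G (a i)) x"
          using a'(1)[OF i] xy uni_in by (simp only: hit_add hit_scal hit_uni scale_carr)
        finally have "hit (a i) x = hit (a' i) x + fscale (counit G (a i)) x" .
        then show "hit (a i) x \<star> hit (b i) y = hit (a' i) x \<star> hit (b i) y + x \<star> fscale (counit G (a i)) (hit (b i) y)"
          using ab i a'[OF i] xy by simp
      qed
      also have "\<dots> = (\<Sum>i<n. hit (a' i) x \<star> hit (b i) y) + x \<star> hit f y"
      proof -
        have "x \<star> (\<Sum>i<n. fscale (counit G (a i)) (hit (b i) y)) = (\<Sum>i<n. x \<star> fscale (counit G (a i)) (hit (b i) y))"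
          using xy ab by (intro dual.lin_sum[of fscale "\<lambda>z. x \<star> z"]) (auto simp: lin_def)
        then show ?thesis using hs[of "{..<n}" "\<lambda>i. counit G (a i)"] fe by (simp add: sum.distrib)
      qed
      also have "\<dots> \<in> filt m"
      proof (intro filt_closed(2) filt_sum)
        fix i assume "i \<in> {..<n}"
        then show "hit (a' i) x \<star> hit (b i) y \<in> filt m"
          using Suc.hyps(1)[of p' q "hit (a' i) x" "hit (b i) y"] Suc.prems Suc.hyps(2) 3 a' ab filt_hit[of y q "b i"] by auto
      next
        show "x \<star> hit f y \<in> filt m"
          using Suc.hyps(1)[of p q' x "hit f y"] Suc.prems Suc.hyps(2) 3 f by auto
      qed
      finally show ?thesis .
    qed
    then show ?thesis using Suc.hyps(2)[symmetric] xy by simp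
  qed
qed

text \<open>The group algebra of the connected component.\<close>

definition A0 :: "('h \<Rightarrow> 'k) set" where
  "A0 = {x \<in> D. \<forall>h\<in>carr G. x (h \<cdot> e0) = x h}"

lemma A0_D [simp]: "x \<in> A0 \<Longrightarrow> x \<in> D" unfolding A0_def by blast

lemma A0_e0: "x \<in> A0 \<Longrightarrow> h \<in> carr G \<Longrightarrow> x (h \<cdot> e0) = x h" unfolding A0_def by blast

lemma A0_I: "x \<in> D \<Longrightarrow> (\<And>h. h \<in> carr G \<Longrightarrow> x (h \<cdot> e0) = x h) \<Longrightarrow> x \<in> A0"
  unfolding A0_def by blast

text \<open>The complementary idempotent \<open>d\<close> has counit zero, hence lies in every power
  of the augmentation ideal, and functionals killing one of these powers do not see it.\<close>

lemma filt_A0: "x \<in> filt p \<Longrightarrow> x \<in> A0"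
proof -
  assume x: "x \<in> filt p"
  define d where "d = uni G - e0"
  have d: "d \<in> carr G" "counit G d = 0" "d \<cdot> d = d"
    using uni_in e0(2) counit_1 by (auto simp: d_def counit_diff mul_diff uni_mul mul_uni_right)
  have *: "z = 0" if "z \<in> filt p" "hit d z = z" for z p
    using that
  proof (induction p)
    case (Suc p)
    have "hit d z \<in> filt p" using Suc.prems(1) d(1,2) unfolding filt.simps by blast
    then have "z \<in> filt p" unfolding Suc.prems(2) .
    then show ?case using Suc.IH Suc.prems(2) by blast
  qed simp
  have "hit d (hit d x) = hit d x" using d hit_hit[of d d x] by simp
  then have z: "hit d x = 0" using * filt_hit[OF x d(1)] by blast
  show ?thesis
    unfolding A0_def mem_Collect_eq
  proof (intro conjI ballI)
    show xD: "x \<in> D" using filt_D[OF x] .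
    fix h assume h: "h \<in> carr G"
    have "x (d \<cdot> h) = 0" using fun_cong[OF z, of h] h by (simp add: hit_def)
    then show "x (h \<cdot> e0) = x h"
      using xD h uni_in mul_com[of h e0] by (simp add: d_def mul_diff uni_mul D_diff)
  qed
qed

text \<open>On \<open>k[G] e0\<close> the multiplications by elements of counit zero are nilpotent
  and closed under composition, so \<open>flag_ex\<close> makes the maximal ideal nilpotent.\<close>

lemma A0_filt: "\<exists>p. A0 \<subseteq> filt p"
proof -
  interpret E: fdv HeS by (rule fdv_HeS)
  define S where "S = {F. lin_on HeS HeS F \<and> (\<exists>f\<in>He. counit G f = 0 \<and> (\<forall>g\<in>He. F g = f \<cdot> g))}"
  have "\<exists>Z n. Z 0 = {0} \<and> Z n = carr HeS \<and> (\<forall>i. \<forall>s\<in>S. s ` Z (Suc i) \<subseteq> Z i)"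
  proof (rule E.flag_ex)
    show "lin_on HeS HeS s \<and> E.nilp s" if s: "s \<in> S" for s
    proof -
      obtain f where f: "f \<in> He" "counit G f = 0" "\<forall>g\<in>He. s g = f \<cdot> g" using s by (auto simp: S_def)
      have "lin_on HeS HeS (\<lambda>g. f \<cdot> g)" using f by (auto simp: lin_on_def)
      then show ?thesis
        using E.nilp_cong[OF He_local[OF f(1,2)], of s] f s by (auto simp: S_def)
    qed
    fix s t assume "s \<in> S" "t \<in> S"
    then obtain f g where f: "f \<in> He" "counit G f = 0" "\<forall>h\<in>He. s h = f \<cdot> h" "lin_on HeS HeS s"
      and g: "g \<in> He" "counit G g = 0" "\<forall>h\<in>He. t h = g \<cdot> h" "lin_on HeS HeS t" unfolding S_def by blast
    have fg: "f + g \<in> He" using subspace_add[OF He_subspace f(1) g(1)] .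
    show "(\<lambda>v. s v + t v) \<in> S"
      unfolding S_def using f g fg E.lin_on_plus[OF f(4) g(4)] by (auto intro!: bexI[of _ "f + g"])
    show "(\<lambda>v. s (t v)) \<in> S"
      unfolding S_def using f g E.lin_on_comp[OF f(4) g(4)] counit_m[of f g]
      by (auto intro!: bexI[of _ "f \<cdot> g"] simp: mul_ass)
  next
    fix s c assume "s \<in> S"
    then obtain f where f: "f \<in> He" "counit G f = 0" "\<forall>h\<in>He. s h = f \<cdot> h" "lin_on HeS HeS s"
      unfolding S_def by blast
    have "scal G c f \<in> He" using subspace_scale[OF He_subspace f(1)] .
    then show "(\<lambda>v. scal HeS c (s v)) \<in> S"
      unfolding S_def using f E.lin_on_scaled[OF f(4), of c] by (auto intro!: bexI[of _ "scal G c f"])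
  next
    have "0 \<in> He" using subspace_0[OF He_subspace] .
    then show "(\<lambda>v. 0) \<in> S"
      unfolding S_def using lin_on_0[OF counit_lin] by (auto intro!: bexI[of _ 0] simp: lin_on_def)
  qed
  then obtain Z n where Z: "Z 0 = {0}" "Z n = He" "\<And>i s. s \<in> S \<Longrightarrow> s ` Z (Suc i) \<subseteq> Z i" by auto
  \<comment> \<open>Multiplication by a function of counit zero sends \<open>Z (Suc i)\<close> into
    \<open>Z i\<close>, so vanishing of \<open>x\<close> on \<open>Z i\<close> is passed on as
    vanishing of \<open>hit f x\<close> on \<open>Z (Suc i)\<close>.\<close>
  have "x \<in> filt (n - i)" if "x \<in> A0" "\<forall>z\<in>Z i. z \<in> He \<longrightarrow> x z = 0" "i \<le> n" for x i
    using that
  proof (induction "n - i" arbitrary: i x)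
    case 0
    then have "x h = 0" for h
      using A0_e0[OF 0(2), of h] Z(2) D_off[OF A0_D[OF 0(2)], of h] by (cases "h \<in> carr G") auto
    then show ?case using 0 by (auto simp: fun_eq_iff)
  next
    case (Suc m)
    have "hit f x \<in> filt m" if f: "f \<in> carr G" "counit G f = 0" for f
    proof -
      have m: "m = n - Suc i" and le: "Suc i \<le> n" using Suc.hyps(2) by auto
      have xD: "x \<in> D" using Suc.prems by simp
      have xe: "x (f \<cdot> h) = x (f \<cdot> e0 \<cdot> h)" if "h \<in> carr G" for h
        using A0_e0[OF Suc.prems(1), of "f \<cdot> h"] that f mul_ass[of f h e0] mul_ass[of f e0 h] mul_com[of h e0] by simp
      have fS: "(\<lambda>g. f \<cdot> e0 \<cdot> g) \<in> S"
        unfolding S_def using f e0(2) counit_m[of f e0]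
        by (auto simp: lin_on_def intro!: bexI[of _ "f \<cdot> e0"])
      have "hit f x \<in> A0"
      proof (rule A0_I)
        show "hit f x \<in> D" using f xD by simp
        fix h assume h: "h \<in> carr G"
        then show "hit f x (h \<cdot> e0) = hit f x h"
          using A0_e0[OF Suc.prems(1), of "f \<cdot> h"] mul_ass[of f h e0] f by (simp add: hit_def)
      qed
      moreover have "hit f x z = 0" if "z \<in> Z (Suc i)" "z \<in> He" for z
      proof -
        have "f \<cdot> e0 \<cdot> z \<in> Z i" using Z(3)[OF fS, of i] that by auto
        then have "x (f \<cdot> e0 \<cdot> z) = 0" using Suc.prems(2) that f by simp
        then show ?thesis using xe that by (simp add: hit_def)
      qed
      ultimately show ?thesis using Suc.hyps(1)[of "Suc i" "hit f x"] m le by auto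
    qed
    then show ?case using Suc.prems Suc.hyps(2)[symmetric] by simp
  qed
  from this[of _ 0] have "A0 \<subseteq> filt n" using Z(1) D_0 by auto
  then show ?thesis ..
qed

text \<open>This is the assertion that the connected component is closed under multiplication; it
  follows because \<open>A0\<close> is the union of the filtration.\<close>

lemma A0_star [simp]: "x \<in> A0 \<Longrightarrow> y \<in> A0 \<Longrightarrow> x \<star> y \<in> A0"
  using A0_filt filt_star filt_A0 by (meson subsetD)

lemma A0_eps [simp]: "eps \<in> A0"
  using e0(2) by (intro A0_I eps_D) (auto simp: eps_def' counit_m)

definition cut :: "('h \<Rightarrow> 'k) \<Rightarrow> 'h \<Rightarrow> 'k" where
  "cut x = (\<lambda>f. if f \<in> carr G then x (f \<cdot> e0) else 0)"

lemma cut_A0: "x \<in> D \<Longrightarrow> cut x \<in> A0"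
proof -
  assume x: "x \<in> D"
  have "cut x \<in> D" unfolding dual_carr[of "cut x"] lin_def using x by (simp add: cut_def)
  then show ?thesis unfolding A0_def using mul_ass[of _ e0 e0] by (simp add: cut_def)
qed

text \<open>As with \<open>kN\<close>: the coproduct of an element of \<open>A0\<close> lies in the
  tensor square of \<open>A0\<close>.\<close>

lemma swe_A0_cong:
  assumes s: "vector_space s" and x: "x \<in> A0"
    and F: "\<And>v. v \<in> D \<Longrightarrow> linD s (\<lambda>u. F u v)" "\<And>u. u \<in> D \<Longrightarrow> linD s (F u)"
    and F': "\<And>v. v \<in> D \<Longrightarrow> linD s (\<lambda>u. F' u v)" "\<And>u. u \<in> D \<Longrightarrow> linD s (F' u)"
    and eq: "\<And>u v. u \<in> A0 \<Longrightarrow> v \<in> A0 \<Longrightarrow> F u v = F' u v"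
  shows "swe s x F = swe s x F'"
proof -
  define r where "r f = f \<cdot> e0" for f
  have r: "lin_on G G r" by (simp add: lin_on_def r_def)
  have xr: "x (r a \<cdot> r b) = x (a \<cdot> b)" if ab: "a \<in> carr G" "b \<in> carr G" for a b
  proof -
    have "r a \<cdot> r b = (a \<cdot> b) \<cdot> e0"
      unfolding r_def using ab mul_ass[of a e0 "b \<cdot> e0"] mul_ass[of e0 b e0] mul_com[of e0 b] mul_ass[of b e0 e0] mul_ass[of a b e0]
      by simp
    then show ?thesis using A0_e0[OF x] ab by simp
  qed
  have "swe s x F = swe s x (\<lambda>u v. F (cut u) (cut v))"
    unfolding cut_def by (rule swe_restrict[OF s A0_D[OF x] r xr F, unfolded r_def])
  also have "\<dots> = swe s x (\<lambda>u v. F' (cut u) (cut v))"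
    by (intro swe_cong eq cut_A0)
  also have "\<dots> = swe s x F'"
    unfolding cut_def by (rule swe_restrict[OF s A0_D[OF x] r xr F', unfolded r_def, symmetric])
  finally show ?thesis .
qed

section \<open>Rational points\<close>

text \<open>Algebra homomorphisms to \<open>k\<close>, equivalently the group-like elements of
  \<open>kG\<close>; the second description is what \<open>swe_pts\<close> exploits.\<close>

definition pts :: "('h \<Rightarrow> 'k) set" where
  "pts = {g \<in> D. g (uni G) = 1 \<and> (\<forall>a\<in>carr G. \<forall>b\<in>carr G. g (a \<cdot> b) = g a * g b)}"

lemma pts_D [simp]: "g \<in> pts \<Longrightarrow> g \<in> D"
  and pts_uni: "g \<in> pts \<Longrightarrow> g (uni G) = 1"
  and pts_mult: "g \<in> pts \<Longrightarrow> a \<in> carr G \<Longrightarrow> b \<in> carr G \<Longrightarrow> g (a \<cdot> b) = g a * g b"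
  unfolding pts_def by blast+

lemma swe_pts:
  assumes s: "vector_space s" and g: "g \<in> pts"
    and F: "\<And>v. v \<in> D \<Longrightarrow> linD s (\<lambda>u. F u v)" "\<And>u. u \<in> D \<Longrightarrow> linD s (F u)"
  shows "swe s g F = F g g"
  using bilinear_expand[OF s F pts_D[OF g] pts_D[OF g]] g by (simp add: swe_def pts_mult)

text \<open>Translation of functions, characterised by \<open>tr_apply\<close>; the dual basis only
  serves to produce the element.\<close>

definition tr :: "('h \<Rightarrow> 'k) \<Rightarrow> 'h \<Rightarrow> 'h" where
  "tr z h = (\<Sum>b\<in>bas. scal G ((du b \<star> z) h) b)"

lemma tr_carr [simp]: "tr z h \<in> carr G" by (simp add: tr_def)

lemma tr_apply: "x \<in> D \<Longrightarrow> z \<in> D \<Longrightarrow> h \<in> carr G \<Longrightarrow> x (tr z h) = (x \<star> z) h"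
proof -
  assume x: "x \<in> D" "z \<in> D" "h \<in> carr G"
  have "x (tr z h) = (\<Sum>b\<in>bas. x (scal G ((du b \<star> z) h) b))"
    unfolding tr_def using x by (intro D_sum) auto
  also have "\<dots> = (\<Sum>b\<in>bas. x b * (du b \<star> z) h)" using x by (intro sum.cong) auto
  also have "\<dots> = (x \<star> z) h"
    using lin_dual_expand[of "(*)" "\<lambda>x. (x \<star> z) h" x] x by (simp add: lin_def)
  finally show ?thesis .
qed

lemma tr_tr: "g \<in> D \<Longrightarrow> z \<in> D \<Longrightarrow> h \<in> carr G \<Longrightarrow> tr g (tr z h) = tr (g \<star> z) h"
  by (rule carr_ext) (auto simp: tr_apply star_assoc)

lemma tr_eps: "h \<in> carr G \<Longrightarrow> tr eps h = h"
  by (rule carr_ext) (auto simp: tr_apply)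

lemma tr_0: "z \<in> D \<Longrightarrow> tr z 0 = 0"
  by (rule carr_ext) (auto simp: tr_apply D_0)

lemma tr_add: "z \<in> D \<Longrightarrow> a \<in> carr G \<Longrightarrow> b \<in> carr G \<Longrightarrow> tr z (a + b) = tr z a + tr z b"
  by (rule carr_ext) (auto simp: tr_apply)

lemma tr_scal: "z \<in> D \<Longrightarrow> a \<in> carr G \<Longrightarrow> tr z (scal G c a) = scal G c (tr z a)"
  by (rule carr_ext) (auto simp: tr_apply)

lemma tr_mult:
  assumes g: "g \<in> pts" and ab: "a \<in> carr G" "b \<in> carr G"
  shows "tr g (a \<cdot> b) = tr g a \<cdot> tr g b"
proof (rule carr_ext)
  fix x assume x: "x \<in> D"
  have "x (tr g (a \<cdot> b)) = swe (*) x (\<lambda>x1 x2. swe (*) g (\<lambda>y1 y2. (x1 \<star> y1) a * (x2 \<star> y2) b))"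
    using tr_apply x g ab swe_star_eval[OF x pts_D[OF g] ab] by simp
  also have "\<dots> = swe (*) x (\<lambda>x1 x2. x1 (tr g a) * x2 (tr g b))"
  proof (rule swe_cong)
    fix x1 x2 assume "x1 \<in> D" "x2 \<in> D"
    then show "swe (*) g (\<lambda>y1 y2. (x1 \<star> y1) a * (x2 \<star> y2) b) = x1 (tr g a) * x2 (tr g b)"
      using ab g by (subst swe_pts[OF vector_space_mult g]) (auto simp: lin_def algebra_simps tr_apply)
  qed
  also have "\<dots> = x (tr g a \<cdot> tr g b)" using x by (simp add: swe_eval)
  finally show "x (tr g (a \<cdot> b)) = x (tr g a \<cdot> tr g b)" .
qed (use ab in auto)

end

context finite_group_scheme begin

lemma pts_anti:
  assumes g: "g \<in> pts"
  shows "g \<star> anti g = eps" "anti g \<star> g = eps"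
proof -
  note vs = vector_space_fscale
  note u = pts_uni[OF g]
  have "swe fscale g (\<lambda>u v. u \<star> anti v) = g \<star> anti g"
    by (rule swe_pts[OF vs g]) (auto simp: lin_def)
  then show "g \<star> anti g = eps" using swe_anti_right[OF vs pts_D[OF g] lin_id_D] u by (simp add: fscale_def)
  have "swe fscale g (\<lambda>u v. anti u \<star> v) = anti g \<star> g"
    by (rule swe_pts[OF vs g]) (auto simp: lin_def)
  then show "anti g \<star> g = eps" using swe_anti_left[OF vs pts_D[OF g] lin_id_D] u by (simp add: fscale_def)
qed

end

locale closed_field_scheme = finite_group_scheme G
  for G :: "('k::alg_closed_field, 'h::ab_group_add) hopf"
begin

sublocale fdv_closed G by unfold_locales

text \<open>Over an algebraically closed field, \<open>G\<close> is the union of the translates of its connected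
  component by rational points.\<close>

lemma points_separate:
  assumes h: "h \<in> carr G"
    and van: "\<And>x g. x \<in> A0 \<Longrightarrow> g \<in> pts \<Longrightarrow> (x \<star> g) h = 0"
  shows "h = 0"
proof (rule ccontr)
  assume "h \<noteq> 0"
  \<comment> \<open>The functions vanishing on all translates of the component; they form an ideal
    because translations by points are multiplicative.\<close>
  define I where "I = {h \<in> carr G. \<forall>g\<in>pts. tr g h \<cdot> e0 = 0}"
  have hI: "h \<in> I"
    unfolding I_def mem_Collect_eq
  proof (intro conjI ballI h)
    fix g assume g: "g \<in> pts"
    show "tr g h \<cdot> e0 = 0"
    proof (rule carr_ext)
      fix x assume x: "x \<in> D"
      have "x (tr g h \<cdot> e0) = cut x (tr g h)" by (simp add: cut_def)
      also have "\<dots> = 0" using van[OF cut_A0[OF x] g] tr_apply[of "cut x" g h] cut_A0[OF x] g h by simp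
      finally show "x (tr g h \<cdot> e0) = x 0" using D_0 x by simp
    qed auto
  qed
  have I_sub: "subspace I"
    by (rule subspaceI) (auto simp: I_def tr_0 tr_add tr_scal)
  have I_ideal: "f \<cdot> u \<in> I" if "f \<in> carr G" "u \<in> I" for f u
    using that by (auto simp: I_def tr_mult mul_ass)
  \<comment> \<open>In a minimal nonzero ideal inside \<open>I\<close> every nonzero eigenspace of a
    multiplication is again an ideal, hence everything; so all functions act by scalars, and the
    scalars form a rational point.\<close>
  let ?Pr = "\<lambda>U. U \<noteq> {0} \<and> U \<subseteq> I \<and> (\<forall>f\<in>carr G. \<forall>u\<in>U. f \<cdot> u \<in> U)"
  have "?Pr I" using hI \<open>h \<noteq> 0\<close> I_ideal by auto
  moreover have "I \<subseteq> carr G" by (auto simp: I_def)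
  ultimately have "\<exists>U. subspace U \<and> ?Pr U \<and> U \<subseteq> carr G \<and> (\<forall>W. subspace W \<longrightarrow> ?Pr W \<longrightarrow> W \<subseteq> U \<longrightarrow> W = U)"
    by (rule minimal_subspace_ex[of I ?Pr, OF I_sub])
  then obtain U where U: "subspace U" "U \<noteq> {0}" "U \<subseteq> I" "\<forall>f\<in>carr G. \<forall>u\<in>U. f \<cdot> u \<in> U" "U \<subseteq> carr G"
    and min0: "\<forall>W. subspace W \<longrightarrow> ?Pr W \<longrightarrow> W \<subseteq> U \<longrightarrow> W = U"
    by (elim exE conjE) (rule that)
  have min: "W = U" if "subspace W" "?Pr W" "W \<subseteq> U" for W using min0 that by blast
  obtain w where w: "w \<in> U" "w \<noteq> 0" using U(1,2) subspace_0 by blast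
  have wc: "w \<in> carr G" using w U by auto
  have ex: "\<exists>c. f \<cdot> w = scal G c w" if f: "f \<in> carr G" for f
  proof -
    have lf: "lin_on G G (\<lambda>u. f \<cdot> u)" using mul_lin[OF f] .
    have "(\<lambda>u. f \<cdot> u) ` U \<subseteq> U" using U(4) f by auto
    then obtain c v where v: "v \<in> U" "v \<noteq> 0" "f \<cdot> v = scal G c v"
      using eigenvector_ex[OF lf U(1,5,2)] by blast
    define W where "W = {u \<in> U. f \<cdot> u = scal G c u}"
    have "subspace W"
      unfolding W_def using U f subspace_0[OF U(1)] subspace_add[OF U(1)] subspace_scale[OF U(1)]
      by (intro subspaceI) (auto simp: subset_eq scale_right_distrib mult.commute)
    moreover have "f' \<cdot> u \<in> W" if "f' \<in> carr G" "u \<in> W" for f' u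
    proof -
      have u: "u \<in> carr G" "u \<in> U" "f \<cdot> u = scal G c u" using that U by (auto simp: W_def)
      have "f \<cdot> (f' \<cdot> u) = f' \<cdot> (f \<cdot> u)"
        using that u f mul_ass[of f f' u] mul_ass[of f' f u] mul_com[of f f'] by simp
      then show ?thesis using u that U(4) by (simp add: W_def)
    qed
    moreover have "v \<in> W" using v by (simp add: W_def)
    ultimately have "W = U" using U(3) v(2) by (intro min) (auto simp: W_def)
    then show ?thesis using w by (auto simp: W_def)
  qed
  define g where "g f = (if f \<in> carr G then (SOME c. f \<cdot> w = scal G c w) else 0)" for f
  have gw: "f \<cdot> w = scal G (g f) w" if "f \<in> carr G" for f
    using someI_ex[OF ex[OF that]] that by (simp add: g_def)
  have guniq: "g f = c" if "f \<in> carr G" "f \<cdot> w = scal G c w" for f c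
    using gw[OF that(1)] that(2) w(2) by simp
  have "g \<in> D"
    unfolding dual_carr lin_def
  proof (intro conjI ballI allI impI)
    show "g (u + v) = g u + g v" if "u \<in> carr G" "v \<in> carr G" for u v
      using that gw[OF that(1)] gw[OF that(2)] wc by (intro guniq) (auto simp: scale_left_distrib)
    show "g (scal G c v) = c * g v" if "v \<in> carr G" for c v
      using that gw[OF that] wc by (intro guniq) auto
  qed (simp add: g_def)
  moreover have "g (uni G) = 1" using uni_in uni_mul wc by (intro guniq) auto
  moreover have "g (a \<cdot> b) = g a * g b" if "a \<in> carr G" "b \<in> carr G" for a b
    using that gw[OF that(1)] gw[OF that(2)] wc by (intro guniq) (simp_all add: mul_ass mult.commute[of "g a"])
  ultimately have g: "g \<in> pts" unfolding pts_def by blast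
  \<comment> \<open>The idempotent of the component through the point \<open>g\<close>: it acts on
    \<open>w\<close> by \<open>g eg = 1\<close>, whereas membership of \<open>w\<close> in
    \<open>I\<close> makes \<open>eg \<cdot> w\<close> zero.\<close>
  define eg where "eg = tr (anti g) e0"
  have egc: "eg \<in> carr G" by (simp add: eg_def)
  have "tr g eg = e0" using g by (simp add: eg_def tr_tr pts_anti tr_eps)
  moreover have "tr g w \<cdot> e0 = 0" using w U(3) g by (auto simp: I_def)
  ultimately have "tr g (eg \<cdot> w) = 0"
    using tr_mult[OF g egc wc] mul_com[of e0 "tr g w"] by simp
  then have "tr (anti g) (tr g (eg \<cdot> w)) = 0" using g by (simp add: tr_0)
  then have "eg \<cdot> w = 0" using g egc wc by (simp add: tr_tr pts_anti tr_eps)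
  moreover have "g eg = 1"
    using g e0(2) by (simp add: eg_def tr_apply pts_anti) (simp add: eps_def')
  ultimately show False using gw[OF egc] w by simp
qed

end

section \<open>The connected component as a group scheme\<close>

context comm_alg begin

lemma alg_ideal_subspace:
  assumes I: "alg_ideal G I" shows "subspace I"
proof (rule subspaceI)
  fix c x assume x: "x \<in> I"
  then have "x \<in> carr G" using I by (auto simp: alg_ideal_def)
  then have "scal G c x = mul G (scal G c (uni G)) x" using uni_in uni_mul by simp
  moreover have "mul G (scal G c (uni G)) x \<in> I"
    using I x uni_in scale_carr[of "uni G" c] unfolding alg_ideal_def by blast
  ultimately show "scal G c x \<in> I" by simp
qed (use I in \<open>auto simp: alg_ideal_def\<close>)

lemma alg_ideal_in_maximal:
  assumes I: "alg_ideal G I" "I \<noteq> carr G"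
  shows "\<exists>J. maximal_alg_ideal G J \<and> I \<subseteq> J"
proof -
  have Ic: "I \<subseteq> carr G" using I by (auto simp: alg_ideal_def)
  have "alg_ideal G I \<and> I \<noteq> carr G" using I by blast
  from maximal_subspace_ex[of I "\<lambda>J. alg_ideal G J \<and> J \<noteq> carr G", OF alg_ideal_subspace[OF I(1)] this Ic]
  obtain J where J: "alg_ideal G J" "J \<noteq> carr G" "I \<subseteq> J"
    and max: "\<forall>X. subspace X \<longrightarrow> alg_ideal G X \<and> X \<noteq> carr G \<longrightarrow> X \<subseteq> carr G \<longrightarrow> J \<subseteq> X \<longrightarrow> J = X"
    by blast
  have "X = J \<or> X = carr G" if X: "alg_ideal G X" "J \<subseteq> X" for X
  proof -
    have "X \<subseteq> carr G" using X(1) by (simp add: alg_ideal_def)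
    then show ?thesis using max alg_ideal_subspace[OF X(1)] X by blast
  qed
  then have "maximal_alg_ideal G J" using J by (auto simp: maximal_alg_ideal_def)
  then show ?thesis using J by blast
qed

lemma principal_ideal:
  assumes d: "d \<in> carr G"
  shows "alg_ideal G ((\<lambda>f. mul G d f) ` carr G)" "d \<in> (\<lambda>f. mul G d f) ` carr G"
proof -
  have s: "subspace ((\<lambda>f. mul G d f) ` carr G)"
    by (rule subspace_image[OF mul_lin[OF d]]) auto
  show "d \<in> (\<lambda>f. mul G d f) ` carr G"
    using d uni_in mul_uni_right[OF d] by (intro image_eqI[of _ _ "uni G"]) auto
  have "mul G r (mul G d f) \<in> (\<lambda>f. mul G d f) ` carr G" if "r \<in> carr G" "f \<in> carr G" for r f
    using that d mul_ass[of r d f] mul_ass[of d r f] mul_com[of r d] by (intro image_eqI[of _ _ "mul G r f"]) auto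
  then show "alg_ideal G ((\<lambda>f. mul G d f) ` carr G)"
    unfolding alg_ideal_def using s d subspace_0[OF s] subspace_add[OF s] by auto
qed

text \<open>For a nontrivial idempotent \<open>d\<close>, maximal ideals above \<open>d\<close> and
  above \<open>uni G - d\<close> would coincide and contain the unit.\<close>

lemma infinitesimal_idempotent:
  assumes inf: "infinitesimal G" and d: "d \<in> carr G" "mul G d d = d" "d \<noteq> 0"
  shows "d = uni G"
proof (rule ccontr)
  assume ne: "d \<noteq> uni G"
  define e where "e = uni G - d"
  have e: "e \<in> carr G" using d uni_in by (simp add: e_def)
  have de: "mul G d e = 0" using d uni_in by (simp add: e_def mul_diff mul_uni_right)
  have ee: "mul G e e = e" using d uni_in de mul_com[of d e] e by (simp add: e_def mul_diff uni_mul mul_uni_right)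
  have proper: "(\<lambda>f. mul G c f) ` carr G \<noteq> carr G" if c: "c \<in> carr G" "mul G c c = c" "c \<noteq> uni G" for c
  proof
    assume "(\<lambda>f. mul G c f) ` carr G = carr G"
    then obtain m where m: "m \<in> carr G" "uni G = mul G c m" using uni_in by (metis imageE)
    have "c = mul G c (mul G c m)" using m c mul_uni_right by metis
    also have "\<dots> = mul G c m" using mul_ass[of c c m] c m by simp
    finally show False using m c by simp
  qed
  have "e \<noteq> uni G" using d(3) by (auto simp: e_def)
  obtain J where J: "maximal_alg_ideal G J" "(\<lambda>f. mul G d f) ` carr G \<subseteq> J"
    using alg_ideal_in_maximal[OF principal_ideal(1)[OF d(1)] proper[OF d(1,2) ne]] by blast
  obtain J' where J': "maximal_alg_ideal G J'" "(\<lambda>f. mul G e f) ` carr G \<subseteq> J'"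
    using alg_ideal_in_maximal[OF principal_ideal(1)[OF e] proper[OF e ee \<open>e \<noteq> uni G\<close>]] by blast
  have "J = J'" using inf J J' unfolding infinitesimal_def by blast
  then have "d \<in> J" "e \<in> J" using J J' principal_ideal(2) d e by blast+
  then have "d + e \<in> J" using J(1) by (auto simp: maximal_alg_ideal_def alg_ideal_def)
  then have u: "uni G \<in> J" by (simp add: e_def)
  have "carr G \<subseteq> J"
  proof
    fix f assume f: "f \<in> carr G"
    then have "mul G f (uni G) \<in> J" using u J(1) by (auto simp: maximal_alg_ideal_def alg_ideal_def)
    then show "f \<in> J" using mul_uni_right[OF f] by simp
  qed
  then show False using J(1) by (auto simp: maximal_alg_ideal_def alg_ideal_def)
qed

lemma form_cong:
  assumes "\<gamma> \<in> bil G G" "\<And>a b. a \<in> carr G \<Longrightarrow> b \<in> carr G \<Longrightarrow> \<gamma>' a b = \<gamma> a b"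
  shows "\<gamma>' \<in> bil G G"
  using assms by (auto simp: bil_iff lin_def)

end

context bialg begin

section \<open>The bialgebra of the connected component\<close>

abbreviation C where "C \<equiv> conn_comp G"

lemma He_image: "conn_restr G ` carr G = He"
proof (intro equalityI subsetI)
  fix f assume "f \<in> conn_restr G ` carr G"
  then show "f \<in> He" by (auto simp: conn_restr_def)
next
  fix f assume f: "f \<in> He"
  then show "f \<in> conn_restr G ` carr G"
    by (intro image_eqI[of _ _ f]) (auto simp: conn_restr_def)
qed

lemma conn_space_simps: "carr (conn_space G) = He" "scal (conn_space G) = scal G"
  by (simp_all add: conn_space_def He_image)

lemma bil_conn_space: "bil (conn_space G) (conn_space G) = bil HeS HeS"
  by (simp only: bil_def lin_on_def conn_space_simps HeS_simps)

lemma C_simps: "carr C = He" "scal C = scal G" "mul C = mul G" "uni C = e0" "counit C = counit G"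
  "comul C f \<beta> = comul G f (\<lambda>a b. if \<beta> \<in> bil HeS HeS then \<beta> (a \<cdot> e0) (b \<cdot> e0) else 0)"
  by (simp_all add: conn_comp_def conn_space_simps tmap_def ten_def conn_restr_def bil_conn_space)

lemma bil_C: "bil C C = bil HeS HeS"
  by (simp only: bil_def lin_on_def C_simps HeS_simps)

lemma e0_swap: "a \<in> carr G \<Longrightarrow> b \<in> carr G \<Longrightarrow> (a \<cdot> e0) \<cdot> (b \<cdot> e0) = (a \<cdot> b) \<cdot> e0"
  using mul_ass[of a e0 "b \<cdot> e0"] mul_ass[of e0 b e0] mul_com[of e0 b] mul_ass[of b e0 e0] mul_ass[of a b e0] by simp

lemma restr_form: "\<beta> \<in> bil HeS HeS \<Longrightarrow> (\<lambda>a b. \<beta> (a \<cdot> e0) (b \<cdot> e0)) \<in> bil G G"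
  by (auto simp: bil_iff lin_def)

lemma comul_C: "\<beta> \<in> bil HeS HeS \<Longrightarrow> comul C f \<beta> = comul G f (\<lambda>a b. \<beta> (a \<cdot> e0) (b \<cdot> e0))"
  by (simp add: C_simps)

lemma comul_zero: "f \<in> carr G \<Longrightarrow> comul G f (\<lambda>a b. 0) = 0"
  using comul_sum[of f "{}" _ "\<lambda>a b. 0"] by (simp add: bil_iff lin_def)

text \<open>Transposed form of \<open>A0_star\<close>: the form expands into products of functionals
  in \<open>A0\<close>, whose convolution cannot tell \<open>f \<cdot> e0\<close> from
  \<open>f\<close>.\<close>

lemma comul_restr:
  assumes f: "f \<in> carr G" and \<gamma>: "\<gamma> \<in> bil G G"
    and r: "\<And>a b. a \<in> carr G \<Longrightarrow> b \<in> carr G \<Longrightarrow> \<gamma> (a \<cdot> e0) (b \<cdot> e0) = \<gamma> a b"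
  shows "comul G (f \<cdot> e0) \<gamma> = comul G f \<gamma>"
proof -
  have e: "comul G g \<gamma> = (\<Sum>i\<in>bas \<times> bas. \<gamma> (fst i) (snd i) * (cut (du (fst i)) \<star> cut (du (snd i))) g)"
    if g: "g \<in> carr G" for g
  proof -
    have "comul G g \<gamma> = (\<Sum>i\<in>bas \<times> bas. \<gamma> (fst i) (snd i) * comul G g (\<lambda>a b. cut (du (fst i)) a * cut (du (snd i)) b))"
    proof (rule comul_sum[OF g _ \<gamma>])
      show "(\<lambda>a b. cut (du (fst i)) a * cut (du (snd i)) b) \<in> bil G G" for i
        using cut_A0[OF du_dual] by (intro prod_bil) auto
      fix a b assume ab: "a \<in> carr G" "b \<in> carr G"
      have "\<gamma> a b = (\<Sum>i\<in>bas \<times> bas. \<gamma> (fst i) (snd i) * (du (fst i) (a \<cdot> e0) * du (snd i) (b \<cdot> e0)))"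
        using bil_expand[OF fdv_axioms \<gamma>, of "a \<cdot> e0" "b \<cdot> e0"] r[OF ab] ab by simp
      then show "\<gamma> a b = (\<Sum>i\<in>bas \<times> bas. \<gamma> (fst i) (snd i) * (cut (du (fst i)) a * cut (du (snd i)) b))"
        using ab by (simp add: cut_def)
    qed
    then show ?thesis using g by (simp add: star_apply)
  qed
  have "(cut (du p) \<star> cut (du q)) (f \<cdot> e0) = (cut (du p) \<star> cut (du q)) f" for p q
    using A0_e0[OF A0_star[OF cut_A0[OF du_dual] cut_A0[OF du_dual]] f] .
  then show ?thesis using f by (simp add: e)
qed

lemma comm_alg_C: "comm_alg C"
proof
  show "fin_dim_space C"
    by (rule fin_dim_subspace[OF He_subspace]) (auto simp: C_simps)
  show "lin_on C C (mul C a)" if "a \<in> carr C" for a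
    using that subspace_add[OF He_subspace] subspace_scale[OF He_subspace] by (auto simp: lin_on_def C_simps)
qed (auto simp: C_simps mul_ass intro: mul_com, use mul_com He_e0 in \<open>metis He_carr e0_carr\<close>)

text \<open>Every identity is pulled back to \<open>G\<close> by composing forms with multiplication
  by \<open>e0\<close>; nested coproducts require \<open>comul_Ce\<close>, where closure of the
  component under multiplication enters.\<close>

lemma bialg_C: "bialg C"
proof -
  interpret C: comm_alg C by (rule comm_alg_C)
  have bilm: "(\<lambda>c d. \<beta> (a \<cdot> c) (b \<cdot> d)) \<in> bil HeS HeS" if "\<beta> \<in> bil HeS HeS" "a \<in> He" "b \<in> He" for \<beta> a b
    using that by (auto simp: bil_iff lin_def)
  have restr_r: "(a \<cdot> e0) \<cdot> e0 = a \<cdot> e0" if "a \<in> carr G" for a using that by (simp add: mul_ass)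
  have comul_Ce: "comul C (f \<cdot> e0) \<beta> = comul C f \<beta>" if f: "f \<in> carr G" "\<beta> \<in> bil HeS HeS" for f \<beta>
    unfolding comul_C[OF f(2)] by (rule comul_restr[OF f(1) restr_form[OF f(2)]]) (simp add: restr_r)
  have Cadd: "comul C (f + g) \<beta> = comul C f \<beta> + comul C g \<beta>" "comul C (scal G c f) \<beta> = c * comul C f \<beta>"
    if "f \<in> He" "g \<in> He" for f g c \<beta>
    using that by (simp_all add: C_simps comul_add comul_scal)
  have Cin: "comul C f \<in> ten_carr (bil HeS HeS) HeS HeS" if f: "f \<in> carr G" for f
  proof -
    obtain n a b where ab: "\<forall>i<(n::nat). a i \<in> carr G \<and> b i \<in> carr G" "\<forall>\<beta>\<in>bil G G. comul G f \<beta> = (\<Sum>i<n. \<beta> (a i) (b i))"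
      using comul_ex[OF f] by blast
    have "comul C f = (\<lambda>\<beta>. if \<beta> \<in> bil HeS HeS then \<Sum>i<n. 1 * \<beta> (a i \<cdot> e0) (b i \<cdot> e0) else 0)"
      using ab restr_form comul_zero[OF f] by (auto simp: fun_eq_iff C_simps)
    moreover have "\<dots> \<in> ten_carr (bil HeS HeS) HeS HeS"
      using ab by (intro ten_carr_I) auto
    ultimately show ?thesis by simp
  qed
  have Ccong: "comul C f \<beta> = comul C f \<beta>'" if "f \<in> He" "\<beta> \<in> bil HeS HeS" "\<beta>' \<in> bil HeS HeS"
    "\<And>a b. a \<in> He \<Longrightarrow> b \<in> He \<Longrightarrow> \<beta> a b = \<beta>' a b" for f \<beta> \<beta>'
    using ten_cong[OF Cin that(2,3)] that(1,4) by simp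
  have linC: "lin HeS (*) (\<lambda>z. comul C f (\<tau> z))"
    if "f \<in> He" "\<And>z. z \<in> He \<Longrightarrow> \<tau> z \<in> bil HeS HeS" "\<And>a b. a \<in> He \<Longrightarrow> b \<in> He \<Longrightarrow> lin HeS (*) (\<lambda>z. \<tau> z a b)" for f \<tau>
  proof -
    have "lin HeS (*) (\<lambda>z. comul G f (\<lambda>a b. \<tau> z (a \<cdot> e0) (b \<cdot> e0)))"
      using that restr_form by (intro lin_comul_param fdv_HeS) auto
    then show ?thesis using that subspace_add[OF He_subspace] subspace_scale[OF He_subspace]
      by (auto simp: lin_def comul_C)
  qed
  show ?thesis
  proof
    show "lin_on C (tensor C C) (comul C)"
      unfolding lin_on_def using Cin Cadd
      by (auto simp: tensor_carr C_simps(1,2) bil_C fun_eq_iff ten_carr_def)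
    show "comul C (uni C) = ten (bil C C) (uni C) (uni C)"
    proof
      fix \<beta> show "comul C (uni C) \<beta> = ten (bil C C) (uni C) (uni C) \<beta>"
      proof (cases "\<beta> \<in> bil HeS HeS")
        case True
        have "comul C (uni G \<cdot> e0) \<beta> = \<beta> (uni G \<cdot> e0) (uni G \<cdot> e0)"
          using comul_Ce[OF uni_in True] restr_form[OF True] comul_1 by (simp add: comul_C[OF True] ten_def)
        then show ?thesis using True by (simp add: uni_mul C_simps(4) ten_def bil_C)
      qed (simp add: C_simps(4,6) ten_def bil_C comul_zero)
    qed
    show "comul C (mul C f g) =
        lift (\<lambda>a b. lift (\<lambda>c d. ten (bil C C) (mul C a c) (mul C b d)) (comul C g)) (comul C f)"
      if fg: "f \<in> carr C" "g \<in> carr C" for f g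
    proof
      fix \<beta>
      have fH: "f \<in> He" "g \<in> He" using fg by (auto simp: C_simps)
      let ?R = "comul C f (\<lambda>a b. comul C g (\<lambda>c d. if \<beta> \<in> bil HeS HeS then \<beta> (a \<cdot> c) (b \<cdot> d) else 0))"
      have "comul C (f \<cdot> g) \<beta> = ?R"
      proof (cases "\<beta> \<in> bil HeS HeS")
        case False
        have z: "(\<lambda>a b. 0) \<in> bil HeS HeS" by (simp add: bil_iff lin_def)
        show ?thesis using False fH z comul_zero by (simp add: C_simps(6))
      next
        case True
        have m: "(\<lambda>c d. \<beta> (a \<cdot> e0 \<cdot> (c \<cdot> e0)) (b \<cdot> e0 \<cdot> (d \<cdot> e0))) \<in> bil G G" if "a \<in> carr G" "b \<in> carr G" for a b
          using restr_form[OF bilm[OF True]] that by simp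
        have m2: "(\<lambda>a b. comul C g (\<lambda>c d. \<beta> (a \<cdot> c) (b \<cdot> d))) \<in> bil HeS HeS"
        proof (rule bilI; rule linC)
          fix a z assume "a \<in> carr HeS" "z \<in> He"
          then show "(\<lambda>c d. \<beta> (a \<cdot> c) (z \<cdot> d)) \<in> bil HeS HeS" "(\<lambda>c d. \<beta> (z \<cdot> c) (a \<cdot> d)) \<in> bil HeS HeS"
            using bilm[OF True] by auto
        next
          fix a c d assume "a \<in> carr HeS" "c \<in> He" "d \<in> He"
          then show "lin HeS (*) (\<lambda>z. \<beta> (a \<cdot> c) (z \<cdot> d))" "lin HeS (*) (\<lambda>z. \<beta> (z \<cdot> c) (a \<cdot> d))"
            using True by (auto simp: bil_iff lin_def)
        qed (use fH in auto)
        have "comul C (f \<cdot> g) \<beta> = comul G f (\<lambda>a b. comul G g (\<lambda>c d. \<beta> (a \<cdot> c \<cdot> e0) (b \<cdot> d \<cdot> e0)))"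
          using fH restr_form[OF True] by (simp add: comul_C[OF True] comul_m ten_def)
        also have "\<dots> = comul G f (\<lambda>a b. comul C g (\<lambda>c d. \<beta> (a \<cdot> e0 \<cdot> c) (b \<cdot> e0 \<cdot> d)))"
        proof -
          have ee: "comul G g (\<lambda>c d. \<beta> (a \<cdot> c \<cdot> e0) (b \<cdot> d \<cdot> e0)) = comul C g (\<lambda>c d. \<beta> (a \<cdot> e0 \<cdot> c) (b \<cdot> e0 \<cdot> d))"
            if "a \<in> carr G" "b \<in> carr G" for a b
          proof -
            have m': "(\<lambda>c d. \<beta> (a \<cdot> c \<cdot> e0) (b \<cdot> d \<cdot> e0)) \<in> bil G G"
              using that True by (auto simp: bil_iff lin_def)
            have "comul G g (\<lambda>c d. \<beta> (a \<cdot> c \<cdot> e0) (b \<cdot> d \<cdot> e0)) = comul G g (\<lambda>c d. \<beta> (a \<cdot> e0 \<cdot> (c \<cdot> e0)) (b \<cdot> e0 \<cdot> (d \<cdot> e0)))"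
              using that fH m m' by (intro comul_cong) (auto simp: e0_swap)
            then show ?thesis using that bilm[OF True, of "a \<cdot> e0" "b \<cdot> e0"] by (simp add: comul_C)
          qed
          have b1: "(\<lambda>a b. comul C g (\<lambda>c d. \<beta> (a \<cdot> e0 \<cdot> c) (b \<cdot> e0 \<cdot> d))) \<in> bil G G"
            using restr_form[OF m2] by simp
          moreover have "(\<lambda>a b. comul G g (\<lambda>c d. \<beta> (a \<cdot> c \<cdot> e0) (b \<cdot> d \<cdot> e0))) \<in> bil G G"
            using ee by (intro form_cong[OF b1]) auto
          ultimately show ?thesis using fH ee by (intro comul_cong) auto
        qed
        also have "\<dots> = ?R" using True m2 by (simp add: comul_C[OF m2])
        finally show ?thesis .
      qed
      then show "comul C (mul C f g) \<beta> =
        lift (\<lambda>a b. lift (\<lambda>c d. ten (bil C C) (mul C a c) (mul C b d)) (comul C g)) (comul C f) \<beta>"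
        by (simp add: C_simps(3) ten_def bil_C)
    qed
    show "comul C f (\<lambda>a b. comul C a (\<lambda>a1 a2. \<tau> a1 a2 b)) = comul C f (\<lambda>a b. comul C b (\<lambda>b1 b2. \<tau> a b1 b2))"
      if f: "f \<in> carr C" and t: "\<tau> \<in> tril C" for f \<tau>
    proof -
      have fH: "f \<in> He" using f by (simp add: C_simps)
      have t1: "\<tau> a \<in> bil HeS HeS" if "a \<in> He" for a using t that by (simp add: tril_def C_simps(1) bil_C)
      have t2: "lin HeS (*) (\<lambda>a. \<tau> a b c)" if "b \<in> He" "c \<in> He" for b c
        using t that by (simp add: tril_def C_simps(1,2) lin_def)
      have t3: "(\<lambda>a1 a2. \<tau> a1 a2 b) \<in> bil HeS HeS" if "b \<in> He" for b
        using t1 t2 that by (auto simp: bil_iff)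
      define \<sigma> where "\<sigma> a b c = \<tau> (a \<cdot> e0) (b \<cdot> e0) (c \<cdot> e0)" for a b c
      have s: "\<sigma> \<in> tril G"
        using t1 t2 restr_form[OF t1] by (auto simp: tril_def \<sigma>_def lin_def bil_def)
      have L: "(\<lambda>a b. comul C a (\<lambda>a1 a2. \<tau> a1 a2 b)) \<in> bil HeS HeS"
      proof (rule bilI)
        show "lin HeS (*) (\<lambda>b. comul C a (\<lambda>a1 a2. \<tau> a1 a2 b))" if "a \<in> carr HeS" for a
          using that t3 t1 by (intro linC) (auto simp: bil_iff)
        show "lin HeS (*) (\<lambda>a. comul C a (\<lambda>a1 a2. \<tau> a1 a2 b))" for b
          using Cadd by (auto simp: lin_def)
      qed
      have R: "(\<lambda>a b. comul C b (\<lambda>b1 b2. \<tau> a b1 b2)) \<in> bil HeS HeS"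
      proof (rule bilI)
        show "lin HeS (*) (\<lambda>a. comul C b (\<lambda>b1 b2. \<tau> a b1 b2))" if "b \<in> carr HeS" for b
          using that t1 t2 by (intro linC) (auto simp: bil_iff)
        show "lin HeS (*) (\<lambda>b. comul C b (\<lambda>b1 b2. \<tau> a b1 b2))" for a
          using Cadd by (auto simp: lin_def)
      qed
      have eL: "comul C (a \<cdot> e0) (\<lambda>a1 a2. \<tau> a1 a2 (b \<cdot> e0)) = comul G a (\<lambda>a1 a2. \<sigma> a1 a2 b)"
        if "a \<in> carr G" "b \<in> carr G" for a b
      proof -
        have b: "(\<lambda>a1 a2. \<tau> a1 a2 (b \<cdot> e0)) \<in> bil HeS HeS" using that t3 by simp
        show ?thesis by (rule trans[OF comul_Ce[OF that(1) b]]) (simp only: comul_C[OF b] \<sigma>_def)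
      qed
      have eR: "comul C (b \<cdot> e0) (\<lambda>b1 b2. \<tau> (a \<cdot> e0) b1 b2) = comul G b (\<lambda>b1 b2. \<sigma> a b1 b2)"
        if "a \<in> carr G" "b \<in> carr G" for a b
      proof -
        have b: "\<tau> (a \<cdot> e0) \<in> bil HeS HeS" using that t1 by simp
        show ?thesis by (rule trans[OF comul_Ce[OF that(2) b]]) (simp only: comul_C[OF b] \<sigma>_def)
      qed
      have "comul C f (\<lambda>a b. comul C a (\<lambda>a1 a2. \<tau> a1 a2 b)) = comul G f (\<lambda>a b. comul G a (\<lambda>a1 a2. \<sigma> a1 a2 b))"
        unfolding comul_C[OF L] using fH eL
        by (intro comul_cong restr_form[OF L] form_cong[OF restr_form[OF L]]) auto
      also have "\<dots> = comul G f (\<lambda>a b. comul G b (\<lambda>b1 b2. \<sigma> a b1 b2))"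
        using fH s by (intro coass) auto
      also have "\<dots> = comul C f (\<lambda>a b. comul C b (\<lambda>b1 b2. \<tau> a b1 b2))"
        unfolding comul_C[OF R] using fH eR
        by (intro comul_cong restr_form[OF R] form_cong[OF restr_form[OF R]]) auto
      finally show ?thesis .
    qed
    show "comul C f (\<lambda>a b. counit C a * \<phi> b) = \<phi> f" if f: "f \<in> carr C" and p: "lin_on C ground \<phi>" for f \<phi>
    proof -
      have fH: "f \<in> He" and p': "lin HeS (*) \<phi>" using f p by (auto simp: C_simps lin_def)
      have b: "(\<lambda>a b. counit C a * \<phi> b) \<in> bil HeS HeS"
        using p' by (auto simp: bil_iff lin_def C_simps(5) algebra_simps)
      have l: "lin G (*) (\<lambda>b. \<phi> (b \<cdot> e0))" using p' by (auto simp: lin_def)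
      have b2: "(\<lambda>a b. counit G a * \<phi> (b \<cdot> e0)) \<in> bil G G"
        using l by (auto simp: bil_iff lin_def algebra_simps)
      have "comul C f (\<lambda>a b. counit C a * \<phi> b) = comul G f (\<lambda>a b. counit G a * \<phi> (b \<cdot> e0))"
        unfolding comul_C[OF b] using fH restr_form[OF b] b2 e0(2)
        by (intro comul_cong) (auto simp: C_simps(5) counit_m)
      then show ?thesis using counit_l[of f "\<lambda>b. \<phi> (b \<cdot> e0)"] l fH by simp
    qed
    show "comul C f (\<lambda>a b. \<phi> a * counit C b) = \<phi> f" if f: "f \<in> carr C" and p: "lin_on C ground \<phi>" for f \<phi>
    proof -
      have fH: "f \<in> He" and p': "lin HeS (*) \<phi>" using f p by (auto simp: C_simps lin_def)
      have b: "(\<lambda>a b. \<phi> a * counit C b) \<in> bil HeS HeS"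
        using p' by (auto simp: bil_iff lin_def C_simps(5) algebra_simps)
      have l: "lin G (*) (\<lambda>b. \<phi> (b \<cdot> e0))" using p' by (auto simp: lin_def)
      have b2: "(\<lambda>a b. \<phi> (a \<cdot> e0) * counit G b) \<in> bil G G"
        using l by (auto simp: bil_iff lin_def algebra_simps)
      have "comul C f (\<lambda>a b. \<phi> a * counit C b) = comul G f (\<lambda>a b. \<phi> (a \<cdot> e0) * counit G b)"
        unfolding comul_C[OF b] using fH restr_form[OF b] b2 e0(2)
        by (intro comul_cong) (auto simp: C_simps(5) counit_m)
      then show ?thesis using counit_r[of f "\<lambda>b. \<phi> (b \<cdot> e0)"] l fH by simp
    qed
    show "lin_on C ground (counit C)" by (auto simp: lin_def C_simps(1,2,5))
    show "counit C (uni C) = 1" using e0(2) by (simp add: C_simps)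
    show "counit C (mul C a b) = counit C a * counit C b" if "a \<in> carr C" "b \<in> carr C" for a b
      using that by (simp add: C_simps counit_m)
  qed
qed

end

locale inf_normal = normal_sub G N \<pi> + closed_field_scheme G
  for G :: "('k::alg_closed_field, 'h::ab_group_add) hopf" and N :: "('k, 'n::ab_group_add) hopf" and \<pi> +
  assumes infinitesimal_N: "infinitesimal N"
begin

text \<open>The image of \<open>e0\<close> is an idempotent of counit one in a local algebra. This
  is the inclusion of \<open>N\<close> in the connected component.\<close>

lemma pi_e0: "\<pi> e0 = uni N"
proof (rule N.infinitesimal_idempotent[OF infinitesimal_N])
  show "mul N (\<pi> e0) (\<pi> e0) = \<pi> e0" using pi_mul[of e0 e0] by simp
  have "counit N (\<pi> e0) = 1" using pi_counit[of e0] e0(2) by simp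
  then show "\<pi> e0 \<noteq> 0" using N.lin_on_0[OF N.counit_lin] by auto
qed simp

lemma pi_restr: "f \<in> carr G \<Longrightarrow> \<pi> (mul G f e0) = \<pi> f"
  using pi_mul[of f e0] pi_e0 N.mul_uni_right[of "\<pi> f"] by simp

lemma kN_A0: "x \<in> kN \<Longrightarrow> x \<in> A0"
proof (rule A0_I)
  fix h assume x: "x \<in> kN" and h: "h \<in> carr G"
  have "\<pi> (mul G h e0 - h) = 0" using lin_on_diff[OF pi_lin, of "mul G h e0" h] pi_restr[OF h] h by simp
  then have "x (mul G h e0 - h) = 0" using kN_0[OF x] h by simp
  then show "x (mul G h e0) = x h" using D_diff[of x "mul G h e0" h] x h by simp
qed simp

text \<open>Functionals on the connected component, extended to \<open>G\<close>; they form \<open>A0\<close>.\<close>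

definition up :: "('h \<Rightarrow> 'k) \<Rightarrow> 'h \<Rightarrow> 'k" where "up = push G (conn_restr G)"

definition down :: "('h \<Rightarrow> 'k) \<Rightarrow> 'h \<Rightarrow> 'k" where "down x = (\<lambda>f. if f \<in> He then x f else 0)"

abbreviation DC :: "('h \<Rightarrow> 'k) set" where "DC \<equiv> carr (dual_space C)"

lemma up_apply: "up x f = (if f \<in> carr G then x (mul G f e0) else 0)"
  by (simp add: up_def push_def conn_restr_def)

lemma DC_iff: "x \<in> DC \<longleftrightarrow> lin HeS (*) x \<and> (\<forall>f. f \<notin> He \<longrightarrow> x f = 0)"
  by (simp only: dual_carr C_simps(1,2) lin_def HeS_simps)

lemma DC_add: "x \<in> DC \<Longrightarrow> a \<in> He \<Longrightarrow> b \<in> He \<Longrightarrow> x (a + b) = x a + x b"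
  and DC_scal: "x \<in> DC \<Longrightarrow> a \<in> He \<Longrightarrow> x (scal G c a) = c * x a"
  and DC_off: "x \<in> DC \<Longrightarrow> f \<notin> He \<Longrightarrow> x f = 0"
  unfolding DC_iff lin_def HeS_simps by blast+

lemma up_A0: "x \<in> DC \<Longrightarrow> up x \<in> A0"
proof -
  assume x: "x \<in> DC"
  have "up x \<in> D" unfolding dual_carr[of "up x"] lin_def using x
    by (simp add: up_apply DC_add DC_scal)
  then show ?thesis by (rule A0_I) (simp add: up_apply mul_ass)
qed

lemma down_DC: "x \<in> D \<Longrightarrow> down x \<in> DC"
  using subspace_add[OF He_subspace] subspace_scale[OF He_subspace]
  unfolding DC_iff lin_def by (simp add: down_def)

lemma up_down:
  assumes x: "x \<in> A0" shows "up (down x) = x"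
proof
  fix f show "up (down x) f = x f"
    using A0_e0[OF x, of f] D_off[OF A0_D[OF x], of f] by (simp add: up_apply down_def)
qed

lemma closed_sub_C: "closed_sub C N \<pi>"
proof -
  interpret N: bialg N by unfold_locales
  interpret C: bialg C by (rule bialg_C)
  have "comul N (\<pi> a) = tmap N N \<pi> \<pi> (comul C a)" if a: "a \<in> He" for a
  proof
    fix \<beta>
    have "tmap N N \<pi> \<pi> (comul C a) \<beta> = tmap N N \<pi> \<pi> (comul G a) \<beta>"
    proof (cases "\<beta> \<in> bil N N")
      case True
      have b: "(\<lambda>a b. \<beta> (\<pi> a) (\<pi> b)) \<in> bil HeS HeS" "(\<lambda>a b. \<beta> (\<pi> a) (\<pi> b)) \<in> bil G G"
        using True by (auto simp: bil_iff lin_def)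
      have "comul C a (\<lambda>a b. \<beta> (\<pi> a) (\<pi> b)) = comul G a (\<lambda>a b. \<beta> (\<pi> a) (\<pi> b))"
        unfolding comul_C[OF b(1)] using a restr_form[OF b(1)] b(2)
        by (intro comul_cong) (auto simp: pi_restr)
      then show ?thesis using True by (simp add: tmap_apply)
    next
      case False
      have "(\<lambda>a b. 0) \<in> bil HeS HeS" by (simp add: bil_iff lin_def)
      then show ?thesis using False a by (simp add: tmap_apply comul_C comul_zero)
    qed
    then show "comul N (\<pi> a) \<beta> = tmap N N \<pi> \<pi> (comul C a) \<beta>" using pi_comul[of a] a by simp
  qed
  then have hom: "hopf_hom C N \<pi>"
    by (auto simp: hopf_hom_def C_simps(1,2,3,4,5) lin_on_def pi_e0 pi_mul pi_counit)
  have "\<pi> ` He = carr N"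
  proof (intro equalityI subsetI)
    fix m assume "m \<in> carr N"
    then obtain f where f: "f \<in> carr G" "m = \<pi> f" using surj_pi by (metis imageE)
    then show "m \<in> \<pi> ` He" using pi_restr by (intro image_eqI[of _ _ "mul G f e0"]) auto
  qed auto
  then show ?thesis using hom by unfold_locales (auto simp: C_simps(1))
qed

sublocale C: closed_sub C N \<pi> by (rule closed_sub_C)

lemma C_star: "x \<in> DC \<Longrightarrow> y \<in> DC \<Longrightarrow> f \<in> He \<Longrightarrow> C.star x y f = (up x \<star> up y) f"
proof -
  assume xy: "x \<in> DC" "y \<in> DC" and f: "f \<in> He"
  have b: "(\<lambda>a b. x a * y b) \<in> bil HeS HeS" using C.prod_bil[OF xy] bil_C by simp
  have "C.star x y f = comul C f (\<lambda>a b. x a * y b)" using f by (simp add: C.star_apply C_simps(1))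
  also have "\<dots> = comul G f (\<lambda>a b. x (mul G a e0) * y (mul G b e0))" by (rule comul_C[OF b])
  also have "\<dots> = (up x \<star> up y) f"
  proof -
    have "(\<lambda>a b. up x a * up y b) \<in> bil G G" using xy up_A0 by (intro prod_bil) auto
    then show ?thesis
      using f restr_form[OF b] by (auto simp: star_apply up_apply intro!: comul_cong)
  qed
  finally show ?thesis .
qed

lemma up_star: "x \<in> DC \<Longrightarrow> y \<in> DC \<Longrightarrow> up (C.star x y) = up x \<star> up y"
proof (rule D_ext)
  assume xy: "x \<in> DC" "y \<in> DC"
  show "up (C.star x y) \<in> D" "up x \<star> up y \<in> D"
    using xy up_A0 C.star_D by auto
  fix f assume f: "f \<in> carr G"
  then show "up (C.star x y) f = (up x \<star> up y) f"
    using xy C_star[OF xy, of "mul G f e0"] A0_e0[OF A0_star[OF up_A0[OF xy(1)] up_A0[OF xy(2)]] f]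
    by (simp add: up_apply)
qed

lemma up_kN: "y \<in> C.kN \<Longrightarrow> up y \<in> kN"
  unfolding kN_def mem_Collect_eq
proof (intro conjI ballI impI)
  assume y: "y \<in> C.kN"
  then have yD: "y \<in> DC" by simp
  then show "up y \<in> D" using up_A0 by simp
  fix f assume f: "f \<in> carr G" "\<pi> f = 0"
  then have "\<pi> (mul G f e0) = 0" using pi_restr by simp
  then have "y (mul G f e0) = 0" using C.kN_0[OF y] f by (simp add: C_simps(1))
  then show "up y f = 0" by (simp add: up_apply)
qed

lemma down_kN: "z \<in> kN \<Longrightarrow> down z \<in> C.kN"
  unfolding C.kN_def mem_Collect_eq
  using down_DC[of z] kN_0[of z] by (auto simp: C_simps(1) down_def)

text \<open>Left invariance is checked inside \<open>kG\<close>, where \<open>star_ad_anti\<close>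
  is available: right invariance is carried over by \<open>up\<close> and \<open>down\<close>, and
  the conjugates \<open>ad (anti v) (up y)\<close> stay in \<open>kN\<close>.\<close>

sublocale C: quot C N \<pi>
proof unfold_locales
  fix f x y assume f: "f \<in> carr C.Q" and x: "x \<in> DC" and y: "y \<in> C.kN"
  have fH: "f \<in> He" using C.Q_carr[OF f] by (simp add: C_simps(1))
  have fG: "f \<in> carr G" using fH by simp
  have uy: "up y \<in> kN" using up_kN y .
  then have uyD: "up y \<in> D" by simp
  have ux: "up x \<in> A0" using up_A0 x .
  have yD: "y \<in> DC" using y by simp
  have val: "(u \<star> z) f = u f * z (uni G)" if u: "u \<in> A0" and z: "z \<in> kN" for u z
  proof -
    have "(u \<star> z) f = C.star (down u) (down z) f"
      using C_star[of "down u" "down z" f] fH up_down[OF u] up_down[OF kN_A0[OF z]] down_DC u z by simp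
    also have "\<dots> = down u f * down z e0"
      using f down_DC[of u] down_kN[OF z] u by (simp add: C.Q_iff C_simps(4))
    also have "\<dots> = u f * z (uni G)"
      using fH A0_e0[OF kN_A0[OF z], of "uni G"] uni_in uni_mul by (simp add: down_def)
    finally show ?thesis .
  qed
  have "C.star y x f = (up y \<star> up x) f" using C_star[OF yD x fH] .
  also have "\<dots> = swe (*) (up x) (\<lambda>u v. (u \<star> ad (anti v) (up y)) f)"
    using ux uyD by (subst star_ad_anti) (auto simp: swe_fscale_apply)
  also have "\<dots> = swe (*) (up x) (\<lambda>u v. v (uni G) * (up y (uni G) * u f))"
  proof (rule swe_A0_cong[OF vector_space_mult ux])
    show "linD (*) (\<lambda>u. (u \<star> ad (anti v) (up y)) f)" for v
      using uyD by (auto simp: lin_def)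
    show "linD (*) (\<lambda>v. (u \<star> ad (anti v) (up y)) f)" if "u \<in> D" for u
      using that uyD lin_add[OF ad_lin[of "up y"]] lin_scal[OF ad_lin[of "up y"]] by (auto simp: lin_def)
    fix u v assume uv: "u \<in> A0" "v \<in> A0"
    then show "(u \<star> ad (anti v) (up y)) f = v (uni G) * (up y (uni G) * u f)"
      using val[OF uv(1) ad_kN[OF _ uy, of "anti v"]] uyD by (simp add: ad_uni)
  qed (auto simp: lin_def algebra_simps)
  also have "\<dots> = up y (uni G) * up x f"
    using ux by (intro swe_counit_right[OF _ vector_space_mult]) (auto simp: lin_def algebra_simps)
  also have "\<dots> = y (uni C) * x f"
    using uni_in fH uni_mul by (simp add: up_apply C_simps(4))
  finally show "C.star y x f = y (uni C) * x f" .
qed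

end

section \<open>Modules and their tensor products\<close>

context bialg begin

lemma mod_facts:
  assumes M: "scheme_module G M"
  shows "fdv M" and "x \<in> D \<Longrightarrow> m \<in> carr M \<Longrightarrow> act M x m \<in> carr M"
    and "x \<in> D \<Longrightarrow> m \<in> carr M \<Longrightarrow> m' \<in> carr M \<Longrightarrow> act M x (m + m') = act M x m + act M x m'"
    and "x \<in> D \<Longrightarrow> m \<in> carr M \<Longrightarrow> act M x (scal M c m) = scal M c (act M x m)"
    and "x \<in> D \<Longrightarrow> y \<in> D \<Longrightarrow> m \<in> carr M \<Longrightarrow> act M (x + y) m = act M x m + act M y m"
    and "x \<in> D \<Longrightarrow> m \<in> carr M \<Longrightarrow> act M (fscale c x) m = scal M c (act M x m)"
    and "x \<in> D \<Longrightarrow> y \<in> D \<Longrightarrow> m \<in> carr M \<Longrightarrow> act M (x \<star> y) m = act M x (act M y m)"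
    and "m \<in> carr M \<Longrightarrow> act M eps m = m"
proof -
  note d = M[unfolded fd_module_def carr_group_alg lin_on_def]
  have sc: "scal (group_alg G) = fscale" by (simp add: group_alg_def Let_def)
  show "fdv M" using d by unfold_locales blast
  show "x \<in> D \<Longrightarrow> m \<in> carr M \<Longrightarrow> act M x m \<in> carr M" using d by blast
  show "x \<in> D \<Longrightarrow> m \<in> carr M \<Longrightarrow> m' \<in> carr M \<Longrightarrow> act M x (m + m') = act M x m + act M x m'" using d by blast
  show "x \<in> D \<Longrightarrow> m \<in> carr M \<Longrightarrow> act M x (scal M c m) = scal M c (act M x m)" using d by blast
  show "x \<in> D \<Longrightarrow> y \<in> D \<Longrightarrow> m \<in> carr M \<Longrightarrow> act M (x + y) m = act M x m + act M y m" using d by blast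
  show "x \<in> D \<Longrightarrow> m \<in> carr M \<Longrightarrow> act M (fscale c x) m = scal M c (act M x m)" using d unfolding sc by blast
  show "x \<in> D \<Longrightarrow> y \<in> D \<Longrightarrow> m \<in> carr M \<Longrightarrow> act M (x \<star> y) m = act M x (act M y m)" using d by (simp add: star_def)
  show "m \<in> carr M \<Longrightarrow> act M eps m = m" using d by (simp add: eps_def)
qed

lemma scheme_moduleI:
  assumes "fin_dim_space M" "\<And>x m. x \<in> D \<Longrightarrow> m \<in> carr M \<Longrightarrow> act M x m \<in> carr M"
    and "\<And>x m m'. x \<in> D \<Longrightarrow> m \<in> carr M \<Longrightarrow> m' \<in> carr M \<Longrightarrow> act M x (m + m') = act M x m + act M x m'"
    and "\<And>x m c. x \<in> D \<Longrightarrow> m \<in> carr M \<Longrightarrow> act M x (scal M c m) = scal M c (act M x m)"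
    and "\<And>x y m. x \<in> D \<Longrightarrow> y \<in> D \<Longrightarrow> m \<in> carr M \<Longrightarrow> act M (x + y) m = act M x m + act M y m"
    and "\<And>x m c. x \<in> D \<Longrightarrow> m \<in> carr M \<Longrightarrow> act M (fscale c x) m = scal M c (act M x m)"
    and "\<And>x y m. x \<in> D \<Longrightarrow> y \<in> D \<Longrightarrow> m \<in> carr M \<Longrightarrow> act M (x \<star> y) m = act M x (act M y m)"
    and "\<And>m. m \<in> carr M \<Longrightarrow> act M eps m = m"
  shows "scheme_module G M"
proof -
  have sc: "scal (group_alg G) = fscale" by (simp add: group_alg_def Let_def)
  show ?thesis
    unfolding fd_module_def carr_group_alg lin_on_def sc using assms
    by (simp add: star_def[symmetric] eps_def[symmetric])
qed

lemma tensor_rep_simps: "carr (tensor_rep G M P) = ten_carr (bil M P) M P" "scal (tensor_rep G M P) = fscale"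
  by (simp_all add: tensor_rep_def tensor_carr)

lemma swe_ten_carr: "(\<And>u v. u \<in> D \<Longrightarrow> v \<in> D \<Longrightarrow> F u v \<in> ten_carr B V W) \<Longrightarrow> swe fscale x F \<in> ten_carr B V W"
  unfolding swe_def ten_carr_def by (intro fs.span_sum fs.span_scale) simp

lemma tensor_act_linear:
  "act (tensor_rep G M P) x (s + t) = act (tensor_rep G M P) x s + act (tensor_rep G M P) x t"
  "act (tensor_rep G M P) x (fscale c t) = fscale c (act (tensor_rep G M P) x t)"
  "act (tensor_rep G M P) x 0 = 0"
  by (simp_all add: tensor_rep_def fun_eq_iff)

lemma tensor_act_sum: "act (tensor_rep G M P) x (\<Sum>i\<in>I. F i) = (\<Sum>i\<in>I. act (tensor_rep G M P) x (F i))"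
  by (induction I rule: infinite_finite_induct)
    (simp_all only: sum.infinite sum.empty sum.insert tensor_act_linear not_False_eq_True)

lemma tensor_act_swe: "act (tensor_rep G M P) x (swe fscale y F) = swe fscale y (\<lambda>u v. act (tensor_rep G M P) x (F u v))"
  unfolding swe_def tensor_act_sum tensor_act_linear ..

context
  fixes M :: "('k, 'h \<Rightarrow> 'k, 'm::ab_group_add) rep" and P :: "('k, 'h \<Rightarrow> 'k, 'p::ab_group_add) rep"
  assumes M: "scheme_module G M" and P: "scheme_module G P"
begin

interpretation M: fdv M by (rule mod_facts[OF M])
interpretation P: fdv P by (rule mod_facts[OF P])

lemmas Ma = mod_facts(2-)[OF M]
lemmas Pa = mod_facts(2-)[OF P]

text \<open>Bridges the functional encoding of the diagonal action and Sweedler sums; bilinearity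
  has to be established at both levels before the nested \<open>lift\<close> can be
  evaluated.\<close>

lemma tensor_act_ten:
  assumes x: "x \<in> D" and mp: "m \<in> carr M" "p \<in> carr P"
  shows "act (tensor_rep G M P) x (ten (bil M P) m p) =
    swe fscale x (\<lambda>u v. ten (bil M P) (act M u m) (act P v p))"
proof
  let ?B = "bil M P"
  fix \<beta>
  show "act (tensor_rep G M P) x (ten ?B m p) \<beta> = swe fscale x (\<lambda>u v. ten ?B (act M u m) (act P v p)) \<beta>"
  proof (cases "\<beta> \<in> ?B")
    case True
    have e: "comul (group_alg G) x (\<lambda>a b. \<beta> (act M a m) (act P b p)) = swe (*) x (\<lambda>u v. \<beta> (act M u m) (act P v p))"
      if "m \<in> carr M" "p \<in> carr P" for m p
      using True that by (intro comul_group_alg[OF x]) (auto simp: bil_iff lin_def Ma Pa)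
    have "(\<lambda>m p. \<beta> (act M u m) (act P v p)) \<in> ?B" if "u \<in> D" "v \<in> D" for u v
      using that True by (auto simp: bil_iff lin_def Ma Pa)
    then have "(\<lambda>m p. swe (*) x (\<lambda>u v. \<beta> (act M u m) (act P v p))) \<in> ?B"
      unfolding bil_iff by (auto intro!: swe_lin_param vector_space_mult)
    then have "(\<lambda>m p. comul (group_alg G) x (\<lambda>a b. \<beta> (act M a m) (act P b p))) \<in> ?B"
      using e by (simp add: bil_iff lin_def)
    then show ?thesis using True e[OF mp] by (simp add: tensor_rep_def ten_def swe_fscale_apply)
  next
    case False
    have "comul (group_alg G) x (\<lambda>a b. 0) = 0"
      using comul_group_alg[OF x, of "\<lambda>a b. 0"] by (simp add: bil_iff lin_def swe_def)
    then show ?thesis using False by (simp add: tensor_rep_def ten_def swe_fscale_apply) (simp add: swe_def)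
  qed
qed

lemma ten_act_lin:
  assumes "m \<in> carr M" "p \<in> carr P"
  shows "v \<in> D \<Longrightarrow> linD fscale (\<lambda>u. ten (bil M P) (act M u m) (act P v p))"
    "u \<in> D \<Longrightarrow> linD fscale (\<lambda>v. ten (bil M P) (act M u m) (act P v p))"
  using assms
  by (intro lin_comp[OF lin_ten(1)[OF order_refl]] lin_comp[OF lin_ten(2)[OF order_refl]]; simp add: Ma Pa lin_def)+

lemma tensor_act_carr:
  assumes x: "x \<in> D" and t: "t \<in> ten_carr (bil M P) M P"
  shows "act (tensor_rep G M P) x t \<in> ten_carr (bil M P) M P"
  using t
proof (induction rule: ten_carr_induct)
  case (ten m p)
  then show ?case
    unfolding tensor_act_ten[OF x ten] by (intro swe_ten_carr ten_in) (simp_all add: Ma Pa)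
qed (simp_all only: tensor_act_linear ten_carr_closed)

lemma tensor_module: "scheme_module G (tensor_rep G M P)"
proof (rule scheme_moduleI)
  let ?T = "tensor_rep G M P" and ?B = "bil M P"
  note vs = vector_space_fscale
  show "fin_dim_space ?T"
    by (rule fin_dim_ten[OF order_refl M.fin_dim_V P.fin_dim_V]) (simp_all add: tensor_rep_simps)
  show "act ?T x t \<in> carr ?T" if "x \<in> D" "t \<in> carr ?T" for x t
    using that tensor_act_carr by (simp add: tensor_rep_simps)
  show "act ?T x (s + t) = act ?T x s + act ?T x t" for x s t by (rule tensor_act_linear)
  show "act ?T x (scal ?T c t) = scal ?T c (act ?T x t)" for x t c unfolding tensor_rep_simps by (rule tensor_act_linear)
  show "act ?T (x + y) t = act ?T x t + act ?T y t" if xy: "x \<in> D" "y \<in> D" and t: "t \<in> carr ?T" for x y t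
    using t unfolding tensor_rep_simps
  proof (induction rule: ten_carr_induct)
    case (ten m p)
    show ?case unfolding tensor_act_ten[OF xy(1) ten] tensor_act_ten[OF xy(2) ten] tensor_act_ten[OF dual_closed(1)[OF xy] ten]
      by (rule lin_add[OF swe_lin[OF vs] xy])
  qed (simp_all only: tensor_act_linear add.assoc add.left_commute add_0 fs.scale_right_distrib)
  show "act ?T (fscale c x) t = scal ?T c (act ?T x t)" if x: "x \<in> D" and t: "t \<in> carr ?T" for x t c
    using t unfolding tensor_rep_simps
  proof (induction rule: ten_carr_induct)
    case (ten m p)
    show ?case unfolding tensor_act_ten[OF x ten] tensor_act_ten[OF dual_closed(2)[OF x] ten]
      by (rule lin_scal[OF swe_lin[OF vs] x, simplified dual_scal])
  qed (simp_all only: tensor_act_linear fs.scale_right_distrib fs.scale_zero_right fs.scale_left_commute)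
  show "act ?T (x \<star> y) t = act ?T x (act ?T y t)" if xy: "x \<in> D" "y \<in> D" and t: "t \<in> carr ?T" for x y t
    using t unfolding tensor_rep_simps
  proof (induction rule: ten_carr_induct)
    case (ten m p)
    have "act ?T (x \<star> y) (ten ?B m p) =
        swe fscale x (\<lambda>x1 x2. swe fscale y (\<lambda>y1 y2. ten ?B (act M (x1 \<star> y1) m) (act P (x2 \<star> y2) p)))"
      unfolding tensor_act_ten[OF star_D[OF xy] ten] by (rule swe_star[OF vs xy ten_act_lin[OF ten]])
    also have "\<dots> = swe fscale x (\<lambda>x1 x2. swe fscale y (\<lambda>y1 y2. ten ?B (act M x1 (act M y1 m)) (act P x2 (act P y2 p))))"
      using ten by (intro swe_cong) (simp add: Ma Pa)
    also have "\<dots> = swe fscale y (\<lambda>y1 y2. swe fscale x (\<lambda>u v. ten ?B (act M u (act M y1 m)) (act P v (act P y2 p))))"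
      by (rule swe_swap[OF vs])
    also have "\<dots> = act ?T x (act ?T y (ten ?B m p))"
      unfolding tensor_act_ten[OF xy(2) ten] tensor_act_swe
      using ten by (intro swe_cong tensor_act_ten[OF xy(1), symmetric]) (simp_all add: Ma Pa)
    finally show ?case .
  qed (simp_all only: tensor_act_linear)
  show "act ?T eps t = t" if t: "t \<in> carr ?T" for t
    using t unfolding tensor_rep_simps
  proof (induction rule: ten_carr_induct)
    case (ten m p)
    show ?case unfolding tensor_act_ten[OF eps_D ten] using swe_eps[OF vs ten_act_lin[OF ten]] ten by (simp add: Ma Pa)
  qed (simp_all only: tensor_act_linear)
qed

end

end

context quot begin

lemma inflate_simps: "carr (inflate K N \<pi> R) = carr R" "scal (inflate K N \<pi> R) = scal R"
  "act (inflate K N \<pi> R) x = act R (res x)"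
  by (simp_all add: inflate_def pull_rep_def res_def)

lemma inflate_module:
  assumes R: "fd_module (group_alg Q) R"
  shows "scheme_module K (inflate K N \<pi> R)"
proof -
  note d = R[unfolded fd_module_def kQ_simps lin_on_def]
  have m: "mul (group_alg Q) (res x) (res y) = res (x \<star> y)" if "x \<in> D" "y \<in> D" for x y using that by (rule mul_kQ_res)
  show ?thesis
  proof (rule scheme_moduleI, unfold inflate_simps)
    show "fin_dim_space (inflate K N \<pi> R)"
      using d by (simp add: fin_dim_space_def inflate_simps)
    show "act R (res (x \<star> y)) m = act R (res x) (act R (res y) m)" if "x \<in> D" "y \<in> D" "m \<in> carr R" for x y m
      unfolding m[OF that(1,2), symmetric] using d that by simp
    show "act R (res eps) m = m" if "m \<in> carr R" for m
      using d that by (simp add: uni_kQ)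
  qed (use d res_D in \<open>simp_all\<close>)
qed

lemma inflate_kN:
  assumes R: "fd_module (group_alg Q) R" and y: "y \<in> kN" and p: "p \<in> carr R"
  shows "act (inflate K N \<pi> R) y p = scal R (y (uni K)) p"
proof -
  note d = R[unfolded fd_module_def kQ_simps lin_on_def]
  have "res y = fscale (y (uni K)) (res eps)"
    using res_star_kN[OF eps_D y] y by simp
  moreover have "act R (fscale (y (uni K)) (res eps)) p = scal R (y (uni K)) (act R (res eps) p)"
    using d p res_D[OF eps_D] by simp
  ultimately show ?thesis using d p by (simp add: inflate_simps uni_kQ)
qed

lemma characters_uni: "uni K \<in> characters Q"
  unfolding characters_iff Q_iff using uni_in counit_1 by simp

lemma character_kN: "g \<in> characters Q \<Longrightarrow> y \<in> kN \<Longrightarrow> y g = y (uni K)"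
proof -
  assume g: "g \<in> characters Q" and y: "y \<in> kN"
  have gQ: "g \<in> carr Q" "counit K g = 1" using g by (simp_all add: characters_iff)
  have "(eps \<star> y) g = eps g * y (uni K)" using Q_iff[THEN iffD1, OF gQ(1)] y eps_D by blast
  moreover have "eps g = 1" using gQ by (simp add: eps_def')
  ultimately show ?thesis using eps_left[OF kN_D[OF y]] by simp
qed

lemma characters_mult:
  assumes a: "a \<in> characters Q" and b: "b \<in> characters Q"
  shows "mul K a b \<in> characters Q"
proof -
  have c: "a \<in> carr K" "b \<in> carr K" using a b by (simp_all add: characters_iff)
  have st: "(x \<star> y) (mul K a b) = x (mul K a b) * y (mul K a b)" if xy: "x \<in> D" "y \<in> D" for x y
  proof -
    have "(x \<star> y) (mul K a b) = swe (*) x (\<lambda>x1 x2. swe (*) y (\<lambda>y1 y2. (x1 \<star> y1) a * (x2 \<star> y2) b))"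
      by (rule swe_star_eval[OF xy c])
    also have "\<dots> = swe (*) x (\<lambda>x1 x2. swe (*) y (\<lambda>y1 y2. (x1 a * x2 b) * (y1 a * y2 b)))"
      using a b by (intro swe_cong) (simp add: characters_iff)
    also have "\<dots> = x (mul K a b) * y (mul K a b)"
      using xy c by (simp add: swe_mult_left swe_mult_right swe_eval)
    finally show ?thesis .
  qed
  have "y (mul K a b) = y (uni K)" if y: "y \<in> kN" for y
  proof -
    have "y (mul K a b) = swe (*) y (\<lambda>u v. u a * v b)" using y c by (simp add: swe_eval)
    also have "\<dots> = swe (*) y (\<lambda>u v. u (uni K) * v (uni K))"
      using a b by (intro swe_kN_cong[OF vector_space_mult y]) (auto simp: lin_def algebra_simps character_kN)
    also have "\<dots> = y (uni K)" using y uni_in by (simp add: swe_eval uni_mul)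
    finally show ?thesis .
  qed
  then have "mul K a b \<in> carr Q" using c st by (auto simp: Q_iff)
  moreover have "counit K (mul K a b) = 1" using a b c by (simp add: counit_m characters_iff)
  ultimately show ?thesis using st by (simp add: characters_iff)
qed

lemma character_module:
  assumes g: "g \<in> characters Q"
  shows "fd_module (group_alg Q) (char_rep g :: ('a, 'b \<Rightarrow> 'a, 'a) rep)"
proof -
  have gQ: "g \<in> carr Q" using g by (simp add: characters_iff)
  interpret v: vector_space "(*) :: 'a \<Rightarrow> 'a \<Rightarrow> 'a" by (rule vector_space_mult)
  have "v.span {1} = UNIV"
    unfolding v.span_singleton by (auto intro: image_eqI[of _ _ "_ :: 'a"])
  then have fd: "fin_dim_space (char_rep g :: ('a, 'b \<Rightarrow> 'a, 'a) rep)"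
    unfolding fin_dim_space_def char_rep_def by (auto intro!: exI[of _ "{1}"] simp: vector_space_mult)
  have m: "mul (group_alg Q) x y g = x g * y g" if "x \<in> DQ" "y \<in> DQ" for x y
    using that g gQ by (simp add: mul_kQ res_apply characters_iff ext_apply)
  have u: "uni (group_alg Q) g = 1"
    using g gQ by (simp add: uni_kQ res_apply eps_def' characters_iff)
  show ?thesis
    unfolding fd_module_def kQ_simps(1)
  proof (intro conjI ballI fd)
    show "lin_on (char_rep g) (char_rep g) (act (char_rep g) x)" for x
      by (simp add: lin_on_def char_rep_def distrib_left mult.left_commute)
    show "lin_on (group_alg Q) (char_rep g) (\<lambda>x. act (char_rep g) x c)" for c :: 'a
      unfolding lin_on_def kQ_simps char_rep_def rep.simps space.simps
      by (intro conjI ballI allI) (simp_all only: UNIV_I plus_fun_apply distrib_right fscale_apply mult.assoc)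
    show "act (char_rep g) (uni (group_alg Q)) c = c" for c by (simp add: char_rep_def u)
    show "act (char_rep g) (mul (group_alg Q) x y) c = act (char_rep g) x (act (char_rep g) y c)"
      if "x \<in> DQ" "y \<in> DQ" for x y c
      using that by (simp add: char_rep_def m)
  qed
qed

end

section \<open>Endomorphisms commuting with \<open>N\<close>\<close>

context inf_normal begin

notation star (infixl "\<star>" 70)

text \<open>Lets computations with modules over the component be carried out in \<open>kG\<close>.
  Elements of \<open>A0\<close> expand in the images under \<open>up\<close> of the dual basis of
  \<open>C\<close>.\<close>

lemma swe_C:
  assumes s: "vector_space s" and x: "x \<in> DC"
    and F: "\<And>v. v \<in> D \<Longrightarrow> linD s (\<lambda>u. F u v)" "\<And>u. u \<in> D \<Longrightarrow> linD s (F u)"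
  shows "C.swe s x (\<lambda>u v. F (up u) (up v)) = swe s (up x) F"
proof -
  interpret s: vector_space s by fact
  let ?c = "\<lambda>a. up (C.du a)"
  have cA: "?c a \<in> A0" for a using up_A0 by simp
  have cD: "?c a \<in> D" for a using cA by simp
  have ex: "u = (\<Sum>a\<in>C.bas. fscale (u a) (?c a))" if u: "u \<in> A0" for u
  proof (rule D_ext)
    show "u \<in> D" using u by simp
    show "(\<Sum>a\<in>C.bas. fscale (u a) (?c a)) \<in> D" using cD by (intro dual.sum_carr) simp
    fix f assume f: "f \<in> carr G"
    have fe: "mul G f e0 \<in> carr C" using f by (simp add: C_simps(1))
    have "u f = u (mul G f e0)" using A0_e0[OF u f] by simp
    also have "\<dots> = down u (mul G f e0)" using f by (simp add: down_def)
    also have "\<dots> = (\<Sum>b\<in>C.bas. C.du b (mul G f e0) * down u b)"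
      using C.dual_expand[OF down_DC fe] u by simp
    also have "\<dots> = (\<Sum>b\<in>C.bas. C.du b (mul G f e0) * u b)"
      using C.bas_carr by (intro sum.cong) (auto simp: down_def C_simps(1))
    also have "\<dots> = (\<Sum>a\<in>C.bas. fscale (u a) (?c a)) f"
      using f by (simp add: sum_fun_apply up_apply mult.commute)
    finally show "u f = (\<Sum>a\<in>C.bas. fscale (u a) (?c a)) f" .
  qed
  have Fex: "F u v = (\<Sum>a\<in>C.bas. \<Sum>b\<in>C.bas. s (u a * v b) (F (?c a) (?c b)))" if uv: "u \<in> A0" "v \<in> A0" for u v
  proof -
    have l1: "linD s (\<lambda>u. F u v)" using F(1) uv by simp
    have l2: "linD s (F (?c a))" for a using F(2) cD by simp
    have "F u v = F (\<Sum>a\<in>C.bas. fscale (u a) (?c a)) v" using ex[OF uv(1)] by simp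
    also have "\<dots> = (\<Sum>a\<in>C.bas. F (fscale (u a) (?c a)) v)"
      using dual.lin_sum[OF l1, of C.bas "\<lambda>a. fscale (u a) (?c a)"] cD by simp
    also have "\<dots> = (\<Sum>a\<in>C.bas. s (u a) (F (?c a) v))"
      using lin_scal[OF l1 cD] by simp
    also have "\<dots> = (\<Sum>a\<in>C.bas. s (u a) (F (?c a) (\<Sum>b\<in>C.bas. fscale (v b) (?c b))))" using ex[OF uv(2)] by simp
    also have "\<dots> = (\<Sum>a\<in>C.bas. s (u a) (\<Sum>b\<in>C.bas. F (?c a) (fscale (v b) (?c b))))"
      using dual.lin_sum[OF l2, of C.bas "\<lambda>b. fscale (v b) (?c b)"] cD by simp
    also have "\<dots> = (\<Sum>a\<in>C.bas. s (u a) (\<Sum>b\<in>C.bas. s (v b) (F (?c a) (?c b))))"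
      using lin_scal[OF l2 cD] by simp
    finally show ?thesis by (simp add: s.scale_sum_right)
  qed
  have bc: "b \<in> He" if "b \<in> C.bas" for b using C.bas_carr[OF that] by (simp add: C_simps(1))
  have l1: "linD s (\<lambda>u. \<Sum>a\<in>C.bas. \<Sum>b\<in>C.bas. s (u a * v b) (F (?c a) (?c b)))" for v
    by (intro lin_sum_fun[OF s] lin_scale_left[OF s]) (simp add: lin_def algebra_simps)
  have l2: "linD s (\<lambda>v. \<Sum>a\<in>C.bas. \<Sum>b\<in>C.bas. s (u a * v b) (F (?c a) (?c b)))" for u
    by (intro lin_sum_fun[OF s] lin_scale_left[OF s]) (simp add: lin_def algebra_simps)
  have "swe s (up x) F = swe s (up x) (\<lambda>u v. \<Sum>a\<in>C.bas. \<Sum>b\<in>C.bas. s (u a * v b) (F (?c a) (?c b)))"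
    by (rule swe_A0_cong[OF s up_A0[OF x] F l1 l2 Fex])
  also have "\<dots> = (\<Sum>a\<in>C.bas. \<Sum>b\<in>C.bas. s (swe (*) (up x) (\<lambda>u v. u a * v b)) (F (?c a) (?c b)))"
    by (simp only: swe_sum[OF s]) (simp add: swe_def s.scale_sum_left)
  also have "\<dots> = (\<Sum>a\<in>C.bas. \<Sum>b\<in>C.bas. s (x (mul C a b)) (F (?c a) (?c b)))"
    using up_A0[OF x] bc by (intro sum.cong refl) (simp add: swe_eval up_apply C_simps(3))
  finally show ?thesis by (simp add: C.swe_def)
qed

end

locale regular_module = inf_normal G N \<pi>
  for G :: "('k::alg_closed_field, 'h::ab_group_add) hopf" and N :: "('k, 'n::ab_group_add) hopf" and \<pi> +
  fixes M :: "('k, 'h \<Rightarrow> 'k, 'm::ab_group_add) rep"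
  assumes mult: "multiplicative C.Q" and mod: "scheme_module G M"
    and indec: "indecomposable (group_alg C) (res_conn G M)"
    and reg: "quot_regular C N \<pi> (res_conn G M)"
begin

sublocale M: fdv M by (rule mod_facts[OF mod])
sublocale M: fdv_closed M by unfold_locales

lemmas Ma [simp] = mod_facts(2-)[OF mod]

abbreviation X :: "'h set" where "X \<equiv> characters C.Q"

abbreviation sw where "sw \<equiv> swe (scal M)"

lemma vsM: "vector_space (scal M)" by (rule M.vector_space_axioms)

lemma X_He: "l \<in> X \<Longrightarrow> l \<in> He"
  using C.Q_carr[of l] by (simp add: C.characters_iff C_simps(1))

lemma X_carr [simp]: "l \<in> X \<Longrightarrow> l \<in> carr G" using X_He by simp

lemma X_star: "l \<in> X \<Longrightarrow> x \<in> A0 \<Longrightarrow> y \<in> A0 \<Longrightarrow> (x \<star> y) l = x l * y l"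
proof -
  assume l: "l \<in> X" and xy: "x \<in> A0" "y \<in> A0"
  have "C.star (down x) (down y) l = down x l * down y l"
    using l down_DC xy by (simp add: C.characters_iff)
  moreover have "down x l = x l" "down y l = y l" using X_He[OF l] by (simp_all add: down_def)
  moreover have "C.star (down x) (down y) l = (x \<star> y) l"
    using C_star[OF down_DC down_DC, of x y] xy X_He[OF l] by (simp only: up_down A0_D)
  ultimately show ?thesis by simp
qed

lemma X_counit: "l \<in> X \<Longrightarrow> counit G l = 1" by (simp add: C.characters_iff C_simps(5))

lemma e0_X: "e0 \<in> X" using C.characters_uni by (simp add: C_simps(4))

lemma X_mult: "a \<in> X \<Longrightarrow> b \<in> X \<Longrightarrow> mul G a b \<in> X" using C.characters_mult by (simp add: C_simps(3))

lemma A0_e0_uni: "x \<in> A0 \<Longrightarrow> x e0 = x (uni G)"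
  using A0_e0[of x "uni G"] uni_in uni_mul by simp

text \<open>Cancels \<open>b\<close> by locality: \<open>b\<close> is \<open>e0\<close> minus an
  element \<open>n\<close> of the nilpotent maximal ideal, and \<open>z = e0 - a\<close> satisfies
  \<open>z = n z\<close>, hence is zero.\<close>

lemma X_cancel:
  assumes a: "a \<in> X" and b: "b \<in> X" and ab: "mul G a b = b"
  shows "a = e0"
proof -
  interpret E: fdv HeS by (rule fdv_HeS)
  define z where "z = e0 - a"
  define n where "n = e0 - b"
  have zn: "z \<in> He" "n \<in> He" using X_He a b subspace_diff[OF He_subspace] by (auto simp: z_def n_def)
  have "counit G n = 0" using X_counit[OF b] e0(2) b by (simp add: n_def counit_diff)
  then obtain k where k: "((\<lambda>g. mul G n g) ^^ k) z = 0"
    using He_local[OF zn(2)] zn unfolding E.nilp_def by auto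
  have be: "mul G e0 b = b" using X_He[OF b] mul_com[of e0 b] by simp
  have ze: "mul G z e0 = z" using zn by simp
  have "mul G z b = 0" using a b ab be by (simp add: z_def mul_diff)
  then have "mul G z n = z" using zn ze b by (simp add: n_def mul_diff)
  then have nz: "mul G n z = z" using mul_com[of n z] zn by simp
  have "((\<lambda>g. mul G n g) ^^ j) z = z" for j by (induction j) (auto simp: nz)
  then show ?thesis using k by (simp add: z_def)
qed

lemma act_lin: "x \<in> D \<Longrightarrow> lin M (scal M) (act M x)" "m \<in> carr M \<Longrightarrow> linD (scal M) (\<lambda>x. act M x m)"
  by (auto simp: lin_def)

lemma sw_carr: "(\<And>u v. u \<in> D \<Longrightarrow> v \<in> D \<Longrightarrow> F u v \<in> carr M) \<Longrightarrow> sw x F \<in> carr M"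
  by (rule swe_carr[OF M.fdv_axioms])

lemma sw_map: "lin M (scal M) T \<Longrightarrow> (\<And>u v. u \<in> D \<Longrightarrow> v \<in> D \<Longrightarrow> F u v \<in> carr M) \<Longrightarrow> T (sw x F) = sw x (\<lambda>u v. T (F u v))"
  by (rule swe_map[OF M.fdv_axioms])

text \<open>The \<open>N\<close>-endomorphisms of weight \<open>l\<close> for the adjoint action of \<open>G\<^sup>0/N\<close>; they are the
  \<open>G\<^sup>0\<close>-homomorphisms \<open>M \<otimes> k\<^sub>l \<rightarrow> M\<close>.\<close>

definition Wt :: "'h \<Rightarrow> ('m \<Rightarrow> 'm) set" where
  "Wt l = {F. lin_on M M F \<and> (\<forall>x\<in>A0. \<forall>m\<in>carr M. act M x (F m) = sw x (\<lambda>u v. scal M (u l) (F (act M v m))))}"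

lemma Wt_lin: "F \<in> Wt l \<Longrightarrow> lin_on M M F" by (simp add: Wt_def)

lemma Wt_act: "F \<in> Wt l \<Longrightarrow> x \<in> A0 \<Longrightarrow> m \<in> carr M \<Longrightarrow> act M x (F m) = sw x (\<lambda>u v. scal M (u l) (F (act M v m)))"
  by (simp add: Wt_def)

lemma endo [simp]:
  assumes "lin_on M M F"
  shows "m \<in> carr M \<Longrightarrow> F m \<in> carr M" "m \<in> carr M \<Longrightarrow> m' \<in> carr M \<Longrightarrow> F (m + m') = F m + F m'"
    "m \<in> carr M \<Longrightarrow> F (scal M c m) = scal M c (F m)"
  using assms by (auto simp: lin_on_def)

lemma endo_lin: "lin_on M M F \<Longrightarrow> lin M (scal M) F" by (simp add: lin_on_lin)

lemma wt_bilin: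
  assumes F: "lin_on M M F" and m: "m \<in> carr M"
  shows "linD (scal M) (\<lambda>u. scal M (u l) (F (act M v m)))"
    "linD (scal M) (\<lambda>v. scal M (u l) (F (act M v m)))"
  using F m by (auto simp: lin_def M.scale_left_distrib M.scale_right_distrib mult.commute)

text \<open>The trivial character is the counit on \<open>A0\<close>, so degree one consists of the
  endomorphisms over the connected component.\<close>

lemma Wt_one_iff: "F \<in> Wt e0 \<longleftrightarrow> lin_on M M F \<and> (\<forall>x\<in>A0. \<forall>m\<in>carr M. act M x (F m) = F (act M x m))"
proof -
  have "sw x (\<lambda>u v. scal M (u e0) (F (act M v m))) = F (act M x m)"
    if F: "lin_on M M F" and x: "x \<in> A0" and m: "m \<in> carr M" for F x m
  proof -
    have "sw x (\<lambda>u v. scal M (u e0) (F (act M v m))) = sw x (\<lambda>u v. scal M (u (uni G)) (F (act M v m)))"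
      by (rule swe_A0_cong[OF vsM x wt_bilin[OF F m] wt_bilin[OF F m]]) (simp add: A0_e0_uni)
    also have "\<dots> = F (act M x m)"
      using F m x by (intro swe_counit_left[OF _ vsM]) (auto simp: lin_def)
    finally show ?thesis .
  qed
  then show ?thesis by (auto simp: Wt_def)
qed

text \<open>Applying both weight conditions and coassociativity brings \<open>u a * p b\<close> onto
  the coproduct of one component, where it evaluates to the product character.\<close>

lemma Wt_comp:
  assumes a: "a \<in> X" and b: "b \<in> X" and F: "F \<in> Wt a" and G': "G' \<in> Wt b"
  shows "(\<lambda>m. F (G' m)) \<in> Wt (mul G a b)"
proof -
  note lF = Wt_lin[OF F] and lG = Wt_lin[OF G']
  have "act M x (F (G' m)) = sw x (\<lambda>u v. scal M (u (mul G a b)) (F (G' (act M v m))))"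
    if x: "x \<in> A0" and m: "m \<in> carr M" for x m
  proof -
    have xD: "x \<in> D" using x by simp
    have Gm: "G' m \<in> carr M" using lG m by simp
    have inner: "F (sw v (\<lambda>p q. scal M (p b) (G' (act M q m)))) = sw v (\<lambda>p q. scal M (p b) (F (G' (act M q m))))" for v
    proof -
      have "F (sw v (\<lambda>p q. scal M (p b) (G' (act M q m)))) = sw v (\<lambda>p q. F (scal M (p b) (G' (act M q m))))"
        using lG m by (intro sw_map[OF endo_lin[OF lF]]) simp
      also have "\<dots> = sw v (\<lambda>p q. scal M (p b) (F (G' (act M q m))))"
        using lF lG m by (intro swe_cong) simp
      finally show ?thesis .
    qed
    have "act M x (F (G' m)) = sw x (\<lambda>u v. scal M (u a) (F (act M v (G' m))))"
      by (rule Wt_act[OF F x Gm])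
    also have "\<dots> = sw x (\<lambda>u v. scal M (u a) (F (sw v (\<lambda>p q. scal M (p b) (G' (act M q m))))))"
    proof (rule swe_A0_cong[OF vsM x wt_bilin[OF lF Gm]])
      fix u v
      show "linD (scal M) (\<lambda>u. scal M (u a) (F (sw v (\<lambda>p q. scal M (p b) (G' (act M q m))))))"
        by (intro lin_scale_left[OF vsM]) (simp add: lin_def)
      show "linD (scal M) (\<lambda>v. scal M (u a) (F (sw v (\<lambda>p q. scal M (p b) (G' (act M q m))))))"
        unfolding inner by (intro lin_scale_const[OF vsM] swe_lin[OF vsM])
      assume "u \<in> A0" "v \<in> A0"
      then show "scal M (u a) (F (act M v (G' m))) = scal M (u a) (F (sw v (\<lambda>p q. scal M (p b) (G' (act M q m)))))"
        using Wt_act[OF G' _ m, of v] by simp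
    qed
    also have "\<dots> = sw x (\<lambda>u v. sw v (\<lambda>p q. scal M (u a * p b) (F (G' (act M q m)))))"
      unfolding inner by (intro swe_cong) (simp add: swe_def M.scale_sum_right mult_ac)
    also have "\<dots> = sw x (\<lambda>w q. sw w (\<lambda>u p. scal M (u a * p b) (F (G' (act M q m)))))"
      by (rule swe_coassoc[OF vsM xD, symmetric])
    also have "\<dots> = sw x (\<lambda>w q. scal M (w (mul G a b)) (F (G' (act M q m))))"
    proof (rule swe_cong)
      fix w q assume "w \<in> D"
      have "sw w (\<lambda>u p. scal M (u a * p b) (F (G' (act M q m)))) = scal M (swe (*) w (\<lambda>u p. u a * p b)) (F (G' (act M q m)))"
        by (simp add: swe_def M.scale_sum_left)
      then show "sw w (\<lambda>u p. scal M (u a * p b) (F (G' (act M q m)))) = scal M (w (mul G a b)) (F (G' (act M q m)))"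
        using \<open>w \<in> D\<close> a b by (simp add: swe_eval)
    qed
    finally show ?thesis .
  qed
  then show ?thesis using M.lin_on_comp[OF lF lG] by (simp add: Wt_def)
qed

lemma res_conn_simps: "carr (res_conn G M) = carr M" "scal (res_conn G M) = scal M"
  "act (res_conn G M) x = act M (up x)"
  by (simp_all add: res_conn_def pull_rep_def up_def)

lemma indec_split:
  assumes U: "M.subspace U" "U \<subseteq> carr M" "\<And>x u. x \<in> A0 \<Longrightarrow> u \<in> U \<Longrightarrow> act M x u \<in> U"
    and W: "M.subspace W" "W \<subseteq> carr M" "\<And>x u. x \<in> A0 \<Longrightarrow> u \<in> W \<Longrightarrow> act M x u \<in> W"
    and "U \<inter> W = {0}" "{u + w | u w. u \<in> U \<and> w \<in> W} = carr M"
  shows "U = {0} \<or> W = {0}"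
proof -
  have "submodule (group_alg C) (res_conn G M) U" "submodule (group_alg C) (res_conn G M) W"
    unfolding submodule_def res_conn_simps C.carr_group_alg using U W up_A0 by blast+
  then show ?thesis using indec assms(7,8) by (simp add: indecomposable_def res_conn_simps)
qed

lemma Wt_funpow: "F \<in> Wt e0 \<Longrightarrow> (F ^^ n) \<in> Wt e0"
proof (induction n)
  case (Suc n)
  have n: "lin_on M M (F ^^ n)" "act M x ((F ^^ n) m) = (F ^^ n) (act M x m)" if "x \<in> A0" "m \<in> carr M" for x m
    using Suc that by (simp_all add: Wt_one_iff)
  have F: "lin_on M M F" "act M x (F m) = F (act M x m)" if "x \<in> A0" "m \<in> carr M" for x m
    using Suc.prems that by (simp_all add: Wt_one_iff)
  have "act M x (F ((F ^^ n) m)) = F ((F ^^ n) (act M x m))" if "x \<in> A0" "m \<in> carr M" for x m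
    using F(2)[OF that(1) endo(1)[OF n(1)[OF that] that(2)]] n(2)[OF that] by simp
  then show ?case using M.lin_on_funpow[OF Wt_lin[OF Suc.prems], of "Suc n"] by (simp add: Wt_one_iff comp_def)
qed (simp add: Wt_one_iff M.lin_on_id id_def)

text \<open>Subtract an eigenvalue. The Fitting components of the difference are submodules over the
  connected component; the kernel part is nonzero, so indecomposability kills the image
  part.\<close>

lemma Wt_one_nilp:
  assumes F: "F \<in> Wt e0"
  shows "\<exists>c. M.nilp (\<lambda>v. F v - scal M c v)"
proof -
  have lF: "lin_on M M F" using Wt_lin F .
  have nz: "carr M \<noteq> {0}" using indec by (simp add: indecomposable_def res_conn_simps)
  have "F ` carr M \<subseteq> carr M" using lF by auto
  then obtain c v where v: "v \<in> carr M" "v \<noteq> 0" "F v = scal M c v"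
    using M.eigenvector_ex[OF lF M.subspace_carr order_refl nz] by blast
  define H where "H = (\<lambda>v. F v - scal M c v)"
  have lH: "lin_on M M H" unfolding H_def by (intro M.lin_on_minus lF M.lin_on_scaled M.lin_on_id)
  have "act M x (F m - scal M c m) = F (act M x m) - scal M c (act M x m)" if "x \<in> A0" "m \<in> carr M" for x m
  proof -
    have "lin_on M M (act M x)" using A0_D[OF that(1)] unfolding lin_on_def by simp
    from M.lin_on_diff[OF this, of "F m" "scal M c m"] show ?thesis
      using F that lF by (simp add: Wt_one_iff)
  qed
  then have HW: "H \<in> Wt e0" using lH by (simp add: Wt_one_iff H_def)
  obtain n where n: "n > 0" "{u \<in> carr M. (H ^^ n) u = 0} \<inter> (H ^^ n) ` carr M = {0}"
    "{u + w | u w. u \<in> {u \<in> carr M. (H ^^ n) u = 0} \<and> w \<in> (H ^^ n) ` carr M} = carr M"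
    using M.fitting[OF lH] by blast
  have HnW: "(H ^^ n) \<in> Wt e0" by (rule Wt_funpow[OF HW])
  note lHn = Wt_lin[OF HnW]
  have act0: "act M x 0 = 0" if "x \<in> A0" for x using M.lin_0[OF act_lin(1)] that by simp
  have "{u \<in> carr M. (H ^^ n) u = 0} = {0} \<or> (H ^^ n) ` carr M = {0}"
  proof (rule indec_split[OF _ _ _ _ _ _ n(2,3)])
    show "M.subspace {u \<in> carr M. (H ^^ n) u = 0}"
      by (rule M.subspace_kernel[OF lHn]) auto
    show "M.subspace ((H ^^ n) ` carr M)"
      by (rule M.subspace_image[OF lHn]) auto
    show "act M x u \<in> {u \<in> carr M. (H ^^ n) u = 0}" if "x \<in> A0" "u \<in> {u \<in> carr M. (H ^^ n) u = 0}" for x u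
      using that HnW act0 by (auto simp: Wt_one_iff) (metis A0_D)
    show "act M x u \<in> (H ^^ n) ` carr M" if xu: "x \<in> A0" "u \<in> (H ^^ n) ` carr M" for x u
    proof -
      obtain m where m: "m \<in> carr M" "u = (H ^^ n) m" using xu(2) by blast
      then show ?thesis using HnW xu by (intro image_eqI[of _ _ "act M x m"]) (auto simp: Wt_one_iff)
    qed
  qed (use lHn in auto)
  moreover have "{u \<in> carr M. (H ^^ n) u = 0} \<noteq> {0}"
  proof -
    obtain k where k: "n = Suc k" using n(1) by (cases n) auto
    have "H v = 0" using v by (simp add: H_def)
    then have "(H ^^ n) v = 0" unfolding k funpow_Suc_right comp_def
      using M.lin_on_0[OF M.lin_on_funpow[OF lH]] by simp
    then show ?thesis using v by auto
  qed
  ultimately have "(H ^^ n) ` carr M = {0}" by blast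
  then have "M.nilp H" unfolding M.nilp_def by blast
  then show ?thesis unfolding H_def by blast
qed

text \<open>An injective \<open>F\<close> is bijective and, composed with the identification of
  \<open>M \<otimes> k\<close> with \<open>M\<close>, is an isomorphism from
  \<open>M \<otimes> k_l\<close> to \<open>M\<close>, which regularity allows only for the trivial
  character.\<close>

lemma Wt_regular:
  assumes l: "l \<in> X" "l \<noteq> e0" and F: "F \<in> Wt l"
  shows "\<exists>v\<in>carr M. v \<noteq> 0 \<and> F v = 0"
proof (rule ccontr)
  assume no: "\<not> ?thesis"
  note lF = Wt_lin[OF F]
  let ?R = "res_conn G M" and ?I = "inflate C N \<pi> (char_rep l) :: ('k, 'h \<Rightarrow> 'k, 'k) rep"
  let ?T = "tensor_rep C ?R ?I"
  have R: "scheme_module C ?R" using indec by (simp add: indecomposable_def)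
  have I: "scheme_module C ?I" by (rule C.inflate_module[OF C.character_module[OF l(1)]])
  have bilI: "bil ?R ?I = bil M ?I" by (simp only: bil_def lin_on_def res_conn_simps)
  have I_simps: "carr ?I = UNIV" "scal ?I = (*)" by (simp_all add: C.inflate_simps char_rep_def)
  have I_act: "act ?I v c = v l * c" if "v \<in> DC" for v c
    using l(1) by (simp add: C.inflate_simps char_rep_def C.res_apply C.characters_iff)
  have carrT: "carr ?T = ten_carr (bil M ?I) M ?I"
    by (simp only: C.tensor_rep_simps bilI ten_carr_def res_conn_simps)
  have surj: "F ` carr M = carr M" using no by (intro M.inj_imp_surj[OF lF]) auto
  have idl: "lin ?I (*) (\<lambda>c. c)" by (simp add: lin_def I_simps)
  let ?c = "M.contr (\<lambda>c::'k. c)"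
  have cten: "?c (ten (bil M ?I) m c) = scal M c m" if "m \<in> carr M" for m c
    using M.contr_ten[OF idl that] .
  have l1: "lin M fscale (\<lambda>m. ten (bil M ?I) m 1)" by (rule lin_ten(1)[OF order_refl]) (simp add: I_simps)
  \<comment> \<open>Every tensor with a one-dimensional second factor is pure, which identifies the
    tensor product with \<open>M\<close> through \<open>?c\<close>.\<close>
  have tform: "t = ten (bil M ?I) (?c t) 1" if "t \<in> carr ?T" for t
    using that unfolding carrT
  proof (induction rule: ten_carr_induct)
    case zero
    show ?case by (simp only: M.contr_0 M.lin_0[OF l1])
  next
    case (add s t)
    have "ten (bil M ?I) (?c (s + t)) 1 = ten (bil M ?I) (?c s) 1 + ten (bil M ?I) (?c t) 1"
      unfolding M.contr_add by (rule lin_add[OF l1]) simp_all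
    then show ?case by (simp only: add[symmetric])
  next
    case (scale c t)
    have "ten (bil M ?I) (?c (fscale c t)) 1 = fscale c (ten (bil M ?I) (?c t) 1)"
      unfolding M.contr_fscale by (rule lin_scal[OF l1]) simp
    then show ?case by (simp only: scale[symmetric])
  next
    case (ten m c)
    have "ten (bil M ?I) m c = fscale c (ten (bil M ?I) m 1)"
      using lin_scal[OF lin_ten(2)[where W = "?I", OF order_refl ten(1)], of 1 c] by (simp only: I_simps UNIV_I mult_1_right)
    then show ?case unfolding cten[OF ten(1)] lin_scal[OF l1 ten(1)] .
  qed
  have cact: "?c (act ?T x t) = sw (up x) (\<lambda>u v. scal M (v l) (act M u (?c t)))" if x: "x \<in> DC" and t: "t \<in> carr ?T" for x t
  proof -
    have cm: "?c t \<in> carr M" by simp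
    have a1: "act ?T x t = act ?T x (ten (bil ?R ?I) (?c t) 1)" using tform[OF t] bilI by simp
    have a2: "act ?T x (ten (bil ?R ?I) (?c t) 1) = C.swe fscale x (\<lambda>u v. ten (bil ?R ?I) (act ?R u (?c t)) (act ?I v 1))"
      using cm by (intro C.tensor_act_ten[OF R I x]) (simp_all add: res_conn_simps I_simps)
    have "?c (act ?T x t) = ?c (C.swe fscale x (\<lambda>u v. ten (bil ?R ?I) (act ?R u (?c t)) (act ?I v 1)))"
      by (rule arg_cong[of _ _ ?c]) (rule trans[OF a1 a2])
    also have "\<dots> = C.swe (scal M) x (\<lambda>u v. ?c (ten (bil ?R ?I) (act ?R u (?c t)) (act ?I v 1)))"
      unfolding C.swe_def M.contr_sum M.contr_fscale ..
    also have "\<dots> = C.swe (scal M) x (\<lambda>u v. scal M ((up v) l) (act M (up u) (?c t)))"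
    proof (rule C.swe_cong)
      fix u v assume uv: "u \<in> DC" "v \<in> DC"
      have "act ?R u (?c t) \<in> carr M" using uv up_A0 cm by (simp add: res_conn_simps)
      then show "?c (ten (bil ?R ?I) (act ?R u (?c t)) (act ?I v 1)) = scal M ((up v) l) (act M (up u) (?c t))"
        using uv X_He[OF l(1)] unfolding bilI by (simp add: cten I_act res_conn_simps up_apply)
    qed
    also have "\<dots> = sw (up x) (\<lambda>u v. scal M (v l) (act M u (?c t)))"
      using cm by (intro swe_C[OF vsM x]) (auto simp: lin_def M.scale_left_distrib M.scale_right_distrib mult.commute)
    finally show ?thesis .
  qed
  define f where "f t = F (?c t)" for t
  have "module_iso (group_alg C) ?T ?R"
    unfolding module_iso_def
  proof (intro exI conjI ballI)
    show "lin_on ?T ?R f"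
      unfolding lin_on_def f_def res_conn_simps C.tensor_rep_simps M.contr_add M.contr_fscale
      by (simp add: endo[OF lF])
    show "bij_betw f (carr ?T) (carr ?R)"
      unfolding bij_betw_def
    proof
      show "inj_on f (carr ?T)"
      proof (rule inj_onI)
        fix s t assume st: "s \<in> carr ?T" "t \<in> carr ?T" "f s = f t"
        have "F (?c s - ?c t) = 0" using st(3) M.lin_on_diff[OF lF, of "?c s" "?c t"] by (simp add: f_def)
        moreover have "?c s - ?c t \<in> carr M" by (rule M.diff_carr) simp_all
        ultimately have "?c s - ?c t = 0" using no by blast
        then show "s = t" using tform[OF st(1)] tform[OF st(2)] by simp
      qed
      show "f ` carr ?T = carr ?R"
      proof (intro equalityI subsetI)
        fix m assume "m \<in> carr ?R"
        then have "m \<in> F ` carr M" using surj by (simp add: res_conn_simps)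
        then obtain v where v: "v \<in> carr M" "m = F v" by blast
        have "ten (bil M ?I) v 1 \<in> carr ?T" unfolding carrT using v by (intro ten_in) (auto simp: I_simps)
        moreover have "f (ten (bil M ?I) v 1) = m" using v by (simp add: f_def cten)
        ultimately show "m \<in> f ` carr ?T" by blast
      qed (use lF in \<open>auto simp: f_def res_conn_simps\<close>)
    qed
    fix x t assume x: "x \<in> carr (group_alg C)" and t: "t \<in> carr ?T"
    have xD: "x \<in> DC" using x by (simp add: C.carr_group_alg)
    have cm: "?c t \<in> carr M" by simp
    have "f (act ?T x t) = F (sw (up x) (\<lambda>u v. scal M (v l) (act M u (?c t))))"
      unfolding f_def cact[OF xD t] ..
    also have "\<dots> = sw (up x) (\<lambda>u v. F (scal M (v l) (act M u (?c t))))"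
      by (rule sw_map[OF endo_lin[OF lF]]) simp
    also have "\<dots> = sw (up x) (\<lambda>u v. scal M (v l) (F (act M u (?c t))))"
      using lF by (intro swe_cong) simp
    \<comment> \<open>The character sits on the second tensor factor but on the first component in
      \<open>Wt\<close>; cocommutativity reconciles the two.\<close>
    also have "\<dots> = sw (up x) (\<lambda>u v. scal M (u l) (F (act M v (?c t))))"
      by (rule swe_comm)
    also have "\<dots> = act ?R x (f t)"
      using Wt_act[OF F up_A0[OF xD] cm] by (simp add: res_conn_simps f_def)
    finally show "f (act ?T x t) = act ?R x (f t)" .
  qed
  then have "l \<in> {\<mu> \<in> X. module_iso (group_alg C) (tensor_rep C ?R (inflate C N \<pi> (char_rep \<mu>))) ?R}"
    using l(1) by simp
  also have "\<dots> = {e0}" using reg by (simp add: quot_regular_def Let_def C.Q_simps(3) C_simps(4))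
  finally show False using l(2) by simp
qed

sublocale gr: graded_endos M X "mul G" e0 Wt
proof
  show "carr M \<noteq> {0}" using indec by (simp add: indecomposable_def res_conn_simps)
  show "finite X" using C.multiplicative_basis[OF mult] by blast
  show "e0 \<in> X" by (rule e0_X)
  show "mul G a b \<in> X" if "a \<in> X" "b \<in> X" for a b using that by (rule X_mult)
  show "mul G (mul G a b) c = mul G a (mul G b c)" if "a \<in> X" "b \<in> X" "c \<in> X" for a b c
    using that by (intro mul_ass) auto
  show "mul G e0 a = a" "mul G a e0 = a" if "a \<in> X" for a
    using X_He[OF that] mul_com[of e0 a] by auto
  show "a = e0" if "a \<in> X" "b \<in> X" "mul G a b = b" for a b using that by (rule X_cancel)
  show "lin_on M M F" if "F \<in> Wt l" for F l using that by (rule Wt_lin)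
  have sw0: "sw x (\<lambda>u v. 0) = 0" for x by (simp add: swe_def)
  show "(\<lambda>v. 0) \<in> Wt l" for l
  proof -
    have "act M x 0 = 0" if "x \<in> A0" for x using M.lin_0[OF act_lin(1)[OF A0_D[OF that]]] .
    moreover have "lin_on M M (\<lambda>v. 0)" by (simp add: lin_on_def)
    ultimately show ?thesis by (simp add: Wt_def sw0)
  qed
  show "(\<lambda>v. F v + H v) \<in> Wt l" if "l \<in> X" "F \<in> Wt l" "H \<in> Wt l" for l F H
    unfolding Wt_def mem_Collect_eq
  proof (intro conjI ballI)
    show "lin_on M M (\<lambda>v. F v + H v)" using that Wt_lin by (intro M.lin_on_plus)
    fix x m assume x: "x \<in> A0" and m: "m \<in> carr M"
    have "act M x (F m + H m) = act M x (F m) + act M x (H m)"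
      using x m Wt_lin[OF that(2)] Wt_lin[OF that(3)] by simp
    also have "\<dots> = sw x (\<lambda>u v. scal M (u l) (F (act M v m) + H (act M v m)))"
      using Wt_act[OF that(2) x m] Wt_act[OF that(3) x m]
      by (simp add: swe_def M.scale_right_distrib sum.distrib)
    finally show "act M x (F m + H m) = sw x (\<lambda>u v. scal M (u l) (F (act M v m) + H (act M v m)))" .
  qed
  show "(\<lambda>v. scal M c (F v)) \<in> Wt l" if "l \<in> X" "F \<in> Wt l" for l F c
    unfolding Wt_def mem_Collect_eq
  proof (intro conjI ballI)
    show "lin_on M M (\<lambda>v. scal M c (F v))" using that Wt_lin by (intro M.lin_on_scaled)
    fix x m assume x: "x \<in> A0" and m: "m \<in> carr M"
    have "act M x (scal M c (F m)) = scal M c (act M x (F m))"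
      using x m Wt_lin[OF that(2)] by simp
    also have "\<dots> = sw x (\<lambda>u v. scal M (u l) (scal M c (F (act M v m))))"
      using Wt_act[OF that(2) x m] by (simp add: swe_def M.scale_sum_right mult_ac)
    finally show "act M x (scal M c (F m)) = sw x (\<lambda>u v. scal M (u l) (scal M c (F (act M v m))))" .
  qed
  show "(\<lambda>v. F (H v)) \<in> Wt (mul G a b)" if "a \<in> X" "b \<in> X" "F \<in> Wt a" "H \<in> Wt b" for a b F H
    using that by (rule Wt_comp)
  show "(\<lambda>v. v) \<in> Wt e0" by (simp add: Wt_one_iff M.lin_on_id id_def)
  show "inv_into (carr M) F \<in> Wt e0" if F: "F \<in> Wt e0" "bij_betw F (carr M) (carr M)" for F
  proof -
    let ?g = "inv_into (carr M) F"
    note lF = Wt_lin[OF F(1)]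
    have g: "?g m \<in> carr M" "F (?g m) = m" if "m \<in> carr M" for m
      using F(2) that by (auto simp: bij_betw_def f_inv_into_f inv_into_into)
    have gF: "?g (F m) = m" if "m \<in> carr M" for m using F(2) that by (simp add: bij_betw_def)
    have "?g (m + m') = ?g m + ?g m'" if "m \<in> carr M" "m' \<in> carr M" for m m'
      using gF[of "?g m + ?g m'"] g that lF by simp
    moreover have "?g (scal M c m) = scal M c (?g m)" if "m \<in> carr M" for c m
      using gF[of "scal M c (?g m)"] g that lF by simp
    ultimately have lg: "lin_on M M ?g" unfolding lin_on_def using g(1) by blast
    have "act M x (?g m) = ?g (act M x m)" if "x \<in> A0" "m \<in> carr M" for x m
    proof -
      have "act M x (?g m) = ?g (F (act M x (?g m)))"
        using gF[of "act M x (?g m)"] g(1)[OF that(2)] that(1) by simp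
      also have "F (act M x (?g m)) = act M x (F (?g m))"
        using F(1) that g(1) by (simp add: Wt_one_iff)
      finally show ?thesis using g(2) that(2) by simp
    qed
    then show ?thesis using lg by (simp add: Wt_one_iff)
  qed
  show "\<exists>c. M.nilp (\<lambda>v. F v - scal M c v)" if "F \<in> Wt e0" for F using that by (rule Wt_one_nilp)
  show "\<exists>v\<in>carr M. v \<noteq> 0 \<and> F v = 0" if "l \<in> X" "l \<noteq> e0" "F \<in> Wt l" for l F using that by (rule Wt_regular)
qed

section \<open>The adjoint action on endomorphisms\<close>

text \<open>\<open>Tw F x = \<Sum> x\<^sub>1 F S(x\<^sub>2)\<close> is the adjoint action of \<open>x\<close> on the algebra \<open>cE\<close> of \<open>N\<close>-endomorphisms.\<close>

definition cE :: "('m \<Rightarrow> 'm) set" where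
  "cE = {F. lin_on M M F \<and> (\<forall>y\<in>kN. \<forall>m\<in>carr M. act M y (F m) = F (act M y m))}"

definition Tw :: "('m \<Rightarrow> 'm) \<Rightarrow> ('h \<Rightarrow> 'k) \<Rightarrow> 'm \<Rightarrow> 'm" where
  "Tw F x m = sw x (\<lambda>u v. act M u (F (act M (anti v) m)))"

lemma cE_lin: "F \<in> cE \<Longrightarrow> lin_on M M F"
  and cE_kN: "F \<in> cE \<Longrightarrow> y \<in> kN \<Longrightarrow> m \<in> carr M \<Longrightarrow> act M y (F m) = F (act M y m)"
  unfolding cE_def by blast+

lemma Tw_bilin:
  assumes F: "lin_on M M F" and m: "m \<in> carr M"
  shows "v \<in> D \<Longrightarrow> linD (scal M) (\<lambda>u. act M u (F (act M (anti v) m)))"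
    "u \<in> D \<Longrightarrow> linD (scal M) (\<lambda>v. act M u (F (act M (anti v) m)))"
  using F m by (auto simp: lin_def)

lemma Tw_carr [simp]: "lin_on M M F \<Longrightarrow> m \<in> carr M \<Longrightarrow> Tw F x m \<in> carr M"
  unfolding Tw_def by (intro sw_carr) simp

lemma Tw_endo: "lin_on M M F \<Longrightarrow> lin_on M M (Tw F x)"
  unfolding lin_on_lin Tw_def[abs_def]
  by (intro conjI ballI swe_lin_param[OF vsM] sw_carr) (auto simp: lin_on_lin[symmetric] lin_def)

lemma Tw_lin: "linD (scal M) (\<lambda>x. Tw F x m)"
  unfolding Tw_def by (rule swe_lin[OF vsM])

lemma Tw_eps:
  assumes F: "lin_on M M F" and m: "m \<in> carr M"
  shows "Tw F eps m = F m"
  unfolding Tw_def using swe_eps[OF vsM Tw_bilin[OF F m]] F m by simp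

lemma Tw_star:
  assumes F: "lin_on M M F" and x: "x \<in> D" and y: "y \<in> D" and m: "m \<in> carr M"
  shows "Tw F (x \<star> y) m = Tw (Tw F y) x m"
proof -
  have "Tw F (x \<star> y) m = sw x (\<lambda>x1 x2. sw y (\<lambda>y1 y2. act M (x1 \<star> y1) (F (act M (anti (x2 \<star> y2)) m))))"
    unfolding Tw_def by (rule swe_star[OF vsM x y Tw_bilin[OF F m]])
  also have "\<dots> = sw x (\<lambda>x1 x2. sw y (\<lambda>y1 y2. act M x1 (act M y1 (F (act M (anti y2) (act M (anti x2) m))))))"
    using F m by (intro swe_cong) (simp add: anti_star)
  also have "\<dots> = sw x (\<lambda>x1 x2. act M x1 (sw y (\<lambda>y1 y2. act M y1 (F (act M (anti y2) (act M (anti x2) m))))))"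
    using F m by (intro swe_cong sw_map[symmetric] act_lin) simp_all
  finally show ?thesis by (simp add: Tw_def)
qed

text \<open>The action of the first component can be moved inside \<open>F\<close>, where
  \<open>u \<star> anti v\<close> contracts to the counit.\<close>

lemma Tw_kN:
  assumes F: "F \<in> cE" and y: "y \<in> kN" and m: "m \<in> carr M"
  shows "Tw F y m = scal M (y (uni G)) (F m)"
proof -
  note lF = cE_lin[OF F]
  have l: "linD (scal M) (\<lambda>z. F (act M z m))" using lF m by (auto simp: lin_def)
  have "Tw F y m = sw y (\<lambda>u v. F (act M (u \<star> anti v) m))"
    unfolding Tw_def
  proof (rule swe_kN_cong[OF vsM y Tw_bilin[OF lF m]])
    show "v \<in> D \<Longrightarrow> linD (scal M) (\<lambda>u. F (act M (u \<star> anti v) m))"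
      "u \<in> D \<Longrightarrow> linD (scal M) (\<lambda>v. F (act M (u \<star> anti v) m))" for u v
      using lF m by (auto simp: lin_def)
    show "act M u (F (act M (anti v) m)) = F (act M (u \<star> anti v) m)" if "u \<in> kN" "v \<in> kN" for u v
      using cE_kN[OF F that(1), of "act M (anti v) m"] that m by simp
  qed
  also have "\<dots> = scal M (y (uni G)) (F (act M eps m))"
    by (rule swe_anti_right[OF vsM _ l]) (use y in simp)
  finally show ?thesis using m by simp
qed

lemma Tw_star_kN:
  assumes F: "F \<in> cE" and x: "x \<in> D" and y: "y \<in> kN" and m: "m \<in> carr M"
  shows "Tw F (x \<star> y) m = scal M (y (uni G)) (Tw F x m)"
proof -
  note lF = cE_lin[OF F]
  have "Tw F (x \<star> y) m = sw x (\<lambda>u v. act M u (Tw F y (act M (anti v) m)))"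
    using Tw_star[OF lF x kN_D[OF y] m] by (simp add: Tw_def[of "Tw F y"])
  also have "\<dots> = sw x (\<lambda>u v. scal M (y (uni G)) (act M u (F (act M (anti v) m))))"
    using lF m by (intro swe_cong) (simp add: Tw_kN[OF F y])
  also have "\<dots> = scal M (y (uni G)) (Tw F x m)"
    unfolding Tw_def swe_def by (simp add: M.scale_sum_right mult_ac)
  finally show ?thesis .
qed

text \<open>\<open>star_ad_anti\<close> moves \<open>y\<close> to the right side, where
  \<open>Tw_star_kN\<close> applies; normality enters through \<open>ad_kN\<close>.\<close>

lemma Tw_kN_star:
  assumes F: "F \<in> cE" and x: "x \<in> D" and y: "y \<in> kN" and m: "m \<in> carr M"
  shows "Tw F (y \<star> x) m = scal M (y (uni G)) (Tw F x m)"
proof -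
  have "Tw F (y \<star> x) m = Tw F (swe fscale x (\<lambda>u v. u \<star> ad (anti v) y)) m"
    using star_ad_anti[OF x kN_D[OF y]] by simp
  also have "\<dots> = sw x (\<lambda>u v. Tw F (u \<star> ad (anti v) y) m)"
    using swe_map[OF dual.fdv_axioms Tw_lin[of F m], of "\<lambda>u v. u \<star> ad (anti v) y" x] y by simp
  also have "\<dots> = sw x (\<lambda>u v. scal M (y (uni G)) (scal M (v (uni G)) (Tw F u m)))"
    using y m by (intro swe_cong) (simp add: Tw_star_kN[OF F] ad_kN ad_uni mult.commute)
  also have "\<dots> = scal M (y (uni G)) (sw x (\<lambda>u v. scal M (v (uni G)) (Tw F u m)))"
    unfolding swe_def by (simp add: M.scale_sum_right mult_ac)
  also have "\<dots> = scal M (y (uni G)) (Tw F x m)"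
    by (simp add: swe_counit_right[OF x vsM Tw_lin])
  finally show ?thesis .
qed

text \<open>In the adjoint action applied to the first component, the antipode cancels against the
  last component.\<close>

lemma act_Tw:
  assumes F: "lin_on M M F" and x: "x \<in> D" and m: "m \<in> carr M"
  shows "act M x (F m) = sw x (\<lambda>u v. Tw F u (act M v m))"
proof -
  have "sw x (\<lambda>u v. Tw F u (act M v m)) = sw x (\<lambda>w v. sw w (\<lambda>p q. act M p (F (act M (anti q) (act M v m)))))"
    by (simp add: Tw_def)
  also have "\<dots> = sw x (\<lambda>p w. sw w (\<lambda>q v. act M p (F (act M (anti q) (act M v m)))))"
    by (rule swe_coassoc[OF vsM x])
  also have "\<dots> = sw x (\<lambda>p w. sw w (\<lambda>q v. act M p (F (act M (anti q \<star> v) m))))"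
    using m by (intro swe_cong) simp
  also have "\<dots> = sw x (\<lambda>p w. scal M (w (uni G)) (act M p (F m)))"
  proof (rule swe_cong)
    fix p w assume pw: "p \<in> D" "w \<in> D"
    have "linD (scal M) (\<lambda>z. act M p (F (act M z m)))" using F m pw by (auto simp: lin_def)
    from swe_anti_left[OF vsM pw(2) this]
    show "sw w (\<lambda>q v. act M p (F (act M (anti q \<star> v) m))) = scal M (w (uni G)) (act M p (F m))"
      using m by simp
  qed
  also have "\<dots> = act M x (F m)"
    using F m by (intro swe_counit_right[OF x vsM]) (simp add: act_lin)
  finally show ?thesis by simp
qed

text \<open>\<open>act_Tw\<close> expresses commutation with \<open>y\<close> through the adjoint
  action of \<open>kN\<close> on \<open>Tw F x\<close>, which is trivial by
  \<open>Tw_kN_star\<close>.\<close>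

lemma Tw_cE:
  assumes F: "F \<in> cE" and x: "x \<in> D"
  shows "Tw F x \<in> cE"
  unfolding cE_def mem_Collect_eq
proof (intro conjI ballI)
  note lF = cE_lin[OF F]
  show lT: "lin_on M M (Tw F x)" by (rule Tw_endo[OF lF])
  fix y m assume y: "y \<in> kN" and m: "m \<in> carr M"
  have "act M y (Tw F x m) = sw y (\<lambda>u v. Tw (Tw F x) u (act M v m))"
    by (rule act_Tw[OF lT kN_D[OF y] m])
  also have "\<dots> = sw y (\<lambda>u v. scal M (u (uni G)) (Tw F x (act M v m)))"
  proof (rule swe_kN_cong[OF vsM y])
    show "v \<in> D \<Longrightarrow> linD (scal M) (\<lambda>u. Tw (Tw F x) u (act M v m))" for v by (rule Tw_lin)
    show "u \<in> D \<Longrightarrow> linD (scal M) (\<lambda>v. Tw (Tw F x) u (act M v m))" for u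
      using Tw_endo[OF lT] m by (auto simp: lin_def)
    show "v \<in> D \<Longrightarrow> linD (scal M) (\<lambda>u. scal M (u (uni G)) (Tw F x (act M v m)))" for v
      by (intro lin_scale_left[OF vsM] lin_apply)
    show "u \<in> D \<Longrightarrow> linD (scal M) (\<lambda>v. scal M (u (uni G)) (Tw F x (act M v m)))" for u
      using lT m by (intro lin_scale_const[OF vsM]) (auto simp: lin_def)
    show "Tw (Tw F x) u (act M v m) = scal M (u (uni G)) (Tw F x (act M v m))" if "u \<in> kN" "v \<in> kN" for u v
      using that m by (simp add: Tw_star[OF lF, symmetric] x Tw_kN_star[OF F])
  qed
  also have "\<dots> = Tw F x (act M y m)"
    using lT m by (intro swe_counit_left[OF kN_D[OF y] vsM]) (auto simp: lin_def)
  finally show "act M y (Tw F x m) = Tw F x (act M y m)" .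
qed

text \<open>By \<open>Tw_star_kN\<close> the adjoint action of \<open>A0\<close> on \<open>F\<close>
  depends only on images in the group algebra of the component modulo \<open>N\<close>, and there
  \<open>Y\<close> gives the dual basis of the characters.\<close>

lemma Tw_A0_expand:
  assumes F: "F \<in> cE" and m: "m \<in> carr M" and Y: "\<And>\<mu>. \<mu> \<in> X \<Longrightarrow> Y \<mu> \<in> A0"
    "\<And>\<mu> \<nu>. \<mu> \<in> X \<Longrightarrow> \<nu> \<in> X \<Longrightarrow> Y \<mu> \<nu> = (if \<mu> = \<nu> then 1 else 0)"
    "\<And>x. x \<in> DC \<Longrightarrow> (\<forall>\<mu>\<in>X. x \<mu> = 0) \<Longrightarrow> C.res x = 0"
    and x: "x \<in> A0"
  shows "Tw F x m = (\<Sum>\<mu>\<in>X. scal M (x \<mu>) (Tw F (Y \<mu>) m))"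
proof -
  note lF = cE_lin[OF F]
  have fX: "finite X" by (rule gr.finite_X)
  have sY: "(\<Sum>\<mu>\<in>X. fscale (x \<mu>) (Y \<mu>)) \<in> D" using Y(1) by (intro dual.sum_carr) simp
  \<comment> \<open>The difference vanishes on all characters, so its image modulo \<open>N\<close>
    is zero.\<close>
  define w where "w = x - (\<Sum>\<mu>\<in>X. fscale (x \<mu>) (Y \<mu>))"
  have wD: "w \<in> D" unfolding w_def using x sY by (intro dual.diff_carr) simp_all
  have w: "w \<in> A0"
  proof (rule A0_I[OF wD])
    fix h assume h: "h \<in> carr G"
    show "w (mul G h e0) = w h" unfolding w_def
      using A0_e0[OF x h] A0_e0[OF Y(1) h] by (simp add: sum_fun_apply)
  qed
  have "w \<nu> = 0" if "\<nu> \<in> X" for \<nu>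
    using that fX by (simp add: w_def sum_fun_apply Y(2) if_distrib cong: if_cong)
  then have "\<forall>\<mu>\<in>X. down w \<mu> = 0" by (simp add: down_def)
  then have r: "C.res (down w) = 0" by (intro Y(3) down_DC wD) simp_all
  have T0: "Tw F w m = 0"
  proof (rule M.dual_separates)
    show "Tw F w m \<in> carr M" using lF m by simp
    fix \<phi> assume \<phi>: "\<phi> \<in> carr (dual_space M)"
    have l\<phi>: "lin M (*) \<phi>" using \<phi> by (simp add: dual_carr)
    define \<zeta> where "\<zeta> z = \<phi> (Tw F (up z) m)" for z
    have upD: "up z \<in> D" if "z \<in> DC" for z using up_A0[OF that] by simp
    have up_add: "up (z + z') = up z + up z'" "up (fscale c z) = fscale c (up z)" for z z' c
      by (auto simp: fun_eq_iff up_apply)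
    have l: "C.linD (*) \<zeta>"
      unfolding lin_def \<zeta>_def
      using upD lF m by (simp add: up_add lin_add[OF Tw_lin] lin_scal[OF Tw_lin, simplified dual_scal] lin_add[OF l\<phi>] lin_scal[OF l\<phi>])
    have i: "\<zeta> (C.star z y) = \<zeta> z * y (uni C)" if z: "z \<in> DC" and y: "y \<in> C.kN" for z y
    proof -
      have "up y (uni G) = y (uni C)" using uni_in by (simp add: up_apply C_simps(4) uni_mul)
      then show ?thesis unfolding \<zeta>_def
        using y lF m by (simp add: up_star z Tw_star_kN[OF F upD[OF z] up_kN[OF y] m] lin_scal[OF l\<phi>])
    qed
    have "\<zeta> (down w) = \<zeta> 0"
    proof (rule C.invariant_functional_res[OF l i down_DC[OF wD] C.D_closed(3)])
      show "C.res (down w) = C.res 0" unfolding r by (rule ext) (simp add: C.res_apply)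
    qed
    moreover have "up 0 = 0" by (auto simp: fun_eq_iff up_apply)
    moreover have "Tw F 0 m = 0" by (simp add: Tw_def swe_def)
    ultimately show "\<phi> (Tw F w m) = 0"
      using up_down[OF w] M.lin_0[OF l\<phi>] by (simp add: \<zeta>_def)
  qed
  have "Tw F x m = Tw F (w + (\<Sum>\<mu>\<in>X. fscale (x \<mu>) (Y \<mu>))) m" by (simp add: w_def)
  also have "\<dots> = Tw F (\<Sum>\<mu>\<in>X. fscale (x \<mu>) (Y \<mu>)) m"
    using lin_add[OF Tw_lin wD sY] T0 by simp
  also have "\<dots> = (\<Sum>\<mu>\<in>X. Tw F (fscale (x \<mu>) (Y \<mu>)) m)"
    using Y(1) by (intro dual.lin_sum[OF Tw_lin]) simp
  also have "\<dots> = (\<Sum>\<mu>\<in>X. scal M (x \<mu>) (Tw F (Y \<mu>) m))"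
    using Y(1) by (simp add: lin_scal[OF Tw_lin, simplified dual_scal])
  finally show ?thesis .
qed

text \<open>\<open>Tw F (Y \<mu>)\<close> is the component of degree \<open>\<mu>\<close>; the
  components add up to \<open>F\<close> because \<open>eps\<close>, acting as the identity, takes
  the value one on every character.\<close>

lemma cE_total:
  assumes F: "F \<in> cE" shows "F \<in> gr.total"
proof -
  note lF = cE_lin[OF F]
  obtain y where y: "\<And>\<mu>. \<mu> \<in> X \<Longrightarrow> y \<mu> \<in> DC"
    "\<And>\<mu> \<nu>. \<mu> \<in> X \<Longrightarrow> \<nu> \<in> X \<Longrightarrow> y \<mu> \<nu> = (if \<mu> = \<nu> then 1 else 0)"
    "\<And>x. x \<in> DC \<Longrightarrow> (\<forall>\<mu>\<in>X. x \<mu> = 0) \<Longrightarrow> C.res x = 0"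
  proof -
    obtain y where "\<forall>\<mu>\<in>X. y \<mu> \<in> DC \<and> (\<forall>\<mu>'\<in>X. y \<mu> \<mu>' = (if \<mu> = \<mu>' then 1 else 0)) \<and>
        (\<forall>x\<in>DC. (\<forall>\<mu>\<in>X. x \<mu> = 0) \<longrightarrow> C.res x = 0)"
      using conjunct2[OF C.multiplicative_basis[OF mult]] by (elim exE)
    note y = this
    have "\<exists>\<mu>. \<mu> \<in> X" using e0_X by blast
    with y show thesis by (intro that[of y]) blast+
  qed
  define Y where "Y \<mu> = up (y \<mu>)" for \<mu>
  have Y: "\<And>\<mu>. \<mu> \<in> X \<Longrightarrow> Y \<mu> \<in> A0" using y(1) up_A0 by (simp add: Y_def)
  have Y2: "Y \<mu> \<nu> = (if \<mu> = \<nu> then 1 else 0)" if "\<mu> \<in> X" "\<nu> \<in> X" for \<mu> \<nu>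
    using X_He[OF that(2)] that y(2) by (simp add: Y_def up_apply)
  have ex: "Tw F x m = (\<Sum>\<mu>\<in>X. scal M (x \<mu>) (Tw F (Y \<mu>) m))" if "m \<in> carr M" "x \<in> A0" for x m
    by (rule Tw_A0_expand[OF F that(1) Y Y2 y(3) that(2)])
  have fX: "finite X" by (rule gr.finite_X)
  have "Tw F (Y \<mu>) \<in> Wt \<mu>" if \<mu>: "\<mu> \<in> X" for \<mu>
    unfolding Wt_def mem_Collect_eq
  proof (intro conjI ballI)
    show lT: "lin_on M M (Tw F (Y \<mu>))" by (rule Tw_endo[OF lF])
    fix x m assume x: "x \<in> A0" and m: "m \<in> carr M"
    have "act M x (Tw F (Y \<mu>) m) = sw x (\<lambda>u v. Tw (Tw F (Y \<mu>)) u (act M v m))"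
      using x by (intro act_Tw[OF lT _ m]) simp
    also have "\<dots> = sw x (\<lambda>u v. scal M (u \<mu>) (Tw F (Y \<mu>) (act M v m)))"
    proof (rule swe_A0_cong[OF vsM x _ _ wt_bilin[OF lT m]])
      show "v \<in> D \<Longrightarrow> linD (scal M) (\<lambda>u. Tw (Tw F (Y \<mu>)) u (act M v m))" for v by (rule Tw_lin)
      show "u \<in> D \<Longrightarrow> linD (scal M) (\<lambda>v. Tw (Tw F (Y \<mu>)) u (act M v m))" for u
        using Tw_endo[OF lT] m by (auto simp: lin_def)
      fix u v assume u: "u \<in> A0" and v: "v \<in> A0"
      have vm: "act M v m \<in> carr M" using v m by simp
      have "Tw (Tw F (Y \<mu>)) u (act M v m) = Tw F (u \<star> Y \<mu>) (act M v m)"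
        using u Y[OF \<mu>] by (simp add: Tw_star[OF lF _ _ vm])
      also have "\<dots> = (\<Sum>\<nu>\<in>X. scal M ((u \<star> Y \<mu>) \<nu>) (Tw F (Y \<nu>) (act M v m)))"
        by (rule ex[OF vm A0_star[OF u Y[OF \<mu>]]])
      also have "\<dots> = (\<Sum>\<nu>\<in>X. if \<nu> = \<mu> then scal M (u \<mu>) (Tw F (Y \<mu>) (act M v m)) else 0)"
        using X_star[OF _ u Y[OF \<mu>]] Y2[OF \<mu>] by (intro sum.cong) auto
      also have "\<dots> = scal M (u \<mu>) (Tw F (Y \<mu>) (act M v m))" using fX \<mu> by simp
      finally show "Tw (Tw F (Y \<mu>)) u (act M v m) = scal M (u \<mu>) (Tw F (Y \<mu>) (act M v m))" .
    qed
    finally show "act M x (Tw F (Y \<mu>) m) = sw x (\<lambda>u v. scal M (u \<mu>) (Tw F (Y \<mu>) (act M v m)))" .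
  qed
  moreover have "F m = (\<Sum>\<mu>\<in>X. Tw F (Y \<mu>) m)" if m: "m \<in> carr M" for m
  proof -
    have "eps \<mu> = 1" if "\<mu> \<in> X" for \<mu> using X_counit[OF that] that by (simp add: eps_def')
    then show ?thesis using ex[OF m A0_eps] Tw_eps[OF lF m] m lF by simp
  qed
  ultimately show ?thesis unfolding gr.total_def mem_Collect_eq
    by (intro conjI lF exI[of _ "\<lambda>\<mu>. Tw F (Y \<mu>)"] ballI)
qed

lemma Tw_Wt:
  assumes l: "l \<in> X" and F: "F \<in> Wt l" and x: "x \<in> A0" and m: "m \<in> carr M"
  shows "Tw F x m = scal M (x l) (F m)"
proof -
  note lF = Wt_lin[OF F]
  have xD: "x \<in> D" using x by simp
  have "Tw F x m = sw x (\<lambda>w v. sw w (\<lambda>p q. scal M (p l) (F (act M q (act M (anti v) m)))))"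
    unfolding Tw_def
  proof (rule swe_A0_cong[OF vsM x Tw_bilin[OF lF m]])
    show "v \<in> D \<Longrightarrow> linD (scal M) (\<lambda>w. sw w (\<lambda>p q. scal M (p l) (F (act M q (act M (anti v) m)))))" for v
      by (rule swe_lin[OF vsM])
    show "w \<in> D \<Longrightarrow> linD (scal M) (\<lambda>v. sw w (\<lambda>p q. scal M (p l) (F (act M q (act M (anti v) m)))))" for w
      using lF m by (intro swe_lin_param[OF vsM] lin_scale_const[OF vsM]) (auto simp: lin_def)
    show "act M u (F (act M (anti v) m)) = sw u (\<lambda>p q. scal M (p l) (F (act M q (act M (anti v) m))))"
      if "u \<in> A0" "v \<in> A0" for u v
      using that m by (intro Wt_act[OF F]) simp_all
  qed
  also have "\<dots> = sw x (\<lambda>p w. sw w (\<lambda>q v. scal M (p l) (F (act M q (act M (anti v) m)))))"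
    by (rule swe_coassoc[OF vsM xD])
  also have "\<dots> = sw x (\<lambda>p w. scal M (w (uni G)) (scal M (p l) (F m)))"
  proof (rule swe_cong)
    fix p w assume pw: "p \<in> D" "w \<in> D"
    have l: "linD (scal M) (\<lambda>z. scal M (p l) (F (act M z m)))"
      using lF m by (intro lin_scale_const[OF vsM]) (auto simp: lin_def)
    have "sw w (\<lambda>q v. scal M (p l) (F (act M q (act M (anti v) m)))) = sw w (\<lambda>q v. scal M (p l) (F (act M (q \<star> anti v) m)))"
      using m by (intro swe_cong) simp
    also have "\<dots> = scal M (w (uni G)) (scal M (p l) (F m))"
      using swe_anti_right[OF vsM pw(2) l] m by simp
    finally show "sw w (\<lambda>q v. scal M (p l) (F (act M q (act M (anti v) m)))) = scal M (w (uni G)) (scal M (p l) (F m))" .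
  qed
  also have "\<dots> = scal M (x l) (F m)"
    by (intro swe_counit_right[OF xD vsM] lin_scale_left[OF vsM] lin_apply)
  finally show ?thesis .
qed

text \<open>\<open>A0\<close> acts on each homogeneous component by its character, and
  \<open>chi\<close> sees only degree one, whose character is the counit.\<close>

lemma chi_Tw_A0:
  assumes F: "F \<in> cE" and x: "x \<in> A0"
  shows "gr.chi (Tw F x) = x (uni G) * gr.chi F"
proof -
  note lF = cE_lin[OF F]
  obtain s where s: "\<And>l. l \<in> X \<Longrightarrow> s l \<in> Wt l" "\<And>m. m \<in> carr M \<Longrightarrow> F m = (\<Sum>l\<in>X. s l m)"
    using cE_total[OF F] by (auto simp: gr.total_def)
  have st: "s l \<in> gr.total" if "l \<in> X" for l using gr.W_total s(1) that by blast
  have chi_s: "gr.chi (s l) = (if l = e0 then gr.chi (s e0) else 0)" if "l \<in> X" for l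
    using gr.chi_other[OF that _ s(1)[OF that]] by auto
  have "gr.chi F = (\<Sum>l\<in>X. gr.chi (s l))"
    using gr.chi_sum[of X s, OF st] gr.chi_cong[of "\<lambda>m. \<Sum>l\<in>X. s l m" F] s(2) by simp
  also have "\<dots> = (\<Sum>l\<in>X. if l = e0 then gr.chi (s e0) else 0)" using chi_s by (rule sum.cong[OF refl])
  also have "\<dots> = gr.chi (s e0)" using gr.finite_X e0_X by simp
  finally have cF: "gr.chi F = gr.chi (s e0)" .
  have sl: "lin_on M M (s l)" if "l \<in> X" for l using Wt_lin s(1) that by blast
  have Tm: "Tw F x m = (\<Sum>l\<in>X. scal M (x l) (s l m))" if m: "m \<in> carr M" for m
  proof -
    have "Tw F x m = sw x (\<lambda>u v. \<Sum>l\<in>X. act M u (s l (act M (anti v) m)))"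
      unfolding Tw_def using m sl by (intro swe_cong) (simp add: s(2) M.lin_sum[OF act_lin(1)])
    also have "\<dots> = (\<Sum>l\<in>X. Tw (s l) x m)" unfolding Tw_def by (rule swe_sum[OF vsM])
    finally show ?thesis using Tw_Wt[OF _ s(1) x m] by simp
  qed
  have t2: "(\<lambda>m. scal M (x l) (s l m)) \<in> gr.total" if "l \<in> X" for l
    using gr.total_scale[OF st[OF that]] .
  have "gr.chi (Tw F x) = gr.chi (\<lambda>m. \<Sum>l\<in>X. scal M (x l) (s l m))"
    using gr.chi_sum[of X "\<lambda>l m. scal M (x l) (s l m)", OF t2] Tm by (intro gr.chi_cong) auto
  also have "\<dots> = (\<Sum>l\<in>X. gr.chi (\<lambda>m. scal M (x l) (s l m)))"
    using gr.chi_sum[of X "\<lambda>l m. scal M (x l) (s l m)", OF t2] by blast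
  also have "\<dots> = (\<Sum>l\<in>X. if l = e0 then x e0 * gr.chi (s e0) else 0)"
    using chi_s by (intro sum.cong refl) (simp add: gr.chi_scale[OF st])
  also have "\<dots> = x e0 * gr.chi F" using gr.finite_X e0_X cF by simp
  finally show ?thesis using A0_e0_uni[OF x] by simp
qed

text \<open>A point acts by conjugation, which keeps \<open>H\<close> nilpotent though it need not
  respect the grading; \<open>chi_nilp\<close> reads off the value.\<close>

lemma chi_Tw_pts:
  assumes F: "F \<in> cE" and g: "g \<in> pts"
  shows "gr.chi (Tw F g) = gr.chi F"
proof -
  note lF = cE_lin[OF F]
  have gD: "g \<in> D" using g by simp
  define c where "c = gr.chi F"
  define H where "H = (\<lambda>m. F m - scal M c m)"
  have H: "H \<in> gr.nil_ideal" unfolding H_def c_def by (rule gr.chi_nil_ideal[OF cE_total[OF F]])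
  have lH: "lin_on M M H" by (rule gr.nil_ideal_lin[OF H])
  define K where "K = (\<lambda>m. Tw F g m - scal M c m)"
  have vs: "vector_space (fscale :: 'k \<Rightarrow> ('h \<Rightarrow> 'k) \<Rightarrow> _)" by (rule vector_space_fscale)
  have lid: "linD fscale (\<lambda>x. x)" by (simp add: lin_def)
  have ga: "g \<star> anti g = eps" "anti g \<star> g = eps"
  proof -
    have "swe fscale g (\<lambda>u v. u \<star> anti v) = g \<star> anti g"
      by (rule swe_pts[OF vs g]) (simp_all add: lin_def)
    then show "g \<star> anti g = eps" using swe_anti_right[OF vs gD lid] pts_uni[OF g] by simp
    have "swe fscale g (\<lambda>u v. anti u \<star> v) = anti g \<star> g"
      by (rule swe_pts[OF vs g]) (simp_all add: lin_def)
    then show "anti g \<star> g = eps" using swe_anti_left[OF vs gD lid] pts_uni[OF g] by simp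
  qed
  have inv: "act M (anti g) (act M g m) = m" "act M g (act M (anti g) m) = m" if m: "m \<in> carr M" for m
    using Ma(6)[of "anti g" g m] Ma(6)[of g "anti g" m] ga gD m by simp_all
  have Tg: "Tw F g m = act M g (F (act M (anti g) m))" if "m \<in> carr M" for m
    unfolding Tw_def by (rule swe_pts[OF vsM g Tw_bilin[OF lF that]])
  have K: "K m = act M g (H (act M (anti g) m))" if m: "m \<in> carr M" for m
  proof -
    have "act M g (H (act M (anti g) m)) = act M g (F (act M (anti g) m)) - act M g (scal M c (act M (anti g) m))"
      unfolding H_def
    proof (rule M.lin_on_diff)
      show "lin_on M M (act M g)" unfolding lin_on_def using gD by simp
      show "F (act M (anti g) m) \<in> carr M" "scal M c (act M (anti g) m) \<in> carr M" using endo(1)[OF lF] gD m by simp_all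
    qed
    then show ?thesis using Tg[OF m] inv(2)[OF m] gD m by (simp add: K_def)
  qed
  have Kn: "(K ^^ n) m = act M g ((H ^^ n) (act M (anti g) m))" if m: "m \<in> carr M" for n m
  proof (induction n)
    case (Suc n)
    have h: "(H ^^ n) (act M (anti g) m) \<in> carr M" using M.lin_on_funpow[OF lH] gD m by simp
    then show ?case using Suc K gD inv(1)[OF h] by simp
  qed (use inv(2)[OF m] in simp)
  from gr.nil_ideal_nilp[OF H, unfolded M.nilp_def] obtain n where n: "\<forall>v\<in>carr M. (H ^^ n) v = 0" ..
  have "(K ^^ n) m = 0" if m: "m \<in> carr M" for m
  proof -
    have "act M (anti g) m \<in> carr M" using m gD by simp
    then have "(H ^^ n) (act M (anti g) m) = 0" using n by blast
    then show ?thesis using Kn[OF m, of n] M.lin_0[OF act_lin(1)[OF gD]] by simp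
  qed
  then have "M.nilp K" unfolding M.nilp_def by blast
  then show ?thesis using gr.chi_nilp[OF cE_total[OF Tw_cE[OF F gD]]] unfolding K_def c_def by blast
qed

text \<open>The defect is evaluation at a function \<open>h\<close>. It vanishes on products of
  elements of \<open>A0\<close> with points, so \<open>points_separate\<close> gives
  \<open>h = 0\<close>.\<close>

lemma chi_Tw:
  assumes F: "F \<in> cE" and x: "x \<in> D"
  shows "gr.chi (Tw F x) = x (uni G) * gr.chi F"
proof -
  define \<zeta> where "\<zeta> x = gr.chi (Tw F x) - x (uni G) * gr.chi F" for x
  have t: "Tw F x \<in> gr.total" if "x \<in> D" for x using cE_total[OF Tw_cE[OF F that]] .
  have "Tw F (x + y) = (\<lambda>m. Tw F x m + Tw F y m)" "Tw F (fscale c x) = (\<lambda>m. scal M c (Tw F x m))"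
    if "x \<in> D" "y \<in> D" for x y c using lin_add[OF Tw_lin] lin_scal[OF Tw_lin, simplified dual_scal] that by (auto simp: fun_eq_iff)
  then have "linD (*) \<zeta>"
    unfolding \<zeta>_def by (intro linI) (simp_all add: gr.chi_add gr.chi_scale t algebra_simps)
  then obtain h where h: "h \<in> carr G" "\<And>x. x \<in> D \<Longrightarrow> \<zeta> x = x h" using functional_eval by blast
  have "h = 0"
  proof (rule points_separate[OF h(1)])
    fix x g assume x: "x \<in> A0" and g: "g \<in> pts"
    have xg: "x \<in> D" "g \<in> D" using x g by simp_all
    note T = Tw_cE[OF F xg(2)]
    have "gr.chi (Tw F (x \<star> g)) = gr.chi (Tw (Tw F g) x)"
      using Tw_star[OF cE_lin[OF F] xg] cE_total[OF Tw_cE[OF T xg(1)]] by (intro gr.chi_cong) simp_all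
    also have "\<dots> = x (uni G) * gr.chi F" using chi_Tw_A0[OF T x] chi_Tw_pts[OF F g] by simp
    finally have "\<zeta> (x \<star> g) = 0" using xg pts_uni[OF g] by (simp add: \<zeta>_def)
    then show "(x \<star> g) h = 0" using h(2) xg by simp
  qed
  then show ?thesis using h(2)[OF x] D_0[OF x] by (simp add: \<zeta>_def)
qed

section \<open>Homomorphisms between the modules \<open>M \<otimes> P\<close>\<close>

text \<open>Modules with trivial action of \<open>N\<close>, described inside \<open>kG\<close>
  rather than as modules over \<open>k(G/N)\<close>.\<close>

definition tmod :: "('k, 'h \<Rightarrow> 'k, 'p::ab_group_add) rep \<Rightarrow> bool" where
  "tmod P \<longleftrightarrow> scheme_module G P \<and> (\<forall>y\<in>kN. \<forall>p\<in>carr P. act P y p = scal P (y (uni G)) p)"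

abbreviation TM where "TM \<equiv> tensor_rep G M"

definition ghom :: "('k, 'h \<Rightarrow> 'k, 'p::ab_group_add) rep \<Rightarrow> ('k, 'h \<Rightarrow> 'k, 'q::ab_group_add) rep
    \<Rightarrow> ((('m \<Rightarrow> 'p \<Rightarrow> 'k) \<Rightarrow> 'k) \<Rightarrow> (('m \<Rightarrow> 'q \<Rightarrow> 'k) \<Rightarrow> 'k)) \<Rightarrow> bool" where
  "ghom P P' f \<longleftrightarrow> lin_on (TM P) (TM P') f \<and> (\<forall>x\<in>D. \<forall>t\<in>carr (TM P). f (act (TM P) x t) = act (TM P') x (f t))"

text \<open>A homomorphism \<open>f\<close> is a matrix with entries \<open>blk P f q p\<close> in \<open>cE\<close>, and \<open>Phi\<close> applies the character
  \<open>chi\<close> to each entry.\<close>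

definition blk :: "('k, 'h \<Rightarrow> 'k, 'p::ab_group_add) rep
    \<Rightarrow> ((('m \<Rightarrow> 'p \<Rightarrow> 'k) \<Rightarrow> 'k) \<Rightarrow> (('m \<Rightarrow> 'q \<Rightarrow> 'k) \<Rightarrow> 'k)) \<Rightarrow> ('q \<Rightarrow> 'k) \<Rightarrow> 'p \<Rightarrow> 'm \<Rightarrow> 'm" where
  "blk P f q p m = M.contr q (f (ten (bil M P) m p))"

definition Phi :: "('k, 'h \<Rightarrow> 'k, 'p::ab_group_add) rep \<Rightarrow> ('k, 'h \<Rightarrow> 'k, 'q::ab_group_add) rep
    \<Rightarrow> ((('m \<Rightarrow> 'p \<Rightarrow> 'k) \<Rightarrow> 'k) \<Rightarrow> (('m \<Rightarrow> 'q \<Rightarrow> 'k) \<Rightarrow> 'k)) \<Rightarrow> 'p \<Rightarrow> 'q" where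
  "Phi P P' f p = (\<Sum>k\<in>fdv.bas P'. scal P' (gr.chi (blk P f (fdv.du P' k) p)) k)"

lemma tmod_mod: "tmod P \<Longrightarrow> scheme_module G P"
  and tmod_kN: "tmod P \<Longrightarrow> y \<in> kN \<Longrightarrow> p \<in> carr P \<Longrightarrow> act P y p = scal P (y (uni G)) p"
  unfolding tmod_def by blast+

lemma tmod_fdv: "tmod P \<Longrightarrow> fdv P" by (rule mod_facts(1)[OF tmod_mod])

lemma TM_module: "tmod P \<Longrightarrow> scheme_module G (TM P)" by (rule tensor_module[OF mod tmod_mod])

lemma TM_carr: "carr (TM P) = ten_carr (bil M P) M P" and TM_scal: "scal (TM P) = fscale"
  by (rule tensor_rep_simps)+

lemma ghom_lin: "ghom P P' f \<Longrightarrow> lin_on (TM P) (TM P') f"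
  and ghom_act: "ghom P P' f \<Longrightarrow> x \<in> D \<Longrightarrow> t \<in> carr (TM P) \<Longrightarrow> f (act (TM P) x t) = act (TM P') x (f t)"
  unfolding ghom_def by blast+

lemma ten_TM: "m \<in> carr M \<Longrightarrow> p \<in> carr P \<Longrightarrow> ten (bil M P) m p \<in> carr (TM P)"
  unfolding TM_carr by (rule ten_in)

lemma TM_fdv: "tmod P \<Longrightarrow> fdv (TM P)" by (rule mod_facts(1)[OF TM_module])

lemma TM_act_lin: "tmod P \<Longrightarrow> x \<in> D \<Longrightarrow> lin (TM P) fscale (act (TM P) x)"
  using mod_facts(3,4)[OF TM_module] by (auto simp: lin_def TM_scal)

lemma ghom_lin': "ghom P P' f \<Longrightarrow> lin (TM P) fscale f"
  using ghom_lin[of P P' f] by (simp add: lin_on_lin TM_scal)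

lemma ghom_carr: "ghom P P' f \<Longrightarrow> t \<in> carr (TM P) \<Longrightarrow> f t \<in> carr (TM P')"
  using ghom_lin[of P P' f] by (simp add: lin_on_def)

lemma contr_lin: "lin (TM P) (scal M) (M.contr q)"
  by (rule linI) (simp_all add: M.contr_add M.contr_fscale TM_scal)

lemma contr_swe: "M.contr q (swe fscale x F) = sw x (\<lambda>u v. M.contr q (F u v))"
  unfolding swe_def M.contr_sum M.contr_fscale ..

lemma contr_functional:
  assumes P: "fdv P" and t: "t \<in> carr (TM P)" and q: "lin P (*) q"
  shows "M.contr q t = (\<Sum>k\<in>fdv.bas P. scal M (q k) (M.contr (fdv.du P k) t))"
proof -
  interpret P: fdv P by fact
  show ?thesis
    using t unfolding TM_carr
  proof (induction rule: ten_carr_induct)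
    case (ten m p)
    then show ?case
      using P.lin_expand[OF q ten(2)]
      by (simp add: M.contr_ten[OF q] M.contr_ten[OF P.lin_du] mult.commute flip: M.scale_sum_left)
  next
    case (scale c t)
    then show ?case by (simp only: M.contr_fscale M.scale_sum_right M.scale_left_commute)
  qed (simp_all only: M.contr_0 M.contr_add M.scale_right_distrib M.scale_zero_right sum.distrib sum.neutral_const)
qed

lemma TM_expand:
  assumes "fdv P" "t \<in> carr (TM P)"
  shows "t = (\<Sum>c\<in>fdv.bas P. ten (bil M P) (M.contr (fdv.du P c) t) c)"
  using M.ten_contr_expand[OF fdv.fin_dim_V[OF assms(1)], of t] assms(2) by (simp add: TM_carr tensor_carr)

lemma contr_act_ten:
  assumes P: "tmod P" and u: "u \<in> D" and z: "z \<in> carr M" and p: "p \<in> carr P" and q: "lin P (*) q"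
  shows "M.contr q (act (TM P) u (ten (bil M P) z p)) = sw u (\<lambda>a b. scal M (q (act P b p)) (act M a z))"
  unfolding tensor_act_ten[OF mod tmod_mod[OF P] u z p] contr_swe
  using z by (intro swe_cong M.contr_ten[OF q]) simp

lemma TM_lin_sum:
  assumes "tmod P" "lin (TM P) s f" "\<And>c. c \<in> I \<Longrightarrow> g c \<in> carr (TM P)"
  shows "f (\<Sum>c\<in>I. g c) = (\<Sum>c\<in>I. f (g c))"
  using fdv.lin_sum[OF TM_fdv[OF assms(1)] assms(2)] assms(3) by blast

lemma ten_lin: "p \<in> carr P \<Longrightarrow> lin M fscale (\<lambda>m. ten (bil M P) m p)" "m \<in> carr M \<Longrightarrow> lin P fscale (ten (bil M P) m)"
  by (rule lin_ten, simp_all)+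

text \<open>Since \<open>kN\<close> acts on \<open>P\<close> through its counit, the diagonal action
  collapses onto the factor \<open>M\<close>; this makes matrix entries commute with
  \<open>N\<close>.\<close>

lemma ten_kN:
  assumes P: "tmod P" and y: "y \<in> kN" and m: "m \<in> carr M" and p: "p \<in> carr P"
  shows "act (TM P) y (ten (bil M P) m p) = ten (bil M P) (act M y m) p"
proof -
  note vs = vector_space_fscale
  note Pa = mod_facts(2-)[OF tmod_mod[OF P]]
  have yD: "y \<in> D" using y by simp
  have l: "linD fscale (\<lambda>u. ten (bil M P) (act M u m) p)"
    using m p by (intro lin_comp[OF ten_lin(1)]) (simp_all add: act_lin)
  have "act (TM P) y (ten (bil M P) m p) = swe fscale y (\<lambda>u v. ten (bil M P) (act M u m) (act P v p))"
    by (rule tensor_act_ten[OF mod tmod_mod[OF P] yD m p])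
  also have "\<dots> = swe fscale y (\<lambda>u v. fscale (v (uni G)) (ten (bil M P) (act M u m) p))"
  proof (rule swe_kN_cong[OF vs y ten_act_lin[OF mod tmod_mod[OF P] m p]])
    show "v \<in> D \<Longrightarrow> linD fscale (\<lambda>u. fscale (v (uni G)) (ten (bil M P) (act M u m) p))" for v
      by (intro lin_scale_const[OF vs] l)
    show "u \<in> D \<Longrightarrow> linD fscale (\<lambda>v. fscale (v (uni G)) (ten (bil M P) (act M u m) p))" for u
      by (intro lin_scale_left[OF vs] lin_apply)
    show "ten (bil M P) (act M u m) (act P v p) = fscale (v (uni G)) (ten (bil M P) (act M u m) p)"
      if "u \<in> kN" "v \<in> kN" for u v
      using that m lin_scal[OF ten_lin(2)[of "act M u m"] p] by (simp add: tmod_kN[OF P _ p])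
  qed
  also have "\<dots> = ten (bil M P) (act M y m) p" by (rule swe_counit_right[OF yD vs l])
  finally show ?thesis .
qed

lemma contr_kN:
  assumes P: "tmod P" and y: "y \<in> kN" and t: "t \<in> carr (TM P)" and q: "lin P (*) q"
  shows "M.contr q (act (TM P) y t) = act M y (M.contr q t)"
  using t unfolding TM_carr
proof (induction rule: ten_carr_induct)
  case (ten m p)
  then show ?case using y by (simp add: ten_kN[OF P y] M.contr_ten[OF q])
next
  case zero
  show ?case using M.lin_0[OF act_lin(1)[OF kN_D[OF y]]]
    by (simp only: tensor_act_linear M.contr_0)
qed (use y in \<open>simp_all only: tensor_act_linear M.contr_add M.contr_fscale Ma kN_D M.contr_carr\<close>)

lemma blk_endo:
  assumes f: "ghom P P' f" and p: "p \<in> carr P"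
  shows "lin_on M M (blk P f q p)"
proof -
  have "lin M (scal M) (\<lambda>m. M.contr q (f (ten (bil M P) m p)))"
    using p by (intro lin_comp[OF contr_lin[of P']] lin_comp[OF ghom_lin'[OF f, folded TM_scal]])
      (simp_all add: ten_TM ten_lin TM_scal ghom_carr[OF f] ghom_lin'[OF f] lin_comp[OF ghom_lin'[OF f]])
  then show ?thesis by (simp add: lin_on_lin blk_def[abs_def])
qed

lemma blk_cE:
  assumes P: "tmod P" and P': "tmod P'" and f: "ghom P P' f" and p: "p \<in> carr P" and q: "lin P' (*) q"
  shows "blk P f q p \<in> cE"
  unfolding cE_def mem_Collect_eq
proof (intro conjI ballI)
  show "lin_on M M (blk P f q p)" by (rule blk_endo[OF f p])
  fix y m assume y: "y \<in> kN" and m: "m \<in> carr M"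
  have t: "ten (bil M P) m p \<in> carr (TM P)" using m p by (rule ten_TM)
  have "act M y (blk P f q p m) = M.contr q (act (TM P') y (f (ten (bil M P) m p)))"
    unfolding blk_def by (rule contr_kN[OF P' y ghom_carr[OF f t] q, symmetric])
  also have "\<dots> = blk P f q p (act M y m)"
    using ghom_act[OF f kN_D[OF y] t] ten_kN[OF P y m p] by (simp add: blk_def)
  finally show "act M y (blk P f q p m) = blk P f q p (act M y m)" .
qed

text \<open>Cocommutativity, conjugated by coassociativity, exchanges the last two of three
  components.\<close>

lemma swe_rot:
  assumes s: "vector_space s" and x: "x \<in> D"
  shows "swe s x (\<lambda>u v. swe s u (\<lambda>a b. F a b v)) = swe s x (\<lambda>w b. swe s w (\<lambda>a v. F a b v))"
proof -
  have "swe s x (\<lambda>u v. swe s u (\<lambda>a b. F a b v)) = swe s x (\<lambda>a w. swe s w (\<lambda>b v. F a b v))"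
    by (rule swe_coassoc[OF s x])
  also have "\<dots> = swe s x (\<lambda>a w. swe s w (\<lambda>v b. F a b v))"
  proof (rule swe_cong)
    show "swe s w (\<lambda>b v. F a b v) = swe s w (\<lambda>v b. F a b v)" for a w by (rule swe_comm)
  qed
  also have "\<dots> = swe s x (\<lambda>w b. swe s w (\<lambda>a v. F a b v))"
    by (rule swe_coassoc[OF s x, symmetric])
  finally show ?thesis .
qed

text \<open>Twisting \<open>m\<close> by \<open>anti\<close> compensates the action on the first
  factor: after two components are exchanged, \<open>a \<star> anti v\<close> contracts to the
  counit. An action on \<open>P\<close> alone is thereby rewritten through the diagonal action, with
  which homomorphisms commute.\<close>

lemma ten_act_right:
  assumes P: "tmod P" and x: "x \<in> D" and m: "m \<in> carr M" and p: "p \<in> carr P"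
  shows "ten (bil M P) m (act P x p) = swe fscale x (\<lambda>u v. act (TM P) u (ten (bil M P) (act M (anti v) m) p))"
proof -
  note vs = vector_space_fscale
  note Pa = mod_facts(2-)[OF tmod_mod[OF P]]
  have "swe fscale x (\<lambda>u v. act (TM P) u (ten (bil M P) (act M (anti v) m) p)) =
    swe fscale x (\<lambda>u v. swe fscale u (\<lambda>a b. ten (bil M P) (act M a (act M (anti v) m)) (act P b p)))"
    using m p by (intro swe_cong tensor_act_ten[OF mod tmod_mod[OF P]]) simp_all
  also have "\<dots> = swe fscale x (\<lambda>w b. swe fscale w (\<lambda>a v. ten (bil M P) (act M a (act M (anti v) m)) (act P b p)))"
    by (rule swe_rot[OF vs x])
  also have "\<dots> = swe fscale x (\<lambda>w b. fscale (w (uni G)) (ten (bil M P) m (act P b p)))"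
  proof (rule swe_cong)
    fix w b assume wb: "w \<in> D" "b \<in> D"
    have l: "linD fscale (\<lambda>z. ten (bil M P) (act M z m) (act P b p))"
      by (rule ten_act_lin[OF mod tmod_mod[OF P] m p wb(2)])
    have "swe fscale w (\<lambda>a v. ten (bil M P) (act M a (act M (anti v) m)) (act P b p)) =
      swe fscale w (\<lambda>a v. ten (bil M P) (act M (a \<star> anti v) m) (act P b p))"
      using m by (intro swe_cong) simp
    then show "swe fscale w (\<lambda>a v. ten (bil M P) (act M a (act M (anti v) m)) (act P b p)) =
      fscale (w (uni G)) (ten (bil M P) m (act P b p))"
      using swe_anti_right[OF vs wb(1) l] m by simp
  qed
  also have "\<dots> = ten (bil M P) m (act P x p)"
    using m p by (intro swe_counit_left[OF x vs] lin_comp[OF ten_lin(2)]) (simp_all add: Pa lin_def)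
  finally show ?thesis by simp
qed

text \<open>Equivariance of \<open>f\<close> read off on its matrix: acting on a column index acts
  on the row index and, by the adjoint action, on the entries. After \<open>chi\<close> only the
  action on the row index survives.\<close>

lemma blk_act:
  assumes P: "tmod P" and P': "tmod P'" and f: "ghom P P' f" and p: "p \<in> carr P" and q: "lin P' (*) q"
    and x: "x \<in> D" and m: "m \<in> carr M"
  shows "blk P f q (act P x p) m =
    (\<Sum>k\<in>fdv.bas P'. sw x (\<lambda>w b. scal M (q (act P' b k)) (Tw (blk P f (fdv.du P' k) p) w m)))"
proof -
  interpret P': fdv P' by (rule tmod_fdv[OF P'])
  note P'a = mod_facts(2-)[OF tmod_mod[OF P']]
  let ?b = "\<lambda>k. blk P f (P'.du k) p"
  have bm: "?b k z \<in> carr M" for k z by (simp add: blk_def)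
  have tz: "ten (bil M P) z p \<in> carr (TM P)" if "z \<in> carr M" for z using that p by (rule ten_TM)
  have 1: "M.contr q (act (TM P') u (f (ten (bil M P) z p))) =
      (\<Sum>k\<in>P'.bas. sw u (\<lambda>a b. scal M (q (act P' b k)) (act M a (?b k z))))" if u: "u \<in> D" and z: "z \<in> carr M" for u z
  proof -
    have "f (ten (bil M P) z p) = (\<Sum>k\<in>P'.bas. ten (bil M P') (?b k z) k)"
      using TM_expand[OF P'.fdv_axioms ghom_carr[OF f tz[OF z]]] by (simp add: blk_def)
    moreover have "ten (bil M P') (?b k z) k \<in> carr (TM P')" if "k \<in> P'.bas" for k
      using that bm by (intro ten_TM) simp_all
    ultimately have "act (TM P') u (f (ten (bil M P) z p)) = (\<Sum>k\<in>P'.bas. act (TM P') u (ten (bil M P') (?b k z) k))"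
      using TM_lin_sum[OF P' TM_act_lin[OF P' u], of P'.bas "\<lambda>k. ten (bil M P') (?b k z) k"] by simp
    then show ?thesis
      using contr_act_ten[OF P' u bm _ q] by (simp add: M.contr_sum)
  qed
  interpret T: fdv "TM P" by (rule TM_fdv[OF P])
  have lf: "lin (TM P) (scal M) (\<lambda>t. M.contr q (f t))"
    using ghom_carr[OF f] ghom_lin'[OF f] by (intro lin_comp[OF contr_lin[of P']]) (simp_all add: TM_scal)
  have "blk P f q (act P x p) m = M.contr q (f (swe fscale x (\<lambda>u v. act (TM P) u (ten (bil M P) (act M (anti v) m) p))))"
    unfolding blk_def using ten_act_right[OF P x m p] by simp
  also have "\<dots> = sw x (\<lambda>u v. M.contr q (f (act (TM P) u (ten (bil M P) (act M (anti v) m) p))))"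
    using m tz mod_facts(2)[OF TM_module[OF P]] by (intro swe_map[OF T.fdv_axioms lf, unfolded TM_scal]) simp
  also have "\<dots> = sw x (\<lambda>u v. \<Sum>k\<in>P'.bas. sw u (\<lambda>a b. scal M (q (act P' b k)) (act M a (?b k (act M (anti v) m)))))"
    using m tz by (intro swe_cong) (simp add: ghom_act[OF f] 1)
  also have "\<dots> = (\<Sum>k\<in>P'.bas. sw x (\<lambda>u v. sw u (\<lambda>a b. scal M (q (act P' b k)) (act M a (?b k (act M (anti v) m))))))"
    by (rule swe_sum[OF vsM])
  also have "\<dots> = (\<Sum>k\<in>P'.bas. sw x (\<lambda>w b. sw w (\<lambda>a v. scal M (q (act P' b k)) (act M a (?b k (act M (anti v) m))))))"
    by (intro sum.cong refl swe_rot[OF vsM x])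
  also have "\<dots> = (\<Sum>k\<in>P'.bas. sw x (\<lambda>w b. scal M (q (act P' b k)) (Tw (?b k) w m)))"
    unfolding Tw_def by (simp add: swe_def M.scale_sum_right mult_ac)
  finally show ?thesis .
qed

lemma chi_swe:
  assumes "\<And>u v. u \<in> D \<Longrightarrow> v \<in> D \<Longrightarrow> F u v \<in> gr.total"
  shows "(\<lambda>m. sw x (\<lambda>u v. F u v m)) \<in> gr.total" "gr.chi (\<lambda>m. sw x (\<lambda>u v. F u v m)) = swe (*) x (\<lambda>u v. gr.chi (F u v))"
proof -
  have t: "(\<lambda>m. scal M (x (mul G a b)) (F (du a) (du b) m)) \<in> gr.total" for a b
    using assms by (intro gr.total_scale) simp
  have t2: "(\<lambda>m. \<Sum>b\<in>bas. scal M (x (mul G a b)) (F (du a) (du b) m)) \<in> gr.total" for a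
    using gr.chi_sum[of bas "\<lambda>b m. scal M (x (mul G a b)) (F (du a) (du b) m)", OF t] by blast
  show "(\<lambda>m. sw x (\<lambda>u v. F u v m)) \<in> gr.total"
    unfolding swe_def using gr.chi_sum[of bas "\<lambda>a m. \<Sum>b\<in>bas. scal M (x (mul G a b)) (F (du a) (du b) m)", OF t2] by blast
  have "gr.chi (\<lambda>m. sw x (\<lambda>u v. F u v m)) = (\<Sum>a\<in>bas. \<Sum>b\<in>bas. gr.chi (\<lambda>m. scal M (x (mul G a b)) (F (du a) (du b) m)))"
    unfolding swe_def using gr.chi_sum[of bas "\<lambda>a m. \<Sum>b\<in>bas. scal M (x (mul G a b)) (F (du a) (du b) m)", OF t2]
      gr.chi_sum[of bas "\<lambda>b m. scal M (x (mul G a b)) (F (du a) (du b) m)" for a, OF t] by simp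
  also have "\<dots> = swe (*) x (\<lambda>u v. gr.chi (F u v))"
    unfolding swe_def using assms by (intro sum.cong refl gr.chi_scale) simp
  finally show "gr.chi (\<lambda>m. sw x (\<lambda>u v. F u v m)) = swe (*) x (\<lambda>u v. gr.chi (F u v))" .
qed

text \<open>Removes the basis from the definition of \<open>Phi\<close>; equalities in
  \<open>P'\<close> are afterwards tested on functionals.\<close>

lemma Phi_functional:
  assumes P: "tmod P" and P': "tmod P'" and f: "ghom P P' f" and p: "p \<in> carr P" and q: "lin P' (*) q"
  shows "q (Phi P P' f p) = gr.chi (blk P f q p)"
proof -
  interpret P': fdv P' by (rule tmod_fdv[OF P'])
  have t: "blk P f (P'.du k) p \<in> gr.total" for k
    by (rule cE_total[OF blk_cE[OF P P' f p]]) (rule P'.lin_du)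
  have t2: "(\<lambda>m. scal M (q k) (blk P f (P'.du k) p m)) \<in> gr.total" for k by (rule gr.total_scale[OF t])
  have "q (Phi P P' f p) = (\<Sum>k\<in>P'.bas. q k * gr.chi (blk P f (P'.du k) p))"
    unfolding Phi_def by (simp add: P'.lin_sum[OF q] lin_scal[OF q] mult.commute)
  also have "\<dots> = gr.chi (\<lambda>m. \<Sum>k\<in>P'.bas. scal M (q k) (blk P f (P'.du k) p m))"
    using gr.chi_sum[of P'.bas "\<lambda>k m. scal M (q k) (blk P f (P'.du k) p m)", OF t2] gr.chi_scale[OF t] by simp
  also have "\<dots> = gr.chi (blk P f q p)"
  proof (rule gr.chi_cong[OF cE_total[OF blk_cE[OF P P' f p q]]])
    fix m assume "m \<in> carr M"
    then show "blk P f q p m = (\<Sum>k\<in>P'.bas. scal M (q k) (blk P f (P'.du k) p m))"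
      unfolding blk_def by (intro contr_functional[OF P'.fdv_axioms _ q] ghom_carr[OF f] ten_TM p)
  qed
  finally show ?thesis .
qed

lemma Phi_carr: "tmod P' \<Longrightarrow> Phi P P' f p \<in> carr P'"
proof -
  assume "tmod P'"
  then interpret P': fdv P' by (rule tmod_fdv)
  show ?thesis unfolding Phi_def by (intro P'.sum_carr) simp
qed

lemma functional_eq:
  assumes P: "tmod P" and "v \<in> carr P" "w \<in> carr P" "\<And>q. lin P (*) q \<Longrightarrow> q v = q w"
  shows "v = w"
proof -
  interpret P: fdv P by (rule tmod_fdv[OF P])
  have "v - w = 0"
  proof (rule P.dual_separates)
    fix q assume "q \<in> carr (dual_space P)"
    then have q: "lin P (*) q" by (simp add: dual_carr)
    have "q (v - w + w) = q (v - w) + q w" by (rule lin_add[OF q P.diff_carr assms(3)]) fact+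
    then show "q (v - w) = 0" using assms(4)[OF q] by simp
  qed (use assms in simp)
  then show ?thesis by simp
qed

lemma Phi_lin:
  assumes P: "tmod P" and P': "tmod P'" and f: "ghom P P' f"
  shows "lin_on P P' (Phi P P' f)"
proof -
  interpret P: fdv P by (rule tmod_fdv[OF P])
  interpret P': fdv P' by (rule tmod_fdv[OF P'])
  note c = Phi_carr[OF P']
  have tot: "blk P f q p \<in> gr.total" if "p \<in> carr P" "lin P' (*) q" for p q
    by (rule cE_total[OF blk_cE[OF P P' f that]])
  have l: "lin P (scal M) (\<lambda>p. blk P f q p m)" if "m \<in> carr M" for m q
  proof -
    have "lin P fscale (\<lambda>p. f (ten (bil M P) m p))"
      using that by (intro lin_comp[OF ghom_lin'[OF f]]) (simp_all add: ten_TM ten_lin TM_scal)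
    then show ?thesis unfolding blk_def
      using that by (intro lin_comp[OF contr_lin[of P']]) (simp_all add: ten_TM TM_scal ghom_carr[OF f])
  qed
  show ?thesis
    unfolding lin_on_lin
  proof (intro conjI ballI linI c)
    fix u v assume uv: "u \<in> carr P" "v \<in> carr P"
    show "Phi P P' f (u + v) = Phi P P' f u + Phi P P' f v"
    proof (rule functional_eq[OF P' c])
      show "Phi P P' f u + Phi P P' f v \<in> carr P'" by (intro P'.add_carr c)
      fix q assume q: "lin P' (*) q"
      have "gr.chi (blk P f q (u + v)) = gr.chi (\<lambda>m. blk P f q u m + blk P f q v m)"
        by (rule gr.chi_cong[OF gr.total_add[OF tot tot]]) (simp_all add: uv q lin_add[OF l])
      then show "q (Phi P P' f (u + v)) = q (Phi P P' f u + Phi P P' f v)"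
        using uv by (simp add: lin_add[OF q c c] Phi_functional[OF P P' f _ q] gr.chi_add tot q)
    qed
  next
    fix a v assume v: "v \<in> carr P"
    show "Phi P P' f (scal P a v) = scal P' a (Phi P P' f v)"
    proof (rule functional_eq[OF P' c])
      show "scal P' a (Phi P P' f v) \<in> carr P'" by (intro P'.scale_carr c)
      fix q assume q: "lin P' (*) q"
      have "gr.chi (blk P f q (scal P a v)) = gr.chi (\<lambda>m. scal M a (blk P f q v m))"
        by (rule gr.chi_cong[OF gr.total_scale[OF tot]]) (simp_all add: v q lin_scal[OF l])
      then show "q (Phi P P' f (scal P a v)) = q (scal P' a (Phi P P' f v))"
        using v by (simp add: lin_scal[OF q c] Phi_functional[OF P P' f _ q] gr.chi_scale tot q)
    qed
  qed
qed

text \<open>By \<open>chi_Tw\<close> the adjoint action on the entries contributes only the counit,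
  which the counit identity then absorbs.\<close>

lemma Phi_act:
  assumes P: "tmod P" and P': "tmod P'" and f: "ghom P P' f" and p: "p \<in> carr P" and x: "x \<in> D"
  shows "Phi P P' f (act P x p) = act P' x (Phi P P' f p)"
proof (rule functional_eq[OF P' Phi_carr[OF P']])
  interpret P': fdv P' by (rule tmod_fdv[OF P'])
  note Pa = mod_facts(2-)[OF tmod_mod[OF P]] and P'a = mod_facts(2-)[OF tmod_mod[OF P']]
  show "act P' x (Phi P P' f p) \<in> carr P'" by (intro P'a x Phi_carr[OF P'])
  fix q assume q: "lin P' (*) q"
  let ?b = "\<lambda>k. blk P f (P'.du k) p"
  have b: "?b k \<in> cE" for k by (rule blk_cE[OF P P' f p]) (rule P'.lin_du)
  have t: "Tw (?b k) w \<in> gr.total" if "w \<in> D" for k w by (rule cE_total[OF Tw_cE[OF b that]])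
  have t2: "(\<lambda>m. scal M (q (act P' v k)) (Tw (?b k) w m)) \<in> gr.total" if "w \<in> D" for w v k
    by (rule gr.total_scale[OF t[OF that]])
  have t3: "(\<lambda>m. sw x (\<lambda>w v. scal M (q (act P' v k)) (Tw (?b k) w m))) \<in> gr.total" for k
    by (rule chi_swe(1)[OF t2])
  have "q (Phi P P' f (act P x p)) = gr.chi (blk P f q (act P x p))"
    using p x by (intro Phi_functional[OF P P' f _ q]) (simp add: Pa)
  also have "\<dots> = gr.chi (\<lambda>m. \<Sum>k\<in>P'.bas. sw x (\<lambda>w v. scal M (q (act P' v k)) (Tw (?b k) w m)))"
    using gr.chi_sum[of P'.bas "\<lambda>k m. sw x (\<lambda>w v. scal M (q (act P' v k)) (Tw (?b k) w m))", OF t3] blk_act[OF P P' f p q x] by (intro gr.chi_cong) auto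
  also have "\<dots> = (\<Sum>k\<in>P'.bas. gr.chi (\<lambda>m. sw x (\<lambda>w v. scal M (q (act P' v k)) (Tw (?b k) w m))))"
    using gr.chi_sum[of P'.bas "\<lambda>k m. sw x (\<lambda>w v. scal M (q (act P' v k)) (Tw (?b k) w m))", OF t3] by blast
  also have "\<dots> = (\<Sum>k\<in>P'.bas. swe (*) x (\<lambda>w v. gr.chi (\<lambda>m. scal M (q (act P' v k)) (Tw (?b k) w m))))"
    by (intro sum.cong refl chi_swe(2)[OF t2])
  also have "\<dots> = (\<Sum>k\<in>P'.bas. swe (*) x (\<lambda>w v. w (uni G) * (q (act P' v k) * gr.chi (?b k))))"
    by (intro sum.cong refl swe_cong) (simp add: gr.chi_scale[OF t] chi_Tw[OF b])
  also have "\<dots> = (\<Sum>k\<in>P'.bas. q (act P' x k) * gr.chi (?b k))"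
  proof (intro sum.cong refl swe_counit_left[OF x vector_space_mult])
    fix k assume "k \<in> P'.bas"
    then show "linD (*) (\<lambda>v. q (act P' v k) * gr.chi (?b k))"
      by (auto simp: lin_def P'a lin_add[OF q] lin_scal[OF q] distrib_right)
  qed
  also have "\<dots> = q (act P' x (Phi P P' f p))"
  proof -
    have l: "lin P' (*) (\<lambda>z. q (act P' x z))" using x by (auto simp: lin_def P'a lin_add[OF q] lin_scal[OF q])
    then show ?thesis unfolding Phi_def
      by (simp add: P'.lin_sum[OF l] lin_scal[OF l] mult.commute)
  qed
  finally show "q (Phi P P' f (act P x p)) = q (act P' x (Phi P P' f p))" .
qed

lemma blk_comp:
  assumes P: "tmod P" and P': "tmod P'" and f: "ghom P P' f" and g: "ghom P' P'' g" and p: "p \<in> carr P" and m: "m \<in> carr M"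
  shows "blk P (\<lambda>t. g (f t)) q p m = (\<Sum>k\<in>fdv.bas P'. blk P' g q k (blk P f (fdv.du P' k) p m))"
proof -
  interpret P': fdv P' by (rule tmod_fdv[OF P'])
  have "f (ten (bil M P) m p) = (\<Sum>k\<in>P'.bas. ten (bil M P') (blk P f (P'.du k) p m) k)"
    using TM_expand[OF P'.fdv_axioms ghom_carr[OF f ten_TM[OF m p]]] by (simp add: blk_def)
  moreover have "ten (bil M P') (blk P f (P'.du k) p m) k \<in> carr (TM P')" if "k \<in> P'.bas" for k
    using that by (intro ten_TM) (simp_all add: blk_def)
  ultimately have "g (f (ten (bil M P) m p)) = (\<Sum>k\<in>P'.bas. g (ten (bil M P') (blk P f (P'.du k) p m) k))"
    using TM_lin_sum[OF P' ghom_lin'[OF g], of P'.bas "\<lambda>k. ten (bil M P') (blk P f (P'.du k) p m) k"] by simp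
  then show ?thesis by (simp add: blk_def[of _ "\<lambda>t. g (f t)"] blk_def[of _ g] M.contr_sum)
qed

lemma ghom_comp: "ghom P P' f \<Longrightarrow> ghom P' P'' g \<Longrightarrow> ghom P P'' (\<lambda>t. g (f t))"
  unfolding ghom_def lin_on_def TM_scal by auto

text \<open>Composition multiplies the matrices of blocks, and \<open>chi\<close> is
  multiplicative.\<close>

lemma Phi_comp:
  assumes P: "tmod P" and P': "tmod P'" and P'': "tmod P''" and f: "ghom P P' f" and g: "ghom P' P'' g" and p: "p \<in> carr P"
  shows "Phi P P'' (\<lambda>t. g (f t)) p = Phi P' P'' g (Phi P P' f p)"
proof (rule functional_eq[OF P'' Phi_carr[OF P''] Phi_carr[OF P'']])
  interpret P': fdv P' by (rule tmod_fdv[OF P'])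
  fix q assume q: "lin P'' (*) q"
  note gf = ghom_comp[OF f g]
  have 1: "blk P f (P'.du k) p \<in> gr.total" for k
    by (rule cE_total[OF blk_cE[OF P P' f p]]) (rule P'.lin_du)
  have 2: "blk P' g q k \<in> gr.total" if "k \<in> P'.bas" for k
    using that by (intro cE_total[OF blk_cE[OF P' P'' g _ q]]) simp
  have 3: "(\<lambda>m. blk P' g q k (blk P f (P'.du k) p m)) \<in> gr.total" if "k \<in> P'.bas" for k
    by (rule gr.total_comp[OF 2[OF that] 1])
  have "q (Phi P P'' (\<lambda>t. g (f t)) p) = gr.chi (blk P (\<lambda>t. g (f t)) q p)"
    by (rule Phi_functional[OF P P'' gf p q])
  also have "\<dots> = gr.chi (\<lambda>m. \<Sum>k\<in>P'.bas. blk P' g q k (blk P f (P'.du k) p m))"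
    using gr.chi_sum[of P'.bas "\<lambda>k m. blk P' g q k (blk P f (P'.du k) p m)", OF 3] blk_comp[OF P P' f g p]
    by (intro gr.chi_cong) auto
  also have "\<dots> = (\<Sum>k\<in>P'.bas. gr.chi (blk P' g q k) * gr.chi (blk P f (P'.du k) p))"
    using gr.chi_sum[of P'.bas "\<lambda>k m. blk P' g q k (blk P f (P'.du k) p m)", OF 3] 1 2 by (simp add: gr.chi_comp)
  also have "\<dots> = (\<Sum>k\<in>P'.bas. q (Phi P' P'' g k) * gr.chi (blk P f (P'.du k) p))"
    by (intro sum.cong refl) (simp add: Phi_functional[OF P' P'' g _ q])
  also have "\<dots> = q (Phi P' P'' g (Phi P P' f p))"
  proof -
    have l: "lin_on P' P'' (Phi P' P'' g)" by (rule Phi_lin[OF P' P'' g])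
    have l': "lin P' (*) (\<lambda>z. q (Phi P' P'' g z))"
      using l by (intro lin_comp[OF q]) (auto simp: lin_on_lin)
    then show ?thesis unfolding Phi_def[of P P']
      by (simp add: P'.lin_sum[OF l'] lin_scal[OF l'] mult.commute)
  qed
  finally show "q (Phi P P'' (\<lambda>t. g (f t)) p) = q (Phi P' P'' g (Phi P P' f p))" .
qed

lemma ghom_id: "ghom P P (\<lambda>t. t)" by (simp add: ghom_def lin_on_def)

lemma Phi_id:
  assumes P: "tmod P" and p: "p \<in> carr P"
  shows "Phi P P (\<lambda>t. t) p = p"
proof (rule functional_eq[OF P Phi_carr[OF P] p])
  fix q assume q: "lin P (*) q"
  have "gr.chi (blk P (\<lambda>t. t) q p) = gr.chi (\<lambda>m. scal M (q p) m)"
    by (rule gr.chi_cong[OF gr.total_scale[OF gr.W_total[OF e0_X]]])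
      (simp_all add: Wt_one_iff M.lin_on_id blk_def M.contr_ten[OF q])
  also have "\<dots> = q p"
    using gr.chi_scale[OF gr.W_total[OF e0_X, of "\<lambda>m. m"], of "q p"] by (simp add: Wt_one_iff M.lin_on_id gr.chi_id)
  finally show "q (Phi P P (\<lambda>t. t) p) = q p" by (simp add: Phi_functional[OF P P ghom_id p q])
qed

lemma Phi_cong:
  assumes "\<And>t. t \<in> carr (TM P) \<Longrightarrow> f t = g t" "p \<in> carr P" "tmod P" "tmod P'" "ghom P P' f"
  shows "Phi P P' f p = Phi P P' g p"
proof -
  interpret P': fdv P' by (rule tmod_fdv) fact
  have "gr.chi (blk P f (P'.du k) p) = gr.chi (blk P g (P'.du k) p)" for k
  proof (rule gr.chi_cong[symmetric])
    show "blk P f (P'.du k) p \<in> gr.total"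
      by (rule cE_total[OF blk_cE[OF assms(3,4,5,2)]]) (rule P'.lin_du)
    show "blk P f (P'.du k) p m = blk P g (P'.du k) p m" if "m \<in> carr M" for m
      using assms(1)[OF ten_TM[OF that assms(2)]] by (simp add: blk_def)
  qed
  then show ?thesis by (simp add: Phi_def)
qed

text \<open>Applying \<open>h\<close> moves all coordinates one step down the common filtration of
  \<open>nil_ideal\<close>. As \<open>h t\<close> equals \<open>h (h t)\<close>, its coordinates lie
  in every step.\<close>

lemma idempotent_nil:
  assumes P: "tmod P" and h: "ghom P P h" and idem: "\<And>t. t \<in> carr (TM P) \<Longrightarrow> h (h t) = h t"
    and nil: "\<And>q p. lin P (*) q \<Longrightarrow> p \<in> carr P \<Longrightarrow> blk P h q p \<in> gr.nil_ideal" and t: "t \<in> carr (TM P)"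
  shows "h t = 0"
proof -
  interpret P: fdv P by (rule tmod_fdv[OF P])
  obtain Y L where Y: "Y 0 = carr M" "Y L = {0}" "\<And>F k. F \<in> gr.nil_ideal \<Longrightarrow> F ` Y k \<subseteq> Y (Suc k)" "\<And>k. M.subspace (Y k)"
  proof -
    from gr.nil_ideal_flag obtain Y L where "Y 0 = carr M \<and> Y L = {0} \<and> (\<forall>k. Y k \<subseteq> carr M)
      \<and> (\<forall>F\<in>gr.nil_ideal. \<forall>k. F ` Y k \<subseteq> Y (Suc k)) \<and> (\<forall>k. M.subspace (Y k))" by (elim exE)
    note Y = this
    show thesis by (rule that[of Y L]) (use Y in blast)+
  qed
  have "M.contr q (h t) \<in> Y l" if "lin P (*) q" "t \<in> carr (TM P)" for l q t
    using that
  proof (induction l arbitrary: q t)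
    case 0
    then show ?case using Y(1) by simp
  next
    case (Suc l)
    let ?z = "\<lambda>k. M.contr (P.du k) (h t)"
    note ht = ghom_carr[OF h Suc.prems(2)]
    have zY: "?z k \<in> Y l" for k by (rule Suc.IH[OF P.lin_du Suc.prems(2)])
    have "h t = h (\<Sum>k\<in>P.bas. ten (bil M P) (?z k) k)"
      using idem[OF Suc.prems(2)] TM_expand[OF P.fdv_axioms ht] by simp
    also have "\<dots> = (\<Sum>k\<in>P.bas. h (ten (bil M P) (?z k) k))"
      by (rule TM_lin_sum[OF P ghom_lin'[OF h]]) (simp add: ten_TM)
    finally have "M.contr q (h t) = M.contr q (\<Sum>k\<in>P.bas. h (ten (bil M P) (?z k) k))" by (rule arg_cong)
    then have c: "M.contr q (h t) = (\<Sum>k\<in>P.bas. blk P h q k (?z k))"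
      by (simp only: blk_def M.contr_sum)
    have b: "blk P h q k (?z k) \<in> Y (Suc l)" if "k \<in> P.bas" for k
      using Y(3)[OF nil[OF Suc.prems(1)], of k l] zY that by auto
    show ?case by (rule ssubst[OF c], rule M.subspace_sum[OF Y(4) b])
  qed
  then have "M.contr (P.du k) (h t) = 0" for k using Y(2) P.lin_du t by blast
  then have "h t = (\<Sum>k\<in>P.bas. ten (bil M P) 0 k)" using TM_expand[OF P.fdv_axioms ghom_carr[OF h t]] by simp
  moreover have "ten (bil M P) 0 k = 0" if "k \<in> P.bas" for k
    by (rule M.lin_0[OF ten_lin(1)[OF P.bas_carr[OF that]]])
  ultimately show ?thesis by simp
qed

section \<open>Transfer of indecomposability and of isomorphism classes\<close>

lemma inflate_tmod: "fd_module (group_alg Q) R \<Longrightarrow> tmod (inflate G N \<pi> R)"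
  unfolding tmod_def using inflate_module[of R] inflate_kN[of R] by (auto simp: inflate_simps)

lemma inflate_submodule:
  assumes "A \<subseteq> carr R" "module.subspace (scal R) A" "\<And>x a. x \<in> D \<Longrightarrow> a \<in> A \<Longrightarrow> act (inflate G N \<pi> R) x a \<in> A"
  shows "submodule (group_alg Q) R A"
  unfolding submodule_def kQ_simps
proof (intro conjI ballI assms(1,2))
  fix x u assume "x \<in> DQ" "u \<in> A"
  then show "act R x u \<in> A" using assms(3)[of "ext x" u] by (simp add: inflate_simps)
qed

text \<open>The projection \<open>e\<close> of a decomposition yields an idempotent on
  \<open>R\<close> under \<open>Phi\<close>, whose image and kernel are submodules. If the image is
  zero, \<open>e\<close> has entries in \<open>nil_ideal\<close>; if the kernel is zero,
  \<open>Phi\<close> sends \<open>e\<close> to the identity and \<open>\<lambda>t. t - e t\<close>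
  has such entries. In both cases \<open>idempotent_nil\<close> applies.\<close>

lemma indecomposable_TM:
  assumes R: "indecomposable (group_alg Q) R"
  shows "indecomposable (group_alg G) (TM (inflate G N \<pi> R))"
proof -
  let ?P = "inflate G N \<pi> R"
  have Rm: "fd_module (group_alg Q) R" using R by (simp add: indecomposable_def)
  have P: "tmod ?P" by (rule inflate_tmod[OF Rm])
  interpret P: fdv ?P by (rule tmod_fdv[OF P])
  interpret T: fdv "TM ?P" by (rule TM_fdv[OF P])
  note Pa = mod_facts(2-)[OF tmod_mod[OF P]]
  have nz: "carr (TM ?P) \<noteq> {0}"
  proof -
    have "carr ?P \<noteq> {0}" using R by (simp add: indecomposable_def inflate_simps)
    then obtain p where p: "p \<in> carr ?P" "p \<noteq> 0" using P.zero_carr by blast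
    obtain m where m: "m \<in> carr M" "m \<noteq> 0" using gr.nonzero M.zero_carr by blast
    obtain q where q: "lin ?P (*) q" "q p \<noteq> 0"
      using P.dual_separates[OF p(1)] p(2) by (auto simp: dual_carr)
    have "M.contr q (ten (bil M ?P) m p) \<noteq> 0" using M.contr_ten[OF q(1) m(1)] q(2) m(2) by simp
    moreover have "M.contr q 0 = 0" by (simp add: M.contr_def)
    ultimately have "ten (bil M ?P) m p \<noteq> 0" by metis
    then show ?thesis using ten_TM[OF m(1) p(1)] by blast
  qed
  show ?thesis
    unfolding indecomposable_def
  proof (intro conjI TM_module[OF P] nz allI impI)
    fix U W assume U: "submodule (group_alg G) (TM ?P) U" and W: "submodule (group_alg G) (TM ?P) W"
      and UW: "U \<inter> W = {0}" "{u + w | u w. u \<in> U \<and> w \<in> W} = carr (TM ?P)"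
    have sU: "T.subspace U" "U \<subseteq> carr (TM ?P)" "\<And>x u. x \<in> D \<Longrightarrow> u \<in> U \<Longrightarrow> act (TM ?P) x u \<in> U"
      using U unfolding submodule_def carr_group_alg by blast+
    have sW: "T.subspace W" "W \<subseteq> carr (TM ?P)" "\<And>x u. x \<in> D \<Longrightarrow> u \<in> W \<Longrightarrow> act (TM ?P) x u \<in> W"
      using W unfolding submodule_def carr_group_alg by blast+
    have 0: "0 \<in> U" "0 \<in> W" using UW(1) by blast+
    obtain e where e: "lin_on (TM ?P) (TM ?P) e" "\<And>t. t \<in> carr (TM ?P) \<Longrightarrow> e t \<in> U"
      "\<And>t. t \<in> carr (TM ?P) \<Longrightarrow> t - e t \<in> W" "\<And>u w. u \<in> U \<Longrightarrow> w \<in> W \<Longrightarrow> e (u + w) = u"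
      using T.complement_projection[OF sU(1) sW(1) UW] by blast
    have eU: "e u = u" if "u \<in> U" for u using e(4)[OF that 0(2)] by simp
    have eW: "e w = 0" if "w \<in> W" for w using e(4)[OF 0(1) that] by simp
    have ge: "ghom ?P ?P e"
      unfolding ghom_def
    proof (intro conjI e(1) ballI)
      fix x t assume x: "x \<in> D" and t: "t \<in> carr (TM ?P)"
      have c: "e t \<in> carr (TM ?P)" "t - e t \<in> carr (TM ?P)" using e(2,3)[OF t] sU(2) sW(2) by blast+
      have "act (TM ?P) x t = act (TM ?P) x (e t) + act (TM ?P) x (t - e t)"
        using lin_add[OF TM_act_lin[OF P x] c] by simp
      then show "e (act (TM ?P) x t) = act (TM ?P) x (e t)"
        using e(4)[OF sU(3)[OF x e(2)[OF t]] sW(3)[OF x e(3)[OF t]]] by simp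
    qed
    have ee: "e (e t) = e t" if "t \<in> carr (TM ?P)" for t using eU e(2) that by blast
    let ?f = "Phi ?P ?P e"
    note fl = Phi_lin[OF P P ge] and fa = Phi_act[OF P P ge]
    have fc: "?f p \<in> carr ?P" for p by (rule Phi_carr[OF P])
    have ff: "?f (?f p) = ?f p" if "p \<in> carr ?P" for p
      by (rule trans[OF Phi_comp[OF P P P ge ge that, symmetric] Phi_cong[OF ee that P P ghom_comp[OF ge ge]]])
    let ?A = "?f ` carr ?P" and ?B = "{p \<in> carr ?P. ?f p = 0}"
    have sc: "scal ?P = scal R" "carr ?P = carr R" by (simp_all add: inflate_simps)
    have A: "submodule (group_alg Q) R ?A"
    proof (rule inflate_submodule)
      show "?A \<subseteq> carr R" using fc sc by auto
      show "module.subspace (scal R) ?A" using P.subspace_image[OF fl P.subspace_carr] sc by simp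
      show "act ?P x a \<in> ?A" if x: "x \<in> D" and a: "a \<in> ?A" for x a
      proof -
        obtain p where p: "p \<in> carr ?P" "a = ?f p" using a by blast
        then have "act ?P x a = ?f (act ?P x p)" using fa[OF p(1) x] by simp
        then show ?thesis using Pa(1)[OF x p(1)] by blast
      qed
    qed
    have B: "submodule (group_alg Q) R ?B"
    proof (rule inflate_submodule)
      show "?B \<subseteq> carr R" using sc by auto
      show "module.subspace (scal R) ?B" using P.subspace_kernel[OF fl P.subspace_carr] sc by simp
      show "act ?P x a \<in> ?B" if "x \<in> D" "a \<in> ?B" for x a
        using that fa[of a x] Pa(1)[of x a] P.lin_on_0 mod_facts(3)[OF tmod_mod[OF P], of x 0 0] by auto
    qed
    have AB: "?A \<inter> ?B = {0}"
    proof -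
      have "?f 0 = 0" using P.lin_on_0[OF fl] .
      then have "0 \<in> ?A \<inter> ?B" using P.zero_carr by (auto intro: image_eqI[of _ _ 0])
      moreover have "x = 0" if "x \<in> ?A \<inter> ?B" for x using that ff by auto
      ultimately show ?thesis by blast
    qed
    have "{u + w | u w. u \<in> ?A \<and> w \<in> ?B} = carr R"
    proof (intro equalityI subsetI)
      fix x assume "x \<in> carr R"
      then have x: "x \<in> carr ?P" using sc by simp
      have d: "x - ?f x \<in> carr ?P" by (rule P.diff_carr[OF x fc])
      have "?f (x - ?f x) = ?f x - ?f (?f x)" by (rule P.lin_on_diff[OF fl x fc])
      then have "x - ?f x \<in> ?B" using d ff[OF x] by simp
      moreover have "?f x \<in> ?A" using x by blast
      moreover have "x = ?f x + (x - ?f x)" by simp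
      ultimately show "x \<in> {u + w | u w. u \<in> ?A \<and> w \<in> ?B}" by blast
    next
      fix x assume "x \<in> {u + w | u w. u \<in> ?A \<and> w \<in> ?B}"
      then obtain u w where "x = u + w" "u \<in> ?A" "w \<in> ?B" by blast
      then have "x \<in> carr ?P" using P.add_carr[of u w] fc by blast
      then show "x \<in> carr R" using sc by simp
    qed
    then have "?A = {0} \<or> ?B = {0}" using R A B AB unfolding indecomposable_def by blast
    moreover have "U = {0}" if A0: "?A = {0}"
    proof -
      have "blk ?P e q p \<in> gr.nil_ideal" if q: "lin ?P (*) q" and p: "p \<in> carr ?P" for q p
      proof (rule gr.chi_0_nil_ideal)
        show "blk ?P e q p \<in> gr.total" by (rule cE_total[OF blk_cE[OF P P ge p q]])
        have "?f p = 0" using A0 p by blast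
        then show "gr.chi (blk ?P e q p) = 0" using Phi_functional[OF P P ge p q] P.lin_0[OF q] by simp
      qed
      note nil = this
      have "e t = 0" if "t \<in> carr (TM ?P)" for t by (rule idempotent_nil[OF P ge ee nil that])
      then show ?thesis using eU sU(2) 0 by fastforce
    qed
    moreover have "W = {0}" if B0: "?B = {0}"
    proof -
      let ?h = "\<lambda>t. t - e t"
      have lh: "lin_on (TM ?P) (TM ?P) ?h" by (rule T.lin_on_minus[OF T.lin_on_id e(1)])
      have gh: "ghom ?P ?P ?h"
        unfolding ghom_def
      proof (intro conjI lh ballI)
        fix x t assume x: "x \<in> D" and t: "t \<in> carr (TM ?P)"
        have "lin_on (TM ?P) (TM ?P) (act (TM ?P) x)"
          using TM_act_lin[OF P x] mod_facts(2)[OF TM_module[OF P] x] by (simp add: lin_on_lin TM_scal)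
        from T.lin_on_diff[OF this t ghom_carr[OF ge t]] show "act (TM ?P) x t - e (act (TM ?P) x t) = act (TM ?P) x (t - e t)"
          using ghom_act[OF ge x t] by simp
      qed
      have hh: "?h (?h t) = ?h t" if "t \<in> carr (TM ?P)" for t using eW[OF e(3)[OF that]] by simp
      have fid: "?f p = p" if p: "p \<in> carr ?P" for p
      proof -
        have "p - ?f p \<in> ?B" using P.lin_on_diff[OF fl p fc] ff[OF p] P.diff_carr[OF p fc] by simp
        then show ?thesis using B0 by auto
      qed
      have "blk ?P ?h q p \<in> gr.nil_ideal" if q: "lin ?P (*) q" and p: "p \<in> carr ?P" for q p
      proof -
        have tot: "blk ?P e q p \<in> gr.total" by (rule cE_total[OF blk_cE[OF P P ge p q]])
        have "gr.chi (blk ?P e q p) = q p" using Phi_functional[OF P P ge p q] fid[OF p] by simp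
        then have "(\<lambda>m. scal M (- 1) (blk ?P e q p m - scal M (q p) m)) \<in> gr.nil_ideal"
          using gr.nil_ideal_scale[OF gr.chi_nil_ideal[OF tot], of "- 1"] by simp
        then show ?thesis
        proof (rule gr.nil_ideal_cong)
          fix m assume m: "m \<in> carr M"
          have t: "ten (bil M ?P) m p \<in> carr (TM ?P)" by (rule ten_TM[OF m p])
          have "M.contr q (ten (bil M ?P) m p) = M.contr q (?h (ten (bil M ?P) m p)) + M.contr q (e (ten (bil M ?P) m p))"
            by (simp add: M.contr_add[symmetric])
          then show "scal M (- 1) (blk ?P e q p m - scal M (q p) m) = blk ?P ?h q p m"
            using M.contr_ten[OF q m, of p] by (simp add: blk_def)
        qed
      qed
      note nil = this
      have "?h t = 0" if "t \<in> carr (TM ?P)" for t by (rule idempotent_nil[OF P gh hh nil that])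
      then show ?thesis using eW sW(2) 0 by fastforce
    qed
    ultimately show "U = {0} \<or> W = {0}" by blast
  qed
qed

lemma ghom_inv:
  assumes P: "tmod P" and P': "tmod P'" and f: "ghom P P' f" and b: "bij_betw f (carr (TM P)) (carr (TM P'))"
  shows "ghom P' P (inv_into (carr (TM P)) f)"
proof -
  interpret T: fdv "TM P" by (rule TM_fdv[OF P])
  let ?g = "inv_into (carr (TM P)) f"
  have g: "?g t \<in> carr (TM P)" "f (?g t) = t" if "t \<in> carr (TM P')" for t
    using b that by (auto simp: bij_betw_def f_inv_into_f inv_into_into)
  have gf: "?g (f t) = t" if "t \<in> carr (TM P)" for t using b that by (simp add: bij_betw_def)
  have "?g (s + t) = ?g s + ?g t" if "s \<in> carr (TM P')" "t \<in> carr (TM P')" for s t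
    using gf[OF T.add_carr[OF g(1)[OF that(1)] g(1)[OF that(2)]]] lin_add[OF ghom_lin'[OF f] g(1)[OF that(1)] g(1)[OF that(2)]] g(2) that
    by simp
  moreover have "?g (fscale c t) = fscale c (?g t)" if "t \<in> carr (TM P')" for c t
    using gf[OF T.scale_carr[OF g(1)[OF that]], of c] lin_scal[OF ghom_lin'[OF f] g(1)[OF that], of c] g(2)[OF that]
    by (simp add: TM_scal)
  moreover have "?g (act (TM P') x t) = act (TM P) x (?g t)" if "x \<in> D" "t \<in> carr (TM P')" for x t
    using gf[OF mod_facts(2)[OF TM_module[OF P] that(1) g(1)[OF that(2)]]] ghom_act[OF f that(1) g(1)[OF that(2)]] g(2)[OF that(2)]
    by simp
  ultimately show ?thesis unfolding ghom_def lin_on_def TM_scal using g(1) by blast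
qed

text \<open>Functoriality of \<open>Phi\<close> turns mutually inverse homomorphisms into mutually
  inverse ones.\<close>

lemma module_iso_TM_imp:
  assumes R: "fd_module (group_alg Q) R" and R': "fd_module (group_alg Q) R'"
    and iso: "module_iso (group_alg G) (TM (inflate G N \<pi> R)) (TM (inflate G N \<pi> R'))"
  shows "module_iso (group_alg Q) R R'"
proof -
  let ?P = "inflate G N \<pi> R" and ?P' = "inflate G N \<pi> R'"
  note P = inflate_tmod[OF R] and P' = inflate_tmod[OF R']
  obtain f where f: "ghom ?P ?P' f" and b: "bij_betw f (carr (TM ?P)) (carr (TM ?P'))"
    using iso unfolding module_iso_def ghom_def carr_group_alg by blast
  let ?g = "inv_into (carr (TM ?P)) f"
  note g = ghom_inv[OF P P' f b]
  have gf: "?g (f t) = t" if "t \<in> carr (TM ?P)" for t using b that by (simp add: bij_betw_def)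
  have fg: "f (?g t) = t" if "t \<in> carr (TM ?P')" for t using b that by (simp add: bij_betw_def f_inv_into_f)
  let ?F = "Phi ?P ?P' f" and ?G = "Phi ?P' ?P ?g"
  have GF: "?G (?F p) = p" if p: "p \<in> carr ?P" for p
    using Phi_comp[OF P P' P f g p] Phi_cong[OF gf p P P ghom_comp[OF f g]] Phi_id[OF P p] by simp
  have FG: "?F (?G p) = p" if p: "p \<in> carr ?P'" for p
    using Phi_comp[OF P' P P' g f p] Phi_cong[OF fg p P' P' ghom_comp[OF g f]] Phi_id[OF P' p] by simp
  have c: "carr ?P = carr R" "carr ?P' = carr R'" by (simp_all add: inflate_simps)
  show ?thesis
    unfolding module_iso_def
  proof (intro exI conjI ballI)
    show "lin_on R R' ?F" using Phi_lin[OF P P' f] unfolding lin_on_def inflate_simps .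
    show "bij_betw ?F (carr R) (carr R')"
      by (rule bij_betw_byWitness[of _ ?G]) (use GF FG Phi_carr[OF P] Phi_carr[OF P'] in \<open>auto simp: c\<close>)
    fix x p assume "x \<in> carr (group_alg Q)" "p \<in> carr R"
    then show "?F (act R x p) = act R' x (?F p)"
      using Phi_act[OF P P' f, of p "ext x"] by (simp add: c kQ_simps inflate_simps)
  qed
qed

text \<open>The map \<open>id \<otimes> g\<close>, set to zero away from bilinear forms, as every
  element of the target tensor product is.\<close>

definition idmap :: "('k, 'h \<Rightarrow> 'k, 'q::ab_group_add) rep \<Rightarrow> ('p::ab_group_add \<Rightarrow> 'q) \<Rightarrow> (('m \<Rightarrow> 'p \<Rightarrow> 'k) \<Rightarrow> 'k) \<Rightarrow> ('m \<Rightarrow> 'q \<Rightarrow> 'k) \<Rightarrow> 'k" where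
  "idmap P' g t = (\<lambda>\<beta>. if \<beta> \<in> bil M P' then t (\<lambda>m p. \<beta> m (g p)) else 0)"

lemma idmap_add: "idmap P' g (s + t) = idmap P' g s + idmap P' g t"
  and idmap_fscale: "idmap P' g (fscale c t) = fscale c (idmap P' g t)"
  and idmap_0: "idmap P' g 0 = 0"
  by (auto simp: idmap_def fun_eq_iff)

lemma idmap_sum: "idmap P' g (\<Sum>i\<in>I. F i) = (\<Sum>i\<in>I. idmap P' g (F i))"
  by (induction I rule: infinite_finite_induct) (simp_all only: sum.infinite sum.empty sum.insert idmap_add idmap_0 not_False_eq_True)

lemma idmap_ten:
  assumes "lin_on P P' g"
  shows "idmap P' g (ten (bil M P) m p) = ten (bil M P') m (g p)"
proof
  fix \<beta>
  have "(\<lambda>m p. \<beta> m (g p)) \<in> bil M P" if "\<beta> \<in> bil M P'"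
    using that assms by (auto simp: bil_iff lin_on_def lin_def)
  then show "idmap P' g (ten (bil M P) m p) \<beta> = ten (bil M P') m (g p) \<beta>"
    by (simp add: idmap_def ten_def)
qed

lemma idmap_carr:
  assumes g: "lin_on P P' g" and t: "t \<in> carr (TM P)"
  shows "idmap P' g t \<in> carr (TM P')"
  using t unfolding TM_carr
proof (induction rule: ten_carr_induct)
  case (ten m p)
  then show ?case using g by (auto simp: idmap_ten[OF g] lin_on_def intro!: ten_in)
qed (simp_all only: idmap_0 idmap_add idmap_fscale ten_carr_closed)

lemma idmap_comp:
  assumes g: "lin_on P P' g" and g': "lin_on P' P'' g'" and k: "lin_on P P'' k" "\<And>p. p \<in> carr P \<Longrightarrow> g' (g p) = k p"
    and t: "t \<in> carr (TM P)"
  shows "idmap P'' g' (idmap P' g t) = idmap P'' k t"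
  using t unfolding TM_carr
proof (induction rule: ten_carr_induct)
  case (ten m p)
  then show ?case by (simp add: idmap_ten[OF g] idmap_ten[OF g'] idmap_ten[OF k(1)] k(2))
qed (simp_all only: idmap_0 idmap_add idmap_fscale)

lemma idmap_id:
  assumes t: "t \<in> carr (TM P)"
  shows "idmap P (\<lambda>p. p) t = t"
  using t unfolding TM_carr
proof (induction rule: ten_carr_induct)
  case (ten m p)
  then show ?case using idmap_ten[of P P "\<lambda>p. p"] by (simp add: lin_on_def)
qed (simp_all only: idmap_0 idmap_add idmap_fscale)

lemma idmap_ghom:
  assumes P: "tmod P" and P': "tmod P'" and g: "lin_on P P' g"
    and ga: "\<And>x p. x \<in> D \<Longrightarrow> p \<in> carr P \<Longrightarrow> g (act P x p) = act P' x (g p)"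
  shows "ghom P P' (idmap P' g)"
  unfolding ghom_def
proof (intro conjI ballI)
  show "lin_on (TM P) (TM P') (idmap P' g)"
    unfolding lin_on_def TM_scal using idmap_carr[OF g] by (simp add: idmap_add idmap_fscale)
  fix x t assume x: "x \<in> D" and t: "t \<in> carr (TM P)"
  show "idmap P' g (act (TM P) x t) = act (TM P') x (idmap P' g t)"
    using t unfolding TM_carr
  proof (induction rule: ten_carr_induct)
    case (ten m p)
    have gp: "g p \<in> carr P'" using g ten by (simp add: lin_on_def)
    have "idmap P' g (act (TM P) x (ten (bil M P) m p)) = swe fscale x (\<lambda>u v. idmap P' g (ten (bil M P) (act M u m) (act P v p)))"
      unfolding tensor_act_ten[OF mod tmod_mod[OF P] x ten] swe_def idmap_sum idmap_fscale ..
    also have "\<dots> = swe fscale x (\<lambda>u v. ten (bil M P') (act M u m) (act P' v (g p)))"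
      using ten by (intro swe_cong) (simp add: idmap_ten[OF g] ga)
    finally show ?case
      using tensor_act_ten[OF mod tmod_mod[OF P'] x ten(1) gp] by (simp add: idmap_ten[OF g])
  qed (simp_all only: idmap_0 idmap_add idmap_fscale tensor_act_linear)
qed

lemma module_iso_TM:
  assumes R: "fd_module (group_alg Q) R" and R': "fd_module (group_alg Q) R'"
    and iso: "module_iso (group_alg Q) R R'"
  shows "module_iso (group_alg G) (TM (inflate G N \<pi> R)) (TM (inflate G N \<pi> R'))"
proof -
  let ?P = "inflate G N \<pi> R" and ?P' = "inflate G N \<pi> R'"
  note P = inflate_tmod[OF R] and P' = inflate_tmod[OF R']
  obtain f where f: "lin_on R R' f" "bij_betw f (carr R) (carr R')"
    "\<And>x p. x \<in> DQ \<Longrightarrow> p \<in> carr R \<Longrightarrow> f (act R x p) = act R' x (f p)"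
    using iso unfolding module_iso_def kQ_simps by blast
  let ?g = "inv_into (carr R) f"
  have g: "?g t \<in> carr R" "f (?g t) = t" if "t \<in> carr R'" for t
    using f(2) that by (auto simp: bij_betw_def f_inv_into_f inv_into_into)
  have gf: "?g (f t) = t" if "t \<in> carr R" for t using f(2) that by (simp add: bij_betw_def)
  have fl: "lin_on ?P ?P' f" using f(1) unfolding lin_on_def inflate_simps .
  interpret P: fdv ?P by (rule tmod_fdv[OF P])
  interpret P': fdv ?P' by (rule tmod_fdv[OF P'])
  have gl: "lin_on ?P' ?P ?g"
    unfolding lin_on_def inflate_simps
  proof (intro conjI ballI allI g(1))
    fix u v assume uv: "u \<in> carr R'" "v \<in> carr R'"
    have "?g u + ?g v \<in> carr R" using P.add_carr[of "?g u" "?g v"] g(1) uv by (simp add: inflate_simps)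
    then show "?g (u + v) = ?g u + ?g v"
      using gf[of "?g u + ?g v"] f(1) g uv unfolding lin_on_def by simp
  next
    fix c u assume u: "u \<in> carr R'"
    have "scal R c (?g u) \<in> carr R" using P.scale_carr[of "?g u" c] g(1) u by (simp add: inflate_simps)
    then show "?g (scal R' c u) = scal R c (?g u)"
      using gf[of "scal R c (?g u)"] f(1) g u unfolding lin_on_def by simp
  qed
  have gh: "ghom ?P ?P' (idmap ?P' f)"
    by (rule idmap_ghom[OF P P' fl]) (simp add: inflate_simps f(3))
  have 1: "idmap ?P ?g (idmap ?P' f t) = t" if t: "t \<in> carr (TM ?P)" for t
    using idmap_comp[OF fl gl P.lin_on_id _ t] gf idmap_id[OF t] by (simp add: inflate_simps)
  have 2: "idmap ?P' f (idmap ?P ?g t) = t" if t: "t \<in> carr (TM ?P')" for t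
    using idmap_comp[OF gl fl P'.lin_on_id _ t] g(2) idmap_id[OF t] by (simp add: inflate_simps)
  show ?thesis
    unfolding module_iso_def carr_group_alg
  proof (intro exI conjI)
    show "lin_on (TM ?P) (TM ?P') (idmap ?P' f)" by (rule ghom_lin[OF gh])
    show "bij_betw (idmap ?P' f) (carr (TM ?P)) (carr (TM ?P'))"
      by (rule bij_betw_byWitness[of _ "idmap ?P ?g"]) (use 1 2 idmap_carr[OF fl] idmap_carr[OF gl] in auto)
    show "\<forall>x\<in>D. \<forall>t\<in>carr (TM ?P). idmap ?P' f (act (TM ?P) x t) = act (TM ?P') x (idmap ?P' f t)"
      using ghom_act[OF gh] by blast
  qed
qed

section \<open>The tensor identity\<close>

abbreviation Reg where "Reg \<equiv> inflate G N \<pi> (regular_rep (group_alg Q))"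

abbreviation one where "one \<equiv> res eps"

abbreviation B where "B \<equiv> balanced_forms G N \<pi> M"

abbreviation Ind where "Ind \<equiv> induced_rep G N \<pi> M"

lemma regular_module: "fd_module (group_alg Q) (regular_rep (group_alg Q))"
proof -
  have fd: "fin_dim_space (regular_rep (group_alg Q))"
    using Q.fin_dim_dual by (simp add: fin_dim_space_def regular_rep_def kQ_simps)
  have m: "mul (group_alg Q) (mul (group_alg Q) x y) z = mul (group_alg Q) x (mul (group_alg Q) y z)"
    if "x \<in> DQ" "y \<in> DQ" "z \<in> DQ" for x y z
    using that mul_kQ_res[of "ext x \<star> ext y" "ext z"] mul_kQ_res[of "ext x" "ext y \<star> ext z"]
    by (simp add: mul_kQ star_assoc)
  have u: "mul (group_alg Q) (uni (group_alg Q)) x = x" if "x \<in> DQ" for x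
    using that mul_kQ_res[of eps "ext x"] by (simp add: uni_kQ)
  show ?thesis
    unfolding fd_module_def lin_on_def
    using fd m u by (simp add: regular_rep_def kQ_simps Q.dual_closed mul_kQ)
qed

lemma Reg: "tmod Reg" by (rule inflate_tmod[OF regular_module])

lemma Reg_simps: "carr Reg = DQ" "scal Reg = fscale"
  by (simp_all add: inflate_simps regular_rep_def kQ_simps)

lemma Reg_act_one: "x \<in> D \<Longrightarrow> act Reg x one = res x"
  using mul_kQ_res[of x eps] by (simp add: inflate_simps regular_rep_def)

lemma one_Reg: "one \<in> carr Reg" by (simp add: Reg_simps)

lemma lin_kG: "lin (group_alg G) s f \<longleftrightarrow> linD s f"
  by (simp add: lin_def carr_group_alg group_alg_def Let_def)

lemma B_iff: "\<beta> \<in> B \<longleftrightarrow> \<beta> \<in> bil (group_alg G) M \<and>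
    (\<forall>x\<in>D. \<forall>y\<in>kN. \<forall>m\<in>carr M. \<beta> (x \<star> y) m = \<beta> x (act M y m))"
  unfolding balanced_forms_def mem_Collect_eq carr_group_alg N.carr_group_alg star_def
  using push_kN kN_push by blast

lemma B_lin: "\<beta> \<in> B \<Longrightarrow> x \<in> D \<Longrightarrow> lin M (*) (\<beta> x)" "\<beta> \<in> B \<Longrightarrow> m \<in> carr M \<Longrightarrow> linD (*) (\<lambda>x. \<beta> x m)"
  and B_kN: "\<beta> \<in> B \<Longrightarrow> x \<in> D \<Longrightarrow> y \<in> kN \<Longrightarrow> m \<in> carr M \<Longrightarrow> \<beta> (x \<star> y) m = \<beta> x (act M y m)"
  unfolding B_iff bil_iff lin_kG carr_group_alg by blast+

lemma B_I:
  "(\<And>x. x \<in> D \<Longrightarrow> lin M (*) (\<beta> x)) \<Longrightarrow> (\<And>m. m \<in> carr M \<Longrightarrow> linD (*) (\<lambda>x. \<beta> x m)) \<Longrightarrow>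
   (\<And>x y m. x \<in> D \<Longrightarrow> y \<in> kN \<Longrightarrow> m \<in> carr M \<Longrightarrow> \<beta> (x \<star> y) m = \<beta> x (act M y m)) \<Longrightarrow> \<beta> \<in> B"
  unfolding B_iff bil_iff lin_kG carr_group_alg by blast

lemma ten_B_lin: "x \<in> D \<Longrightarrow> lin M fscale (ten B x)" "m \<in> carr M \<Longrightarrow> linD fscale (\<lambda>x. ten B x m)"
  using B_lin by (auto simp: lin_def ten_def fun_eq_iff)

lemma Ind_simps: "carr Ind = ten_carr B (group_alg G) M" "scal Ind = fscale"
  "act Ind z t = (\<lambda>\<beta>. t (\<lambda>x m. ten B (z \<star> x) m \<beta>))"
  by (simp_all add: induced_rep_def Let_def lift_def star_def)

lemma Ind_act_ten:
  assumes z: "z \<in> D" and x: "x \<in> D" and m: "m \<in> carr M"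
  shows "act Ind z (ten B x m) = ten B (z \<star> x) m"
proof
  fix \<beta>
  have "(\<lambda>x m. \<beta> (z \<star> x) m) \<in> B" if \<beta>: "\<beta> \<in> B"
  proof (rule B_I)
    show "linD (*) (\<lambda>x. \<beta> (z \<star> x) m)" if "m \<in> carr M" for m
      using B_lin(2)[OF \<beta> that] z by (auto simp: lin_def)
    show "\<beta> (z \<star> (x \<star> y)) m = \<beta> (z \<star> x) (act M y m)" if "x \<in> D" "y \<in> kN" "m \<in> carr M" for x y m
      using B_kN[OF \<beta> star_D[OF z that(1)] that(2,3)] z that by (simp add: star_assoc)
  qed (use B_lin(1)[OF \<beta>] z in simp)
  then show "act Ind z (ten B x m) \<beta> = ten B (z \<star> x) m \<beta>"
    by (cases "\<beta> \<in> B") (simp_all add: Ind_simps ten_def)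
qed

text \<open>Since \<open>x (m \<otimes> 1) = \<Sum> x\<^sub>1 m \<otimes> x\<^sub>2\<close>, the maps \<open>Psi\<close> and \<open>Theta\<close> are \<open>x \<otimes> m \<mapsto> \<Sum> x\<^sub>1 m \<otimes> x\<^sub>2\<close> and
  \<open>m \<otimes> x \<mapsto> \<Sum> x\<^sub>1 \<otimes> S(x\<^sub>2) m\<close>.\<close>

definition Psi :: "((('h \<Rightarrow> 'k) \<Rightarrow> 'm \<Rightarrow> 'k) \<Rightarrow> 'k) \<Rightarrow> ('m \<Rightarrow> ('h \<Rightarrow> 'k) \<Rightarrow> 'k) \<Rightarrow> 'k" where
  "Psi t = (\<lambda>\<beta>. if \<beta> \<in> bil M Reg then t (\<lambda>x m. act (TM Reg) x (ten (bil M Reg) m one) \<beta>) else 0)"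

definition zet :: "(('h \<Rightarrow> 'k) \<Rightarrow> 'm \<Rightarrow> 'k) \<Rightarrow> 'm \<Rightarrow> ('h \<Rightarrow> 'k) \<Rightarrow> 'k" where
  "zet \<beta> m x = swe (*) x (\<lambda>u v. \<beta> u (act M (anti v) m))"

definition Theta :: "(('m \<Rightarrow> ('h \<Rightarrow> 'k) \<Rightarrow> 'k) \<Rightarrow> 'k) \<Rightarrow> (('h \<Rightarrow> 'k) \<Rightarrow> 'm \<Rightarrow> 'k) \<Rightarrow> 'k" where
  "Theta t = (\<lambda>\<beta>. if \<beta> \<in> B then t (\<lambda>m p. zet \<beta> m (ext p)) else 0)"

lemma Psi_add: "Psi (s + t) = Psi s + Psi t" and Psi_fscale: "Psi (fscale c t) = fscale c (Psi t)" and Psi_0: "Psi 0 = 0"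
  by (auto simp: Psi_def fun_eq_iff)

lemma Psi_sum: "Psi (\<Sum>i\<in>I. F i) = (\<Sum>i\<in>I. Psi (F i))"
  by (induction I rule: infinite_finite_induct) (simp_all only: sum.infinite sum.empty sum.insert Psi_add Psi_0 not_False_eq_True)

lemma Theta_add: "Theta (s + t) = Theta s + Theta t" and Theta_fscale: "Theta (fscale c t) = fscale c (Theta t)" and Theta_0: "Theta 0 = 0"
  by (auto simp: Theta_def fun_eq_iff)

lemma Theta_sum: "Theta (\<Sum>i\<in>I. F i) = (\<Sum>i\<in>I. Theta (F i))"
  by (induction I rule: infinite_finite_induct) (simp_all only: sum.infinite sum.empty sum.insert Theta_add Theta_0 not_False_eq_True)

lemma Ind_act_add: "act Ind z (s + t) = act Ind z s + act Ind z t"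
  and Ind_act_fscale: "act Ind z (fscale c t) = fscale c (act Ind z t)" and Ind_act_0: "act Ind z 0 = 0"
  by (auto simp: Ind_simps fun_eq_iff)

lemma lin_eval: "lin V fscale F \<Longrightarrow> lin V (*) (\<lambda>v. F v b)" by (auto simp: lin_def)

lemmas RT = mod_facts(2-)[OF TM_module[OF Reg]]

lemma Psi_ten:
  assumes x: "x \<in> D" and m: "m \<in> carr M"
  shows "Psi (ten B x m) = act (TM Reg) x (ten (bil M Reg) m one)"
proof
  have tm: "ten (bil M Reg) m one \<in> carr (TM Reg)" if "m \<in> carr M" for m using that one_Reg by (rule ten_TM)
  fix \<beta>
  show "Psi (ten B x m) \<beta> = act (TM Reg) x (ten (bil M Reg) m one) \<beta>"
  proof (cases "\<beta> \<in> bil M Reg")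
    case True
    have "(\<lambda>x m. act (TM Reg) x (ten (bil M Reg) m one) \<beta>) \<in> B"
    proof (rule B_I)
      show "lin M (*) (\<lambda>m. act (TM Reg) x (ten (bil M Reg) m one) \<beta>)" if "x \<in> D" for x
        using tm ten_lin(1)[OF one_Reg]
        by (intro lin_eval[of M _ \<beta>] lin_comp[OF TM_act_lin[OF Reg that]]) (simp_all add: TM_scal)
      show "linD (*) (\<lambda>x. act (TM Reg) x (ten (bil M Reg) m one) \<beta>)" if "m \<in> carr M" for m
        by (rule lin_eval[of _ _ \<beta>]) (rule linI, simp_all only: RT(4)[OF _ _ tm[OF that]] RT(5)[OF _ tm[OF that]] TM_scal dual_scal)
      show "act (TM Reg) (x \<star> y) (ten (bil M Reg) m one) \<beta> = act (TM Reg) x (ten (bil M Reg) (act M y m) one) \<beta>"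
        if "x \<in> D" "y \<in> kN" "m \<in> carr M" for x y m
        using RT(6)[OF that(1) kN_D[OF that(2)] tm[OF that(3)]] ten_kN[OF Reg that(2,3) one_Reg] by simp
    qed
    then show ?thesis using True by (simp add: Psi_def ten_def)
  next
    case False
    have "act (TM Reg) x (ten (bil M Reg) m one) \<in> ten_carr (bil M Reg) M Reg"
      using RT(1)[OF x tm[OF m]] by (simp add: TM_carr)
    from ten_off[OF this False] False show ?thesis by (simp add: Psi_def)
  qed
qed

lemma Psi_carr: "t \<in> carr Ind \<Longrightarrow> Psi t \<in> carr (TM Reg)"
  unfolding Ind_simps
proof (induction rule: ten_carr_induct)
  case (ten x m)
  then have "x \<in> D" "m \<in> carr M" by (simp_all add: carr_group_alg)
  then show ?case using RT(1)[OF _ ten_TM[OF _ one_Reg]] by (simp add: Psi_ten)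
qed (simp_all only: Psi_0 Psi_add Psi_fscale TM_carr ten_carr_closed)

lemma Psi_act:
  assumes z: "z \<in> D" and t: "t \<in> carr Ind"
  shows "Psi (act Ind z t) = act (TM Reg) z (Psi t)"
  using t unfolding Ind_simps(1)
proof (induction rule: ten_carr_induct)
  case (ten x m)
  then have xm: "x \<in> D" "m \<in> carr M" by (simp_all add: carr_group_alg)
  have "Psi (act Ind z (ten B x m)) = act (TM Reg) (z \<star> x) (ten (bil M Reg) m one)"
    using Ind_act_ten[OF z xm] Psi_ten[OF star_D[OF z xm(1)] xm(2)] by simp
  then show ?case
    using RT(6)[OF z xm(1) ten_TM[OF xm(2) one_Reg]] Psi_ten[OF xm] by simp
qed (simp_all only: Ind_act_0 Ind_act_add Ind_act_fscale Psi_0 Psi_add Psi_fscale tensor_act_linear)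

lemma zet_lin: "linD (*) (zet \<beta> m)"
  unfolding zet_def by (rule swe_lin[OF vector_space_mult])

text \<open>Makes \<open>Theta\<close> independent of the lift \<open>ext\<close>: under
  \<open>x \<star> y\<close> with \<open>y\<close> in \<open>kN\<close>, balancedness moves the
  component of \<open>y\<close> to \<open>M\<close>, where it meets the antipode of the other
  component and contracts to the counit.\<close>

lemma zet_res:
  assumes \<beta>: "\<beta> \<in> B" and m: "m \<in> carr M" and x: "x \<in> D"
  shows "zet \<beta> m (ext (res x)) = zet \<beta> m x"
proof (rule invariant_functional_res[OF zet_lin])
  note vs = vector_space_mult[where ?'k = 'k]
  note Bl = lin_add[OF B_lin(1)[OF \<beta>]] lin_scal[OF B_lin(1)[OF \<beta>]] lin_add[OF B_lin(2)[OF \<beta>]] lin_scal[OF B_lin(2)[OF \<beta>], simplified dual_scal]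
  fix x y assume x: "x \<in> D" and y: "y \<in> kN"
  have yD: "y \<in> D" using y by simp
  have "zet \<beta> m (x \<star> y) = swe (*) x (\<lambda>x1 x2. swe (*) y (\<lambda>y1 y2. \<beta> (x1 \<star> y1) (act M (anti (x2 \<star> y2)) m)))"
    unfolding zet_def using m by (intro swe_star[OF vs x yD]) (auto simp: lin_def Bl)
  also have "\<dots> = swe (*) x (\<lambda>x1 x2. y (uni G) * \<beta> x1 (act M (anti x2) m))"
  proof (rule swe_cong)
    fix u v assume uv: "u \<in> D" "v \<in> D"
    have l: "linD (*) (\<lambda>z. \<beta> u (act M z (act M (anti v) m)))"
      using uv m by (auto simp: lin_def Bl)
    have "swe (*) y (\<lambda>y1 y2. \<beta> (u \<star> y1) (act M (anti (v \<star> y2)) m)) =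
        swe (*) y (\<lambda>y1 y2. \<beta> u (act M (y1 \<star> anti y2) (act M (anti v) m)))"
    proof (rule swe_kN_cong[OF vs y])
      show "\<beta> (u \<star> a) (act M (anti (v \<star> b)) m) = \<beta> u (act M (a \<star> anti b) (act M (anti v) m))"
        if "a \<in> kN" "b \<in> kN" for a b
        using B_kN[OF \<beta> uv(1) that(1), of "act M (anti (v \<star> b)) m"] that uv m by (simp add: anti_star)
    qed (use uv m in \<open>auto simp: lin_def Bl\<close>)
    also have "\<dots> = y (uni G) * \<beta> u (act M (anti v) m)"
      using swe_anti_right[OF vs yD l] uv m by simp
    finally show "swe (*) y (\<lambda>y1 y2. \<beta> (u \<star> y1) (act M (anti (v \<star> y2)) m)) = y (uni G) * \<beta> u (act M (anti v) m)" .
  qed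
  also have "\<dots> = zet \<beta> m x * y (uni G)" unfolding zet_def swe_mult_left by simp
  finally show "zet \<beta> m (x \<star> y) = zet \<beta> m x * y (uni G)" .
qed (use x in simp_all)

lemma Theta_ten:
  assumes m: "m \<in> carr M" and x: "x \<in> D"
  shows "Theta (ten (bil M Reg) m (res x)) = swe fscale x (\<lambda>u v. ten B u (act M (anti v) m))"
proof
  fix \<beta>
  show "Theta (ten (bil M Reg) m (res x)) \<beta> = swe fscale x (\<lambda>u v. ten B u (act M (anti v) m)) \<beta>"
  proof (cases "\<beta> \<in> B")
    case True
    have "(\<lambda>m p. zet \<beta> m (ext p)) \<in> bil M Reg"
    proof (rule bilI)
      show "lin Reg (*) (\<lambda>p. zet \<beta> m (ext p))" for m
        by (intro lin_comp[OF zet_lin]) (simp_all add: Reg_simps lin_def)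
      show "lin M (*) (\<lambda>m. zet \<beta> m (ext p))" for p
        unfolding zet_def
        by (intro swe_lin_param[OF vector_space_mult] lin_comp[OF B_lin(1)[OF True]]) (simp_all add: act_lin)
    qed
    then show ?thesis using True by (simp add: Theta_def ten_def zet_res[OF True m x] swe_fscale_apply) (simp add: zet_def)
  next
    case False
    then show ?thesis by (simp add: Theta_def swe_fscale_apply ten_def) (simp add: swe_def)
  qed
qed

text \<open>After reordering by cocommutativity the composite is the sum of the terms
  \<open>x1 \<otimes> (anti x2 \<star> x3) m\<close>.\<close>

lemma Theta_Psi: "t \<in> carr Ind \<Longrightarrow> Theta (Psi t) = t"
  unfolding Ind_simps
proof (induction rule: ten_carr_induct)
  case (ten x m)
  then have x: "x \<in> D" and m: "m \<in> carr M" by (simp_all add: carr_group_alg)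
  note vs = vector_space_fscale
  have "Theta (Psi (ten B x m)) = Theta (swe fscale x (\<lambda>u v. ten (bil M Reg) (act M u m) (act Reg v one)))"
    using Psi_ten[OF x m] tensor_act_ten[OF mod tmod_mod[OF Reg] x m one_Reg] by simp
  also have "\<dots> = swe fscale x (\<lambda>u v. Theta (ten (bil M Reg) (act M u m) (act Reg v one)))"
    unfolding swe_def Theta_sum Theta_fscale ..
  also have "\<dots> = swe fscale x (\<lambda>u v. swe fscale v (\<lambda>a b. ten B a (act M (anti b) (act M u m))))"
    using m by (intro swe_cong) (simp add: Reg_act_one Theta_ten)
  also have "\<dots> = swe fscale x (\<lambda>v u. swe fscale v (\<lambda>a b. ten B a (act M (anti b) (act M u m))))"
    by (rule swe_comm)
  also have "\<dots> = swe fscale x (\<lambda>a w. swe fscale w (\<lambda>b u. ten B a (act M (anti b) (act M u m))))"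
    by (rule swe_coassoc[OF vs x])
  also have "\<dots> = swe fscale x (\<lambda>a w. fscale (w (uni G)) (ten B a m))"
  proof (rule swe_cong)
    fix a w assume aw: "a \<in> D" "w \<in> D"
    have l: "linD fscale (\<lambda>z. ten B a (act M z m))"
      using m by (intro lin_comp[OF ten_B_lin(1)[OF aw(1)]]) (simp_all add: act_lin)
    have "swe fscale w (\<lambda>b u. ten B a (act M (anti b) (act M u m))) = swe fscale w (\<lambda>b u. ten B a (act M (anti b \<star> u) m))"
      using m by (intro swe_cong) simp
    also have "\<dots> = fscale (w (uni G)) (ten B a m)"
      using swe_anti_left[OF vs aw(2) l] m by simp
    finally show "swe fscale w (\<lambda>b u. ten B a (act M (anti b) (act M u m))) = fscale (w (uni G)) (ten B a m)" .
  qed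
  also have "\<dots> = ten B x m" by (rule swe_counit_right[OF x vs ten_B_lin(2)[OF m]])
  finally show ?case .
qed (simp_all only: Psi_0 Psi_add Psi_fscale Theta_0 Theta_add Theta_fscale)

text \<open>The composite is the right-hand side of \<open>ten_act_right\<close> with
  \<open>one\<close> as second factor.\<close>

lemma Psi_Theta: "t \<in> carr (TM Reg) \<Longrightarrow> Psi (Theta t) = t"
  unfolding TM_carr
proof (induction rule: ten_carr_induct)
  case (ten m p)
  then have p: "p \<in> DQ" and m: "m \<in> carr M" by (simp_all add: Reg_simps)
  have e: "ext p \<in> D" using p by simp
  have "Psi (Theta (ten (bil M Reg) m p)) = Psi (swe fscale (ext p) (\<lambda>u v. ten B u (act M (anti v) m)))"
    using Theta_ten[OF m e] p by simp
  also have "\<dots> = swe fscale (ext p) (\<lambda>u v. Psi (ten B u (act M (anti v) m)))"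
    unfolding swe_def Psi_sum Psi_fscale ..
  also have "\<dots> = swe fscale (ext p) (\<lambda>u v. act (TM Reg) u (ten (bil M Reg) (act M (anti v) m) one))"
    using m by (intro swe_cong) (simp add: Psi_ten)
  also have "\<dots> = ten (bil M Reg) m p"
    using ten_act_right[OF Reg e m one_Reg] Reg_act_one[OF e] p by simp
  finally show ?case .
qed (simp_all only: Psi_0 Psi_add Psi_fscale Theta_0 Theta_add Theta_fscale)

lemma Theta_carr: "t \<in> carr (TM Reg) \<Longrightarrow> Theta t \<in> carr Ind"
  unfolding TM_carr Ind_simps
proof (induction rule: ten_carr_induct)
  case (ten m p)
  then have p: "p \<in> DQ" and m: "m \<in> carr M" by (simp_all add: Reg_simps)
  have "ten B u (act M (anti v) m) \<in> ten_carr B (group_alg G) M" if "u \<in> D" "v \<in> D" for u v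
    using that m by (intro ten_in) (simp_all add: carr_group_alg)
  then have "swe fscale (ext p) (\<lambda>u v. ten B u (act M (anti v) m)) \<in> ten_carr B (group_alg G) M"
    by (rule swe_ten_carr)
  then show ?case using Theta_ten[OF m, of "ext p"] p by simp
qed (simp_all only: Theta_0 Theta_add Theta_fscale ten_carr_closed)

lemma idmap_zero: "t \<in> carr (TM P) \<Longrightarrow> fdv P' \<Longrightarrow> lin_on P P' (\<lambda>p. 0) \<Longrightarrow> idmap P' (\<lambda>p. 0) t = 0"
  unfolding TM_carr
proof (induction rule: ten_carr_induct)
  case (ten m p)
  interpret P': fdv P' by fact
  show ?case using idmap_ten[OF ten(4)] P'.lin_0[OF ten_lin(2)[OF ten(1)]] by simp
qed (simp_all only: idmap_0 idmap_add idmap_fscale fs.scale_zero_right add_0)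

text \<open>Follows \<open>Psi\<close> by the projections of the regular module onto the
  \<open>P i\<close>. The summands are separate modules \<open>L i\<close>, not subspaces of one
  tensor product, so inclusions and projections both act through \<open>idmap\<close>.\<close>

lemma induced_decomposition:
  assumes dec: "pim_decomposition (group_alg Q) n P"
  defines "R \<equiv> \<lambda>i. sub_regular_rep (group_alg Q) (P i)"
  shows "module_iso (group_alg G) Ind (direct_sum_rep n (\<lambda>i. TM (inflate G N \<pi> (R i))))"
proof -
  let ?I = "{1..n}"
  define L where "L i = inflate G N \<pi> (R i)" for i
  define cond where "cond r u \<longleftrightarrow> (\<forall>i\<in>?I. u i \<in> P i) \<and> (\<forall>i. i \<notin> ?I \<longrightarrow> u i = 0) \<and> (\<Sum>i\<in>?I. u i) = r"
    for r and u :: "nat \<Rightarrow> 'h \<Rightarrow> 'k"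
  have ex: "\<exists>!u. cond r u" if "r \<in> DQ" for r
    using dec that unfolding pim_decomposition_def cond_def kQ_simps by blast
  \<comment> \<open>Additivity, homogeneity and equivariance of the projections all come from
    uniqueness of the decomposition, through \<open>pr_eq\<close>.\<close>
  define pr where "pr i r = (THE u. cond r u) i" for i r
  have pr: "cond r (\<lambda>i. pr i r)" if "r \<in> DQ" for r
    unfolding pr_def using theI'[OF ex[OF that]] by simp
  have pr_eq: "pr i r = u i" if "r \<in> DQ" "cond r u" for r u i
    unfolding pr_def by (rule arg_cong[of _ _ "\<lambda>u. u i"], rule the1_equality) (use ex that in blast)+
  have sub: "P i \<subseteq> DQ" "fs.subspace (P i)" "\<And>x u. x \<in> DQ \<Longrightarrow> u \<in> P i \<Longrightarrow> mul (group_alg Q) x u \<in> P i"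
    and Rm: "fd_module (group_alg Q) (R i)" if "i \<in> ?I" for i
    using dec that unfolding pim_decomposition_def submodule_def regular_rep_def kQ_simps R_def indecomposable_def by auto
  note sadd = fs.subspace_add[OF sub(2)] and sscale = fs.subspace_scale[OF sub(2)]
  have PD: "p \<in> DQ" if "i \<in> ?I" "p \<in> P i" for i p using sub(1) that by blast
  have L: "tmod (L i)" if "i \<in> ?I" for i unfolding L_def by (rule inflate_tmod[OF Rm[OF that]])
  have L_simps: "carr (L i) = P i" "scal (L i) = fscale" "act (L i) x = act Reg x" for i x
    by (simp_all add: L_def inflate_simps R_def sub_regular_rep_def regular_rep_def kQ_simps)
  have pr_P: "pr i r \<in> P i" if "i \<in> ?I" "r \<in> DQ" for i r using pr[OF that(2)] that(1) by (simp add: cond_def)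
  have pr_0: "pr i r = 0" if "i \<notin> ?I" "r \<in> DQ" for i r using pr[OF that(2)] that(1) by (simp add: cond_def)
  have pr_sum: "(\<Sum>i\<in>?I. pr i r) = r" if "r \<in> DQ" for r using pr[OF that] by (simp add: cond_def)
  have pr_add: "pr i (r + s) = pr i r + pr i s" if rs: "r \<in> DQ" "s \<in> DQ" for i r s
  proof (rule pr_eq)
    show "cond (r + s) (\<lambda>i. pr i r + pr i s)"
      unfolding cond_def using rs pr_P pr_0 pr_sum sadd by (simp add: sum.distrib)
  qed (rule Q.dual_closed(1)[OF rs])
  have pr_scale: "pr i (fscale c r) = fscale c (pr i r)" if r: "r \<in> DQ" for i c r
  proof (rule pr_eq)
    show "cond (fscale c r) (\<lambda>i. fscale c (pr i r))"
      unfolding cond_def using r pr_P pr_0 pr_sum sscale by (simp add: fs.scale_sum_right[symmetric])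
  qed (rule Q.dual_closed(2)[OF r])
  interpret RR: fdv Reg by (rule tmod_fdv[OF Reg])
  have pr_act: "pr i (act Reg x r) = act Reg x (pr i r)" if x: "x \<in> D" and r: "r \<in> DQ" for x i r
  proof (rule pr_eq)
    note Ra = mod_facts(2-)[OF tmod_mod[OF Reg]]
    have l: "lin Reg fscale (act Reg x)" using x by (auto simp: lin_def Ra Reg_simps(2)[symmetric])
    show "act Reg x r \<in> DQ" using Ra(1)[OF x, of r] r by (simp add: Reg_simps)
    have "(\<Sum>i\<in>?I. act Reg x (pr i r)) = act Reg x (\<Sum>i\<in>?I. pr i r)"
      using PD pr_P r by (intro RR.lin_sum[OF l, symmetric]) (simp add: Reg_simps)
    moreover have "act Reg x (pr i r) \<in> P i" if "i \<in> ?I" for i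
      using sub(3)[OF that res_D[OF x] pr_P[OF that r]] by (simp add: inflate_simps regular_rep_def)
    moreover have "act Reg x (pr i r) = 0" if "i \<notin> ?I" for i
      using pr_0[OF that r] RR.lin_0[OF l] by simp
    ultimately show "cond (act Reg x r) (\<lambda>i. act Reg x (pr i r))" using pr_sum[OF r] by (simp add: cond_def)
  qed
  have pr_P_eq: "pr j p = (if j = i then p else 0)" if i: "i \<in> ?I" and p: "p \<in> P i" for i j p
  proof (rule pr_eq[OF PD[OF i p]])
    have "0 \<in> P j" if "j \<in> ?I" for j using fs.subspace_0[OF sub(2)[OF that]] .
    then show "cond p (\<lambda>j. if j = i then p else 0)" using i p by (simp add: cond_def)
  qed
  have lp: "lin_on Reg (L i) (pr i)" if "i \<in> ?I" for i
    using pr_P[OF that] pr_add pr_scale by (simp add: lin_on_def Reg_simps L_simps)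
  have li: "lin_on (L i) Reg (\<lambda>p. p)" if "i \<in> ?I" for i
    using PD[OF that] by (simp add: lin_on_def Reg_simps L_simps)
  have gp: "ghom Reg (L i) (idmap (L i) (pr i))" if "i \<in> ?I" for i
    by (rule idmap_ghom[OF Reg L[OF that] lp[OF that]]) (simp add: L_simps pr_act Reg_simps)
  define Xi where "Xi t = (\<lambda>i. if i \<in> ?I then idmap (L i) (pr i) (Psi t) else 0)" for t
  define Y where "Y u = Theta (\<Sum>i\<in>?I. idmap Reg (\<lambda>p. p) (u i))" for u
  let ?S = "direct_sum_rep n (\<lambda>i. TM (L i))"
  have S: "u \<in> carr ?S \<longleftrightarrow> (\<forall>i\<in>?I. u i \<in> carr (TM (L i))) \<and> (\<forall>i. i \<notin> ?I \<longrightarrow> u i = 0)"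
    "scal ?S c u = (\<lambda>i. fscale c (u i))" "act ?S x u = (\<lambda>i. if i \<in> ?I then act (TM (L i)) x (u i) else 0)" for u c x
    by (simp_all add: direct_sum_rep_def TM_scal)
  interpret T: fdv "TM Reg" by (rule TM_fdv[OF Reg])
  have sum_pr: "(\<Sum>i\<in>?I. idmap Reg (\<lambda>p. p) (idmap (L i) (pr i) s)) = s" if s: "s \<in> carr (TM Reg)" for s
  proof -
    have lr: "lin_on Reg Reg (pr i)" if "i \<in> ?I" for i
      using lp[OF that] PD[OF that] by (simp add: lin_on_def Reg_simps L_simps)
    have "(\<Sum>i\<in>?I. idmap Reg (\<lambda>p. p) (idmap (L i) (pr i) s)) = (\<Sum>i\<in>?I. idmap Reg (pr i) s)"
      by (intro sum.cong refl idmap_comp[OF lp li lr _ s]) simp_all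
    also have "\<dots> = s"
      using s unfolding TM_carr
    proof (induction rule: ten_carr_induct)
      case (ten m p)
      have "(\<Sum>i\<in>?I. idmap Reg (pr i) (ten (bil M Reg) m p)) = (\<Sum>i\<in>?I. ten (bil M Reg) m (pr i p))"
        by (intro sum.cong refl idmap_ten lr)
      also have "\<dots> = ten (bil M Reg) m (\<Sum>i\<in>?I. pr i p)"
        using PD pr_P ten(2) by (intro RR.lin_sum[OF ten_lin(2)[OF ten(1)], symmetric]) (simp add: Reg_simps)
      finally show ?case using pr_sum ten(2) by (simp add: Reg_simps)
    qed (simp_all only: idmap_0 idmap_add idmap_fscale sum.distrib sum.neutral_const fs.scale_sum_right[symmetric])
    finally show ?thesis .
  qed
  have Y_in: "(\<Sum>i\<in>?I. idmap Reg (\<lambda>p. p) (u i)) \<in> carr (TM Reg)" if "u \<in> carr ?S" for u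
    using that idmap_carr[OF li] by (intro T.sum_carr) (simp add: S)
  have "lin_on Ind ?S Xi"
    unfolding lin_on_def
  proof (intro conjI ballI allI)
    show "Xi t \<in> carr ?S" if "t \<in> carr Ind" for t
      using idmap_carr[OF lp Psi_carr[OF that]] by (simp add: S Xi_def)
    show "Xi (s + t) = Xi s + Xi t" for s t by (rule ext) (simp add: Xi_def Psi_add idmap_add)
    show "Xi (scal Ind c t) = scal ?S c (Xi t)" for c t
      by (rule ext) (simp add: S Xi_def Ind_simps Psi_fscale idmap_fscale)
  qed
  moreover have "bij_betw Xi (carr Ind) (carr ?S)"
  proof (rule bij_betw_byWitness[of _ Y])
    show "\<forall>t\<in>carr Ind. Y (Xi t) = t"
      using sum_pr[OF Psi_carr] Theta_Psi by (simp add: Xi_def Y_def)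
    show "\<forall>u\<in>carr ?S. Xi (Y u) = u"
    proof
      fix u assume u: "u \<in> carr ?S"
      show "Xi (Y u) = u"
      proof
        fix j
        show "Xi (Y u) j = u j"
        proof (cases "j \<in> ?I")
          case True
          \<comment> \<open>Including the \<open>i\<close>-th summand and projecting to the
            \<open>j\<close>-th is the identity or zero, so only the term \<open>i = j\<close>
            survives.\<close>
          have ld: "lin_on (L i) (L j) (\<lambda>p. if j = i then p else 0)" for i
            using fs.subspace_0[OF sub(2)[OF True]] by (auto simp: lin_on_def L_simps)
          have "Xi (Y u) j = (\<Sum>i\<in>?I. idmap (L j) (pr j) (idmap Reg (\<lambda>p. p) (u i)))"
            using True Psi_Theta[OF Y_in[OF u]] by (simp add: Xi_def Y_def idmap_sum)
          also have "\<dots> = (\<Sum>i\<in>?I. idmap (L j) (\<lambda>p. if j = i then p else 0) (u i))"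
            using u by (intro sum.cong refl idmap_comp[OF li lp[OF True] ld]) (simp_all add: pr_P_eq L_simps S)
          also have "\<dots> = (\<Sum>i\<in>?I. if j = i then u i else 0)"
          proof (rule sum.cong[OF refl])
            fix i assume i: "i \<in> ?I"
            have ui: "u i \<in> carr (TM (L i))" using u i by (simp add: S)
            show "idmap (L j) (\<lambda>p. if j = i then p else 0) (u i) = (if j = i then u i else 0)"
            proof (cases "j = i")
              case True
              then show ?thesis using idmap_id[OF ui] by simp
            next
              case False
              then show ?thesis using idmap_zero[OF ui tmod_fdv[OF L[OF True]]] ld[of i] by simp
            qed
          qed
          also have "\<dots> = u j" using True by simp
          finally show ?thesis .
        next
          case False
          then have "u j = 0" using u unfolding S by blast
          then show ?thesis unfolding Xi_def using False by (simp only: if_False)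
        qed
      qed
    qed
    show "Xi ` carr Ind \<subseteq> carr ?S" using idmap_carr[OF lp Psi_carr] by (auto simp: S Xi_def)
    show "Y ` carr ?S \<subseteq> carr Ind" unfolding Y_def using Theta_carr[OF Y_in] by blast
  qed
  moreover have "Xi (act Ind x t) = act ?S x (Xi t)" if "x \<in> D" "t \<in> carr Ind" for x t
    unfolding S(3) using ghom_act[OF gp that(1) Psi_carr[OF that(2)]] Psi_act[OF that] by (auto simp: Xi_def)
  ultimately show ?thesis unfolding module_iso_def carr_group_alg L_def[symmetric] by blast
qed

end

theorem proposition5p1:
  fixes G :: "('k::alg_closed_field, 'h::ab_group_add) hopf"
    and N :: "('k, 'n::ab_group_add) hopf"
    and \<pi> :: "'h \<Rightarrow> 'n"
    and P :: "nat \<Rightarrow> ('h \<Rightarrow> 'k) set"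
    and n :: nat
    and M :: "('k, 'h \<Rightarrow> 'k, 'm::ab_group_add) rep"
  assumes "finite_group_scheme G"
    and "normal_subgroup_scheme G N \<pi>"
    and "infinitesimal N"
    and "multiplicative (quot_scheme (conn_comp G) N \<pi>)"
    and "pim_decomposition (group_alg (quot_scheme G N \<pi>)) n P"
    and "scheme_module G M"
    and "indecomposable (group_alg (conn_comp G)) (res_conn G M)"
    and "quot_regular (conn_comp G) N \<pi> (res_conn G M)"
  shows "let kGN = group_alg (quot_scheme G N \<pi>);
             PM = (\<lambda>i. sub_regular_rep kGN (P i));
             MP = (\<lambda>i. tensor_rep G M (inflate G N \<pi> (PM i)))
         in module_iso (group_alg G) (induced_rep G N \<pi> M) (direct_sum_rep n MP) \<and>
            (\<forall>i\<in>{1..n}. indecomposable (group_alg G) (MP i)) \<and>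
            (\<forall>i\<in>{1..n}. \<forall>j\<in>{1..n}.
               module_iso (group_alg G) (MP i) (MP j) \<longleftrightarrow> module_iso kGN (PM i) (PM j))"
proof -
  interpret finite_group_scheme G by fact
  interpret regular_module G N \<pi> M by unfold_locales (fact assms)+
  have PM: "indecomposable (group_alg Q) (sub_regular_rep (group_alg Q) (P i))" if "i \<in> {1..n}" for i
    using assms(5) that unfolding pim_decomposition_def by blast
  then have fd: "fd_module (group_alg Q) (sub_regular_rep (group_alg Q) (P i))" if "i \<in> {1..n}" for i
    using that unfolding indecomposable_def by blast
  show ?thesis
    unfolding Let_def
    using induced_decomposition[OF assms(5)] indecomposable_TM[OF PM]
      module_iso_TM[OF fd fd] module_iso_TM_imp[OF fd fd] by blast
qed

end
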